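(* Let $B_1\subset\mathbb{R}^n$ be the open unit ball, let $\eta:\mathbb{R}^n\to\mathbb{R}^n$ be a smooth compactly supported vector field, and let $F_t:\mathbb{R}^n\to\mathbb{R}^n$ be a smooth transformation map (smooth in $(t,x)$, for $|t|$ small) with $$F_t(x)=x+t\eta(x)+O(t^2),$$ so that $F_t$ is a diffeomorphism for $|t|$ small. Let $\Omega_t=F_t(B_1)$ and let $u(t)$ be the torsion function of $\Omega_t$, i.e. $-\Delta u(t)=1$ in $\Omega_t$ and $u(t)=0$ on $\partial\Omega_t$. Then $u(t)$ depends smoothly on $t$. Moreover, for $x\in B_1$ and $y=F_t(x)$, $$|\nabla u(t)(y)|^2=\frac{|x|^2}{n^2}+\frac{2}{n^2}\Big(\eta(x)\cdot x-x\cdot\nabla (T\zeta)(x)\Big)t+O(t^2)\quad (t\to 0),$$ where $\zeta=\eta\cdot\nu$ on $\partial B_1$, $\nu$ is the unit outer normal to $\partial B_1$, and $T\zeta$ is the harmonic extension of $\zeta$ into $B_1$. In particular, if $\sigma\in\partial B_1$ and $y=F_t(\sigma)\in\partial\Omega_t$, then $$|\nabla u(t)(y)|^2=\frac{1}{n^2}+\frac{2}{n^2}\Big(\zeta(\sigma)-\partial_\nu (T\zeta)(\sigma)\Big)t+O(t^2)\quad (t\to 0).$$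
   Context: The harmonic extension $T\zeta$ of a smooth function $\zeta$ on $\partial B_1$ is the unique function, harmonic in $B_1$ and continuous on $\overline{B_1}$, equal to $\zeta$ on $\partial B_1$ (it is smooth up to the boundary). $\partial_\nu$ denotes the outward normal derivative on $\partial B_1$. "$u(t)$ depends smoothly on $t$" is understood in the sense that $(x,t)\mapsto u(t)(F_t(x))$ is a smooth function of $x\in B_1$ and $t$ near $0$. *)

theory Defs
  imports "HOL-Analysis.Analysis" "HOL-Library.Landau_Symbols"
begin

(* Only meant for open S: the derivatives are taken at interior points.  The condition
   that all directional derivatives along fixed vectors be of class C^k is the condition
   that the Frechet derivative be of class C^k, since the domain has finite dimension. *)
primrec Ck_on :: "nat \<Rightarrow> 'a::euclidean_space set \<Rightarrow> ('a \<Rightarrow> 'b::real_normed_vector) \<Rightarrow> bool" where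
  "Ck_on 0 S f \<longleftrightarrow> continuous_on S f"
| "Ck_on (Suc k) S f \<longleftrightarrow>
     (\<forall>x\<in>S. f differentiable (at x)) \<and>
     (\<forall>v. Ck_on k S (\<lambda>x. frechet_derivative f (at x) v))"

definition smooth_on :: "'a::euclidean_space set \<Rightarrow> ('a \<Rightarrow> 'b::real_normed_vector) \<Rightarrow> bool" where
  "smooth_on S f \<longleftrightarrow> (\<forall>k. Ck_on k S f)"

definition diffeomorphism_on :: "'a::euclidean_space set \<Rightarrow> ('a \<Rightarrow> 'a) \<Rightarrow> bool" where
  "diffeomorphism_on U f \<longleftrightarrow>
     open U \<and> smooth_on U f \<and> inj_on f U \<and> open (f ` U) \<and> smooth_on (f ` U) (inv_into U f)"

definition laplacian :: "('a::euclidean_space \<Rightarrow> real) \<Rightarrow> 'a \<Rightarrow> real" where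
  "laplacian f x =
     (\<Sum>b\<in>Basis. frechet_derivative (\<lambda>y. frechet_derivative f (at y) b) (at x) b)"

(* With S the closure of a smooth domain, this is the gradient up to the boundary: at a
   boundary point the derivative is taken from inside, and it is still unique.  It has its
   meaning only where f is differentiable at x within S. *)
definition gradient_within :: "'a::euclidean_space set \<Rightarrow> ('a \<Rightarrow> real) \<Rightarrow> 'a \<Rightarrow> 'a" where
  "gradient_within S f x = (\<Sum>b\<in>Basis. frechet_derivative f (at x within S) b *\<^sub>R b)"

abbreviation gradient :: "('a::euclidean_space \<Rightarrow> real) \<Rightarrow> 'a \<Rightarrow> 'a" where
  "gradient \<equiv> gradient_within UNIV"

definition torsion_function :: "'a::euclidean_space set \<Rightarrow> ('a \<Rightarrow> real) \<Rightarrow> bool" where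
  "torsion_function \<Omega> u \<longleftrightarrow>
     Ck_on 2 \<Omega> u \<and> continuous_on (closure \<Omega>) u \<and>
     (\<forall>x\<in>\<Omega>. - laplacian u x = 1) \<and> (\<forall>x\<in>frontier \<Omega>. u x = 0)"

definition harmonic_on :: "'a::euclidean_space set \<Rightarrow> ('a \<Rightarrow> real) \<Rightarrow> bool" where
  "harmonic_on \<Omega> h \<longleftrightarrow> Ck_on 2 \<Omega> h \<and> (\<forall>x\<in>\<Omega>. laplacian h x = 0)"

(* h is the harmonic extension of z from the unit sphere; this determines h on the closed
   unit ball, and nothing is required of h outside it. *)
definition harmonic_extension :: "('a::euclidean_space \<Rightarrow> real) \<Rightarrow> ('a \<Rightarrow> real) \<Rightarrow> bool" where
  "harmonic_extension z h \<longleftrightarrow>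
     harmonic_on (ball 0 1) h \<and> continuous_on (cball 0 1) h \<and> (\<forall>x\<in>sphere 0 1. h x = z x)"

(* The outer unit normal to the unit ball at a point x of the unit sphere is x itself. *)
definition unit_normal :: "'a::euclidean_space \<Rightarrow> 'a" where
  "unit_normal x = x"

(* Outward normal derivative on the unit sphere of a function on the closed unit ball. *)
definition normal_derivative :: "('a::euclidean_space \<Rightarrow> real) \<Rightarrow> 'a \<Rightarrow> real" where
  "normal_derivative h x = frechet_derivative h (at x within cball 0 1) (unit_normal x)"

end

theory Submission
  imports Defs
begin

text \<open>Pulled back to the unit ball by \<open>F\<^sub>t\<close>, the Laplacian becomes \<open>L\<^sub>t = \<Sum>\<^sub>b Y\<^sub>b Y\<^sub>b\<close>, where the \<open>Y\<^sub>b\<close> are the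
  pulled back coordinate fields; they commute with \<open>L\<^sub>t\<close>.  All estimates come from the maximum principle.
  With \<open>d = 1 - |x|\<^sup>2\<close>, the barriers \<open>d\<^sup>1\<^sup>/\<^sup>2\<close> and \<open>3 d - d\<^sup>3\<^sup>/\<^sup>2\<close> bound a solution that vanishes on the sphere,
  and a gradient estimate on cubes, scaled by the distance to the sphere, turns this into bounds on all
  derivatives, of order \<open>m\<close> by a multiple of a power of \<open>d\<close> with the exponent lowered by \<open>m\<close>.  The difference
  quotients in \<open>t\<close> of \<open>v\<^sub>t = u(t) \<circ> F\<^sub>t\<close> solve Dirichlet problems of the same kind, so their weighted bounds
  give smoothness in \<open>(t, x)\<close> inside the ball.

  Rotating the ball is another such family of coordinates.  It shows that the tangential derivatives of a
  solution are as good as the solution; the equation then controls the remaining second derivative, so the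
  Hessian is \<open>O(d\<^sup>-\<^sup>1\<^sup>/\<^sup>2)\<close>.  This is integrable, so the gradient extends continuously to the sphere.

  For the expansion, let \<open>w = T\<zeta> - \<eta> \<bullet> x\<close>, which vanishes on the sphere.  The function
  \<open>z = v\<^sub>t - d / (2 n) - (t / n) w\<close> vanishes there too.  Up to \<open>O(t\<^sup>2)\<close>, \<open>d / (2 n) - (t / n) (\<eta> \<bullet> x)\<close> is
  \<open>(1 - |F\<^sub>t|\<^sup>2) / (2 n)\<close>, whose image under \<open>L\<^sub>t\<close> is exactly \<open>-1\<close>; hence \<open>L\<^sub>t z = O(t\<^sup>2 d\<^sup>-\<^sup>1\<^sup>/\<^sup>2)\<close>, so
  \<open>z = O(t\<^sup>2 d)\<close> and the gradient of \<open>z\<close> is \<open>O(t\<^sup>2)\<close> uniformly in the ball.\<close>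

section \<open>Smooth functions\<close>

text \<open>The exponents are dictated by one loss: differentiating \<open>L t\<close> in time costs
  two space derivatives, hence two powers of d. The class O(d^(1/2)) survives this, because a right
  side O(d^(-3/2)) is exactly what the barrier d^(1/2) absorbs; so every time derivative lies in the
  class of the solution itself and no boundary regularity enters. Exponent 1 would break the scheme:
  a right side of order d^(-1) gives only d log d. The price is a gradient bound d^(-1/2), too weak
  for a uniform expansion. There exponent 1 is used once, with a right side O(d^(-1/2)), for which
  the other barrier is made. No Dirichlet problem is solved along the way. The time derivative is
  constructed as a limit of difference quotients, and these converge at a linear rate because the
  differences of two quotients again vanish on the sphere and satisfy an equation of the same kind.
  The data are weak: the torsion function and the harmonic extension are C^2 inside and merely
  continuous up to the boundary, so even interior smoothness has to be derived, from the gradient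
  estimate on cubes.\<close>

definition pd :: "'a::euclidean_space \<Rightarrow> ('a \<Rightarrow> 'b::real_normed_vector) \<Rightarrow> 'a \<Rightarrow> 'b" where
  "pd v f = (\<lambda>x. frechet_derivative f (at x) v)"

lemma Ck_on_Suc_pd:
  "Ck_on (Suc k) S f \<longleftrightarrow> (\<forall>x\<in>S. f differentiable (at x)) \<and> (\<forall>v. Ck_on k S (pd v f))"
  by (simp add: pd_def)

declare Ck_on.simps(2) [simp del]

lemma pd_eq: "(f has_derivative f') (at x) \<Longrightarrow> pd v f x = f' v"
  unfolding pd_def using frechet_derivative_at by metis

lemma has_derivative_pd: "f differentiable (at x) \<Longrightarrow> (f has_derivative (\<lambda>v. pd v f x)) (at x)"
  unfolding pd_def using frechet_derivative_works by metis

lemma pd_cong: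
  assumes "open S" "\<And>x. x \<in> S \<Longrightarrow> f x = g x" "x \<in> S"
  shows "pd v f x = pd v g x"
proof -
  have "(f has_derivative D) (at x) \<longleftrightarrow> (g has_derivative D) (at x)" for D
    using assms has_derivative_transform_within_open by metis
  then show ?thesis unfolding pd_def frechet_derivative_def by simp
qed

lemma differentiable_cong:
  assumes "open S" "\<And>x. x \<in> S \<Longrightarrow> f x = g x" "x \<in> S"
  shows "f differentiable (at x) \<longleftrightarrow> g differentiable (at x)"
  unfolding differentiable_def using assms has_derivative_transform_within_open by metis

lemma Ck_on_cong:
  assumes "open S" "\<And>x. x \<in> S \<Longrightarrow> f x = g x"
  shows "Ck_on k S f \<longleftrightarrow> Ck_on k S g"
  using assms(2)
proof (induction k arbitrary: f g)
  case 0
  then show ?case by (simp cong: continuous_on_cong)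
next
  case (Suc k)
  have "Ck_on k S (pd v f) \<longleftrightarrow> Ck_on k S (pd v g)" for v
    by (rule Suc.IH) (use pd_cong[OF assms(1), of f g] Suc.prems in auto)
  moreover have "f differentiable (at x) \<longleftrightarrow> g differentiable (at x)" if "x \<in> S" for x
    by (rule differentiable_cong[OF assms(1)]) (use Suc.prems that in auto)
  ultimately show ?case unfolding Ck_on_Suc_pd by auto
qed

lemma Ck_on_SucI:
  assumes "open S" "\<And>x. x \<in> S \<Longrightarrow> (f has_derivative (\<lambda>v. D v x)) (at x)" "\<And>v. Ck_on k S (D v)"
  shows "Ck_on (Suc k) S f"
proof -
  have "Ck_on k S (pd v f)" for v
    using Ck_on_cong[OF assms(1), of "pd v f" "D v" k] pd_eq[OF assms(2)] assms(3) by simp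
  then show ?thesis unfolding Ck_on_Suc_pd using assms(2) differentiable_def by blast
qed

lemma Ck_on_SucD: "Ck_on (Suc k) S f \<Longrightarrow> Ck_on k S f"
proof (induction k arbitrary: f)
  case 0
  then show ?case
    by (simp add: Ck_on_Suc_pd continuous_at_imp_continuous_on differentiable_imp_continuous_within)
next
  case (Suc k)
  then show ?case by (subst Ck_on_Suc_pd) (auto simp: Ck_on_Suc_pd[of "Suc k"])
qed

lemma Ck_on_subset: "Ck_on k S f \<Longrightarrow> T \<subseteq> S \<Longrightarrow> Ck_on k T f"
proof (induction k arbitrary: f)
  case 0
  then show ?case by (simp add: continuous_on_subset)
next
  case (Suc k)
  then show ?case unfolding Ck_on_Suc_pd by blast
qed

lemma Ck_on_const [simp]: "Ck_on k S (\<lambda>x. c)"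
proof (induction k arbitrary: c)
  case (Suc k)
  have "pd v (\<lambda>x::'a. c) = (\<lambda>x. 0)" for v by (simp add: pd_def)
  then show ?case unfolding Ck_on_Suc_pd using Suc by simp
qed simp

lemma Ck_on_linear:
  assumes "bounded_linear h" "open S" "Ck_on k S f"
  shows "Ck_on k S (\<lambda>x. h (f x))"
  using assms(3)
proof (induction k arbitrary: f)
  case 0
  then show ?case using assms(1) by (simp add: bounded_linear.continuous_on)
next
  case (Suc k)
  have d: "((\<lambda>x. h (f x)) has_derivative (\<lambda>v. h (pd v f x))) (at x)" if "x \<in> S" for x
    using Suc.prems that assms(1) has_derivative_pd bounded_linear.has_derivative
    unfolding Ck_on_Suc_pd by metis
  show ?case
    by (rule Ck_on_SucI[OF assms(2) d]) (use Suc in \<open>auto simp: Ck_on_Suc_pd\<close>)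
qed

lemma Ck_on_add:
  assumes "open S" "Ck_on k S f" "Ck_on k S g"
  shows "Ck_on k S (\<lambda>x. f x + g x)"
  using assms(2,3)
proof (induction k arbitrary: f g)
  case 0
  then show ?case by (simp add: continuous_on_add)
next
  case (Suc k)
  have d: "((\<lambda>x. f x + g x) has_derivative (\<lambda>v. pd v f x + pd v g x)) (at x)" if "x \<in> S" for x
    using Suc.prems that has_derivative_pd has_derivative_add unfolding Ck_on_Suc_pd by metis
  show ?case
    by (rule Ck_on_SucI[OF assms(1) d]) (use Suc in \<open>auto simp: Ck_on_Suc_pd\<close>)
qed

lemma Ck_on_bilinear:
  assumes "bounded_bilinear h" "open S" "Ck_on k S f" "Ck_on k S g"
  shows "Ck_on k S (\<lambda>x. h (f x) (g x))"
  using assms(3,4)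
proof (induction k arbitrary: f g)
  case 0
  then show ?case using assms(1) by (simp add: bounded_bilinear.continuous_on)
next
  case (Suc k)
  have d: "((\<lambda>x. h (f x) (g x)) has_derivative (\<lambda>v. h (f x) (pd v g x) + h (pd v f x) (g x))) (at x)"
    if "x \<in> S" for x
    using Suc.prems that
    by (intro bounded_bilinear.FDERIV[OF assms(1)] has_derivative_pd) (auto simp: Ck_on_Suc_pd)
  have c: "Ck_on k S (\<lambda>x. h (f x) (pd v g x) + h (pd v f x) (g x))" for v
    by (intro Ck_on_add assms Suc.IH)
      (use Suc.prems Ck_on_SucD in \<open>auto simp: Ck_on_Suc_pd\<close>)
  show ?case by (rule Ck_on_SucI[OF assms(2) d c])
qed

lemma Ck_on_sum:
  assumes "open S" "finite I" "\<And>i. i \<in> I \<Longrightarrow> Ck_on k S (f i)"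
  shows "Ck_on k S (\<lambda>x. \<Sum>i\<in>I. f i x)"
  using assms(2,3) by (induction I rule: finite_induct) (auto intro!: Ck_on_add assms(1))

lemma pd_linear:
  assumes "f differentiable (at x)"
  shows "linear (\<lambda>v. pd v f x)"
  using has_derivative_pd[OF assms] has_derivative_linear by blast

lemma pd_expand:
  fixes f :: "'a::euclidean_space \<Rightarrow> 'b::real_normed_vector"
  assumes "f differentiable (at x)"
  shows "pd v f x = (\<Sum>b\<in>Basis. (v \<bullet> b) *\<^sub>R pd b f x)"
proof -
  interpret linear "\<lambda>v. pd v f x" by (rule pd_linear[OF assms])
  have "pd v f x = pd (\<Sum>b\<in>Basis. (v \<bullet> b) *\<^sub>R b) f x" by (simp add: euclidean_representation)
  then show ?thesis by (simp add: sum scaleR)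
qed

lemma pd_compose:
  fixes f :: "'b::euclidean_space \<Rightarrow> 'c::real_normed_vector" and g :: "'a::euclidean_space \<Rightarrow> 'b"
  assumes "g differentiable (at x)" "f differentiable (at (g x))"
  shows "((\<lambda>x. f (g x)) has_derivative (\<lambda>v. pd (pd v g x) f (g x))) (at x)"
  using has_derivative_compose[OF has_derivative_pd[OF assms(1)] has_derivative_pd[OF assms(2)]] .

text \<open>The derivative of the composition is taken in the direction \<open>pd v g x\<close>,
  which moves with \<open>x\<close>. Expanding it over the basis leaves derivatives of
  \<open>f\<close> in fixed directions, composed with \<open>g\<close>, and the induction hypothesis
  applies to these.\<close>

lemma Ck_on_compose:
  fixes f :: "'b::euclidean_space \<Rightarrow> 'c::real_normed_vector" and g :: "'a::euclidean_space \<Rightarrow> 'b"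
  assumes "open S" "open T" "\<And>x. x \<in> S \<Longrightarrow> g x \<in> T" "Ck_on k T f" "Ck_on k S g"
  shows "Ck_on k S (\<lambda>x. f (g x))"
  using assms(4,5)
proof (induction k arbitrary: f)
  case 0
  then show ?case using assms(3) by (auto intro: continuous_on_compose2)
next
  case (Suc k)
  have d: "((\<lambda>x. f (g x)) has_derivative (\<lambda>v. pd (pd v g x) f (g x))) (at x)" if "x \<in> S" for x
    using Suc.prems that assms(3) pd_compose unfolding Ck_on_Suc_pd by metis
  have c: "Ck_on k S (\<lambda>x. \<Sum>b\<in>Basis. (pd v g x \<bullet> b) *\<^sub>R pd b f (g x))" for v
  proof (intro Ck_on_sum assms(1) Ck_on_bilinear[OF bounded_bilinear_scaleR] finite_Basis)
    fix b :: 'b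
    show "Ck_on k S (\<lambda>x. pd v g x \<bullet> b)"
      by (rule Ck_on_linear[OF bounded_linear_inner_left assms(1)])
        (use Suc.prems in \<open>auto simp: Ck_on_Suc_pd\<close>)
    show "Ck_on k S (\<lambda>x. pd b f (g x))"
      by (rule Suc.IH) (use Suc.prems Ck_on_SucD in \<open>auto simp: Ck_on_Suc_pd\<close>)
  qed
  have "pd (pd v g x) f (g x) = (\<Sum>b\<in>Basis. (pd v g x \<bullet> b) *\<^sub>R pd b f (g x))" if "x \<in> S" for x v
    using Suc.prems(1) assms(3)[OF that] by (intro pd_expand) (auto simp: Ck_on_Suc_pd)
  then have "((\<lambda>x. f (g x)) has_derivative (\<lambda>v. \<Sum>b\<in>Basis. (pd v g x \<bullet> b) *\<^sub>R pd b f (g x))) (at x)"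
    if "x \<in> S" for x using d[OF that] that by simp
  then show ?case by (rule Ck_on_SucI[OF assms(1) _ c])
qed

lemma smooth_on_pd: "smooth_on S f \<Longrightarrow> smooth_on S (pd v f)"
  unfolding smooth_on_def using Ck_on_Suc_pd by blast

lemma smooth_onD: "smooth_on S f \<Longrightarrow> x \<in> S \<Longrightarrow> f differentiable (at x)"
  unfolding smooth_on_def using Ck_on_Suc_pd by blast

lemma smooth_on_continuous: "smooth_on S f \<Longrightarrow> continuous_on S f"
  unfolding smooth_on_def using Ck_on.simps(1) by blast

lemma smooth_on_Ck: "smooth_on S f \<Longrightarrow> Ck_on k S f"
  unfolding smooth_on_def by blast

lemma smooth_on_cong:
  "open S \<Longrightarrow> (\<And>x. x \<in> S \<Longrightarrow> f x = g x) \<Longrightarrow> smooth_on S f \<longleftrightarrow> smooth_on S g"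
  unfolding smooth_on_def using Ck_on_cong by blast

lemma smooth_on_subset: "smooth_on S f \<Longrightarrow> T \<subseteq> S \<Longrightarrow> smooth_on T f"
  unfolding smooth_on_def using Ck_on_subset by blast

lemma smooth_on_const: "smooth_on S (\<lambda>x. c)"
  unfolding smooth_on_def by simp

lemma smooth_on_linear: "bounded_linear h \<Longrightarrow> open S \<Longrightarrow> smooth_on S f \<Longrightarrow> smooth_on S (\<lambda>x. h (f x))"
  unfolding smooth_on_def using Ck_on_linear by blast

lemma smooth_on_add: "open S \<Longrightarrow> smooth_on S f \<Longrightarrow> smooth_on S g \<Longrightarrow> smooth_on S (\<lambda>x. f x + g x)"
  unfolding smooth_on_def using Ck_on_add by blast

lemma smooth_on_bilinear:
  "bounded_bilinear h \<Longrightarrow> open S \<Longrightarrow> smooth_on S f \<Longrightarrow> smooth_on S g \<Longrightarrow> smooth_on S (\<lambda>x. h (f x) (g x))"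
  unfolding smooth_on_def using Ck_on_bilinear by blast

lemmas smooth_on_scaleR = smooth_on_bilinear[OF bounded_bilinear_scaleR]
lemmas smooth_on_inner = smooth_on_bilinear[OF bounded_bilinear_inner]

lemma smooth_on_mult:
  fixes f g :: "'a::euclidean_space \<Rightarrow> real"
  shows "open S \<Longrightarrow> smooth_on S f \<Longrightarrow> smooth_on S g \<Longrightarrow> smooth_on S (\<lambda>x. f x * g x)"
  by (rule smooth_on_bilinear[OF bounded_bilinear_mult])

lemma smooth_on_uminus: "open S \<Longrightarrow> smooth_on S f \<Longrightarrow> smooth_on S (\<lambda>x. - f x)"
  by (rule smooth_on_linear[OF bounded_linear_minus[OF bounded_linear_ident]])

lemma smooth_on_diff: "open S \<Longrightarrow> smooth_on S f \<Longrightarrow> smooth_on S g \<Longrightarrow> smooth_on S (\<lambda>x. f x - g x)"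
  using smooth_on_add[of S f "\<lambda>x. - g x"] smooth_on_uminus by auto

lemma smooth_on_sum:
  "open S \<Longrightarrow> finite I \<Longrightarrow> (\<And>i. i \<in> I \<Longrightarrow> smooth_on S (f i)) \<Longrightarrow> smooth_on S (\<lambda>x. \<Sum>i\<in>I. f i x)"
  unfolding smooth_on_def using Ck_on_sum by blast

lemma smooth_on_prod:
  fixes f :: "'i \<Rightarrow> 'a::euclidean_space \<Rightarrow> real"
  assumes "open S" "finite I" "\<And>i. i \<in> I \<Longrightarrow> smooth_on S (f i)"
  shows "smooth_on S (\<lambda>x. \<Prod>i\<in>I. f i x)"
  using assms(2,3)
  by (induction I rule: finite_induct) (auto intro!: smooth_on_const smooth_on_mult assms(1))

lemma smooth_on_compose:
  fixes f :: "'b::euclidean_space \<Rightarrow> 'c::real_normed_vector" and g :: "'a::euclidean_space \<Rightarrow> 'b"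
  shows "open S \<Longrightarrow> open T \<Longrightarrow> (\<And>x. x \<in> S \<Longrightarrow> g x \<in> T) \<Longrightarrow> smooth_on T f \<Longrightarrow> smooth_on S g
    \<Longrightarrow> smooth_on S (\<lambda>x. f (g x))"
  unfolding smooth_on_def using Ck_on_compose by blast

text \<open>Membership in \<open>P\<close> passes from a function to all its directional
  derivatives, so the induction on the order never has to name a higher derivative. Harmonic
  functions, limits of difference quotients and functions of time and space are all shown smooth by
  exhibiting such a class.\<close>

lemma smooth_on_coinduct:
  assumes "open S" "P f"
    and step: "\<And>f. P f \<Longrightarrow> (\<forall>x\<in>S. f differentiable (at x)) \<and> (\<forall>v. \<exists>g. P g \<and> (\<forall>x\<in>S. pd v f x = g x))"
  shows "smooth_on S f"
proof -
  have "Ck_on k S f" if "P f" for k f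
    using that
  proof (induction k arbitrary: f)
    case 0
    then show ?case
      using step by (simp add: continuous_at_imp_continuous_on differentiable_imp_continuous_within)
  next
    case (Suc k)
    have "Ck_on k S (pd v f)" for v
      using step[OF Suc.prems] Suc.IH Ck_on_cong[OF assms(1)] by metis
    then show ?case unfolding Ck_on_Suc_pd using step[OF Suc.prems] by auto
  qed
  then show ?thesis using assms(2) by (simp add: smooth_on_def)
qed

section \<open>Elementary smooth functions and the inversion of matrices\<close>

lemma smooth_on_bounded_linear:
  fixes h :: "'a::euclidean_space \<Rightarrow> 'b::real_normed_vector"
  assumes "bounded_linear h" "open S" shows "smooth_on S h"
proof (rule smooth_on_coinduct[where P="\<lambda>f. f = h \<or> (\<exists>c. f = (\<lambda>x. c))", OF assms(2)])
  have d: "(h has_derivative h) (at x)" for x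
    using assms(1) bounded_linear_imp_has_derivative by blast
  fix f :: "'a \<Rightarrow> 'b" assume "f = h \<or> (\<exists>c. f = (\<lambda>x. c))"
  then show "(\<forall>x\<in>S. f differentiable at x) \<and> (\<forall>v. \<exists>g. (g = h \<or> (\<exists>c. g = (\<lambda>x. c))) \<and> (\<forall>x\<in>S. pd v f x = g x))"
  proof
    assume f: "f = h"
    have "pd v f x = h v" for v x unfolding f by (rule pd_eq[OF d])
    then show ?thesis using d f differentiable_def by blast
  next
    assume "\<exists>c. f = (\<lambda>x. c)"
    then obtain c where f: "f = (\<lambda>x. c)" by blast
    have "pd v f x = 0" for v x unfolding f by (simp add: pd_def)
    then show ?thesis using f by auto
  qed
qed simp

lemma smooth_on_ident: "open S \<Longrightarrow> smooth_on S (\<lambda>x. x)"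
  using smooth_on_bounded_linear[OF bounded_linear_ident] .

lemma smooth_on_fst: "open S \<Longrightarrow> smooth_on S fst"
  using smooth_on_bounded_linear[OF bounded_linear_fst] .

lemma smooth_on_snd: "open S \<Longrightarrow> smooth_on S snd"
  using smooth_on_bounded_linear[OF bounded_linear_snd] .

lemma smooth_on_Pair:
  assumes "open S" "smooth_on S f" "smooth_on S g"
  shows "smooth_on S (\<lambda>x. (f x, g x))"
proof -
  have "smooth_on S (\<lambda>x. (f x, 0) + (0, g x))"
    by (intro smooth_on_add assms smooth_on_linear[of "\<lambda>a. (a, 0)"] smooth_on_linear[of "\<lambda>a. (0, a)"]
        bounded_linear_Pair bounded_linear_ident bounded_linear_zero)
  then show ?thesis by simp
qed

text \<open>On the real line the derivative in direction \<open>v\<close> is \<open>v\<close> times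
  the ordinary derivative, so the class has to absorb constant factors.\<close>

lemma smooth_on_real_coinduct:
  fixes f :: "real \<Rightarrow> real"
  assumes "open S" "P f"
    and step: "\<And>f. P f \<Longrightarrow> \<exists>g. (\<forall>c. P (\<lambda>x. c * g x)) \<and> (\<forall>x\<in>S. (f has_real_derivative g x) (at x))"
  shows "smooth_on S f"
proof (rule smooth_on_coinduct[where P=P, OF assms(1,2)])
  fix f assume "P f"
  then obtain g where g: "\<forall>c. P (\<lambda>x. c * g x)" "\<forall>x\<in>S. (f has_real_derivative g x) (at x)"
    using step by blast
  have d: "(f has_derivative (\<lambda>v. v * g x)) (at x)" if "x \<in> S" for x
    using g(2) that by (simp add: has_field_derivative_def mult.commute[of _ "g x"] mult_commute_abs)
  then have "pd v f x = v * g x" if "x \<in> S" for x v using pd_eq that by blast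
  then show "(\<forall>x\<in>S. f differentiable at x) \<and> (\<forall>v. \<exists>h. P h \<and> (\<forall>x\<in>S. pd v f x = h x))"
    using d g(1) differentiable_def by blast
qed

lemma smooth_on_inverse: "smooth_on {x::real. x \<noteq> 0} inverse"
proof (rule smooth_on_real_coinduct[where P="\<lambda>f. \<exists>c k. f = (\<lambda>x::real. c * inverse x ^ k)"])
  show "open {x::real. x \<noteq> 0}" by (simp add: open_Collect_neq)
  show "\<exists>c k. inverse = (\<lambda>x::real. c * inverse x ^ k)"
    by (rule exI[of _ 1], rule exI[of _ 1]) auto
  fix f :: "real \<Rightarrow> real" assume "\<exists>c k. f = (\<lambda>x::real. c * inverse x ^ k)"
  then obtain c k where f: "f = (\<lambda>x. c * inverse x ^ k)" by blast
  have "(f has_real_derivative - c * k * inverse x ^ Suc k) (at x)" if "x \<noteq> 0" for x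
    unfolding f using that
    by (auto intro!: derivative_eq_intros) (cases k; simp add: field_simps)
  moreover have "\<exists>c' l. (\<lambda>x. e * (- c * k * inverse x ^ Suc k)) = (\<lambda>x::real. c' * inverse x ^ l)" for e
    by (rule exI[of _ "- e * c * k"], rule exI[of _ "Suc k"]) auto
  ultimately show "\<exists>g. (\<forall>c. \<exists>c' l. (\<lambda>x. c * g x) = (\<lambda>x::real. c' * inverse x ^ l)) \<and>
      (\<forall>x\<in>{x. x \<noteq> 0}. (f has_real_derivative g x) (at x))"
    by (intro exI[of _ "\<lambda>x. - c * k * inverse x ^ Suc k"]) auto
qed

lemma smooth_on_powr: "smooth_on {0<..} (\<lambda>x::real. x powr r)"
proof (rule smooth_on_real_coinduct[where P="\<lambda>f. \<exists>c r. f = (\<lambda>x::real. c * x powr r)"])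
  show "\<exists>c s. (\<lambda>x::real. x powr r) = (\<lambda>x. c * x powr s)" by (rule exI[of _ 1]) auto
  fix f :: "real \<Rightarrow> real" assume "\<exists>c r. f = (\<lambda>x::real. c * x powr r)"
  then obtain c k where f: "f = (\<lambda>x. c * x powr k)" by blast
  have "(f has_real_derivative c * k * x powr (k - 1)) (at x)" if "x > 0" for x
    unfolding f using that by (auto intro!: derivative_eq_intros)
  moreover have "\<exists>c' l. (\<lambda>x. e * (c * k * x powr (k - 1))) = (\<lambda>x::real. c' * x powr l)" for e
    by (rule exI[of _ "e * c * k"], rule exI[of _ "k - 1"]) auto
  ultimately show "\<exists>g. (\<forall>c. \<exists>c' l. (\<lambda>x. c * g x) = (\<lambda>x::real. c' * x powr l)) \<and>
      (\<forall>x\<in>{0<..}. (f has_real_derivative g x) (at x))"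
    by (intro exI[of _ "\<lambda>x. c * k * x powr (k - 1)"]) auto
qed simp

lemma smooth_on_cos_sin: "smooth_on UNIV (\<lambda>x::real. a * cos x + b * sin x)"
proof (rule smooth_on_real_coinduct[where P="\<lambda>f. \<exists>a b. f = (\<lambda>x::real. a * cos x + b * sin x)"])
  fix f :: "real \<Rightarrow> real" assume "\<exists>a b. f = (\<lambda>x::real. a * cos x + b * sin x)"
  then obtain a b where f: "f = (\<lambda>x. a * cos x + b * sin x)" by blast
  have "(f has_real_derivative (b * cos x + (- a) * sin x)) (at x)" for x
    unfolding f by (auto intro!: derivative_eq_intros)
  moreover have "\<exists>a' b'. (\<lambda>x. e * (b * cos x + (- a) * sin x)) = (\<lambda>x::real. a' * cos x + b' * sin x)" for e
    by (rule exI[of _ "e * b"], rule exI[of _ "- e * a"]) (auto simp: algebra_simps)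
  ultimately show "\<exists>g. (\<forall>c. \<exists>a' b'. (\<lambda>x. c * g x) = (\<lambda>x::real. a' * cos x + b' * sin x)) \<and>
      (\<forall>x\<in>UNIV. (f has_real_derivative g x) (at x))"
    by (intro exI[of _ "\<lambda>x. b * cos x + (- a) * sin x"]) auto
qed auto

lemma smooth_on_divide:
  fixes f g :: "'a::euclidean_space \<Rightarrow> real"
  assumes "open S" "smooth_on S f" "smooth_on S g" "\<And>x. x \<in> S \<Longrightarrow> g x \<noteq> 0"
  shows "smooth_on S (\<lambda>x. f x / g x)"
proof -
  have "smooth_on S (\<lambda>x. inverse (g x))"
    by (rule smooth_on_compose[OF assms(1) _ _ smooth_on_inverse assms(3)])
      (use assms(4) in \<open>auto simp: open_Collect_neq\<close>)
  then show ?thesis unfolding divide_inverse by (intro smooth_on_mult assms)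
qed

lemma smooth_on_vec_lambda:
  fixes f :: "'n::finite \<Rightarrow> 'a::euclidean_space \<Rightarrow> real"
  assumes "open S" "\<And>k. smooth_on S (f k)"
  shows "smooth_on S (\<lambda>x. \<chi> k. f k x)"
proof -
  have "(\<lambda>x. \<chi> k. f k x) = (\<lambda>x. \<Sum>k\<in>UNIV. f k x *\<^sub>R axis k 1)"
    by (auto simp: vec_eq_iff axis_def if_distrib cong: if_cong)
  moreover have "smooth_on S (\<lambda>x. \<Sum>k\<in>UNIV. f k x *\<^sub>R (axis k 1 :: real^'n))"
    by (intro smooth_on_sum smooth_on_scaleR assms smooth_on_const finite)
  ultimately show ?thesis by simp
qed

lemma smooth_on_vec_nth:
  fixes f :: "'a::euclidean_space \<Rightarrow> real^'n"
  shows "open S \<Longrightarrow> smooth_on S f \<Longrightarrow> smooth_on S (\<lambda>x. f x $ k)"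
  by (rule smooth_on_linear[OF bounded_linear_vec_nth])

lemma smooth_on_det:
  fixes M :: "'a::euclidean_space \<Rightarrow> real^'n^'n"
  assumes "open S" "\<And>i j. smooth_on S (\<lambda>x. M x $ i $ j)"
  shows "smooth_on S (\<lambda>x. det (M x))"
  unfolding det_def
  by (intro smooth_on_sum smooth_on_mult smooth_on_const smooth_on_prod assms finite)

text \<open>Cramer's rule presents the inverse as a quotient of polynomials in the matrix entries;
  this is how an inverse is seen to depend smoothly on parameters.\<close>

lemma inv_linear_cramer:
  fixes L :: "real^'n \<Rightarrow> real^'n"
  assumes "linear L" "inj L"
  shows "inv L b = (\<chi> k. det (\<chi> i j. if j = k then b $ i else matrix L $ i $ j) / det (matrix L))"
    and "det (matrix L) \<noteq> 0"
proof -
  have "surj L" using assms linear_injective_imp_surjective by blast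
  then have e: "matrix L *v inv L b = b"
    using matrix_works[of L] assms(1) surj_f_inv_f by (metis linear_matrix_vector_mul_eq matrix_vector_mul)
  show d: "det (matrix L) \<noteq> 0"
    using det_nz_iff_inj assms by blast
  show "inv L b = (\<chi> k. det (\<chi> i j. if j = k then b $ i else matrix L $ i $ j) / det (matrix L))"
    using cramer[OF d, of "inv L b" b] e by simp
qed

lemma smooth_on_inv_linear:
  fixes M :: "'a::euclidean_space \<Rightarrow> real^'n \<Rightarrow> real^'n"
  assumes "open S" "\<And>v. smooth_on S (\<lambda>z. M z v)" "\<And>z. z \<in> S \<Longrightarrow> linear (M z)" "\<And>z. z \<in> S \<Longrightarrow> inj (M z)"
  shows "smooth_on S (\<lambda>z. inv (M z) b)"
proof -
  have m: "smooth_on S (\<lambda>z. matrix (M z) $ i $ j)" for i j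
    unfolding matrix_def by (simp add: smooth_on_vec_nth assms)
  have m': "smooth_on S (\<lambda>z. if j = k then b $ i else matrix (M z) $ i $ j)" for i j k
    by (cases "j = k") (auto simp: m smooth_on_const)
  have "smooth_on S (\<lambda>z. \<chi> k. det (\<chi> i j. if j = k then b $ i else matrix (M z) $ i $ j) / det (matrix (M z)))"
    by (intro smooth_on_vec_lambda smooth_on_divide smooth_on_det assms(1) inv_linear_cramer(2) assms(3,4))
      (auto simp: m m')
  moreover have "inv (M z) b = (\<chi> k. det (\<chi> i j. if j = k then b $ i else matrix (M z) $ i $ j) / det (matrix (M z)))"
    if "z \<in> S" for z
    using inv_linear_cramer(1) assms(3,4) that by blast
  ultimately show ?thesis
    using smooth_on_cong[OF assms(1)] by (metis (no_types, lifting))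
qed

section \<open>Second differences and the symmetry of second derivatives\<close>

lemma second_difference_mvt:
  fixes f :: "'a::euclidean_space \<Rightarrow> real"
  assumes f: "Ck_on 2 S f" and h: "h > 0"
    and S: "\<And>s t. 0 \<le> s \<Longrightarrow> s \<le> h \<Longrightarrow> 0 \<le> t \<Longrightarrow> t \<le> h \<Longrightarrow> x + s *\<^sub>R u + t *\<^sub>R v \<in> S"
  shows "\<exists>\<xi>\<in>{0<..<h}. \<exists>\<tau>\<in>{0<..<h}.
    f (x + h *\<^sub>R u + h *\<^sub>R v) - f (x + h *\<^sub>R u) - f (x + h *\<^sub>R v) + f x
      = h\<^sup>2 * pd v (pd u f) (x + \<xi> *\<^sub>R u + \<tau> *\<^sub>R v)"
proof -
  have f1: "f differentiable (at y)" "pd u f differentiable (at y)" if "y \<in> S" for y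
    using f that by (auto simp: numeral_2_eq_2 Ck_on_Suc_pd)
  \<comment> \<open>The difference in direction \<open>v\<close> is regarded as a function of the
    step along \<open>u\<close>. The mean value theorem is applied first in that step and then in
    the step along \<open>v\<close>, so the mixed derivative arises in the order
    \<open>pd v (pd u f)\<close>.\<close>
  define g where "g = (\<lambda>s. f (x + s *\<^sub>R u + h *\<^sub>R v) - f (x + s *\<^sub>R u))"
  have "(g has_real_derivative (pd u f (x + s *\<^sub>R u + h *\<^sub>R v) - pd u f (x + s *\<^sub>R u))) (at s)"
    if "0 \<le> s" "s \<le> h" for s
  proof -
    have "((\<lambda>s. f (x + s *\<^sub>R u + t *\<^sub>R v)) has_derivative (\<lambda>k. pd (k *\<^sub>R u) f (x + s *\<^sub>R u + t *\<^sub>R v))) (at s)"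
      if t: "0 \<le> t" "t \<le> h" for t
      by (rule has_derivative_compose[OF _ has_derivative_pd[OF f1(1)], of _ _ s UNIV, simplified])
        (use S[OF that(1,2)] \<open>0 \<le> s\<close> \<open>s \<le> h\<close> t S in \<open>auto intro!: derivative_eq_intros\<close>)
    from this[of h] this[of 0] h
    have D: "(g has_derivative (\<lambda>k. pd (k *\<^sub>R u) f (x + s *\<^sub>R u + h *\<^sub>R v) - pd (k *\<^sub>R u) f (x + s *\<^sub>R u))) (at s)"
      unfolding g_def by (intro has_derivative_diff) auto
    have "pd (k *\<^sub>R u) f y = k * pd u f y" if "y \<in> S" for k y
      using linear.scaleR[OF pd_linear[OF f1(1)[OF that]], of k u] by simp
    note eqs = this
    show ?thesis
      unfolding has_field_derivative_def
      by (rule has_derivative_eq_rhs[OF D]) (use eqs S[of s h] S[of s 0] that h in \<open>auto simp: fun_eq_iff algebra_simps\<close>)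
  qed
  from MVT2[OF h, of g, OF this] obtain \<xi> where \<xi>: "0 < \<xi>" "\<xi> < h"
    and 1: "g h - g 0 = h * (pd u f (x + \<xi> *\<^sub>R u + h *\<^sub>R v) - pd u f (x + \<xi> *\<^sub>R u))" by auto
  define k where "k = (\<lambda>t. pd u f (x + \<xi> *\<^sub>R u + t *\<^sub>R v))"
  have "(k has_real_derivative pd v (pd u f) (x + \<xi> *\<^sub>R u + t *\<^sub>R v)) (at t)"
    if "0 \<le> t" "t \<le> h" for t
  proof -
    have y: "x + \<xi> *\<^sub>R u + t *\<^sub>R v \<in> S" using S[of \<xi> t] \<xi> that by auto
    have D: "(k has_derivative (\<lambda>r. pd (r *\<^sub>R v) (pd u f) (x + \<xi> *\<^sub>R u + t *\<^sub>R v))) (at t)"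
      unfolding k_def
      by (rule has_derivative_compose[OF _ has_derivative_pd[OF f1(2)], of _ _ t UNIV, simplified])
        (use y in \<open>auto intro!: derivative_eq_intros\<close>)
    have "pd (r *\<^sub>R v) (pd u f) y = r * pd v (pd u f) y" if "y \<in> S" for r y
      using linear.scaleR[OF pd_linear[OF f1(2)[OF that]], of r v] by simp
    from this[OF y] show ?thesis
      unfolding has_field_derivative_def by (intro has_derivative_eq_rhs[OF D]) auto
  qed
  from MVT2[OF h, of k, OF this] obtain \<tau> where \<tau>: "0 < \<tau>" "\<tau> < h"
    and 2: "k h - k 0 = h * pd v (pd u f) (x + \<xi> *\<^sub>R u + \<tau> *\<^sub>R v)" by auto
  have "f (x + h *\<^sub>R u + h *\<^sub>R v) - f (x + h *\<^sub>R u) - f (x + h *\<^sub>R v) + f x = g h - g 0"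
    by (simp add: g_def algebra_simps)
  also have "\<dots> = h * (k h - k 0)" using 1 by (simp add: k_def)
  also have "\<dots> = h\<^sup>2 * pd v (pd u f) (x + \<xi> *\<^sub>R u + \<tau> *\<^sub>R v)" using 2 by (simp add: power2_eq_square)
  finally show ?thesis using \<xi> \<tau> by (intro bexI[of _ \<xi>] bexI[of _ \<tau>]) auto
qed

text \<open>Continuity of the mixed derivative lets the intermediate point of the mean value theorem
  be replaced by \<open>x\<close>. The directions are arbitrary: exchanging them gives the symmetry,
  and opposite directions give the sign at a maximum.\<close>

lemma second_difference_near:
  fixes f :: "'a::euclidean_space \<Rightarrow> real"
  assumes f: "Ck_on 2 S f" and "open S" "x \<in> S" "e > 0"
  shows "\<exists>r>0. \<forall>h\<in>{0<..<r}.
    \<bar>(f (x + h *\<^sub>R u + h *\<^sub>R v) - f (x + h *\<^sub>R u) - f (x + h *\<^sub>R v) + f x) / h\<^sup>2 - pd v (pd u f) x\<bar> < e"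
proof -
  have "continuous_on S (pd v (pd u f))"
    using f by (simp add: numeral_2_eq_2 Ck_on_Suc_pd)
  then have "isCont (pd v (pd u f)) x" using assms continuous_on_eq_continuous_at by blast
  then obtain d where d: "d > 0" "\<And>y. dist y x < d \<Longrightarrow> dist (pd v (pd u f) y) (pd v (pd u f) x) < e"
    using \<open>e > 0\<close> unfolding continuous_at_eps_delta by blast
  obtain d' where d': "d' > 0" "ball x d' \<subseteq> S" using assms openE by blast
  define N where "N = norm u + norm v + 1"
  have N: "N > 0" using norm_ge_zero[of u] norm_ge_zero[of v] unfolding N_def by linarith
  \<comment> \<open>Divided by \<open>N\<close> so that the whole parallelogram spanned by the two
    increments lies within \<open>min d d'\<close> of \<open>x\<close>.\<close>
  define r where "r = min d d' / N"
  have r: "r > 0" unfolding r_def using d d' N by simp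
  have near: "dist (x + s *\<^sub>R u + t *\<^sub>R v) x < min d d'"
    if "0 \<le> s" "s \<le> h" "0 \<le> t" "t \<le> h" "0 < h" "h < r" for s t h
  proof -
    have "dist (x + s *\<^sub>R u + t *\<^sub>R v) x \<le> s * norm u + t * norm v"
      using norm_triangle_ineq[of "s *\<^sub>R u" "t *\<^sub>R v"] that by (simp add: dist_norm)
    also have "\<dots> \<le> h * norm u + h * norm v" using that by (intro add_mono mult_right_mono) auto
    also have "\<dots> \<le> h * N" using that unfolding N_def by (simp add: algebra_simps)
    also have "\<dots> < r * N" using that N by simp
    also have "\<dots> = min d d'" unfolding r_def using N by simp
    finally show ?thesis .
  qed
  show ?thesis
  proof (intro exI[of _ r] conjI ballI r)
    fix h assume h: "h \<in> {0<..<r}"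
    have S: "x + s *\<^sub>R u + t *\<^sub>R v \<in> S" if "0 \<le> s" "s \<le> h" "0 \<le> t" "t \<le> h" for s t
      using near[OF that] h d' by (auto simp: dist_commute subset_eq)
    have h0: "h > 0" using h by simp
    obtain \<xi> \<tau> where "\<xi> \<in> {0<..<h}" "\<tau> \<in> {0<..<h}"
      and eq: "f (x + h *\<^sub>R u + h *\<^sub>R v) - f (x + h *\<^sub>R u) - f (x + h *\<^sub>R v) + f x
      = h\<^sup>2 * pd v (pd u f) (x + \<xi> *\<^sub>R u + \<tau> *\<^sub>R v)"
      using second_difference_mvt[OF f h0 S] by blast
    then have "dist (x + \<xi> *\<^sub>R u + \<tau> *\<^sub>R v) x < d" using near[of \<xi> h \<tau>] h by auto
    from d(2)[OF this] eq h
    show "\<bar>(f (x + h *\<^sub>R u + h *\<^sub>R v) - f (x + h *\<^sub>R u) - f (x + h *\<^sub>R v) + f x) / h\<^sup>2 - pd v (pd u f) x\<bar> < e"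
      by (simp add: dist_real_def)
  qed
qed

text \<open>The second difference quotient is symmetric in the two directions and approximates both
  mixed derivatives.\<close>

lemma pd_commute:
  fixes f :: "'a::euclidean_space \<Rightarrow> real"
  assumes f: "Ck_on 2 S f" and "open S" "x \<in> S"
  shows "pd v (pd u f) x = pd u (pd v f) x"
proof (rule ccontr)
  assume ne: "\<not> ?thesis"
  \<comment> \<open>Half the gap: a single quotient cannot be strictly closer than this to both
    values.\<close>
  define e where "e = \<bar>pd v (pd u f) x - pd u (pd v f) x\<bar> / 2"
  have e: "e > 0" using ne by (simp add: e_def)
  define D where "D = (\<lambda>h. (f (x + h *\<^sub>R u + h *\<^sub>R v) - f (x + h *\<^sub>R u) - f (x + h *\<^sub>R v) + f x) / h\<^sup>2)"
  obtain r1 where r1: "r1 > 0" "\<forall>h\<in>{0<..<r1}. \<bar>D h - pd v (pd u f) x\<bar> < e"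
    using second_difference_near[OF assms e, of u v] unfolding D_def by blast
  obtain r2 where r2: "r2 > 0" "\<forall>h\<in>{0<..<r2}.
     \<bar>(f (x + h *\<^sub>R v + h *\<^sub>R u) - f (x + h *\<^sub>R v) - f (x + h *\<^sub>R u) + f x) / h\<^sup>2 - pd u (pd v f) x\<bar> < e"
    using second_difference_near[OF assms e, of v u] by blast
  define h where "h = min r1 r2 / 2"
  have "\<bar>D h - pd v (pd u f) x\<bar> < e" "\<bar>D h - pd u (pd v f) x\<bar> < e"
    using r1 r2 bspec[OF r2(2), of h] by (auto simp: h_def D_def algebra_simps)
  moreover have "\<bar>pd v (pd u f) x - pd u (pd v f) x\<bar>
      \<le> \<bar>D h - pd v (pd u f) x\<bar> + \<bar>D h - pd u (pd v f) x\<bar>" by linarith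
  moreover have "\<bar>pd v (pd u f) x - pd u (pd v f) x\<bar> = e + e" by (simp add: e_def)
  ultimately show False by linarith
qed

text \<open>The lower bound excludes kernel vectors of the derivative, since along such a vector
  \<open>f\<close> would move by o(s); the image is open by invariance of domain. The derivative of
  the inverse \<open>g\<close> is \<open>M (g y)\<close> with \<open>M\<close> smooth, so each order
  of smoothness of \<open>g\<close> produces the next.\<close>

lemma smooth_on_inverse_map:
  fixes f :: "real^'n \<Rightarrow> real^'n"
  assumes S: "open S" and f: "smooth_on S f" and c: "c > 0"
    and low: "\<And>x y. x \<in> S \<Longrightarrow> y \<in> S \<Longrightarrow> c * norm (x - y) \<le> norm (f x - f y)"
  shows "inj_on f S" and "open (f ` S)" and "smooth_on (f ` S) (inv_into S f)"
    and "\<And>x. x \<in> S \<Longrightarrow> inj (\<lambda>v. pd v f x)"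
proof -
  show inj: "inj_on f S"
    using low c by (intro inj_onI) (metis diff_self mult_le_0_iff norm_le_zero_iff norm_zero
        not_less right_minus_eq)
  show op: "open (f ` S)"
    by (rule invariance_of_domain[OF smooth_on_continuous[OF f] S inj])
  show injd: "inj (\<lambda>v. pd v f x)" if x: "x \<in> S" for x
  proof -
    have lin: "linear (\<lambda>v. pd v f x)" by (rule pd_linear[OF smooth_onD[OF f x]])
    have "v = 0" if v: "pd v f x = 0" for v
    proof (rule ccontr)
      assume nz: "v \<noteq> 0"
      have "((\<lambda>s::real. x + s *\<^sub>R v) has_derivative (\<lambda>s. s *\<^sub>R v)) (at 0)"
        by (auto intro!: derivative_eq_intros)
      from has_derivative_compose[OF this, of f "\<lambda>v. pd v f x"] has_derivative_pd[OF smooth_onD[OF f x]]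
      have "((\<lambda>s. f (x + s *\<^sub>R v)) has_derivative (\<lambda>s. pd (s *\<^sub>R v) f x)) (at 0)" by simp
      moreover have "pd (s *\<^sub>R v) f x = 0" for s using linear.scaleR[OF lin, of s v] v by simp
      ultimately have "((\<lambda>s. f (x + s *\<^sub>R v)) has_derivative (\<lambda>s. 0)) (at 0)" by simp
      then have "\<And>e. e > 0 \<Longrightarrow> \<exists>d>0. \<forall>s. norm s < d \<longrightarrow> norm (f (x + s *\<^sub>R v) - f x) \<le> e * norm s"
        by (simp add: has_derivative_at_alt)
      from this[of "c * norm v / 2"] obtain d where d: "d > 0"
        "\<And>s. norm s < d \<Longrightarrow> norm (f (x + s *\<^sub>R v) - f x) \<le> c * norm v / 2 * norm s"
        using c nz by auto
      obtain d' where d': "d' > 0" "ball x d' \<subseteq> S" using S x openE by blast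
      define s where "s = min d (d' / norm v) / 2"
      have s: "0 < s" "s < d" "s * norm v < d'"
        using d d' nz by (auto simp: s_def field_simps min_def)
      then have "x + s *\<^sub>R v \<in> S" using d'(2) by (auto simp: dist_norm subset_eq)
      then have "c * (s * norm v) \<le> norm (f (x + s *\<^sub>R v) - f x)"
        using low[of "x + s *\<^sub>R v" x] x s by simp
      also have "\<dots> \<le> c * norm v / 2 * s" using d(2)[of s] s by simp
      finally show False using s c nz by (simp add: field_simps)
    qed
    then show ?thesis using linear_injective_0[OF lin] by blast
  qed
  define g where "g = inv_into S f"
  have gf: "g (f x) = x" if "x \<in> S" for x using inj that by (simp add: g_def)
  have fg: "f (g y) = y" "g y \<in> S" if "y \<in> f ` S" for y
    using that by (auto simp: g_def f_inv_into_f inv_into_into)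
  have "c * norm (g y - g z) \<le> norm (y - z)" if "y \<in> f ` S" "z \<in> f ` S" for y z
    using low[of "g y" "g z"] fg that by simp
  then have "(1/c)-lipschitz_on (f ` S) g"
    using c by (intro lipschitz_onI) (auto simp: dist_norm field_simps)
  then have contg: "continuous_on (f ` S) g" by (rule lipschitz_on_continuous_on)
  define M where "M = (\<lambda>x b. inv (\<lambda>v. pd v f x) b)"
  have M: "smooth_on S (\<lambda>x. M x b)" for b
    unfolding M_def
    by (rule smooth_on_inv_linear[OF S smooth_on_pd[OF f] pd_linear[OF smooth_onD[OF f]] injd])
  have dg: "(g has_derivative M (g y)) (at y)" if y: "y \<in> f ` S" for y
  proof -
    have lin: "linear (\<lambda>v. pd v f (g y))" by (rule pd_linear[OF smooth_onD[OF f fg(2)[OF y]]])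
    have inj': "inj (\<lambda>v. pd v f (g y))" by (rule injd[OF fg(2)[OF y]])
    obtain N where N: "linear N" "\<And>v. N (pd v f (g y)) = v"
      using linear_injective_left_inverse[OF lin inj'] by (auto simp: o_def id_def fun_eq_iff)
    have "surj (\<lambda>v. pd v f (g y))" using lin inj' linear_injective_imp_surjective by blast
    from surj_f_inv_f[OF this] have "M (g y) b = N b" for b
      using N(2)[of "M (g y) b"] by (simp add: M_def)
    then have "bounded_linear (M (g y))"
      using N(1) linear_conv_bounded_linear by (metis ext)
    moreover have "M (g y) \<circ> (\<lambda>v. pd v f (g y)) = id"
      unfolding M_def using inj' by auto
    ultimately have "(g has_derivative M (g y)) (at (f (g y)))"
      using has_derivative_inverse_dieudonne[OF S op smooth_on_continuous[OF f] contg gf fg(2)[OF y]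
        has_derivative_pd[OF smooth_onD[OF f fg(2)[OF y]]]] by blast
    then show ?thesis using fg(1)[OF y] by simp
  qed
  have "Ck_on k (f ` S) g" for k
  proof (induction k)
    case 0
    show ?case using contg by simp
  next
    case (Suc k)
    have "Ck_on k (f ` S) (pd b g)" for b
    proof -
      have "Ck_on k (f ` S) (\<lambda>y. M (g y) b)"
        by (rule Ck_on_compose[OF op S fg(2) smooth_on_Ck[OF M] Suc])
      then show ?thesis
        using Ck_on_cong[OF op, of "pd b g" "\<lambda>y. M (g y) b"] pd_eq[OF dg] by blast
    qed
    then show ?case unfolding Ck_on_Suc_pd using dg differentiable_def by blast
  qed
  then show "smooth_on (f ` S) (inv_into S f)" unfolding smooth_on_def g_def by blast
qed

section \<open>Interior estimates for the Laplacian\<close>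

lemma pd_add: "f differentiable (at x) \<Longrightarrow> g differentiable (at x) \<Longrightarrow> pd v (\<lambda>x. f x + g x) x = pd v f x + pd v g x"
  by (rule pd_eq[OF has_derivative_add[OF has_derivative_pd has_derivative_pd]])

lemma pd_diff: "f differentiable (at x) \<Longrightarrow> g differentiable (at x) \<Longrightarrow> pd v (\<lambda>x. f x - g x) x = pd v f x - pd v g x"
  by (rule pd_eq[OF has_derivative_diff[OF has_derivative_pd has_derivative_pd]])

lemma pd_mult:
  fixes f g :: "'a::euclidean_space \<Rightarrow> real"
  shows "f differentiable (at x) \<Longrightarrow> g differentiable (at x) \<Longrightarrow> pd v (\<lambda>x. f x * g x) x = f x * pd v g x + pd v f x * g x"
  by (rule pd_eq[OF has_derivative_mult[OF has_derivative_pd has_derivative_pd]])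

lemma pd_cmult:
  fixes f :: "'a::euclidean_space \<Rightarrow> real"
  shows "f differentiable (at x) \<Longrightarrow> pd v (\<lambda>x. c * f x) x = c * pd v f x"
  by (rule pd_eq[OF has_derivative_mult_right[OF has_derivative_pd]])

lemma pd_const [simp]: "pd v (\<lambda>x. c) x = 0"
  by (simp add: pd_def)

lemma pd_sum:
  fixes f :: "'i \<Rightarrow> 'a::euclidean_space \<Rightarrow> real"
  shows "(\<And>i. i \<in> I \<Longrightarrow> f i differentiable (at x)) \<Longrightarrow> pd v (\<lambda>x. \<Sum>i\<in>I. f i x) x = (\<Sum>i\<in>I. pd v (f i) x)"
  by (rule pd_eq[OF has_derivative_sum[OF has_derivative_pd]])

lemma laplacian_alt: "laplacian f x = (\<Sum>b\<in>Basis. pd b (pd b f) x)"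
  by (simp add: laplacian_def pd_def)

lemma Ck2D:
  assumes "Ck_on 2 S f" "x \<in> S"
  shows "f differentiable (at x)" "pd v f differentiable (at x)"
  using assms by (auto simp: numeral_2_eq_2 Ck_on_Suc_pd)

lemma pd_pd_add:
  assumes "open S" "Ck_on 2 S f" "Ck_on 2 S g" "x \<in> S"
  shows "pd v (pd w (\<lambda>x. f x + g x)) x = pd v (pd w f) x + pd v (pd w g) x"
proof -
  have "pd v (pd w (\<lambda>x. f x + g x)) x = pd v (\<lambda>x. pd w f x + pd w g x) x"
    by (rule pd_cong[OF assms(1) _ assms(4)]) (rule pd_add[OF Ck2D(1)[OF assms(2)] Ck2D(1)[OF assms(3)]])
  then show ?thesis using pd_add[OF Ck2D(2)[OF assms(2,4)] Ck2D(2)[OF assms(3,4)], of v w w] by simp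
qed

lemma pd_pd_cmult:
  fixes f :: "'a::euclidean_space \<Rightarrow> real"
  assumes "open S" "Ck_on 2 S f" "x \<in> S"
  shows "pd v (pd w (\<lambda>x. c * f x)) x = c * pd v (pd w f) x"
proof -
  have "pd v (pd w (\<lambda>x. c * f x)) x = pd v (\<lambda>x. c * pd w f x) x"
    by (rule pd_cong[OF assms(1) _ assms(3)]) (rule pd_cmult[OF Ck2D(1)[OF assms(2)]])
  then show ?thesis using pd_cmult[OF Ck2D(2)[OF assms(2,3)], of v c w] by simp
qed

lemma Ck_on_cmult:
  fixes f :: "'a::euclidean_space \<Rightarrow> real"
  shows "open S \<Longrightarrow> Ck_on k S f \<Longrightarrow> Ck_on k S (\<lambda>x. c * f x)"
  by (rule Ck_on_linear[OF bounded_linear_mult_right])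

lemma laplacian_add:
  assumes "open S" "Ck_on 2 S f" "Ck_on 2 S g" "x \<in> S"
  shows "laplacian (\<lambda>x. f x + g x) x = laplacian f x + laplacian g x"
  unfolding laplacian_alt using pd_pd_add[OF assms] by (simp add: sum.distrib)

lemma laplacian_cmult:
  assumes "open S" "Ck_on 2 S f" "x \<in> S"
  shows "laplacian (\<lambda>x. c * f x) x = c * laplacian f x"
  unfolding laplacian_alt using pd_pd_cmult[OF assms] by (simp add: sum_distrib_left)

lemma laplacian_diff:
  assumes "open S" "Ck_on 2 S f" "Ck_on 2 S g" "x \<in> S"
  shows "laplacian (\<lambda>x. f x - g x) x = laplacian f x - laplacian g x"
  using laplacian_add[OF assms(1,2) Ck_on_cmult[OF assms(1,3), of "-1"] assms(4)]
    laplacian_cmult[OF assms(1,3,4), of "-1"] by simp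

lemma Ck_on_diff:
  fixes f g :: "'a::euclidean_space \<Rightarrow> real"
  assumes "open S" "Ck_on k S f" "Ck_on k S g"
  shows "Ck_on k S (\<lambda>x. f x - g x)"
  using Ck_on_add[OF assms(1,2) Ck_on_cmult[OF assms(1,3), of "-1"]] by simp

section \<open>Second derivatives at a maximum and the maximum principle\<close>

lemma pd_pd_at_max:
  fixes f :: "'a::euclidean_space \<Rightarrow> real"
  assumes "open S" "Ck_on 2 S f" "x \<in> S" "\<And>y. y \<in> S \<Longrightarrow> f y \<le> f x"
  shows "pd v (pd v f) x \<le> 0"
proof (rule ccontr)
  assume "\<not> ?thesis"
  then have e: "pd v (pd v f) x > 0" by simp
  have m: "pd (- v) (pd v f) x = - pd v (pd v f) x"
    using linear_neg[OF pd_linear[OF Ck2D(2)[OF assms(2,3)]]] by simp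
  obtain r where r: "r > 0" "\<And>h. h \<in> {0<..<r} \<Longrightarrow>
    \<bar>(f (x + h *\<^sub>R v + h *\<^sub>R (- v)) - f (x + h *\<^sub>R v) - f (x + h *\<^sub>R (- v)) + f x) / h\<^sup>2 - pd (- v) (pd v f) x\<bar>
      < pd v (pd v f) x"
    using second_difference_near[OF assms(2,1,3) e, of v "- v"] by blast
  obtain d where d: "d > 0" "ball x d \<subseteq> S" using assms(1,3) openE by blast
  have nv: "norm v + 1 > 0" using norm_ge_zero[of v] by linarith
  define D where "D = d / (norm v + 1)"
  have D: "D > 0" using nv d(1) by (simp add: D_def)
  define h where "h = min r D / 2"
  have h: "0 < h" "h < r" "h < D"
    using r(1) D by (auto simp: h_def)
  then have "h * norm v < d" using nv by (simp add: D_def field_simps)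
  then have "x + h *\<^sub>R v \<in> S" "x + h *\<^sub>R (- v) \<in> S"
    using d(2) h(1) by (auto simp: subset_eq dist_norm)
  \<comment> \<open>With opposite increments the first term is \<open>f x\<close> itself, so the
    numerator is a sum of two nonnegative drops from the maximum, while the quotient tends to minus
    the second derivative in direction \<open>v\<close>.\<close>
  then have "0 \<le> (f (x + h *\<^sub>R v + h *\<^sub>R (- v)) - f (x + h *\<^sub>R v) - f (x + h *\<^sub>R (- v)) + f x) / h\<^sup>2"
    using assms(4)[of "x + h *\<^sub>R v"] assms(4)[of "x + h *\<^sub>R (- v)"] by simp
  then show False using r(2)[of h] h m by (simp add: abs_less_iff)
qed

lemma laplacian_at_max:
  fixes f :: "'a::euclidean_space \<Rightarrow> real"
  assumes "open S" "Ck_on 2 S f" "x \<in> S" "\<And>y. y \<in> S \<Longrightarrow> f y \<le> f x"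
  shows "laplacian f x \<le> 0"
  unfolding laplacian_alt by (intro sum_nonpos pd_pd_at_max[OF assms])

text \<open>The strict sign contradicts \<open>laplacian_at_max\<close> at an interior maximum
  directly; the comparison functions are built with room to spare.\<close>

lemma max_principle:
  fixes p :: "'a::euclidean_space \<Rightarrow> real"
  assumes "compact K" "open S" "S \<subseteq> K" "continuous_on K p" "Ck_on 2 S p"
    and pos: "\<And>x. x \<in> S \<Longrightarrow> laplacian p x > 0" and bd: "\<And>x. x \<in> K - S \<Longrightarrow> p x \<le> 0"
    and x: "x \<in> K"
  shows "p x \<le> 0"
proof -
  obtain z where z: "z \<in> K" "\<And>y. y \<in> K \<Longrightarrow> p y \<le> p z"
    using continuous_attains_sup[OF assms(1) _ assms(4)] x by blast
  have "z \<notin> S"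
  proof
    assume "z \<in> S"
    then have "laplacian p z \<le> 0" using laplacian_at_max[OF assms(2,5)] z assms(3) by blast
    then show False using pos[OF \<open>z \<in> S\<close>] by simp
  qed
  then have "p z \<le> 0" using bd z by blast
  then show ?thesis using z(2)[OF x] by simp
qed

text \<open>The comparison function is that of Gilbarg and Trudinger, Section 3.4: it is applied on a half
  cube to the odd part of \<^term>\<open>u\<close> in the direction \<^term>\<open>b\<close>, which vanishes on the middle face.\<close>

lemma gradient_cube_upper:
  fixes u :: "'a::euclidean_space \<Rightarrow> real"
  assumes U: "open U" "Ck_on 2 U u" and b: "b \<in> Basis" and r: "r > 0"
    and Q: "cbox (y0 - r *\<^sub>R One) (y0 + r *\<^sub>R One) \<subseteq> U"
    and M: "\<And>y. y \<in> cbox (y0 - r *\<^sub>R One) (y0 + r *\<^sub>R One) \<Longrightarrow> \<bar>u y\<bar> \<le> M"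
    and N: "\<And>y. y \<in> cbox (y0 - r *\<^sub>R One) (y0 + r *\<^sub>R One) \<Longrightarrow> \<bar>laplacian u y\<bar> < N"
  shows "pd b u y0 \<le> DIM('a) / r * M + r / 2 * N"
proof -
  let ?Q = "cbox (y0 - r *\<^sub>R One) (y0 + r *\<^sub>R One)"
  define n where "n = real DIM('a)"
  have Qiff: "y \<in> ?Q \<longleftrightarrow> (\<forall>j\<in>Basis. \<bar>(y - y0) \<bullet> j\<bar> \<le> r)" for y
    by (auto simp: mem_box inner_diff_left inner_add_left abs_le_iff algebra_simps)
  have y0: "y0 \<in> ?Q" using r by (simp add: Qiff)
  have M0: "M \<ge> 0" using M[OF y0] by linarith
  have N0: "N > 0" using N[OF y0] by linarith
  have bb: "b \<bullet> b = 1" using b by simp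
  define s where "s = (\<lambda>y. (y - y0) \<bullet> b)"
  \<comment> \<open>Reflection in the hyperplane through \<open>y0\<close> orthogonal to
    \<open>b\<close>; it maps the cube to itself.\<close>
  define \<sigma> where "\<sigma> = (\<lambda>y. y - (2 * s y) *\<^sub>R b)"
  define \<sigma>' where "\<sigma>' = (\<lambda>v. v - (2 * (v \<bullet> b)) *\<^sub>R b)"
  have \<sigma>j: "(\<sigma> y - y0) \<bullet> j = (if j = b then - ((y - y0) \<bullet> j) else (y - y0) \<bullet> j)" if "j \<in> Basis" for y j
    using b that by (auto simp: \<sigma>_def s_def inner_diff_left inner_Basis algebra_simps)
  have \<sigma>Q: "\<sigma> y \<in> ?Q" if "y \<in> ?Q" for y
    unfolding Qiff using that[unfolded Qiff] \<sigma>j by auto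
  have d\<sigma>: "(\<sigma> has_derivative \<sigma>') (at y)" for y
    unfolding \<sigma>_def \<sigma>'_def s_def by (auto intro!: derivative_eq_intros)
  define U' where "U' = U \<inter> \<sigma> -` U"
  have cont\<sigma>: "continuous_on UNIV \<sigma>"
    unfolding \<sigma>_def s_def by (intro continuous_intros)
  have U': "open U'" unfolding U'_def using U(1) cont\<sigma> by (simp add: open_Int open_vimage)
  have QU': "?Q \<subseteq> U'" unfolding U'_def using Q \<sigma>Q by auto
  have sm\<sigma>: "smooth_on UNIV \<sigma>"
    unfolding \<sigma>_def s_def
    by (intro smooth_on_diff smooth_on_scaleR smooth_on_ident smooth_on_const smooth_on_mult smooth_on_inner open_UNIV)
  have cu\<sigma>: "Ck_on 2 U' (\<lambda>y. u (\<sigma> y))"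
    by (rule Ck_on_compose[OF U' U(1) _ U(2) Ck_on_subset[OF smooth_on_Ck[OF sm\<sigma>]]]) (auto simp: U'_def)
  have cu: "Ck_on 2 U' u" using Ck_on_subset[OF U(2)] unfolding U'_def by auto
  have pd\<sigma>: "pd v (\<lambda>y. f (\<sigma> y)) y = pd (\<sigma>' v) f (\<sigma> y)" if "f differentiable (at (\<sigma> y))"
    for f :: "'a \<Rightarrow> real" and v y
    by (rule pd_eq[OF has_derivative_compose[OF d\<sigma> has_derivative_pd[OF that]]])
  have lap\<sigma>: "laplacian (\<lambda>y. u (\<sigma> y)) y = laplacian u (\<sigma> y)" if y: "y \<in> U'" for y
  proof -
    have "pd j (pd j (\<lambda>y. u (\<sigma> y))) y = pd j (pd j u) (\<sigma> y)" if j: "j \<in> Basis" for j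
    proof -
      have "pd j (pd j (\<lambda>y. u (\<sigma> y))) y = pd j (\<lambda>y. pd (\<sigma>' j) u (\<sigma> y)) y"
        by (rule pd_cong[OF U' _ y]) (rule pd\<sigma>[OF Ck2D(1)[OF U(2)]], simp add: U'_def)
      also have "\<dots> = pd (\<sigma>' j) (pd (\<sigma>' j) u) (\<sigma> y)"
        by (rule pd\<sigma>[OF Ck2D(2)[OF U(2)]]) (use y in \<open>simp add: U'_def\<close>)
      also have "\<dots> = pd j (pd j u) (\<sigma> y)"
      proof (cases "j = b")
        case True
        have jb: "\<sigma>' j = - j" using True bb by (simp add: \<sigma>'_def scaleR_2)
        have m1: "pd (- j) f z = - pd j f z" if "f differentiable (at z)" for f :: "'a \<Rightarrow> real" and z
          using linear_neg[OF pd_linear[OF that]] by simp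
        have "pd (- j) (pd (- j) u) (\<sigma> y) = - pd j (pd (- j) u) (\<sigma> y)"
          by (rule m1[OF Ck2D(2)[OF U(2)]]) (use y in \<open>simp add: U'_def\<close>)
        also have "pd j (pd (- j) u) (\<sigma> y) = pd j (\<lambda>z. (-1) * pd j u z) (\<sigma> y)"
          by (rule pd_cong[OF U(1)]) (use m1[OF Ck2D(1)[OF U(2)]] y in \<open>auto simp: U'_def\<close>)
        also have "\<dots> = - pd j (pd j u) (\<sigma> y)"
          using pd_cmult[OF Ck2D(2)[OF U(2)], of "\<sigma> y" j "-1"] y by (simp add: U'_def)
        finally show ?thesis using jb by simp
      next
        case False
        then have "\<sigma>' j = j" using b j by (simp add: \<sigma>'_def inner_Basis)
        then show ?thesis by simp
      qed
      finally show ?thesis .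
    qed
    then show ?thesis unfolding laplacian_alt by simp
  qed
  \<comment> \<open>The coefficients make the Laplacian of \<open>\<psi>\<close> exactly
    \<open>- N\<close> while \<open>\<psi>\<close> is at least \<open>M\<close> on the outer faces.
    The slope of \<open>\<psi>\<close> at \<open>y0\<close> in direction \<open>b\<close> is
    \<open>\<beta>\<close>, which is therefore the bound to be proved.\<close>
  define \<alpha> where "\<alpha> = M / r\<^sup>2"
  define \<beta> where "\<beta> = n / r * M + r / 2 * N"
  define \<gamma> where "\<gamma> = - (n * M / r\<^sup>2 + N / 2)"
  define \<psi> where "\<psi> = (\<lambda>y. \<alpha> * ((y - y0) \<bullet> (y - y0)) + \<beta> * s y + \<gamma> * (s y)\<^sup>2)"
  have sm\<psi>: "smooth_on UNIV \<psi>"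
    unfolding \<psi>_def s_def power2_eq_square
    by (intro smooth_on_add smooth_on_diff smooth_on_ident smooth_on_const smooth_on_mult smooth_on_inner open_UNIV)
  have pd\<psi>: "pd v \<psi> y = 2 * \<alpha> * ((y - y0) \<bullet> v) + \<beta> * (v \<bullet> b) + 2 * \<gamma> * s y * (v \<bullet> b)" for v y
    by (rule pd_eq[where f'="\<lambda>v. 2 * \<alpha> * ((y - y0) \<bullet> v) + \<beta> * (v \<bullet> b) + 2 * \<gamma> * s y * (v \<bullet> b)"])
      (auto simp: \<psi>_def s_def power2_eq_square inner_commute algebra_simps intro!: derivative_eq_intros)
  have "pd v (pd v \<psi>) y = 2 * \<alpha> * (v \<bullet> v) + 2 * \<gamma> * (v \<bullet> b)\<^sup>2" for v y
    unfolding pd\<psi>[abs_def]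
    by (rule pd_eq[where f'="\<lambda>w. 2 * \<alpha> * (w \<bullet> v) + 2 * \<gamma> * (w \<bullet> b) * (v \<bullet> b)", THEN trans])
      (auto simp: s_def power2_eq_square algebra_simps intro!: derivative_eq_intros)
  then have "laplacian \<psi> y = (\<Sum>j\<in>Basis. 2 * \<alpha> + (if j = b then 2 * \<gamma> else 0))" for y
    unfolding laplacian_alt using b by (intro sum.cong refl) (auto simp: inner_Basis)
  moreover have "(\<Sum>j\<in>(Basis::'a set). 2 * \<alpha> + (if j = b then 2 * \<gamma> else 0)) = n * (2 * \<alpha>) + 2 * \<gamma>"
    using b by (simp add: sum.distrib n_def)
  moreover have "n * (2 * \<alpha>) + 2 * \<gamma> = - N" using r by (simp add: \<alpha>_def \<gamma>_def field_simps)
  ultimately have lap\<psi>: "laplacian \<psi> y = - N" for y by simp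
  define p where "p = (\<lambda>y. (1/2) * (u y - u (\<sigma> y)) - \<psi> y)"
  define S where "S = box (y0 - r *\<^sub>R One) (y0 + r *\<^sub>R One) \<inter> {y. s y > 0}"
  define K where "K = ?Q \<inter> {y. s y \<ge> 0}"
  have S: "open S"
  proof -
    have "open {y. s y > 0}" unfolding s_def by (intro open_Collect_less continuous_intros)
    then show ?thesis unfolding S_def by (intro open_Int open_box)
  qed
  have "closed {y. s y \<ge> 0}" unfolding s_def by (intro closed_Collect_le continuous_intros)
  then have K: "compact K" unfolding K_def by (simp add: compact_Int_closed)
  have SK: "S \<subseteq> K" unfolding S_def K_def using box_subset_cbox by auto
  have KU': "K \<subseteq> U'" using QU' unfolding K_def by auto
  have ph: "Ck_on 2 U' (\<lambda>y. (1/2) * (u y - u (\<sigma> y)))"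
    by (intro Ck_on_cmult Ck_on_diff U' cu cu\<sigma>)
  have Ck\<psi>: "Ck_on 2 U' \<psi>" by (rule Ck_on_subset[OF smooth_on_Ck[OF sm\<psi>]]) simp
  have cp: "Ck_on 2 U' p" unfolding p_def by (rule Ck_on_diff[OF U' ph Ck\<psi>])
  have lapp: "laplacian p y > 0" if "y \<in> S" for y
  proof -
    have y: "y \<in> U'" "y \<in> ?Q" using that SK KU' K_def by auto
    have "laplacian p y = (1/2) * (laplacian u y - laplacian u (\<sigma> y)) + N"
      unfolding p_def
      using laplacian_diff[OF U' ph Ck\<psi> y(1)] laplacian_cmult[OF U' Ck_on_diff[OF U' cu cu\<sigma>] y(1), of "1/2"]
        laplacian_diff[OF U' cu cu\<sigma> y(1)] lap\<sigma>[OF y(1)] lap\<psi> by simp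
    moreover have "laplacian u y > - N" "laplacian u (\<sigma> y) < N"
      using N[OF y(2)] N[OF \<sigma>Q[OF y(2)]] by auto
    ultimately show ?thesis by argo
  qed
  \<comment> \<open>A sum of three terms that are visibly nonnegative on the half cube: the first
    reaches \<open>M\<close> on the side faces, the second on the face
    \<open>s y = r\<close>.\<close>
  have \<psi>eq: "\<psi> y = \<alpha> * ((y - y0) \<bullet> (y - y0) - (s y)\<^sup>2) + M / r\<^sup>2 * (s y * (n * r - (n - 1) * s y)) + N / 2 * s y * (r - s y)" for y
    using r unfolding \<psi>_def \<alpha>_def \<beta>_def \<gamma>_def by (simp add: field_simps power2_eq_square)
  have bd: "p y \<le> 0" if y: "y \<in> K - S" for y
  proof -
    have yQ: "y \<in> ?Q" and s0: "s y \<ge> 0" using y by (auto simp: K_def)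
    have sr: "s y \<le> r" using yQ[unfolded Qiff] b by (auto simp: s_def abs_le_iff)
    have n1: "n \<ge> 1" unfolding n_def by (simp add: DIM_ge_Suc0)
    have sq: "(y - y0) \<bullet> (y - y0) = (\<Sum>j\<in>Basis. ((y - y0) \<bullet> j)\<^sup>2)"
      by (subst euclidean_inner) (simp add: power2_eq_square)
    have sq': "(y - y0) \<bullet> (y - y0) - (s y)\<^sup>2 = (\<Sum>j\<in>Basis-{b}. ((y - y0) \<bullet> j)\<^sup>2)"
      unfolding sq s_def using b by (simp add: sum_diff1)
    have t1: "(y - y0) \<bullet> (y - y0) - (s y)\<^sup>2 \<ge> 0" unfolding sq' by (simp add: sum_nonneg)
    have "(n - 1) * s y \<le> (n - 1) * r" using sr n1 by (intro mult_left_mono) auto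
    then have t2a: "n * r - (n - 1) * s y \<ge> r" by (simp add: algebra_simps)
    then have t2: "s y * (n * r - (n - 1) * s y) \<ge> 0" using s0 r by (intro mult_nonneg_nonneg) auto
    have t3: "N / 2 * s y * (r - s y) \<ge> 0" using N0 s0 sr by simp
    have \<alpha>0: "\<alpha> \<ge> 0" using M0 by (simp add: \<alpha>_def)
    show ?thesis
    proof (cases "s y = 0")
      case True
      then have "\<sigma> y = y" by (simp add: \<sigma>_def)
      moreover have "\<psi> y \<ge> 0" unfolding \<psi>eq using True t1 \<alpha>0 by simp
      ultimately show ?thesis by (simp add: p_def)
    next
      case False
      then have "y \<notin> box (y0 - r *\<^sub>R One) (y0 + r *\<^sub>R One)" using y s0 by (auto simp: S_def)
      then obtain j where j: "j \<in> Basis" "\<not> (\<bar>(y - y0) \<bullet> j\<bar> < r)"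
        by (auto simp: mem_box inner_diff_left inner_add_left abs_less_iff algebra_simps)
      then have jr: "\<bar>(y - y0) \<bullet> j\<bar> = r" using yQ[unfolded Qiff] by (auto simp: not_less intro: antisym)
      have "\<psi> y \<ge> M"
      proof (cases "j = b")
        case True
        then have "s y = r" using jr s0 by (simp add: s_def)
        then have "\<psi> y = \<alpha> * ((y - y0) \<bullet> (y - y0) - (s y)\<^sup>2) + M"
          unfolding \<psi>eq using r by (simp add: field_simps power2_eq_square)
        then show ?thesis using mult_nonneg_nonneg[OF \<alpha>0 t1] by linarith
      next
        case False
        have "r\<^sup>2 = ((y - y0) \<bullet> j)\<^sup>2" using jr by (metis power2_abs)
        also have "\<dots> \<le> (y - y0) \<bullet> (y - y0) - (s y)\<^sup>2"
          unfolding sq' using j False by (intro member_le_sum) auto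
        finally have "\<alpha> * r\<^sup>2 \<le> \<alpha> * ((y - y0) \<bullet> (y - y0) - (s y)\<^sup>2)" using \<alpha>0 mult_left_mono by blast
        moreover have "\<alpha> * r\<^sup>2 = M" using r by (simp add: \<alpha>_def)
        moreover have "M / r\<^sup>2 * (s y * (n * r - (n - 1) * s y)) \<ge> 0" using M0 t2 by simp
        ultimately show ?thesis unfolding \<psi>eq using t3 by linarith
      qed
      then show ?thesis
        using M[OF yQ] M[OF \<sigma>Q[OF yQ]] by (simp add: p_def abs_le_iff)
    qed
  qed
  have le: "p y \<le> 0" if "y \<in> K" for y
    by (rule max_principle[OF K S SK _ Ck_on_subset[OF cp] lapp bd that])
      (use KU' SK cp in \<open>auto intro: continuous_at_imp_continuous_on differentiable_imp_continuous_within Ck2D\<close>)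
  define g where "g = (\<lambda>t. p (y0 + t *\<^sub>R b))"
  have s\<sigma>: "\<sigma> y0 = y0" by (simp add: \<sigma>_def s_def)
  have "(p has_derivative (\<lambda>v. pd v p y0)) (at y0)"
    using has_derivative_pd Ck2D(1)[OF cp] y0 QU' by blast
  then have "(g has_derivative (\<lambda>t. pd (t *\<^sub>R b) p y0)) (at 0)"
    unfolding g_def
    by (intro has_derivative_compose[of "\<lambda>t. y0 + t *\<^sub>R b" _ 0 UNIV p, simplified])
      (auto intro!: derivative_eq_intros)
  moreover have "pd (t *\<^sub>R b) p y0 = pd b p y0 * t" for t
    using linear.scaleR[OF pd_linear[OF Ck2D(1)[OF cp]], of y0 t b] y0 QU' by auto
  ultimately have dg: "(g has_real_derivative pd b p y0) (at 0)"
    by (simp add: has_field_derivative_def)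
  have y0U: "y0 \<in> U" "y0 \<in> U'" using y0 QU' Q by auto
  have "pd b p y0 = (1/2) * (pd b u y0 - pd (\<sigma>' b) u y0) - pd b \<psi> y0"
    unfolding p_def
    using pd_diff[OF Ck2D(1)[OF ph y0U(2)] Ck2D(1)[OF Ck\<psi> y0U(2)], of b]
      pd_cmult[OF Ck2D(1)[OF Ck_on_diff[OF U' cu cu\<sigma>] y0U(2)], of b "1/2"]
      pd_diff[OF Ck2D(1)[OF cu y0U(2)] Ck2D(1)[OF cu\<sigma> y0U(2)], of b] pd\<sigma>[of u y0 b] Ck2D(1)[OF U(2) y0U(1)] s\<sigma>
    by simp
  moreover have "\<sigma>' b = - b" using bb by (simp add: \<sigma>'_def scaleR_2)
  moreover have "pd (- b) u y0 = - pd b u y0"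
    using linear_neg[OF pd_linear[OF Ck2D(1)[OF U(2) y0U(1)]]] by simp
  moreover have "pd b \<psi> y0 = \<beta>" using bb by (simp add: pd\<psi> s_def)
  ultimately have eq: "pd b p y0 = pd b u y0 - \<beta>" by simp
  \<comment> \<open>\<open>p\<close> is zero at \<open>y0\<close> and nonpositive on the half cube,
    so it cannot increase from \<open>y0\<close> in direction \<open>b\<close>.\<close>
  have "pd b p y0 \<le> 0"
  proof (rule ccontr)
    assume "\<not> ?thesis"
    then obtain d where d: "d > 0" "\<And>h. 0 < h \<Longrightarrow> h < d \<Longrightarrow> g 0 < g (0 + h)"
      using DERIV_pos_inc_right[OF dg] by force
    define h where "h = min d r / 2"
    have h: "0 < h" "h < d" "h < r" using d r by (auto simp: h_def)
    have "y0 + h *\<^sub>R b \<in> K"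
      unfolding K_def using h b bb by (auto simp: Qiff s_def inner_Basis)
    then have "g h \<le> 0" using le by (simp add: g_def)
    moreover have "g 0 = 0" using s\<sigma> by (simp add: g_def p_def \<psi>_def s_def)
    ultimately show False using d(2)[of h] h by simp
  qed
  then show ?thesis using eq unfolding \<beta>_def n_def by simp
qed

text \<open>The one-sided estimate applies to \<open>u\<close> and to its negative. Its strict bound
  on the Laplacian is relaxed by a slack \<open>e\<close> that tends to zero.\<close>

lemma gradient_cube:
  fixes u :: "'a::euclidean_space \<Rightarrow> real"
  assumes U: "open U" "Ck_on 2 U u" and b: "b \<in> Basis" and r: "r > 0"
    and Q: "cbox (y0 - r *\<^sub>R One) (y0 + r *\<^sub>R One) \<subseteq> U"
    and M: "\<And>y. y \<in> cbox (y0 - r *\<^sub>R One) (y0 + r *\<^sub>R One) \<Longrightarrow> \<bar>u y\<bar> \<le> M"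
    and N: "\<And>y. y \<in> cbox (y0 - r *\<^sub>R One) (y0 + r *\<^sub>R One) \<Longrightarrow> \<bar>laplacian u y\<bar> \<le> N"
  shows "\<bar>pd b u y0\<bar> \<le> DIM('a) / r * M + r / 2 * N"
proof -
  have y0: "y0 \<in> cbox (y0 - r *\<^sub>R One) (y0 + r *\<^sub>R One)"
    using r by (auto simp: mem_box inner_diff_left inner_add_left)
  have "\<bar>pd b u y0\<bar> \<le> DIM('a) / r * M + r / 2 * (N + e)" if e: "e > 0" for e
  proof -
    have 1: "pd b u y0 \<le> DIM('a) / r * M + r / 2 * (N + e)"
      by (rule gradient_cube_upper[OF U b r Q M]) (use N e in force)+
    have m: "Ck_on 2 U (\<lambda>y. - 1 * u y)" by (rule Ck_on_cmult[OF U])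
    have "pd b (\<lambda>y. - 1 * u y) y0 \<le> DIM('a) / r * M + r / 2 * (N + e)"
    proof (rule gradient_cube_upper[OF U(1) m b r Q])
      fix y assume y: "y \<in> cbox (y0 - r *\<^sub>R One) (y0 + r *\<^sub>R One)"
      show "\<bar>- 1 * u y\<bar> \<le> M" using M[OF y] by simp
      have "y \<in> U" using y Q by blast
      then show "\<bar>laplacian (\<lambda>y. - 1 * u y) y\<bar> < N + e"
        using laplacian_cmult[OF U, of y "-1"] N[OF y] e by simp
    qed
    then show ?thesis
      using 1 pd_cmult[OF Ck2D(1)[OF U(2)], of y0 b "-1"] y0 Q by (auto simp: abs_le_iff)
  qed
  then have *: "\<bar>pd b u y0\<bar> - (DIM('a) / r * M + r / 2 * N) \<le> r / 2 * e" if "e > 0" for e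
    using that unfolding distrib_left by (smt (verit))
  have "\<bar>pd b u y0\<bar> - (DIM('a) / r * M + r / 2 * N) \<le> e" if "e > 0" for e
    using *[of "2 * e / r"] that r by simp
  then show ?thesis by (metis dense_ge le_iff_diff_le_0)
qed

lemma cbox_One_subset_ball:
  fixes y0 :: "'a::euclidean_space" and r :: real
  assumes "y \<in> cbox (y0 - r *\<^sub>R One) (y0 + r *\<^sub>R One)"
  shows "norm (y - y0) \<le> DIM('a) * r"
proof -
  have "norm (y - y0) \<le> (\<Sum>j\<in>Basis. \<bar>(y - y0) \<bullet> j\<bar>)" by (rule norm_le_l1)
  also have "\<dots> \<le> (\<Sum>j\<in>(Basis::'a set). r)"
    using assms by (intro sum_mono)
      (auto simp: mem_box inner_diff_left inner_add_left abs_le_iff algebra_simps)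
  finally show ?thesis by simp
qed

section \<open>Smoothness of functions with constant Laplacian\<close>

lemma has_derivative_uniform_limit:
  fixes f :: "nat \<Rightarrow> 'a::euclidean_space \<Rightarrow> real"
  assumes S: "open S" "convex S"
    and d: "\<And>n x. x \<in> S \<Longrightarrow> f n differentiable (at x)"
    and G: "\<And>b. b \<in> Basis \<Longrightarrow> uniform_limit S (\<lambda>n. pd b (f n)) (G b) sequentially"
    and g: "\<And>x. x \<in> S \<Longrightarrow> (\<lambda>n. f n x) \<longlonglongrightarrow> g x"
    and x: "x \<in> S"
  shows "(g has_derivative (\<lambda>h. \<Sum>b\<in>Basis. (h \<bullet> b) * G b x)) (at x)"
proof -
  have "\<exists>g'. \<forall>x\<in>S. (\<lambda>n. f n x) \<longlonglongrightarrow> g' x \<and> (g' has_derivative (\<lambda>h. \<Sum>b\<in>Basis. (h \<bullet> b) * G b x)) (at x within S)"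
  proof (rule has_derivative_sequence[where f=f and f'="\<lambda>n x h. \<Sum>b\<in>Basis. (h \<bullet> b) * pd b (f n) x"
        and g'="\<lambda>x h. \<Sum>b\<in>Basis. (h \<bullet> b) * G b x" and ?x0.0=x and l="g x"])
    show "convex S" "x \<in> S" "(\<lambda>n. f n x) \<longlonglongrightarrow> g x" by (fact S x g[OF x])+
    show "(f n has_derivative (\<lambda>h. \<Sum>b\<in>Basis. (h \<bullet> b) * pd b (f n) x)) (at x within S)" if "x \<in> S" for n x
    proof -
      have "(\<lambda>h. pd h (f n) x) = (\<lambda>h. \<Sum>b\<in>Basis. (h \<bullet> b) * pd b (f n) x)"
        using pd_expand[OF d[OF that]] unfolding real_scaleR_def by blast
      then show ?thesis using has_derivative_at_withinI[OF has_derivative_pd[OF d[OF that]]] by metis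
    qed
    fix e :: real assume e: "e > 0"
    define e' where "e' = e / DIM('a)"
    have e': "e' > 0" using e by (simp add: e'_def)
    have "\<forall>\<^sub>F n in sequentially. \<forall>b\<in>Basis. \<forall>x\<in>S. dist (pd b (f n) x) (G b x) < e'"
      using G e' by (auto simp: eventually_ball_finite_distrib uniform_limit_iff)
    then show "\<forall>\<^sub>F n in sequentially. \<forall>x\<in>S. \<forall>h. norm ((\<Sum>b\<in>Basis. (h \<bullet> b) * pd b (f n) x) - (\<Sum>b\<in>Basis. (h \<bullet> b) * G b x)) \<le> e * norm h"
    proof (rule eventually_mono, intro ballI allI)
      fix n x h assume H: "\<forall>b\<in>Basis. \<forall>x\<in>S. dist (pd b (f n) x) (G b x) < e'" and x: "x \<in> S"
      have "norm ((\<Sum>b\<in>Basis. (h \<bullet> b) * pd b (f n) x) - (\<Sum>b\<in>Basis. (h \<bullet> b) * G b x))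
        = norm (\<Sum>b\<in>Basis. (h \<bullet> b) * (pd b (f n) x - G b x))"
        by (simp add: sum_subtractf right_diff_distrib)
      also have "\<dots> \<le> (\<Sum>b\<in>(Basis::'a set). norm h * e')"
      proof (rule sum_norm_le)
        fix b :: 'a assume b: "b \<in> Basis"
        have "\<bar>pd b (f n) x - G b x\<bar> \<le> e'" using H b x by (auto simp: dist_real_def less_imp_le)
        then show "norm ((h \<bullet> b) * (pd b (f n) x - G b x)) \<le> norm h * e'"
          unfolding real_norm_def abs_mult by (intro mult_mono Basis_le_norm b) auto
      qed
      also have "\<dots> = e * norm h" by (simp add: e'_def)
      finally show "norm ((\<Sum>b\<in>Basis. (h \<bullet> b) * pd b (f n) x) - (\<Sum>b\<in>Basis. (h \<bullet> b) * G b x)) \<le> e * norm h" .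
    qed
  qed
  then obtain g' where g': "\<And>x. x \<in> S \<Longrightarrow> (\<lambda>n. f n x) \<longlonglongrightarrow> g' x"
    "\<And>x. x \<in> S \<Longrightarrow> (g' has_derivative (\<lambda>h. \<Sum>b\<in>Basis. (h \<bullet> b) * G b x)) (at x within S)" by blast
  have "g' y = g y" if "y \<in> S" for y using LIMSEQ_unique g'(1) g that by blast
  moreover have "(g' has_derivative (\<lambda>h. \<Sum>b\<in>Basis. (h \<bullet> b) * G b x)) (at x)"
    using g'(2)[OF x] at_within_open[OF x S(1)] by simp
  ultimately show ?thesis using has_derivative_transform_within_open[OF _ S(1) x] by blast
qed

lemma laplacian_pd_commute:
  fixes f :: "'a::euclidean_space \<Rightarrow> real"
  assumes S: "open S" and f: "Ck_on 2 S f" "\<And>w. Ck_on 2 S (pd w f)" and x: "x \<in> S"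
  shows "laplacian (pd v f) x = pd v (laplacian f) x"
proof -
  have "pd b (pd b (pd v f)) x = pd v (pd b (pd b f)) x" for b
  proof -
    have "pd b (pd b (pd v f)) x = pd b (pd v (pd b f)) x"
      by (rule pd_cong[OF S _ x]) (rule pd_commute[OF f(1) S])
    also have "\<dots> = pd v (pd b (pd b f)) x" by (rule pd_commute[OF f(2) S x])
    finally show ?thesis .
  qed
  moreover have "pd v (laplacian f) x = (\<Sum>b\<in>Basis. pd v (pd b (pd b f)) x)"
    unfolding laplacian_alt[abs_def] by (intro pd_sum Ck2D(2)[OF f(2) x])
  ultimately show ?thesis by (simp add: laplacian_alt)
qed

text \<open>The gradient estimate, applied to differences of members of the sequence, turns uniform
  convergence on the larger ball into uniform convergence of the partial derivatives on the smaller
  one.\<close>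

lemma harmonic_limit_C1:
  fixes f :: "nat \<Rightarrow> 'a::euclidean_space \<Rightarrow> real"
  assumes \<rho>: "\<rho> > 0"
    and f: "\<And>n. Ck_on 2 (ball x0 (2 * \<rho>)) (f n)" "\<And>n x. x \<in> ball x0 (2 * \<rho>) \<Longrightarrow> laplacian (f n) x = 0"
    and lim: "uniform_limit (ball x0 (2 * \<rho>)) f g sequentially"
  shows "Ck_on 1 (ball x0 \<rho>) g"
proof -
  let ?U = "ball x0 (2 * \<rho>)" and ?B = "ball x0 \<rho>"
  have BU: "?B \<subseteq> ?U" using \<rho> by auto
  \<comment> \<open>Points of a cube of half side \<open>r\<close> are within
    \<open>\<rho> / 2\<close> of its centre, so cubes centred in the small ball stay in the large
    one.\<close>
  define r where "r = \<rho> / (2 * DIM('a))"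
  have r: "r > 0" using \<rho> by (simp add: r_def)
  have Q: "cbox (x - r *\<^sub>R One) (x + r *\<^sub>R One) \<subseteq> ?U" if "x \<in> ?B" for x
  proof
    fix y assume "y \<in> cbox (x - r *\<^sub>R One) (x + r *\<^sub>R One)"
    then have "norm (y - x) \<le> DIM('a) * r" by (rule cbox_One_subset_ball)
    also have "\<dots> = \<rho> / 2" by (simp add: r_def)
    finally have "dist y x < \<rho>" using \<rho> by (simp add: dist_norm)
    then show "y \<in> ?U" using that dist_triangle[of x0 y x] by (simp add: dist_commute)
  qed
  have C: "uniformly_Cauchy_on ?U f"
    using lim uniformly_convergent_Cauchy uniformly_convergent_on_def by blast
  have "uniformly_convergent_on ?B (\<lambda>n. pd b (f n))" if b: "b \<in> Basis" for b
  proof (rule Cauchy_uniformly_convergent, rule uniformly_Cauchy_onI)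
    fix e :: real assume e: "e > 0"
    define e' where "e' = e * r / (2 * DIM('a))"
    have e': "e' > 0" using e r by (simp add: e'_def)
    obtain N where N: "\<And>x m n. x \<in> ?U \<Longrightarrow> m \<ge> N \<Longrightarrow> n \<ge> N \<Longrightarrow> dist (f m x) (f n x) < e'"
      using C e' unfolding uniformly_Cauchy_on_def by blast
    show "\<exists>M. \<forall>x\<in>?B. \<forall>m\<ge>M. \<forall>n\<ge>M. dist (pd b (f m) x) (pd b (f n) x) < e"
    proof (intro exI[of _ N] ballI allI impI)
      fix x m n assume x: "x \<in> ?B" and mn: "N \<le> m" "N \<le> n"
      have xU: "x \<in> ?U" using x BU by blast
      have "\<bar>pd b (\<lambda>y. f m y - f n y) x\<bar> \<le> DIM('a) / r * e' + r / 2 * 0"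
      proof (rule gradient_cube[OF open_ball Ck_on_diff[OF open_ball f(1) f(1)] b r Q[OF x]])
        fix y assume "y \<in> cbox (x - r *\<^sub>R One) (x + r *\<^sub>R One)"
        then have y: "y \<in> ?U" using Q[OF x] by blast
        show "\<bar>f m y - f n y\<bar> \<le> e'" using N[OF y mn] by (simp add: dist_real_def)
        show "\<bar>laplacian (\<lambda>y. f m y - f n y) y\<bar> \<le> 0"
          using laplacian_diff[OF open_ball f(1) f(1) y] f(2)[OF y] by simp
      qed
      also have "\<dots> = e / 2" using r by (simp add: e'_def)
      finally show "dist (pd b (f m) x) (pd b (f n) x) < e"
        using pd_diff[OF Ck2D(1)[OF f(1) xU] Ck2D(1)[OF f(1) xU], of b m n] e by (simp add: dist_real_def)
    qed
  qed
  then obtain G where G: "\<And>b. b \<in> Basis \<Longrightarrow> uniform_limit ?B (\<lambda>n. pd b (f n)) (G b) sequentially"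
    unfolding uniformly_convergent_on_def by metis
  have dg: "(g has_derivative (\<lambda>h. \<Sum>b\<in>Basis. (h \<bullet> b) * G b x)) (at x)" if x: "x \<in> ?B" for x
  proof (rule has_derivative_uniform_limit[OF open_ball convex_ball _ G _ x])
    show "f n differentiable (at x)" if "x \<in> ?B" for n x using Ck2D(1)[OF f(1)] that BU by blast
    show "(\<lambda>n. f n x) \<longlonglongrightarrow> g x" if "x \<in> ?B" for x
      using tendsto_uniform_limitI[OF lim] that BU by blast
  qed
  have cG: "continuous_on ?B (G b)" if "b \<in> Basis" for b
  proof (rule uniform_limit_theorem[OF _ G[OF that] trivial_limit_sequentially])
    show "\<forall>\<^sub>F n in sequentially. continuous_on ?B (pd b (f n))"
      using Ck2D(2)[OF f(1)] BU
      by (intro always_eventually allI continuous_at_imp_continuous_on ballI differentiable_imp_continuous_within) blast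
  qed
  have "Ck_on (Suc 0) ?B g"
    by (rule Ck_on_SucI[OF open_ball dg]) (auto intro!: continuous_intros cG)
  then show ?thesis by simp
qed

text \<open>Second difference quotients of \<open>u\<close> are harmonic, since the constant
  cancels, and they converge locally uniformly to the second derivatives. By
  \<open>harmonic_limit_C1\<close> the second derivatives are therefore C^1, which makes
  \<open>u\<close> of class C^3.\<close>

lemma constant_laplacian_C3:
  fixes u :: "'a::euclidean_space \<Rightarrow> real"
  assumes S: "open S" and u: "Ck_on 2 S u" and k: "\<And>x. x \<in> S \<Longrightarrow> laplacian u x = \<kappa>"
  shows "Ck_on 2 S (pd v u)"
proof -
  have "\<exists>\<rho>>0. ball x0 \<rho> \<subseteq> S \<and> Ck_on 1 (ball x0 \<rho>) (pd w (pd v u))" if x0: "x0 \<in> S" for x0 w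
  proof -
    obtain R where R: "R > 0" "cball x0 R \<subseteq> S" using S x0 open_contains_cball by blast
    \<comment> \<open>The quotients are formed on the ball of radius \<open>2 * \<rho>\<close> with
      displacements of length at most \<open>\<rho>\<close>, so all sampled points stay in
      \<open>cball x0 R\<close>.\<close>
    define \<rho> where "\<rho> = R / 4"
    have \<rho>: "\<rho> > 0" using R by (simp add: \<rho>_def)
    define C where "C = norm v + norm w + 1"
    have C: "C > 0" using norm_ge_zero[of v] norm_ge_zero[of w] unfolding C_def by linarith
    define h where "h = (\<lambda>n. \<rho> / C / real (Suc n))"
    have "h n * C = \<rho> / real (Suc n)" for n using C by (simp add: h_def)
    moreover have "\<rho> / real (Suc n) \<le> \<rho> / 1" for n using \<rho> by (intro divide_left_mono) auto
    ultimately have h: "0 < h n" "h n * C \<le> \<rho>" for n using \<rho> C by (auto simp: h_def)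
    have "h \<longlonglongrightarrow> 0" unfolding h_def by (rule LIMSEQ_Suc[OF lim_const_over_n])
    then have hC: "(\<lambda>n. h n * C) \<longlonglongrightarrow> 0" using tendsto_mult_left_zero by blast
    let ?g = "pd w (pd v u)"
    have contg: "continuous_on (cball x0 R) ?g"
    proof (rule continuous_on_subset[OF _ R(2)])
      show "continuous_on S ?g" using u by (simp add: numeral_2_eq_2 Ck_on_Suc_pd)
    qed
    have uc: "uniformly_continuous_on (cball x0 R) ?g"
      by (rule compact_uniformly_continuous[OF contg compact_cball])
    define \<phi> where "\<phi> = (\<lambda>n x. (u (x + h n *\<^sub>R v + h n *\<^sub>R w) - u (x + h n *\<^sub>R v) - u (x + h n *\<^sub>R w) + u x) / (h n)\<^sup>2)"
    let ?U = "ball x0 (2 * \<rho>)"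
    have near: "norm (s *\<^sub>R v + t *\<^sub>R w) \<le> h n * C" if "0 \<le> s" "s \<le> h n" "0 \<le> t" "t \<le> h n" for s t n
    proof -
      have "norm (s *\<^sub>R v + t *\<^sub>R w) \<le> s * norm v + t * norm w"
        using norm_triangle_ineq[of "s *\<^sub>R v" "t *\<^sub>R w"] that by simp
      also have "\<dots> \<le> h n * norm v + h n * norm w" using that by (intro add_mono mult_right_mono) auto
      also have "\<dots> \<le> h n * C" using h(1)[of n] by (simp add: C_def algebra_simps)
      finally show ?thesis .
    qed
    have inR: "x + s *\<^sub>R v + t *\<^sub>R w \<in> cball x0 R"
      if "x \<in> ?U" "0 \<le> s" "s \<le> h n" "0 \<le> t" "t \<le> h n" for x s t n
    proof -
      have "dist x0 (x + s *\<^sub>R v + t *\<^sub>R w) \<le> dist x0 x + norm (s *\<^sub>R v + t *\<^sub>R w)"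
        using dist_triangle[of x0 "x + s *\<^sub>R v + t *\<^sub>R w" x] dist_norm[of "x + s *\<^sub>R v + t *\<^sub>R w" x]
        by (simp add: dist_commute add.assoc)
      also have "\<dots> \<le> 2 * \<rho> + \<rho>" using that(1) near[OF that(2-5)] h(2)[of n] by (intro add_mono) auto
      finally show ?thesis using \<rho> by (simp add: \<rho>_def)
    qed
    have Ct: "Ck_on 2 ?U (\<lambda>x. u (x + (s *\<^sub>R v + t *\<^sub>R w)))" and Lt: "x \<in> ?U \<Longrightarrow> laplacian (\<lambda>x. u (x + (s *\<^sub>R v + t *\<^sub>R w))) x = \<kappa>"
      if st: "0 \<le> s" "s \<le> h n" "0 \<le> t" "t \<le> h n" for s t n x
    proof -
      let ?a = "s *\<^sub>R v + t *\<^sub>R w"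
      have inS: "x + ?a \<in> S" if "x \<in> ?U" for x using inR[OF that st] R(2) by (auto simp: add.assoc)
      show "Ck_on 2 ?U (\<lambda>x. u (x + ?a))"
        by (rule Ck_on_compose[OF open_ball S inS u]) (auto intro!: smooth_on_Ck smooth_on_add smooth_on_ident smooth_on_const)
      have pt: "pd j (\<lambda>x. f (x + ?a)) x = pd j f (x + ?a)" if "f differentiable (at (x + ?a))" for f :: "'a \<Rightarrow> real" and j x
        by (rule pd_eq[OF has_derivative_compose[where f="\<lambda>x. x + ?a" and f'="\<lambda>v. v", OF _ has_derivative_pd[OF that]]])
          (auto intro!: derivative_eq_intros)
      show "laplacian (\<lambda>x. u (x + ?a)) x = \<kappa>" if x: "x \<in> ?U"
      proof -
        have "pd j (pd j (\<lambda>x. u (x + ?a))) x = pd j (pd j u) (x + ?a)" for j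
        proof -
          have "pd j (pd j (\<lambda>x. u (x + ?a))) x = pd j (\<lambda>x. pd j u (x + ?a)) x"
            by (rule pd_cong[OF open_ball _ x]) (rule pt[OF Ck2D(1)[OF u inS]])
          also have "\<dots> = pd j (pd j u) (x + ?a)" by (rule pt[OF Ck2D(2)[OF u inS[OF x]]])
          finally show ?thesis .
        qed
        then show ?thesis using k[OF inS[OF x]] by (simp add: laplacian_alt)
      qed
    qed
    have \<phi>eq: "\<phi> n = (\<lambda>x. (1 / (h n)\<^sup>2) * ((u (x + (h n *\<^sub>R v + h n *\<^sub>R w)) - u (x + (h n *\<^sub>R v + 0 *\<^sub>R w))) - (u (x + (0 *\<^sub>R v + h n *\<^sub>R w)) - u (x + (0 *\<^sub>R v + 0 *\<^sub>R w)))))" for n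
      by (simp add: \<phi>_def fun_eq_iff add.assoc)
    have h0: "0 \<le> h n" for n using h(1)[of n] by simp
    note C1 = Ct[OF h0 order_refl h0 order_refl] Ct[OF h0 order_refl order_refl h0]
      Ct[OF order_refl h0 h0 order_refl] Ct[OF order_refl h0 order_refl h0]
    have L1: "laplacian (\<lambda>x. u (x + (h n *\<^sub>R v + h n *\<^sub>R w))) x = \<kappa>"
      "laplacian (\<lambda>x. u (x + (h n *\<^sub>R v + 0 *\<^sub>R w))) x = \<kappa>"
      "laplacian (\<lambda>x. u (x + (0 *\<^sub>R v + h n *\<^sub>R w))) x = \<kappa>"
      "laplacian (\<lambda>x. u (x + (0 *\<^sub>R v + 0 *\<^sub>R w))) x = \<kappa>" if x: "x \<in> ?U" for n x
      by (intro Lt[of _ n _ x] x h0 order_refl)+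
    have "Ck_on 2 ?U (\<phi> n)" for n
      unfolding \<phi>eq by (intro Ck_on_cmult Ck_on_diff open_ball C1)
    moreover have "laplacian (\<phi> n) x = 0" if x: "x \<in> ?U" for n x
      unfolding \<phi>eq
      using L1(1-3)[OF x, of n] L1(4)[OF x]
      by (subst laplacian_cmult[OF open_ball _ x] laplacian_diff[OF open_ball _ _ x],
          (intro Ck_on_diff open_ball C1)+)+ simp
    moreover have "uniform_limit ?U \<phi> ?g sequentially"
      unfolding uniform_limit_iff
    proof (intro allI impI)
      fix e :: real assume "e > 0"
      then obtain d where d: "d > 0" "\<And>x y. x \<in> cball x0 R \<Longrightarrow> y \<in> cball x0 R \<Longrightarrow> dist y x < d \<Longrightarrow> dist (?g y) (?g x) < e"
        using uc unfolding uniformly_continuous_on_def by blast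
      have "\<forall>\<^sub>F n in sequentially. h n * C < d" using order_tendstoD(2)[OF hC d(1)] .
      then show "\<forall>\<^sub>F n in sequentially. \<forall>x\<in>?U. dist (\<phi> n x) (?g x) < e"
      proof (rule eventually_mono, intro ballI)
        fix n x assume n: "h n * C < d" and x: "x \<in> ?U"
        obtain \<xi> \<tau> where \<xi>: "\<xi> \<in> {0<..<h n}" "\<tau> \<in> {0<..<h n}"
          and eq: "u (x + h n *\<^sub>R v + h n *\<^sub>R w) - u (x + h n *\<^sub>R v) - u (x + h n *\<^sub>R w) + u x
              = (h n)\<^sup>2 * ?g (x + \<xi> *\<^sub>R v + \<tau> *\<^sub>R w)"
          using second_difference_mvt[OF u h(1)[of n], of x v w] inR[OF x] R(2) by blast
        have p: "0 \<le> \<xi>" "\<xi> \<le> h n" "0 \<le> \<tau>" "\<tau> \<le> h n" using \<xi> by auto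
        have "dist (x + \<xi> *\<^sub>R v + \<tau> *\<^sub>R w) x < d"
          using near[OF p] n by (simp add: dist_norm add.assoc)
        moreover have "x \<in> cball x0 R" using x \<rho> by (auto simp: \<rho>_def)
        ultimately have "dist (?g (x + \<xi> *\<^sub>R v + \<tau> *\<^sub>R w)) (?g x) < e"
          using d(2) inR[OF x p] by blast
        then show "dist (\<phi> n x) (?g x) < e" using eq h(1)[of n] by (simp add: \<phi>_def)
      qed
    qed
    ultimately have "Ck_on 1 (ball x0 \<rho>) ?g" by (intro harmonic_limit_C1[OF \<rho>]) auto
    moreover have "ball x0 \<rho> \<subseteq> S" using R \<rho> by (auto simp: \<rho>_def subset_eq)
    ultimately show ?thesis using \<rho> by blast
  qed
  then have loc: "\<exists>\<rho>>0. ball x0 \<rho> \<subseteq> S \<and> pd w (pd v u) differentiable (at x0) \<and> isCont (pd z (pd w (pd v u))) x0"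
    if "x0 \<in> S" for x0 w z
    using that unfolding One_nat_def Ck_on_Suc_pd Ck_on.simps(1)
    by (metis centre_in_ball continuous_on_eq_continuous_at open_ball)
  show ?thesis
    unfolding numeral_2_eq_2 Ck_on_Suc_pd Ck_on.simps(1)
    using loc Ck2D(2)[OF u] by (auto intro!: continuous_at_imp_continuous_on)
qed

text \<open>The derivatives of such a function are harmonic and, by the preceding lemma, again C^2,
  so the class is closed under differentiation. Torsion functions and the harmonic extension obtain
  their interior smoothness here.\<close>

lemma constant_laplacian_smooth:
  fixes u :: "'a::euclidean_space \<Rightarrow> real"
  assumes S: "open S" and u: "Ck_on 2 S u" and k: "\<And>x. x \<in> S \<Longrightarrow> laplacian u x = \<kappa>"
  shows "smooth_on S u"
proof (rule smooth_on_coinduct[OF S, where P="\<lambda>u. Ck_on 2 S u \<and> (\<exists>\<kappa>. \<forall>x\<in>S. laplacian u x = \<kappa>)"])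
  show "Ck_on 2 S u \<and> (\<exists>\<kappa>. \<forall>x\<in>S. laplacian u x = \<kappa>)" using u k by blast
  fix f :: "'a \<Rightarrow> real" assume "Ck_on 2 S f \<and> (\<exists>\<kappa>. \<forall>x\<in>S. laplacian f x = \<kappa>)"
  then obtain \<kappa> where f: "Ck_on 2 S f" "\<And>x. x \<in> S \<Longrightarrow> laplacian f x = \<kappa>" by blast
  have c: "Ck_on 2 S (pd v f)" for v by (rule constant_laplacian_C3[OF S f])
  have "laplacian (pd v f) x = 0" if x: "x \<in> S" for v x
    using laplacian_pd_commute[OF S f(1) c x] pd_cong[OF S f(2) x, where v=v] by simp
  then show "(\<forall>x\<in>S. f differentiable at x) \<and>
    (\<forall>v. \<exists>g. (Ck_on 2 S g \<and> (\<exists>\<kappa>. \<forall>x\<in>S. laplacian g x = \<kappa>)) \<and> (\<forall>x\<in>S. pd v f x = g x))"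
    using c Ck2D(1)[OF f(1)] by blast
qed

section \<open>Weighted bounds on the unit ball\<close>

text \<open>Between one and two times the distance to the sphere, but a polynomial, so that barriers
  built from it can be differentiated at the centre as well.\<close>

definition bdef :: "'a::euclidean_space \<Rightarrow> real" where
  "bdef x = 1 - x \<bullet> x"

lemma bdef_ball: "x \<in> ball 0 1 \<Longrightarrow> 0 < bdef x \<and> bdef x \<le> 1"
  by (simp add: bdef_def dot_square_norm power_less_one_iff)

lemma bdef_le: "x \<in> ball 0 1 \<Longrightarrow> bdef x \<le> 2 * (1 - norm x)"
proof -
  assume "x \<in> ball 0 1"
  then have "0 \<le> (1 - norm x)\<^sup>2" "bdef x = 1 - (norm x)\<^sup>2" by (auto simp: bdef_def dot_square_norm)
  then show ?thesis by (simp add: power2_eq_square algebra_simps)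
qed

lemma bdef_diff:
  assumes "norm x \<le> 1" "norm y \<le> 1"
  shows "\<bar>bdef x - bdef y\<bar> \<le> 2 * norm (x - y)"
proof -
  have "bdef x - bdef y = (y - x) \<bullet> (x + y)" by (simp add: bdef_def algebra_simps inner_commute)
  also have "\<bar>\<dots>\<bar> \<le> norm (y - x) * norm (x + y)" by (rule Cauchy_Schwarz_ineq2)
  also have "\<dots> \<le> norm (y - x) * 2" using norm_triangle_ineq[of x y] assms by (intro mult_left_mono) auto
  finally show ?thesis by (simp add: norm_minus_commute)
qed

text \<open>Serves to compare the weights at points whose mutual distance is a small fraction of
  their distance to the sphere. The sign of \<open>\<gamma>\<close> decides which of the two bounds
  on \<open>t\<close> is used.\<close>

lemma powr_comparable:
  fixes s t \<gamma> :: real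
  assumes "0 < s" "s / 2 \<le> t" "t \<le> 2 * s"
  shows "t powr \<gamma> \<le> 2 powr \<bar>\<gamma>\<bar> * s powr \<gamma>"
proof (cases "\<gamma> \<ge> 0")
  case True
  have "t powr \<gamma> \<le> (2 * s) powr \<gamma>" using assms True by (intro powr_mono2) auto
  then show ?thesis using True assms by (simp add: powr_mult)
next
  case False
  have "t powr \<gamma> \<le> (s / 2) powr \<gamma>" using assms False by (intro powr_mono2') auto
  also have "\<dots> = 2 powr (- \<gamma>) * s powr \<gamma>" using assms by (simp add: powr_divide powr_minus field_simps)
  finally show ?thesis using False by simp
qed

text \<open>Every derivative costs one power of the distance to the sphere.  The index set makes the bounds
  uniform in a family.\<close>

primrec wbounded :: "nat \<Rightarrow> real \<Rightarrow> 'i set \<Rightarrow> ('i \<Rightarrow> 'a::euclidean_space \<Rightarrow> real) \<Rightarrow> bool" where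
  "wbounded 0 \<gamma> I w \<longleftrightarrow> (\<exists>C. \<forall>i\<in>I. \<forall>x\<in>ball 0 1. \<bar>w i x\<bar> \<le> C * bdef x powr \<gamma>)"
| "wbounded (Suc m) \<gamma> I w \<longleftrightarrow> (\<exists>C. \<forall>i\<in>I. \<forall>x\<in>ball 0 1. \<bar>w i x\<bar> \<le> C * bdef x powr \<gamma>) \<and>
     (\<forall>b\<in>Basis. wbounded m (\<gamma> - 1) I (\<lambda>i. pd b (w i)))"

definition wsmooth :: "real \<Rightarrow> 'i set \<Rightarrow> ('i \<Rightarrow> 'a::euclidean_space \<Rightarrow> real) \<Rightarrow> bool" where
  "wsmooth \<gamma> I w \<longleftrightarrow> (\<forall>i\<in>I. smooth_on (ball 0 1) (w i)) \<and> (\<forall>m. wbounded m \<gamma> I w)"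

declare wbounded.simps [simp del]

lemma wbounded_Suc: "wbounded (Suc m) \<gamma> I w \<longleftrightarrow> wbounded 0 \<gamma> I w \<and>
     (\<forall>b\<in>Basis. wbounded m (\<gamma> - 1) I (\<lambda>i. pd b (w i)))"
  by (simp add: wbounded.simps)

lemma wbounded_0: "wbounded m \<gamma> I w \<Longrightarrow> wbounded 0 \<gamma> I w"
  by (cases m) (auto simp: wbounded_Suc)

lemma wbounded0I:
  "(\<And>i x. i \<in> I \<Longrightarrow> x \<in> ball 0 1 \<Longrightarrow> \<bar>w i x\<bar> \<le> C * bdef x powr \<gamma>) \<Longrightarrow> wbounded 0 \<gamma> I w"
  unfolding wbounded.simps by blast

lemma wbounded0E:
  fixes w :: "'i \<Rightarrow> 'a::euclidean_space \<Rightarrow> real"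
  assumes "wbounded 0 \<gamma> I w"
  obtains C where "C > 0" "\<And>i x. i \<in> I \<Longrightarrow> x \<in> ball 0 1 \<Longrightarrow> \<bar>w i x\<bar> \<le> C * bdef x powr \<gamma>"
proof -
  obtain C where C: "\<And>i x. i \<in> I \<Longrightarrow> x \<in> ball 0 1 \<Longrightarrow> \<bar>w i x\<bar> \<le> C * bdef x powr \<gamma>"
    using assms unfolding wbounded.simps by blast
  show thesis
  proof (rule that[of "\<bar>C\<bar> + 1"])
    fix i and x :: 'a assume ix: "i \<in> I" "x \<in> ball 0 1"
    have "C * bdef x powr \<gamma> \<le> (\<bar>C\<bar> + 1) * bdef x powr \<gamma>" by (intro mult_right_mono) auto
    then show "\<bar>w i x\<bar> \<le> (\<bar>C\<bar> + 1) * bdef x powr \<gamma>" using C[OF ix] by linarith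
  qed simp
qed

lemma wbounded0_cong:
  "(\<And>i x. i \<in> I \<Longrightarrow> x \<in> ball 0 1 \<Longrightarrow> w i x = w' i x) \<Longrightarrow> wbounded 0 \<gamma> I w \<longleftrightarrow> wbounded 0 \<gamma> I w'"
  unfolding wbounded.simps by simp

lemma wbounded_cong:
  "(\<And>i x. i \<in> I \<Longrightarrow> x \<in> ball 0 1 \<Longrightarrow> w i x = w' i x) \<Longrightarrow> wbounded m \<gamma> I w \<longleftrightarrow> wbounded m \<gamma> I w'"
proof (induction m arbitrary: \<gamma> w w')
  case 0
  then show ?case by (rule wbounded0_cong)
next
  case (Suc m)
  have "wbounded m (\<gamma> - 1) I (\<lambda>i. pd b (w i)) \<longleftrightarrow> wbounded m (\<gamma> - 1) I (\<lambda>i. pd b (w' i))" for b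
    by (rule Suc.IH) (rule pd_cong[OF open_ball], use Suc.prems in blast, assumption)
  then show ?case unfolding wbounded_Suc using wbounded0_cong[of I w w' \<gamma>, OF Suc.prems] by simp
qed

lemma wbounded0_weaken:
  fixes w :: "'i \<Rightarrow> 'a::euclidean_space \<Rightarrow> real"
  assumes le: "\<gamma>' \<le> \<gamma>" and b: "wbounded 0 \<gamma> I w"
  shows "wbounded 0 \<gamma>' I w"
proof -
  obtain C where C: "C > 0" "\<And>i x. i \<in> I \<Longrightarrow> x \<in> ball 0 1 \<Longrightarrow> \<bar>w i x\<bar> \<le> C * bdef x powr \<gamma>"
    using wbounded0E[OF b] by blast
  show ?thesis
  proof (rule wbounded0I)
    fix i and x :: 'a assume ix: "i \<in> I" "x \<in> ball 0 1"
    have "bdef x powr \<gamma> \<le> bdef x powr \<gamma>'" using bdef_ball[OF ix(2)] le by (intro powr_mono') auto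
    then show "\<bar>w i x\<bar> \<le> C * bdef x powr \<gamma>'"
      using C(1) C(2)[OF ix] by (meson less_imp_le mult_left_mono order_trans)
  qed
qed

lemma wbounded_weaken: "\<gamma>' \<le> \<gamma> \<Longrightarrow> wbounded m \<gamma> I w \<Longrightarrow> wbounded m \<gamma>' I w"
proof (induction m arbitrary: \<gamma> \<gamma>' w)
  case 0
  then show ?case by (rule wbounded0_weaken)
next
  case (Suc m)
  then show ?case
    using Suc.IH[of "\<gamma>' - 1" "\<gamma> - 1"] wbounded0_weaken unfolding wbounded_Suc by auto
qed

lemma wbounded_reindex:
  "wbounded m \<gamma> I w \<Longrightarrow> (\<And>j. j \<in> J \<Longrightarrow> f j \<in> I) \<Longrightarrow> wbounded m \<gamma> J (\<lambda>j. w (f j))"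
proof (induction m arbitrary: \<gamma> w)
  case 0
  then show ?case unfolding wbounded.simps by blast
next
  case (Suc m)
  have "wbounded 0 \<gamma> J (\<lambda>j. w (f j))" using Suc.prems unfolding wbounded.simps by blast
  moreover have "wbounded m (\<gamma> - 1) J (\<lambda>j. pd b (w (f j)))" if "b \<in> Basis" for b
    by (rule Suc.IH[of "\<gamma> - 1" "\<lambda>i. pd b (w i)"]) (use Suc.prems that in \<open>auto simp: wbounded_Suc\<close>)
  ultimately show ?case unfolding wbounded_Suc by blast
qed

lemma wbounded_SucD: "wbounded (Suc m) \<gamma> I w \<Longrightarrow> wbounded m \<gamma> I w"
proof (induction m arbitrary: \<gamma> w)
  case 0
  then show ?case using wbounded_Suc by blast
next
  case (Suc m)
  then show ?case by (subst wbounded_Suc) (subst (asm) wbounded_Suc[of "Suc m"], blast)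
qed

lemma wbounded0_add: "wbounded 0 \<gamma> I w \<Longrightarrow> wbounded 0 \<gamma> I v \<Longrightarrow> wbounded 0 \<gamma> I (\<lambda>i x. w i x + v i x)"
proof -
  assume "wbounded 0 \<gamma> I w" "wbounded 0 \<gamma> I v"
  then obtain C D where C: "\<And>i x. i \<in> I \<Longrightarrow> x \<in> ball 0 1 \<Longrightarrow> \<bar>w i x\<bar> \<le> C * bdef x powr \<gamma>"
    and D: "\<And>i x. i \<in> I \<Longrightarrow> x \<in> ball 0 1 \<Longrightarrow> \<bar>v i x\<bar> \<le> D * bdef x powr \<gamma>"
    by (metis wbounded0E)
  have "\<bar>w i x + v i x\<bar> \<le> (C + D) * bdef x powr \<gamma>" if "i \<in> I" "x \<in> ball 0 1" for i x
    using C[OF that] D[OF that] abs_triangle_ineq[of "w i x" "v i x"] by (simp add: algebra_simps)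
  then show ?thesis by (rule wbounded0I)
qed

lemma wbounded_add:
  assumes "\<And>i. i \<in> I \<Longrightarrow> smooth_on (ball 0 1) (w i)" "\<And>i. i \<in> I \<Longrightarrow> smooth_on (ball 0 1) (v i)"
    "wbounded m \<gamma> I w" "wbounded m \<gamma> I v"
  shows "wbounded m \<gamma> I (\<lambda>i x. w i x + v i x)"
  using assms
proof (induction m arbitrary: \<gamma> w v)
  case 0
  show ?case by (rule wbounded0_add[OF 0(3,4)])
next
  case (Suc m)
  have "wbounded m (\<gamma> - 1) I (\<lambda>i. pd b (\<lambda>x. w i x + v i x))" if b: "b \<in> Basis" for b
  proof -
    have "wbounded m (\<gamma> - 1) I (\<lambda>i x. pd b (w i) x + pd b (v i) x)"
      by (rule Suc.IH) (use Suc.prems b in \<open>auto simp: wbounded_Suc intro: smooth_on_pd\<close>)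
    moreover have "pd b (\<lambda>x. w i x + v i x) x = pd b (w i) x + pd b (v i) x" if "i \<in> I" "x \<in> ball 0 1" for i x
      using pd_add[OF smooth_onD smooth_onD] Suc.prems that by blast
    ultimately show ?thesis
      using wbounded_cong[of I "\<lambda>i. pd b (\<lambda>x. w i x + v i x)" "\<lambda>i x. pd b (w i) x + pd b (v i) x"] by blast
  qed
  moreover have "wbounded 0 \<gamma> I (\<lambda>i x. w i x + v i x)"
    using Suc.prems by (intro wbounded0_add) (auto simp: wbounded_Suc)
  ultimately show ?case unfolding wbounded_Suc by blast
qed

lemma wbounded0_mult:
  "wbounded 0 \<gamma> I w \<Longrightarrow> wbounded 0 \<gamma>' I v \<Longrightarrow> wbounded 0 (\<gamma> + \<gamma>') I (\<lambda>i x. w i x * v i x)"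
proof -
  assume "wbounded 0 \<gamma> I w" "wbounded 0 \<gamma>' I v"
  then obtain C D where C: "\<And>i x. i \<in> I \<Longrightarrow> x \<in> ball 0 1 \<Longrightarrow> \<bar>w i x\<bar> \<le> C * bdef x powr \<gamma>" "C > 0"
    and D: "\<And>i x. i \<in> I \<Longrightarrow> x \<in> ball 0 1 \<Longrightarrow> \<bar>v i x\<bar> \<le> D * bdef x powr \<gamma>'" "D > 0"
    by (metis wbounded0E)
  have "\<bar>w i x * v i x\<bar> \<le> (C * D) * bdef x powr (\<gamma> + \<gamma>')" if "i \<in> I" "x \<in> ball 0 1" for i x
  proof -
    have "\<bar>w i x * v i x\<bar> \<le> (C * bdef x powr \<gamma>) * (D * bdef x powr \<gamma>')"
      unfolding abs_mult using C D that by (intro mult_mono) auto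
    then show ?thesis by (simp add: powr_add mult.assoc mult.left_commute)
  qed
  then show ?thesis by (rule wbounded0I)
qed

lemma wbounded_mult:
  assumes "\<And>i. i \<in> I \<Longrightarrow> smooth_on (ball 0 1) (w i)" "\<And>i. i \<in> I \<Longrightarrow> smooth_on (ball 0 1) (v i)"
    "wbounded m \<gamma> I w" "wbounded m \<gamma>' I v"
  shows "wbounded m (\<gamma> + \<gamma>') I (\<lambda>i x. w i x * v i x)"
  using assms
proof (induction m arbitrary: \<gamma> \<gamma>' w v)
  case 0
  show ?case by (rule wbounded0_mult[OF 0(3,4)])
next
  case (Suc m)
  have "wbounded m (\<gamma> + \<gamma>' - 1) I (\<lambda>i. pd b (\<lambda>x. w i x * v i x))" if b: "b \<in> Basis" for b
  proof -
    have "wbounded m (\<gamma> + (\<gamma>' - 1)) I (\<lambda>i x. w i x * pd b (v i) x)"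
      by (rule Suc.IH)
        (use Suc.prems b wbounded_SucD[OF Suc.prems(3)] wbounded_SucD[OF Suc.prems(4)]
          in \<open>auto simp: wbounded_Suc intro: smooth_on_pd\<close>)
    moreover have "wbounded m ((\<gamma> - 1) + \<gamma>') I (\<lambda>i x. pd b (w i) x * v i x)"
      by (rule Suc.IH)
        (use Suc.prems b wbounded_SucD[OF Suc.prems(3)] wbounded_SucD[OF Suc.prems(4)]
          in \<open>auto simp: wbounded_Suc intro: smooth_on_pd\<close>)
    ultimately have "wbounded m (\<gamma> + \<gamma>' - 1) I (\<lambda>i x. w i x * pd b (v i) x + pd b (w i) x * v i x)"
      using Suc.prems
      by (intro wbounded_add smooth_on_mult smooth_on_pd open_ball) (auto simp: algebra_simps)
    moreover have "pd b (\<lambda>x. w i x * v i x) x = w i x * pd b (v i) x + pd b (w i) x * v i x" if "i \<in> I" "x \<in> ball 0 1" for i x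
      using pd_mult[OF smooth_onD smooth_onD] Suc.prems that by blast
    ultimately show ?thesis
      using wbounded_cong[of I "\<lambda>i. pd b (\<lambda>x. w i x * v i x)" "\<lambda>i x. w i x * pd b (v i) x + pd b (w i) x * v i x"] by blast
  qed
  moreover have "wbounded 0 (\<gamma> + \<gamma>') I (\<lambda>i x. w i x * v i x)"
    using Suc.prems by (intro wbounded0_mult) (auto simp: wbounded_Suc)
  ultimately show ?case unfolding wbounded_Suc by blast
qed

lemma wbounded_zero: "wbounded m \<gamma> I (\<lambda>i (x::'a::euclidean_space). 0)"
proof (induction m arbitrary: \<gamma>)
  case 0
  show ?case by (rule wbounded0I[where C=0]) simp
next
  case (Suc m)
  have "wbounded 0 \<gamma> I (\<lambda>i (x::'a). 0)" by (rule wbounded0I[where C=0]) simp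
  then show ?case using Suc unfolding wbounded_Suc by (simp add: pd_const[abs_def])
qed

lemma wbounded_constant:
  assumes "\<And>i. i \<in> I \<Longrightarrow> \<bar>c i\<bar> \<le> K"
  shows "wbounded m 0 I (\<lambda>i (x::'a::euclidean_space). c i)"
proof -
  have "\<bar>c i\<bar> \<le> K * bdef x powr 0" if "i \<in> I" "x \<in> ball 0 1" for i and x :: 'a
    using assms[OF that(1)] bdef_ball[OF that(2)] by simp
  then have z: "wbounded 0 0 I (\<lambda>i (x::'a). c i)" by (rule wbounded0I)
  then show ?thesis by (cases m) (simp_all add: wbounded_Suc pd_const[abs_def] wbounded_zero)
qed

lemma wsmoothI: "(\<And>i. i \<in> I \<Longrightarrow> smooth_on (ball 0 1) (w i)) \<Longrightarrow> (\<And>m. wbounded m \<gamma> I w) \<Longrightarrow> wsmooth \<gamma> I w"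
  by (simp add: wsmooth_def)

lemma wsmoothD:
  assumes "wsmooth \<gamma> I w"
  shows "i \<in> I \<Longrightarrow> smooth_on (ball 0 1) (w i)" "wbounded m \<gamma> I w"
  using assms by (auto simp: wsmooth_def)

lemma wsmoothE:
  assumes "wsmooth \<gamma> I w"
  obtains C where "C > 0" "\<And>i x. i \<in> I \<Longrightarrow> x \<in> ball 0 1 \<Longrightarrow> \<bar>w i x\<bar> \<le> C * bdef x powr \<gamma>"
  using wsmoothD(2)[OF assms, of 0] wbounded0E by blast

lemma wsmooth_cong:
  assumes "\<And>i x. i \<in> I \<Longrightarrow> x \<in> ball 0 1 \<Longrightarrow> w i x = w' i x"
  shows "wsmooth \<gamma> I w \<longleftrightarrow> wsmooth \<gamma> I w'"
  unfolding wsmooth_def using wbounded_cong[of I w w'] smooth_on_cong[OF open_ball, of 0 1] assms by metis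

lemma wsmooth_pd: "wsmooth \<gamma> I w \<Longrightarrow> b \<in> Basis \<Longrightarrow> wsmooth (\<gamma> - 1) I (\<lambda>i. pd b (w i))"
  unfolding wsmooth_def using smooth_on_pd wbounded_Suc by metis

lemma wsmooth_weaken: "wsmooth \<gamma> I w \<Longrightarrow> \<gamma>' \<le> \<gamma> \<Longrightarrow> wsmooth \<gamma>' I w"
  unfolding wsmooth_def using wbounded_weaken by blast

lemma wsmooth_reindex:
  "wsmooth \<gamma> I w \<Longrightarrow> (\<And>j. j \<in> J \<Longrightarrow> f j \<in> I) \<Longrightarrow> wsmooth \<gamma> J (\<lambda>j. w (f j))"
  unfolding wsmooth_def using wbounded_reindex by blast

lemma wsmooth_add: "wsmooth \<gamma> I w \<Longrightarrow> wsmooth \<gamma> I v \<Longrightarrow> wsmooth \<gamma> I (\<lambda>i x. w i x + v i x)"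
  unfolding wsmooth_def by (auto intro!: wbounded_add smooth_on_add)

lemma wsmooth_mult: "wsmooth \<gamma> I w \<Longrightarrow> wsmooth \<gamma>' I v \<Longrightarrow> wsmooth (\<gamma> + \<gamma>') I (\<lambda>i x. w i x * v i x)"
  unfolding wsmooth_def by (auto intro!: wbounded_mult smooth_on_mult)

lemma wsmooth_mult0: "wsmooth 0 I w \<Longrightarrow> wsmooth \<gamma> I v \<Longrightarrow> wsmooth \<gamma> I (\<lambda>i x. w i x * v i x)"
  using wsmooth_mult[of 0 I w \<gamma> v] by simp

lemma wsmooth_constant: "(\<And>i. i \<in> I \<Longrightarrow> \<bar>c i\<bar> \<le> K) \<Longrightarrow> wsmooth 0 I (\<lambda>i x. c i)"
  by (auto intro!: wsmoothI wbounded_constant smooth_on_const)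

lemma wsmooth_cmult: "(\<And>i. i \<in> I \<Longrightarrow> \<bar>c i\<bar> \<le> K) \<Longrightarrow> wsmooth \<gamma> I w \<Longrightarrow> wsmooth \<gamma> I (\<lambda>i x. c i * w i x)"
  by (rule wsmooth_mult0[OF wsmooth_constant])

lemma wsmooth_diff: "wsmooth \<gamma> I w \<Longrightarrow> wsmooth \<gamma> I v \<Longrightarrow> wsmooth \<gamma> I (\<lambda>i x. w i x - v i x)"
  using wsmooth_add[of \<gamma> I w "\<lambda>i x. - 1 * v i x"] wsmooth_cmult[of I "\<lambda>_. - 1" 1 \<gamma> v] by simp

lemma wsmooth_zero: "wsmooth \<gamma> I (\<lambda>i x. 0)"
  by (intro wsmoothI wbounded_zero smooth_on_const)

lemma wsmooth_sum:
  "finite A \<Longrightarrow> (\<And>a. a \<in> A \<Longrightarrow> wsmooth \<gamma> I (w a)) \<Longrightarrow> wsmooth \<gamma> I (\<lambda>i x. \<Sum>a\<in>A. w a i x)"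
  by (induction A rule: finite_induct) (auto intro!: wsmooth_add wsmooth_zero)

section \<open>Coefficients that are smooth beyond the sphere\<close>

lemma pd_slice:
  fixes c :: "'p::euclidean_space \<times> 'a::euclidean_space \<Rightarrow> 'b::real_normed_vector"
  assumes "c differentiable (at (p, x))"
  shows "pd b (\<lambda>x. c (p, x)) x = pd (0, b) c (p, x)" "pd a (\<lambda>p. c (p, x)) p = pd (a, 0) c (p, x)"
proof -
  have "((\<lambda>x. (p, x)) has_derivative (\<lambda>v. (0, v))) (at x)" "((\<lambda>p. (p, x)) has_derivative (\<lambda>v. (v, 0))) (at p)"
    by (auto intro!: derivative_eq_intros)
  from has_derivative_compose[OF this(1), of c] has_derivative_compose[OF this(2), of c] has_derivative_pd[OF assms]
  have "((\<lambda>x. c (p, x)) has_derivative (\<lambda>b. pd (0, b) c (p, x))) (at x)"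
    "((\<lambda>p. c (p, x)) has_derivative (\<lambda>a. pd (a, 0) c (p, x))) (at p)" by blast+
  then show "pd b (\<lambda>x. c (p, x)) x = pd (0, b) c (p, x)" "pd a (\<lambda>p. c (p, x)) p = pd (a, 0) c (p, x)"
    by (auto dest: pd_eq)
qed

lemma smooth_on_slice:
  fixes c :: "'p::euclidean_space \<times> 'a::euclidean_space \<Rightarrow> 'b::real_normed_vector"
  assumes "smooth_on (P \<times> U) c" "open P" "open U" "p \<in> P"
  shows "smooth_on U (\<lambda>x. c (p, x))"
  by (rule smooth_on_compose[OF assms(3) open_Times[OF assms(2,3)] _ assms(1)])
    (use assms in \<open>auto intro!: smooth_on_Pair smooth_on_const smooth_on_ident\<close>)

text \<open>Compactness of \<open>K\<close> times the closed ball bounds every space derivative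
  without any weight; as \<open>bdef\<close> is at most 1 in the ball, this is more than the lowered
  exponents demand.\<close>

lemma wsmooth_param:
  fixes c :: "'p::euclidean_space \<times> 'a::euclidean_space \<Rightarrow> real"
  assumes c: "smooth_on (P \<times> U) c" and P: "open P" "compact K" "K \<subseteq> P" and U: "open U" "cball 0 1 \<subseteq> U"
  shows "wsmooth 0 K (\<lambda>p x. c (p, x))"
proof (rule wsmoothI)
  have BU: "ball 0 1 \<subseteq> U" using U(2) ball_subset_cball by blast
  show "smooth_on (ball 0 1) (\<lambda>x. c (p, x))" if "p \<in> K" for p
    using smooth_on_slice[OF c P(1) U(1)] that P(3) smooth_on_subset[OF _ BU] by blast
  show "wbounded m 0 K (\<lambda>p x. c (p, x))" for m
    using c
  proof (induction m arbitrary: c)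
    have z: "wbounded 0 0 K (\<lambda>p x. c (p, x))" if c: "smooth_on (P \<times> U) c" for c :: "'p \<times> 'a \<Rightarrow> real"
    proof -
      have "compact (K \<times> cball (0::'a) 1)" using P by (intro compact_Times) auto
      moreover have "continuous_on (K \<times> cball 0 1) c"
        by (rule continuous_on_subset[OF smooth_on_continuous[OF c]]) (use P U in auto)
      ultimately have "bounded (c ` (K \<times> cball 0 1))"
        using compact_continuous_image compact_imp_bounded by blast
      then obtain C where C: "\<And>p x. p \<in> K \<Longrightarrow> x \<in> cball 0 1 \<Longrightarrow> \<bar>c (p, x)\<bar> \<le> C"
        unfolding bounded_iff by fastforce
      have "\<bar>c (p, x)\<bar> \<le> C * bdef x powr 0" if "p \<in> K" "x \<in> ball 0 1" for p x
        using C[OF that(1), of x] that(2) bdef_ball[OF that(2)] by auto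
      then show ?thesis by (rule wbounded0I)
    qed
    case 0
    then show ?case by (rule z)
    case (Suc m)
    have "wbounded m (0 - 1) K (\<lambda>p. pd b (\<lambda>x. c (p, x)))" for b
    proof -
      have "wbounded m 0 K (\<lambda>p x. pd (0, b) c (p, x))" by (rule Suc.IH[OF smooth_on_pd[OF Suc.prems]])
      then have "wbounded m (0 - 1) K (\<lambda>p x. pd (0, b) c (p, x))" by (rule wbounded_weaken[rotated]) simp
      moreover have "pd b (\<lambda>x. c (p, x)) x = pd (0, b) c (p, x)" if "p \<in> K" "x \<in> ball 0 1" for p x
        by (rule pd_slice(1)[OF smooth_onD[OF Suc.prems]]) (use that P BU in auto)
      ultimately show ?thesis
        using wbounded_cong[of K "\<lambda>p. pd b (\<lambda>x. c (p, x))" "\<lambda>p x. pd (0, b) c (p, x)"] by blast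
    qed
    then show ?case unfolding wbounded_Suc using z[OF Suc.prems] by blast
  qed
qed

text \<open>The vector \<open>frame \<Phi> t b x\<close> is mapped to \<open>b\<close> by the derivative of \<open>\<Phi> t\<close> at \<open>x\<close>.\<close>

definition frame :: "(real \<Rightarrow> real^'n \<Rightarrow> real^'n) \<Rightarrow> real \<Rightarrow> real^'n \<Rightarrow> real^'n \<Rightarrow> real^'n" where
  "frame \<Phi> t b x = inv (\<lambda>v. pd v (\<Phi> t) x) b"

definition dframe :: "(real \<Rightarrow> real^'n \<Rightarrow> real^'n) \<Rightarrow> real \<Rightarrow> real^'n \<Rightarrow> (real^'n \<Rightarrow> real) \<Rightarrow> real^'n \<Rightarrow> real" where
  "dframe \<Phi> t b w x = pd (frame \<Phi> t b x) w x"

definition lframe :: "(real \<Rightarrow> real^'n \<Rightarrow> real^'n) \<Rightarrow> real \<Rightarrow> (real^'n \<Rightarrow> real) \<Rightarrow> real^'n \<Rightarrow> real" where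
  "lframe \<Phi> t w x = (\<Sum>b\<in>Basis. dframe \<Phi> t b (dframe \<Phi> t b w) x)"

lemma dframe_cong:
  assumes "open S" "\<And>x. x \<in> S \<Longrightarrow> f x = g x" "x \<in> S"
  shows "dframe \<Phi> t b f x = dframe \<Phi> t b g x"
  unfolding dframe_def using pd_cong[OF assms] by simp

lemma lframe_cong:
  assumes "open S" "\<And>x. x \<in> S \<Longrightarrow> f x = g x" "x \<in> S"
  shows "lframe \<Phi> t f x = lframe \<Phi> t g x"
  unfolding lframe_def using dframe_cong[OF assms(1) dframe_cong[OF assms(1,2)] assms(3)] by simp

lemma pd_norm_le:
  assumes f: "f differentiable (at x)" and S: "open S" "x \<in> S"
    and lip: "\<And>y. y \<in> S \<Longrightarrow> norm (f y - f x) \<le> C * norm (y - x)"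
  shows "norm (pd v f x) \<le> C * norm v"
proof -
  have "((\<lambda>s::real. x + s *\<^sub>R v) has_derivative (\<lambda>s. s *\<^sub>R v)) (at 0)"
    by (auto intro!: derivative_eq_intros)
  from has_derivative_compose[OF this, of f "\<lambda>v. pd v f x"] has_derivative_pd[OF f]
  have "((\<lambda>s. f (x + s *\<^sub>R v)) has_derivative (\<lambda>s. pd (s *\<^sub>R v) f x)) (at 0)" by simp
  moreover have "pd (s *\<^sub>R v) f x = s *\<^sub>R pd v f x" for s using linear.scaleR[OF pd_linear[OF f]] .
  ultimately have "((\<lambda>s. f (x + s *\<^sub>R v)) has_derivative (\<lambda>s. s *\<^sub>R pd v f x)) (at 0)" by simp
  then have der: "\<And>e. e > 0 \<Longrightarrow> \<exists>d>0. \<forall>s. norm s < d \<longrightarrow> norm (f (x + s *\<^sub>R v) - f x - s *\<^sub>R pd v f x) \<le> e * norm s"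
    by (simp add: has_derivative_at_alt)
  have "norm (pd v f x) \<le> C * norm v + e" if e: "e > 0" for e
  proof -
    obtain d where d: "d > 0" "\<And>s. norm s < d \<Longrightarrow> norm (f (x + s *\<^sub>R v) - f x - s *\<^sub>R pd v f x) \<le> e * norm s"
      using der[OF e] by blast
    obtain d' where d': "d' > 0" "ball x d' \<subseteq> S" using S openE by blast
    have nv: "norm v + 1 > 0" using norm_ge_zero[of v] by linarith
    define D where "D = d' / (norm v + 1)"
    have D: "D > 0" using nv d'(1) by (simp add: D_def)
    define s where "s = min d D / 2"
    have s: "0 < s" "s < d" "s < D" using d D by (auto simp: s_def)
    have "s * (norm v + 1) < d'" using s(3) nv by (simp add: D_def pos_less_divide_eq)
    then have "s * norm v < d'" using s(1) by (simp add: algebra_simps)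
    then have "x + s *\<^sub>R v \<in> S" using d'(2) s by (auto simp: dist_norm subset_eq)
    then have 1: "norm (f (x + s *\<^sub>R v) - f x) \<le> C * (s * norm v)" using lip s by fastforce
    have "s * norm (pd v f x) = norm (f (x + s *\<^sub>R v) - f x - (f (x + s *\<^sub>R v) - f x - s *\<^sub>R pd v f x))"
      using s by simp
    also have "\<dots> \<le> C * (s * norm v) + e * s"
      using norm_triangle_ineq4[of "f (x + s *\<^sub>R v) - f x" "f (x + s *\<^sub>R v) - f x - s *\<^sub>R pd v f x"] 1 d(2)[of s] s
      by simp
    finally have "s * norm (pd v f x) \<le> s * (C * norm v + e)" by (simp add: algebra_simps)
    then show ?thesis using s by simp
  qed
  then show ?thesis by (rule field_le_epsilon)
qed

section \<open>The Laplacian in moving coordinates\<close>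

text \<open>The two bounds on time leave a compact interval inside an open one, and the ball of
  radius 2 contains the closed unit ball, so that all coefficients are bounded together with their
  derivatives. The two Lipschitz bounds express uniform ellipticity of the pulled back Laplacian
  geometrically; their constant 2 determines the numerical constants of the barriers and of the
  interior estimate.\<close>

locale frame_family =
  fixes \<Phi> :: "real \<Rightarrow> real^'n \<Rightarrow> real^'n" and e \<delta> :: real
  assumes \<delta>: "0 < \<delta>" "\<delta> < e"
    and smooth: "smooth_on ({-e<..<e} \<times> ball 0 2) (\<lambda>(t, x). \<Phi> t x)"
    and low: "\<And>t x y. \<bar>t\<bar> < e \<Longrightarrow> x \<in> ball 0 2 \<Longrightarrow> y \<in> ball 0 2 \<Longrightarrow> norm (x - y) \<le> 2 * norm (\<Phi> t x - \<Phi> t y)"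
    and up: "\<And>t x y. \<bar>t\<bar> < e \<Longrightarrow> x \<in> ball 0 2 \<Longrightarrow> y \<in> ball 0 2 \<Longrightarrow> norm (\<Phi> t x - \<Phi> t y) \<le> 2 * norm (x - y)"
begin

abbreviation "c \<equiv> frame \<Phi>"
abbreviation "Y \<equiv> dframe \<Phi>"
abbreviation "L \<equiv> lframe \<Phi>"

lemma ball12: "ball 0 1 \<subseteq> (ball 0 2 :: (real^'n) set)" "cball 0 1 \<subseteq> (ball 0 2 :: (real^'n) set)"
  by auto

lemma smooth_t: "\<bar>t\<bar> < e \<Longrightarrow> smooth_on (ball 0 2) (\<Phi> t)"
  using smooth_on_slice[OF smooth open_greaterThanLessThan open_ball, of t] by (simp add: abs_less_iff)

lemma diff_t: "\<bar>t\<bar> < e \<Longrightarrow> x \<in> ball 0 2 \<Longrightarrow> \<Phi> t differentiable (at x)"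
  using smooth_t smooth_onD by blast

lemma inverse_facts:
  assumes "\<bar>t\<bar> < e" "S \<subseteq> ball 0 2" "open S"
  shows "inj_on (\<Phi> t) S" "open (\<Phi> t ` S)" "smooth_on (\<Phi> t ` S) (inv_into S (\<Phi> t))"
    "x \<in> S \<Longrightarrow> inj (\<lambda>v. pd v (\<Phi> t) x)"
proof -
  have l: "(1/2) * norm (x - y) \<le> norm (\<Phi> t x - \<Phi> t y)" if "x \<in> S" "y \<in> S" for x y
    using low[OF assms(1) subsetD[OF assms(2) that(1)] subsetD[OF assms(2) that(2)]] by simp
  have h: "(1/2::real) > 0" by simp
  have s: "smooth_on S (\<Phi> t)" by (rule smooth_on_subset[OF smooth_t[OF assms(1)] assms(2)])
  note i = smooth_on_inverse_map[OF assms(3) s h l]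
  show "inj_on (\<Phi> t) S" "open (\<Phi> t ` S)" "smooth_on (\<Phi> t ` S) (inv_into S (\<Phi> t))"
    "x \<in> S \<Longrightarrow> inj (\<lambda>v. pd v (\<Phi> t) x)"
    using i by blast+
qed

lemmas inj_pd = inverse_facts(4)[OF _ order_refl open_ball]

lemma linear_pd_t: "\<bar>t\<bar> < e \<Longrightarrow> x \<in> ball 0 2 \<Longrightarrow> linear (\<lambda>v. pd v (\<Phi> t) x)"
  by (rule pd_linear[OF diff_t])

lemma pd_frame:
  assumes "\<bar>t\<bar> < e" "x \<in> ball 0 2"
  shows "pd (c t b x) (\<Phi> t) x = b"
proof -
  have "surj (\<lambda>v. pd v (\<Phi> t) x)"
    using linear_pd_t[OF assms] inj_pd[OF assms] linear_injective_imp_surjective by blast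
  from surj_f_inv_f[OF this] show ?thesis unfolding frame_def .
qed

lemma pd_joint:
  assumes "\<bar>t\<bar> < e" "x \<in> ball 0 2"
  shows "pd v (\<Phi> t) x = pd (0, v) (\<lambda>(t, x). \<Phi> t x) (t, x)"
  using pd_slice(1)[OF smooth_onD[OF smooth], of t x v] assms by (simp add: abs_less_iff)

lemma smooth_pd_joint: "smooth_on ({-e<..<e} \<times> ball 0 2) (\<lambda>z. pd v (\<Phi> (fst z)) (snd z))"
proof -
  have o: "open ({-e<..<e} \<times> (ball 0 2 :: (real^'n) set))" by (intro open_Times) auto
  have "pd v (\<Phi> (fst z)) (snd z) = pd (0, v) (\<lambda>(t, x). \<Phi> t x) z" if "z \<in> {-e<..<e} \<times> ball 0 2" for z
    using pd_joint[of "fst z" "snd z" v] that by (auto simp: abs_less_iff)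
  then show ?thesis
    using smooth_on_cong[OF o] smooth_on_pd[OF smooth] by (metis (no_types, lifting))
qed

lemma frame_smooth: "smooth_on ({-e<..<e} \<times> ball 0 2) (\<lambda>z. c (fst z) b (snd z))"
  unfolding frame_def
proof (rule smooth_on_inv_linear[OF _ smooth_pd_joint])
  fix z :: "real \<times> (real^'n)" assume "z \<in> {-e<..<e} \<times> ball 0 2"
  then have "\<bar>fst z\<bar> < e" "snd z \<in> ball 0 2" by auto
  then show "linear (\<lambda>v. pd v (\<Phi> (fst z)) (snd z))" "inj (\<lambda>v. pd v (\<Phi> (fst z)) (snd z))"
    by (rule linear_pd_t, rule inj_pd)
qed (auto intro: open_Times)

lemma frame_smooth_t: "\<bar>t\<bar> < e \<Longrightarrow> smooth_on (ball 0 2) (c t b)"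
  using smooth_on_slice[OF frame_smooth open_greaterThanLessThan open_ball, of t] by (simp add: abs_less_iff)

lemma abs_interval: "\<bar>t\<bar> \<le> \<delta> \<Longrightarrow> \<bar>t\<bar> < e"
  using \<delta> by linarith

lemma interval_subset: "{-\<delta>..\<delta>} \<subseteq> {-e<..<e}"
  using \<delta> by auto

lemma frame_coeff: "wsmooth 0 {-\<delta>..\<delta>} (\<lambda>t x. c t b x \<bullet> j)"
proof -
  have o: "open ({-e<..<e} \<times> (ball 0 2 :: (real^'n) set))" by (intro open_Times) auto
  have "smooth_on ({-e<..<e} \<times> ball 0 2) (\<lambda>z. c (fst z) b (snd z) \<bullet> j)"
    by (intro smooth_on_inner frame_smooth smooth_on_const o)
  from wsmooth_param[OF this open_greaterThanLessThan _ _ open_ball ball12(2), of "{-\<delta>..\<delta>}"] interval_subset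
  show ?thesis by simp
qed

lemma grad_coeff: "wsmooth 0 {-\<delta>..\<delta>} (\<lambda>t x. pd v (\<Phi> t) x \<bullet> j)"
proof -
  have o: "open ({-e<..<e} \<times> (ball 0 2 :: (real^'n) set))" by (intro open_Times) auto
  have "smooth_on ({-e<..<e} \<times> ball 0 2) (\<lambda>z. pd v (\<Phi> (fst z)) (snd z) \<bullet> j)"
    by (intro smooth_on_inner smooth_pd_joint smooth_on_const o)
  from wsmooth_param[OF this open_greaterThanLessThan _ _ open_ball ball12(2), of "{-\<delta>..\<delta>}"] interval_subset
  show ?thesis by simp
qed

text \<open>The frame is a basis at every point, with the entries of the derivative of
  \<open>\<Phi> t\<close> as coordinates. Coordinate derivatives are thus recovered from frame
  derivatives with coefficients that are smooth across the sphere.\<close>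

lemma frame_expand:
  assumes "\<bar>t\<bar> < e" "x \<in> ball 0 2"
  shows "v = (\<Sum>k\<in>Basis. (pd v (\<Phi> t) x \<bullet> k) *\<^sub>R c t k x)"
proof -
  interpret A: linear "\<lambda>v. pd v (\<Phi> t) x" by (rule linear_pd_t[OF assms])
  have "pd (\<Sum>k\<in>Basis. (pd v (\<Phi> t) x \<bullet> k) *\<^sub>R c t k x) (\<Phi> t) x = (\<Sum>k\<in>Basis. (pd v (\<Phi> t) x \<bullet> k) *\<^sub>R k)"
    by (simp add: A.sum A.scaleR pd_frame[OF assms])
  also have "\<dots> = pd v (\<Phi> t) x" by (rule euclidean_representation)
  finally show ?thesis using injD[OF inj_pd[OF assms]] by metis
qed

lemma pd_by_frame:
  assumes "\<bar>t\<bar> < e" "x \<in> ball 0 2" "w differentiable (at x)"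
  shows "pd v w x = (\<Sum>k\<in>Basis. (pd v (\<Phi> t) x \<bullet> k) * Y t k w x)"
proof -
  interpret A: linear "\<lambda>v. pd v w x" by (rule pd_linear[OF assms(3)])
  have "pd v w x = pd (\<Sum>k\<in>Basis. (pd v (\<Phi> t) x \<bullet> k) *\<^sub>R c t k x) w x"
    using frame_expand[OF assms(1,2), of v] by simp
  then show ?thesis by (simp add: A.sum A.scaleR dframe_def)
qed

lemma dframe_expand:
  "w differentiable (at x) \<Longrightarrow> Y t b w x = (\<Sum>j\<in>Basis. (c t b x \<bullet> j) * pd j w x)"
  unfolding dframe_def by (subst pd_expand) auto

lemma dframe_smooth:
  assumes "\<bar>t\<bar> < e" "open S" "S \<subseteq> ball 0 2" "smooth_on S w"
  shows "smooth_on S (Y t b w)"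
proof -
  have "smooth_on S (\<lambda>x. \<Sum>j\<in>Basis. (c t b x \<bullet> j) * pd j w x)"
    by (intro smooth_on_sum smooth_on_mult smooth_on_inner smooth_on_pd smooth_on_const assms finite_Basis
        smooth_on_subset[OF frame_smooth_t])
  moreover have "Y t b w x = (\<Sum>j\<in>Basis. (c t b x \<bullet> j) * pd j w x)" if "x \<in> S" for x
    by (rule dframe_expand[OF smooth_onD[OF assms(4) that]])
  ultimately show ?thesis
    using smooth_on_cong[OF assms(2), of "Y t b w" "\<lambda>x. \<Sum>j\<in>Basis. (c t b x \<bullet> j) * pd j w x"] by blast
qed

lemma lframe_smooth:
  assumes "\<bar>t\<bar> < e" "open S" "S \<subseteq> ball 0 2" "smooth_on S w"
  shows "smooth_on S (L t w)"
proof -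
  have "smooth_on S (\<lambda>x. \<Sum>b\<in>Basis. Y t b (Y t b w) x)"
    by (intro smooth_on_sum dframe_smooth assms finite_Basis)
  then show ?thesis unfolding lframe_def[abs_def] .
qed

lemma dframe_compose:
  assumes "\<bar>t\<bar> < e" "x \<in> ball 0 2" "u differentiable (at (\<Phi> t x))"
  shows "Y t b (\<lambda>x. u (\<Phi> t x)) x = pd b u (\<Phi> t x)"
  unfolding dframe_def
  using pd_eq[OF pd_compose[OF diff_t[OF assms(1,2)] assms(3)], of "c t b x"] pd_frame[OF assms(1,2)] by simp

lemma lframe_compose:
  assumes t: "\<bar>t\<bar> < e" and S: "open S" "S \<subseteq> ball 0 2" and \<Omega>: "\<And>x. x \<in> S \<Longrightarrow> \<Phi> t x \<in> \<Omega>"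
    and u: "Ck_on 2 \<Omega> u" and x: "x \<in> S"
  shows "L t (\<lambda>x. u (\<Phi> t x)) x = laplacian u (\<Phi> t x)"
proof -
  have "Y t b (Y t b (\<lambda>x. u (\<Phi> t x))) x = pd b (pd b u) (\<Phi> t x)" for b
  proof -
    have "Y t b (Y t b (\<lambda>x. u (\<Phi> t x))) x = Y t b (\<lambda>x. pd b u (\<Phi> t x)) x"
      by (rule dframe_cong[OF S(1) _ x]) (rule dframe_compose[OF t _ Ck2D(1)[OF u \<Omega>]], use S in auto)
    also have "\<dots> = pd b (pd b u) (\<Phi> t x)"
      by (rule dframe_compose[OF t _ Ck2D(2)[OF u \<Omega>]]) (use S x in auto)
    finally show ?thesis .
  qed
  then show ?thesis by (simp add: lframe_def laplacian_alt)
qed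

text \<open>Writing a function on the ball as \<open>u\<close> composed with \<open>\<Phi> t\<close>
  turns statements about \<open>L t\<close> into statements about the ordinary Laplacian on the
  image.\<close>

lemma pullback:
  assumes "\<bar>t\<bar> < e" "open S" "S \<subseteq> ball 0 2" "smooth_on S w"
  obtains u where "smooth_on (\<Phi> t ` S) u" "\<And>x. x \<in> S \<Longrightarrow> u (\<Phi> t x) = w x"
proof
  let ?G = "inv_into S (\<Phi> t)"
  show "smooth_on (\<Phi> t ` S) (\<lambda>y. w (?G y))"
    by (rule smooth_on_compose[OF inverse_facts(2)[OF assms(1,3,2)] assms(2) _ assms(4) inverse_facts(3)[OF assms(1,3,2)]])
      (rule inv_into_into)
  show "w (?G (\<Phi> t x)) = w x" if "x \<in> S" for x
    using inv_into_f_f[OF inverse_facts(1)[OF assms(1,3,2)] that] by simp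
qed

text \<open>On the image domain both operators have constant coefficients. The commutation is exact,
  with no lower order terms, and this is what allows interior bounds to be iterated.\<close>

lemma lframe_dframe_commute:
  assumes t: "\<bar>t\<bar> < e" and w: "smooth_on (ball 0 1) w" and x: "x \<in> ball 0 1"
  shows "L t (Y t b w) x = Y t b (L t w) x"
proof -
  let ?S = "ball (0::real^'n) 1" and ?O = "\<Phi> t ` ball 0 1"
  note S = open_ball[of "0::real^'n" 1] ball12(1)
  have O: "open ?O" by (rule inverse_facts(2)[OF t S(2,1)])
  obtain u where u: "smooth_on ?O u" "\<And>x. x \<in> ?S \<Longrightarrow> u (\<Phi> t x) = w x"
    using pullback[OF t S w] by blast
  have u': "smooth_on ?O (laplacian u)"
    unfolding laplacian_alt[abs_def] by (intro smooth_on_sum O finite_Basis smooth_on_pd u)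
  have Lw: "L t w x = laplacian u (\<Phi> t x)" if "x \<in> ?S" for x
  proof -
    have "L t w x = L t (\<lambda>x. u (\<Phi> t x)) x" by (rule lframe_cong[OF S(1) _ that]) (simp add: u(2))
    also have "\<dots> = laplacian u (\<Phi> t x)" by (rule lframe_compose[OF t S _ smooth_on_Ck[OF u(1)] that]) auto
    finally show ?thesis .
  qed
  have Yw: "Y t b w x = pd b u (\<Phi> t x)" if "x \<in> ?S" for x
  proof -
    have "Y t b w x = Y t b (\<lambda>x. u (\<Phi> t x)) x" by (rule dframe_cong[OF S(1) _ that]) (simp add: u(2))
    also have "\<dots> = pd b u (\<Phi> t x)" by (rule dframe_compose[OF t _ smooth_onD[OF u(1)]]) (use that in auto)
    finally show ?thesis .
  qed
  have "L t (Y t b w) x = L t (\<lambda>x. pd b u (\<Phi> t x)) x" by (rule lframe_cong[OF S(1) _ x]) (simp add: Yw)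
  also have "\<dots> = laplacian (pd b u) (\<Phi> t x)"
    by (rule lframe_compose[OF t S _ smooth_on_Ck[OF smooth_on_pd[OF u(1)]] x]) auto
  also have "\<dots> = pd b (laplacian u) (\<Phi> t x)"
    by (rule laplacian_pd_commute[OF O smooth_on_Ck[OF u(1)] smooth_on_Ck[OF smooth_on_pd[OF u(1)]]]) (use x in auto)
  also have "\<dots> = Y t b (\<lambda>x. laplacian u (\<Phi> t x)) x"
    by (rule dframe_compose[OF t _ smooth_onD[OF u'], symmetric]) (use x in auto)
  also have "\<dots> = Y t b (L t w) x" by (rule dframe_cong[OF S(1) _ x]) (simp add: Lw)
  finally show ?thesis .
qed

lemma dframe_diff: "f differentiable (at x) \<Longrightarrow> g differentiable (at x) \<Longrightarrow> Y t b (\<lambda>x. f x - g x) x = Y t b f x - Y t b g x"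
  unfolding dframe_def by (rule pd_diff)

lemma dframe_add: "f differentiable (at x) \<Longrightarrow> g differentiable (at x) \<Longrightarrow> Y t b (\<lambda>x. f x + g x) x = Y t b f x + Y t b g x"
  unfolding dframe_def by (rule pd_add)

lemma dframe_cmult: "f differentiable (at x) \<Longrightarrow> Y t b (\<lambda>x. k * f x) x = k * Y t b f x"
  unfolding dframe_def by (rule pd_cmult)

lemma lframe_add:
  assumes t: "\<bar>t\<bar> < e" and f: "smooth_on (ball 0 1) f" and g: "smooth_on (ball 0 1) g" and x: "x \<in> ball 0 1"
  shows "L t (\<lambda>x. f x + g x) x = L t f x + L t g x"
proof -
  have "Y t b (Y t b (\<lambda>x. f x + g x)) x = Y t b (Y t b f) x + Y t b (Y t b g) x" for b
  proof -
    have "Y t b (Y t b (\<lambda>x. f x + g x)) x = Y t b (\<lambda>x. Y t b f x + Y t b g x) x"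
      by (rule dframe_cong[OF open_ball _ x]) (rule dframe_add[OF smooth_onD[OF f] smooth_onD[OF g]])
    also have "\<dots> = Y t b (Y t b f) x + Y t b (Y t b g) x"
      by (rule dframe_add; rule smooth_onD[OF dframe_smooth[OF t open_ball ball12(1)] x]; fact)
    finally show ?thesis .
  qed
  then show ?thesis by (simp add: lframe_def sum.distrib)
qed

lemma lframe_cmult:
  assumes t: "\<bar>t\<bar> < e" and f: "smooth_on (ball 0 1) f" and x: "x \<in> ball 0 1"
  shows "L t (\<lambda>x. k * f x) x = k * L t f x"
proof -
  have "Y t b (Y t b (\<lambda>x. k * f x)) x = k * Y t b (Y t b f) x" for b
  proof -
    have "Y t b (Y t b (\<lambda>x. k * f x)) x = Y t b (\<lambda>x. k * Y t b f x) x"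
      by (rule dframe_cong[OF open_ball _ x]) (rule dframe_cmult[OF smooth_onD[OF f]])
    also have "\<dots> = k * Y t b (Y t b f) x"
      by (rule dframe_cmult; rule smooth_onD[OF dframe_smooth[OF t open_ball ball12(1)] x]; fact)
    finally show ?thesis .
  qed
  then show ?thesis by (simp add: lframe_def sum_distrib_left)
qed

lemma smooth_on_cmult:
  fixes f :: "'b::euclidean_space \<Rightarrow> real"
  shows "open S \<Longrightarrow> smooth_on S f \<Longrightarrow> smooth_on S (\<lambda>x. k * f x)"
  by (intro smooth_on_mult smooth_on_const)

lemma lframe_diff:
  assumes t: "\<bar>t\<bar> < e" and f: "smooth_on (ball 0 1) f" and g: "smooth_on (ball 0 1) g" and x: "x \<in> ball 0 1"
  shows "L t (\<lambda>x. f x - g x) x = L t f x - L t g x"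
  using lframe_add[OF t f smooth_on_cmult[OF open_ball g, of "-1"] x] lframe_cmult[OF t g x, of "-1"] by simp

text \<open>If the claim fails, the difference has a positive maximum in the open ball. Seen on the
  image domain its Laplacian is nonpositive there, against the strict inequality.\<close>

lemma comparison:
  assumes t: "\<bar>t\<bar> < e" and f: "smooth_on (ball 0 1) f" "continuous_on (cball 0 1) f"
    and g: "smooth_on (ball 0 1) g" "continuous_on (cball 0 1) g"
    and le: "\<And>x. x \<in> sphere 0 1 \<Longrightarrow> f x \<le> g x" and less: "\<And>x. x \<in> ball 0 1 \<Longrightarrow> L t g x < L t f x"
    and x: "x \<in> cball 0 1"
  shows "f x \<le> g x"
proof (rule ccontr)
  assume n: "\<not> f x \<le> g x"
  let ?p = "\<lambda>x. f x - g x"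
  note S = open_ball[of "0::real^'n" 1] ball12(1)
  have "continuous_on (cball 0 1) ?p" by (intro continuous_on_diff f g)
  then obtain z where z: "z \<in> cball 0 1" "\<And>y. y \<in> cball 0 1 \<Longrightarrow> ?p y \<le> ?p z"
    using continuous_attains_sup[OF compact_cball, of 0 1 ?p] by force
  have "?p z > 0" using z(2)[OF x] n by simp
  then have "z \<notin> sphere 0 1" using le by force
  then have zB: "z \<in> ball 0 1" using z(1) by (simp add: order_le_less)
  have sp: "smooth_on (ball 0 1) ?p" by (intro smooth_on_diff f g open_ball)
  obtain u where u: "smooth_on (\<Phi> t ` ball 0 1) u" "\<And>x. x \<in> ball 0 1 \<Longrightarrow> u (\<Phi> t x) = ?p x"
    using pullback[OF t S sp] by blast
  have "laplacian u (\<Phi> t z) \<le> 0"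
    by (rule laplacian_at_max[OF inverse_facts(2)[OF t S(2,1)] smooth_on_Ck[OF u(1)]]) (use zB u(2) z(2) in auto)
  moreover have "L t ?p z = laplacian u (\<Phi> t z)"
  proof -
    have "L t ?p z = L t (\<lambda>x. u (\<Phi> t x)) z" by (rule lframe_cong[OF S(1) _ zB]) (simp add: u(2))
    also have "\<dots> = laplacian u (\<Phi> t z)" by (rule lframe_compose[OF t S _ smooth_on_Ck[OF u(1)] zB]) auto
    finally show ?thesis .
  qed
  ultimately show False using less[OF zB] lframe_diff[OF t f(1) g(1) zB] by linarith
qed

lemma dframe_sq: "Y t b (\<lambda>x. x \<bullet> x) x = 2 * (c t b x \<bullet> x)"
  unfolding dframe_def
  by (rule pd_eq[where f'="\<lambda>v. 2 * (v \<bullet> x)"]) (auto intro!: derivative_eq_intros simp: inner_commute)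

text \<open>Ellipticity in the radial direction, with the constant coming from \<open>up\<close>:
  \<open>x\<close> is paired with its own frame expansion, whose coordinate vector has length at
  most \<open>2 * norm x\<close>, and the Cauchy-Schwarz inequality is applied.\<close>

lemma frame_radial:
  assumes "\<bar>t\<bar> < e" "x \<in> ball 0 2"
  shows "(norm x)\<^sup>2 \<le> 4 * (\<Sum>b\<in>Basis. (c t b x \<bullet> x)\<^sup>2)"
proof -
  define v where "v = pd x (\<Phi> t) x"
  define q where "q = (\<Sum>b\<in>Basis. (c t b x \<bullet> x) *\<^sub>R b)"
  have qb: "q \<bullet> b = c t b x \<bullet> x" if "b \<in> Basis" for b
    using that by (simp add: q_def inner_sum_left inner_Basis if_distrib cong: if_cong)
  have nq: "(norm q)\<^sup>2 = (\<Sum>b\<in>Basis. (c t b x \<bullet> x)\<^sup>2)"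
    unfolding power2_norm_eq_inner by (subst euclidean_inner) (simp add: qb power2_eq_square)
  have nv: "norm v \<le> 2 * norm x"
    unfolding v_def by (rule pd_norm_le[OF diff_t[OF assms] open_ball assms(2) up[OF assms(1) _ assms(2)]])
  have "(norm x)\<^sup>2 = x \<bullet> (\<Sum>k\<in>Basis. (v \<bullet> k) *\<^sub>R c t k x)"
    using frame_expand[OF assms, of x] by (simp add: v_def dot_square_norm)
  also have "\<dots> = (\<Sum>k\<in>Basis. (v \<bullet> k) * (q \<bullet> k))"
    by (simp add: inner_sum_right qb inner_commute[of x])
  also have "\<dots> = v \<bullet> q" by (rule euclidean_inner[symmetric])
  also have "\<dots> \<le> norm v * norm q" by (rule norm_cauchy_schwarz)
  also have "\<dots> \<le> (2 * norm x) * norm q" using nv by (intro mult_right_mono) auto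
  finally have "norm x * norm x \<le> norm x * (2 * norm q)" by (simp add: power2_eq_square)
  then have "norm x \<le> 2 * norm q" by (cases "x = 0") auto
  then have "(norm x)\<^sup>2 \<le> (2 * norm q)\<^sup>2" by (intro power_mono) auto
  then show ?thesis using nq by (simp add: power_mult_distrib)
qed

text \<open>On functions of \<open>bdef\<close> the operator splits into a radial quadratic form,
  bounded below by \<open>frame_radial\<close>, and a first order part that is a multiple of
  \<open>L t\<close> applied to the square norm. The signs of these two parts decide whether a
  function is a barrier.\<close>

lemma lframe_bdef:
  assumes g: "smooth_on {0<..} g" "\<And>s. s > 0 \<Longrightarrow> (g has_real_derivative g' s) (at s)"
      "\<And>s. s > 0 \<Longrightarrow> (g' has_real_derivative g'' s) (at s)"
    and t: "\<bar>t\<bar> < e" and x: "x \<in> ball 0 1"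
  shows "L t (\<lambda>x. g (bdef x)) x = g'' (bdef x) * (4 * (\<Sum>b\<in>Basis. (c t b x \<bullet> x)\<^sup>2)) - g' (bdef x) * L t (\<lambda>x. x \<bullet> x) x"
proof -
  have ch: "Y t b (\<lambda>x. h (bdef x)) x = h' * (- 2 * (c t b x \<bullet> x))"
    if "(h has_real_derivative h') (at (bdef x))" for h h' b and x :: "real^'n"
  proof -
    have "(bdef has_derivative (\<lambda>v. - 2 * (v \<bullet> x))) (at x)"
      unfolding bdef_def[abs_def] by (auto intro!: derivative_eq_intros simp: inner_commute)
    from has_derivative_compose[OF this that[unfolded has_field_derivative_def]]
    have "((\<lambda>x. h (bdef x)) has_derivative (\<lambda>v. h' * (- 2 * (v \<bullet> x)))) (at x)" by simp
    then show ?thesis unfolding dframe_def by (rule pd_eq)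
  qed
  have "Y t b (Y t b (\<lambda>x. g (bdef x))) x = g'' (bdef x) * (4 * (c t b x \<bullet> x)\<^sup>2) - g' (bdef x) * Y t b (Y t b (\<lambda>x. x \<bullet> x)) x" for b
  proof -
    have db: "bdef x > 0" using bdef_ball[OF x] by simp
    have dY: "Y t b (\<lambda>x. x \<bullet> x) differentiable (at x)"
      by (rule smooth_onD[OF dframe_smooth[OF t open_ball ball12(1)] x])
        (intro smooth_on_inner smooth_on_ident open_ball)
    have dg': "(\<lambda>x. g' (bdef x)) differentiable (at x)"
    proof -
      have "(bdef has_derivative (\<lambda>v. - 2 * (v \<bullet> x))) (at x)"
        unfolding bdef_def[abs_def] by (auto intro!: derivative_eq_intros simp: inner_commute)
      from has_derivative_compose[OF this g(3)[OF db, unfolded has_field_derivative_def]]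
      show ?thesis unfolding differentiable_def by blast
    qed
    have "Y t b (Y t b (\<lambda>x. g (bdef x))) x = Y t b (\<lambda>x. (- 1) * (g' (bdef x) * Y t b (\<lambda>x. x \<bullet> x) x)) x"
    proof (rule dframe_cong[OF open_ball _ x])
      fix x :: "real^'n" assume "x \<in> ball 0 1"
      then have "Y t b (\<lambda>x. g (bdef x)) x = g' (bdef x) * (- 2 * (c t b x \<bullet> x))"
        using bdef_ball by (intro ch g(2)) blast
      then show "Y t b (\<lambda>x. g (bdef x)) x = (- 1) * (g' (bdef x) * Y t b (\<lambda>x. x \<bullet> x) x)"
        by (simp add: dframe_sq)
    qed
    also have "\<dots> = - (Y t b (\<lambda>x. g' (bdef x) * Y t b (\<lambda>x. x \<bullet> x) x) x)"
      by (subst dframe_cmult) (use dY dg' in \<open>auto intro: differentiable_mult\<close>)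
    also have "Y t b (\<lambda>x. g' (bdef x) * Y t b (\<lambda>x. x \<bullet> x) x) x
      = g' (bdef x) * Y t b (Y t b (\<lambda>x. x \<bullet> x)) x + Y t b (\<lambda>x. g' (bdef x)) x * Y t b (\<lambda>x. x \<bullet> x) x"
      using pd_mult[OF dg' dY, of "c t b x"] by (simp only: dframe_def)
    also have "Y t b (\<lambda>x. g' (bdef x)) x * Y t b (\<lambda>x. x \<bullet> x) x = - (g'' (bdef x) * (4 * (c t b x \<bullet> x)\<^sup>2))"
      using ch[OF g(3)[OF db]] dframe_sq by (simp add: power2_eq_square)
    finally show ?thesis by simp
  qed
  then show ?thesis by (simp add: lframe_def sum_subtractf sum_distrib_left)
qed

end

section \<open>Barriers\<close>

lemma wbounded_sum:
  assumes "finite A" "\<And>a i. a \<in> A \<Longrightarrow> i \<in> I \<Longrightarrow> smooth_on (ball 0 1) (w a i)"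
    "\<And>a. a \<in> A \<Longrightarrow> wbounded m \<gamma> I (w a)"
  shows "wbounded m \<gamma> I (\<lambda>i x. \<Sum>a\<in>A. w a i x)"
  using assms
proof (induction A rule: finite_induct)
  case empty
  then show ?case by (simp add: wbounded_zero)
next
  case (insert a A)
  have "wbounded m \<gamma> I (\<lambda>i x. w a i x + (\<Sum>a\<in>A. w a i x))"
    by (rule wbounded_add) (use insert in \<open>auto intro!: smooth_on_sum\<close>)
  then show ?case using insert.hyps by simp
qed

lemma bdef_smooth: "smooth_on (ball 0 1) (\<lambda>x::'a::euclidean_space. bdef x powr r)"
proof (rule smooth_on_compose[OF open_ball _ _ smooth_on_powr])
  show "smooth_on (ball 0 1) (bdef::'a\<Rightarrow>real)"
    unfolding bdef_def[abs_def] by (intro smooth_on_diff smooth_on_const smooth_on_inner smooth_on_ident open_ball)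
qed (use bdef_ball in auto)

lemma bdef_cball: "x \<in> cball 0 1 \<Longrightarrow> 0 \<le> bdef x"
  by (simp add: bdef_def dot_square_norm power_le_one_iff)

lemma bdef_sphere: "x \<in> sphere 0 1 \<Longrightarrow> bdef x = 0"
  by (simp add: bdef_def dot_square_norm)

lemma bdef_norm:
  "norm x < 1 \<Longrightarrow> bdef x \<noteq> 0" "norm x < 1 \<Longrightarrow> 0 < bdef x" "norm x = 1 \<Longrightarrow> bdef x = 0"
  using bdef_ball[of x] bdef_sphere[of x] by auto

lemma bdef_continuous: "r > 0 \<Longrightarrow> continuous_on (cball 0 1) (\<lambda>x::'a::euclidean_space. bdef x powr r)"
  using bdef_cball unfolding bdef_def by (intro continuous_on_powr' continuous_intros) force+

text \<open>The additional bound controls the first order part in \<open>lframe_bdef\<close>. At the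
  identity its value is twice the dimension, so it persists for small times; and since it concerns
  only the square norm, it survives rotations of the ball.\<close>

locale domain_family = frame_family \<Phi> e \<delta>
  for \<Phi> :: "real \<Rightarrow> real^'n \<Rightarrow> real^'n" and e \<delta> +
  assumes lframe_sq: "\<And>t x. \<bar>t\<bar> < e \<Longrightarrow> x \<in> ball 0 1 \<Longrightarrow> 1 \<le> lframe \<Phi> t (\<lambda>x. x \<bullet> x) x"
begin

text \<open>Doubling the barrier creates the strict inequality that \<open>comparison\<close>
  requires. It is applied to \<open>w\<close> and to its negative.\<close>

lemma barrier_bound:
  assumes t: "\<bar>t\<bar> < e" and w: "smooth_on (ball 0 1) w" "continuous_on (cball 0 1) w" "\<And>x. x \<in> sphere 0 1 \<Longrightarrow> w x = 0"
    and \<psi>: "smooth_on (ball 0 1) \<psi>" "continuous_on (cball 0 1) \<psi>" "\<And>x. x \<in> sphere 0 1 \<Longrightarrow> 0 \<le> \<psi> x"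
    and L\<psi>: "\<And>x. x \<in> ball 0 1 \<Longrightarrow> L t \<psi> x \<le> - h x" and h: "\<And>x. x \<in> ball 0 1 \<Longrightarrow> 0 < h x"
    and C: "C > 0" and Lw: "\<And>x. x \<in> ball 0 1 \<Longrightarrow> \<bar>L t w x\<bar> \<le> C * h x"
    and x: "x \<in> cball 0 1"
  shows "\<bar>w x\<bar> \<le> 2 * C * \<psi> x"
proof -
  have s\<psi>: "smooth_on (ball 0 1) (\<lambda>x. 2 * C * \<psi> x)" "continuous_on (cball 0 1) (\<lambda>x. 2 * C * \<psi> x)"
    using \<psi> by (auto intro!: smooth_on_cmult continuous_intros)
  have less: "L t (\<lambda>x. 2 * C * \<psi> x) x < - \<bar>L t w x\<bar>" if "x \<in> ball 0 1" for x
  proof -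
    have "2 * C * L t \<psi> x \<le> 2 * C * (- h x)" using L\<psi>[OF that] C by (intro mult_left_mono) auto
    then show ?thesis
      using lframe_cmult[OF t \<psi>(1) that, of "2 * C"] Lw[OF that] mult_pos_pos[OF C h[OF that]] by linarith
  qed
  have "w x \<le> 2 * C * \<psi> x"
  proof (rule comparison[OF t w(1,2) s\<psi> _ _ x])
    show "w x \<le> 2 * C * \<psi> x" if "x \<in> sphere 0 1" for x
      using w(3)[OF that] \<psi>(3)[OF that] C by simp
    show "L t (\<lambda>x. 2 * C * \<psi> x) x < L t w x" if "x \<in> ball 0 1" for x using less[OF that] by linarith
  qed
  moreover have "- 1 * w x \<le> 2 * C * \<psi> x"
  proof (rule comparison[OF t _ _ s\<psi> _ _ x])
    show "smooth_on (ball 0 1) (\<lambda>x. - 1 * w x)" by (rule smooth_on_cmult[OF open_ball w(1)])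
    show "continuous_on (cball 0 1) (\<lambda>x. - 1 * w x)" using w(2) by (intro continuous_intros)
    show "- 1 * w x \<le> 2 * C * \<psi> x" if "x \<in> sphere 0 1" for x
      using w(3)[OF that] \<psi>(3)[OF that] C by simp
    show "L t (\<lambda>x. 2 * C * \<psi> x) x < L t (\<lambda>x. - 1 * w x) x" if "x \<in> ball 0 1" for x
      using less[OF that] lframe_cmult[OF t w(1) that, of "-1"] by linarith
  qed
  ultimately show ?thesis by linarith
qed

text \<open>Concavity of the square root yields \<open>- 1/4 * d powr (-3/2)\<close> times the
  radial form \<open>S\<close>. The form is only known to be at least \<open>1 - d\<close>, which
  degenerates at the centre; there the first order part, with \<open>l \<ge> 1\<close>,
  compensates.\<close>

lemma barrier_half:
  assumes t: "\<bar>t\<bar> < e" and x: "x \<in> ball 0 1"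
  shows "L t (\<lambda>x. bdef x powr (1/2)) x \<le> - (1/4 * bdef x powr (-3/2))"
proof -
  define d where "d = bdef x"
  define S where "S = 4 * (\<Sum>b\<in>Basis. (c t b x \<bullet> x)\<^sup>2)"
  define l where "l = L t (\<lambda>x. x \<bullet> x) x"
  have d: "0 < d" "d \<le> 1" using bdef_ball[OF x] by (auto simp: d_def)
  have S: "S \<ge> 1 - d" using frame_radial[OF t] x by (auto simp: S_def d_def bdef_def dot_square_norm)
  have l: "l \<ge> 1" using lframe_sq[OF t x] by (simp add: l_def)
  have "L t (\<lambda>x. bdef x powr (1/2)) x = - 1/4 * d powr (-3/2) * S - 1/2 * d powr (-1/2) * l"
    unfolding d_def S_def l_def
    by (rule lframe_bdef[OF smooth_on_powr _ _ t x]) (auto intro!: derivative_eq_intros)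
  moreover have "d powr (-1/2) = d powr (-3/2) * d"
    using d powr_add[of d "-3/2" 1] by simp
  moreover have "d powr (-3/2) * (1 - d) \<le> d powr (-3/2) * S" using S by (intro mult_left_mono) auto
  moreover have "d powr (-3/2) * d * 1 \<le> d powr (-3/2) * d * l" using l d by (intro mult_left_mono) auto
  moreover have "0 \<le> d powr (-3/2) * d" using d by simp
  ultimately show ?thesis unfolding d_def[symmetric] by (simp add: algebra_simps)
qed

text \<open>The factor 3 keeps the slope of \<open>3 * s - s powr (3/2)\<close> at least 3/2 for
  \<open>s\<close> up to 1, so that the first order part has the right sign, while the concave term
  produces the singular \<open>bdef x powr (-1/2)\<close>.\<close>

lemma barrier_one:
  assumes t: "\<bar>t\<bar> < e" and x: "x \<in> ball 0 1"
  shows "L t (\<lambda>x. 3 * bdef x - bdef x powr (3/2)) x \<le> - (3/4 * bdef x powr (-1/2))"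
proof -
  define d where "d = bdef x"
  define S where "S = 4 * (\<Sum>b\<in>Basis. (c t b x \<bullet> x)\<^sup>2)"
  define l where "l = L t (\<lambda>x. x \<bullet> x) x"
  have d: "0 < d" "d \<le> 1" using bdef_ball[OF x] by (auto simp: d_def)
  have S: "S \<ge> 1 - d" using frame_radial[OF t] x by (auto simp: S_def d_def bdef_def dot_square_norm)
  have l: "l \<ge> 1" using lframe_sq[OF t x] by (simp add: l_def)
  have "smooth_on {0<..} (\<lambda>s::real. 3 * s - s powr (3/2))"
    by (intro smooth_on_diff smooth_on_mult smooth_on_const smooth_on_ident smooth_on_powr open_greaterThan)
  then have "L t (\<lambda>x. 3 * bdef x - bdef x powr (3/2)) x = - 3/4 * d powr (-1/2) * S - (3 - 3/2 * d powr (1/2)) * l"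
    unfolding d_def S_def l_def
    by (rule lframe_bdef[OF _ _ _ t x]) (auto intro!: derivative_eq_intros)
  moreover have "d powr (-1/2) * d \<le> 1"
    using d powr_add[of d "-1/2" 1] powr_le1[of "1/2" d] by simp
  moreover have "d powr (-1/2) * (1 - d) \<le> d powr (-1/2) * S" using S by (intro mult_left_mono) auto
  moreover have "3/2 \<le> 3 - 3/2 * d powr (1/2)" using powr_le1[of "1/2" d] d by simp
  then have "3/2 * 1 \<le> (3 - 3/2 * d powr (1/2)) * l" using l by (intro mult_mono) auto
  ultimately show ?thesis unfolding d_def[symmetric] by (simp add: algebra_simps)
qed

lemma sup_bound_half:
  assumes t: "\<bar>t\<bar> < e" and w: "smooth_on (ball 0 1) w" "continuous_on (cball 0 1) w" "\<And>x. x \<in> sphere 0 1 \<Longrightarrow> w x = 0"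
    and C: "C > 0" "\<And>x. x \<in> ball 0 1 \<Longrightarrow> \<bar>L t w x\<bar> \<le> C * bdef x powr (-3/2)" and x: "x \<in> cball 0 1"
  shows "\<bar>w x\<bar> \<le> 8 * C * bdef x powr (1/2)"
proof -
  have "\<bar>w x\<bar> \<le> 2 * (4 * C) * bdef x powr (1/2)"
    by (rule barrier_bound[OF t w bdef_smooth bdef_continuous _ barrier_half[OF t] _ _ _ x])
      (use C in \<open>auto simp: bdef_norm\<close>)
  then show ?thesis by simp
qed

lemma sup_bound_one:
  assumes t: "\<bar>t\<bar> < e" and w: "smooth_on (ball 0 1) w" "continuous_on (cball 0 1) w" "\<And>x. x \<in> sphere 0 1 \<Longrightarrow> w x = 0"
    and C: "C > 0" "\<And>x. x \<in> ball 0 1 \<Longrightarrow> \<bar>L t w x\<bar> \<le> C * bdef x powr (-1/2)" and x: "x \<in> cball 0 1"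
  shows "\<bar>w x\<bar> \<le> 8 * C * bdef x"
proof -
  let ?\<psi> = "\<lambda>x::real^'n. 3 * bdef x - bdef x powr (3/2)"
  have s1: "smooth_on (ball 0 1) (bdef :: real^'n \<Rightarrow> real)"
    unfolding bdef_def[abs_def] by (intro smooth_on_diff smooth_on_const smooth_on_inner smooth_on_ident open_ball)
  have s: "smooth_on (ball 0 1) ?\<psi>"
    by (intro smooth_on_diff smooth_on_cmult s1 bdef_smooth open_ball)
  have co: "continuous_on (cball 0 1) ?\<psi>"
  proof (intro continuous_on_diff bdef_continuous)
    show "continuous_on (cball 0 1) (\<lambda>x::real^'n. 3 * bdef x)"
      unfolding bdef_def by (intro continuous_intros)
  qed simp
  have "\<bar>w x\<bar> \<le> 2 * (4/3 * C) * ?\<psi> x"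
    by (rule barrier_bound[OF t w s co _ barrier_one[OF t] _ _ _ x])
      (use C in \<open>auto simp: bdef_norm\<close>)
  also have "\<dots> \<le> 2 * (4/3 * C) * (3 * bdef x)" using C by (intro mult_left_mono) auto
  finally show ?thesis by simp
qed

section \<open>The image domain and the weighted interior estimate\<close>

lemma closure_image:
  assumes "\<bar>t\<bar> < e"
  shows "closure (\<Phi> t ` ball 0 1) = \<Phi> t ` cball 0 1"
proof
  have co: "continuous_on (cball 0 1) (\<Phi> t)"
    by (rule continuous_on_subset[OF smooth_on_continuous[OF smooth_t[OF assms]] ball12(2)])
  have "closed (\<Phi> t ` cball 0 1)"
    by (rule compact_imp_closed[OF compact_continuous_image[OF co compact_cball]])
  then show "closure (\<Phi> t ` ball 0 1) \<subseteq> \<Phi> t ` cball 0 1"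
    by (intro closure_minimal) (auto intro: imageI)
  have "\<Phi> t ` closure (ball 0 1) \<subseteq> closure (\<Phi> t ` ball 0 1)"
    using co closure_subset[of "\<Phi> t ` ball 0 1"] by (intro image_closure_subset) simp_all
  then show "\<Phi> t ` cball 0 1 \<subseteq> closure (\<Phi> t ` ball 0 1)" by simp
qed

lemma frontier_image:
  assumes "\<bar>t\<bar> < e"
  shows "frontier (\<Phi> t ` ball 0 1) = \<Phi> t ` sphere 0 1"
proof -
  have "frontier (\<Phi> t ` ball 0 1) = \<Phi> t ` cball 0 1 - \<Phi> t ` ball 0 1"
    unfolding frontier_def closure_image[OF assms]
    using interior_open[OF inverse_facts(2)[OF assms ball12(1) open_ball]] by simp
  also have "\<dots> = \<Phi> t ` (cball 0 1 - ball 0 1)"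
    using inj_on_image_set_diff[OF inverse_facts(1)[OF assms order_refl open_ball], of "cball 0 1" "ball 0 1"] ball12
    by auto
  also have "cball 0 1 - ball 0 1 = sphere (0::real^'n) 1" by auto
  finally show ?thesis .
qed

text \<open>A ball reaching outside the image would meet its frontier, which is the image of the
  sphere. But \<open>low\<close> keeps the images of sphere points at distance at least
  \<open>(1 - norm x) / 2\<close>, and this is at least \<open>bdef x / 4\<close>.\<close>

lemma image_contains_ball:
  assumes t: "\<bar>t\<bar> < e" and x: "x \<in> ball 0 1" and z: "norm (z - \<Phi> t x) < bdef x / 4"
  shows "z \<in> \<Phi> t ` ball 0 1"
proof (rule ccontr)
  assume n: "z \<notin> \<Phi> t ` ball 0 1"
  let ?B = "ball (\<Phi> t x) (bdef x / 4)"
  have "\<Phi> t x \<in> ?B \<inter> \<Phi> t ` ball 0 1" using x bdef_ball[OF x] by auto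
  moreover have "z \<in> ?B - \<Phi> t ` ball 0 1" using z n by (auto simp: dist_norm norm_minus_commute)
  ultimately have ne: "?B \<inter> \<Phi> t ` ball 0 1 \<noteq> {}" "?B - \<Phi> t ` ball 0 1 \<noteq> {}" by blast+
  have "?B \<inter> frontier (\<Phi> t ` ball 0 1) \<noteq> {}"
    by (rule connected_Int_frontier[OF convex_connected[OF convex_ball] ne])
  then obtain s where s: "s \<in> sphere 0 1" "norm (\<Phi> t x - \<Phi> t s) < bdef x / 4"
    unfolding frontier_image[OF t] by (auto simp: dist_norm)
  have "1 - norm x \<le> norm (x - s)"
    using norm_triangle_ineq3[of s x] s(1) by (simp add: norm_minus_commute)
  also have "\<dots> \<le> 2 * norm (\<Phi> t x - \<Phi> t s)" by (rule low[OF t]) (use x s in auto)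
  also have "\<dots> < 2 * (bdef x / 4)" using s by simp
  also have "\<dots> \<le> 1 - norm x" using bdef_le[OF x] by simp
  finally show False by simp
qed

text \<open>The gradient estimate is used on a cube around \<open>\<Phi> t x\<close> whose size is
  proportional to \<open>bdef x\<close>. All weights on the cube are comparable to the one at its
  centre, so both terms of \<open>gradient_cube\<close> scale to the same power of
  \<open>bdef\<close>.\<close>

lemma gradient_weighted:
  "\<exists>K>0. \<forall>t w A b x. \<bar>t\<bar> < e \<longrightarrow> smooth_on (ball 0 1) w \<longrightarrow>
     (\<forall>x\<in>ball 0 1. \<bar>w x\<bar> \<le> A * bdef x powr \<gamma>) \<longrightarrow> (\<forall>x\<in>ball 0 1. \<bar>L t w x\<bar> \<le> A * bdef x powr (\<gamma> - 2)) \<longrightarrow>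
     b \<in> Basis \<longrightarrow> x \<in> ball 0 1 \<longrightarrow> \<bar>Y t b w x\<bar> \<le> K * A * bdef x powr (\<gamma> - 1)"
proof -
  define n where "n = real DIM(real^'n)"
  have n: "n \<ge> 1" unfolding n_def by (simp add: DIM_ge_Suc0 Suc_le_eq)
  define K where "K = 16 * n\<^sup>2 * 2 powr \<bar>\<gamma>\<bar> + 2 powr \<bar>\<gamma> - 2\<bar>"
  show ?thesis
  proof (intro exI[of _ K] conjI allI impI)
    show "K > 0" unfolding K_def by (intro add_nonneg_pos) auto
    fix t w A b and x :: "real^'n"
    assume t: "\<bar>t\<bar> < e" and w: "smooth_on (ball 0 1) w" and b: "b \<in> (Basis::(real^'n) set)" and x: "x \<in> ball 0 1"
      and w0: "\<forall>x\<in>ball 0 1. \<bar>w x\<bar> \<le> A * bdef x powr \<gamma>" and Lw: "\<forall>x\<in>ball 0 1. \<bar>L t w x\<bar> \<le> A * bdef x powr (\<gamma> - 2)"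
    let ?O = "\<Phi> t ` ball 0 1"
    note S = open_ball[of "0::real^'n" 1] ball12(1)
    define d where "d = bdef x"
    have d: "0 < d" "d \<le> 1" using bdef_ball[OF x] by (auto simp: d_def)
    have "0 \<le> A * d powr \<gamma>" using order_trans[OF abs_ge_zero bspec[OF w0 x]] unfolding d_def .
    then have A: "A \<ge> 0" using d by (simp add: zero_le_mult_iff)
    obtain u where u: "smooth_on ?O u" "\<And>x. x \<in> ball 0 1 \<Longrightarrow> u (\<Phi> t x) = w x"
      using pullback[OF t S w] by blast
    have Lu: "laplacian u (\<Phi> t x) = L t w x" if "x \<in> ball 0 1" for x
    proof -
      have "L t w x = L t (\<lambda>x. u (\<Phi> t x)) x" by (rule lframe_cong[OF S(1) _ that]) (simp add: u(2))
      also have "\<dots> = laplacian u (\<Phi> t x)" by (rule lframe_compose[OF t S _ smooth_on_Ck[OF u(1)] that]) auto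
      finally show ?thesis by simp
    qed
    have Yu: "Y t b w x = pd b u (\<Phi> t x)"
    proof -
      have "Y t b w x = Y t b (\<lambda>x. u (\<Phi> t x)) x" by (rule dframe_cong[OF S(1) _ x]) (simp add: u(2))
      also have "\<dots> = pd b u (\<Phi> t x)" by (rule dframe_compose[OF t _ smooth_onD[OF u(1)]]) (use x in auto)
      finally show ?thesis .
    qed
    \<comment> \<open>Points of the cube are within \<open>n * r = d / 16\<close> of its centre,
      their preimages within \<open>d / 8\<close> of \<open>x\<close>, and \<open>bdef\<close> then
      changes by at most \<open>d / 4\<close>.\<close>
    define r where "r = d / (16 * n)"
    have r: "r > 0" using d n by (simp add: r_def)
    let ?y = "\<Phi> t x"
    have near: "\<exists>x'\<in>ball 0 1. z = \<Phi> t x' \<and> d / 2 \<le> bdef x' \<and> bdef x' \<le> 2 * d"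
      if z: "z \<in> cbox (?y - r *\<^sub>R One) (?y + r *\<^sub>R One)" for z
    proof -
      have "norm (z - ?y) \<le> n * r" unfolding n_def by (rule cbox_One_subset_ball[OF z])
      also have "n * r = d / 16" using n by (simp add: r_def)
      finally have nz: "norm (z - ?y) \<le> d / 16" .
      then have "norm (z - ?y) < bdef x / 4" using d by (simp add: d_def)
      from image_contains_ball[OF t x this] obtain x' where x': "x' \<in> ball 0 1" "z = \<Phi> t x'" by blast
      have "norm (x' - x) \<le> 2 * norm (\<Phi> t x' - \<Phi> t x)" by (rule low[OF t]) (use x x' in auto)
      also have "\<dots> \<le> d / 8" using nz x' by simp
      finally have "2 * norm (x' - x) \<le> d / 4" by simp
      moreover have "\<bar>bdef x' - d\<bar> \<le> 2 * norm (x' - x)" unfolding d_def by (rule bdef_diff) (use x x' in auto)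
      ultimately have "\<bar>bdef x' - d\<bar> \<le> d / 4" by (rule order_trans[rotated])
      then have "bdef x' - d \<le> d / 4 \<and> d - bdef x' \<le> d / 4"
        unfolding abs_le_iff minus_diff_eq .
      then have "d / 2 \<le> bdef x'" "bdef x' \<le> 2 * d" using d by argo+
      then show ?thesis using x' by blast
    qed
    have Q: "cbox (?y - r *\<^sub>R One) (?y + r *\<^sub>R One) \<subseteq> ?O" using near by blast
    have pc: "A * bdef x' powr q \<le> A * (2 powr \<bar>q\<bar> * d powr q)" if "d / 2 \<le> bdef x'" "bdef x' \<le> 2 * d" for x' :: "real^'n" and q
      using powr_comparable[OF d(1) that] A by (intro mult_left_mono) auto
    have "\<bar>pd b u ?y\<bar> \<le> DIM(real^'n) / r * (A * (2 powr \<bar>\<gamma>\<bar> * d powr \<gamma>)) + r / 2 * (A * (2 powr \<bar>\<gamma> - 2\<bar> * d powr (\<gamma> - 2)))"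
    proof (rule gradient_cube[OF inverse_facts(2)[OF t S(2,1)] smooth_on_Ck[OF u(1)] b r Q])
      fix z assume "z \<in> cbox (?y - r *\<^sub>R One) (?y + r *\<^sub>R One)"
      then obtain x' where x': "x' \<in> ball 0 1" "z = \<Phi> t x'" "d / 2 \<le> bdef x'" "bdef x' \<le> 2 * d" using near by blast
      show "\<bar>u z\<bar> \<le> A * (2 powr \<bar>\<gamma>\<bar> * d powr \<gamma>)"
        using w0 x' u(2) pc[OF x'(3,4)] order_trans by metis
      show "\<bar>laplacian u z\<bar> \<le> A * (2 powr \<bar>\<gamma> - 2\<bar> * d powr (\<gamma> - 2))"
        using Lw x' Lu pc[OF x'(3,4)] order_trans by metis
    qed
    also have "DIM(real^'n) / r * (A * (2 powr \<bar>\<gamma>\<bar> * d powr \<gamma>)) = 16 * n\<^sup>2 * 2 powr \<bar>\<gamma>\<bar> * A * (d powr \<gamma> / d)"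
      using n by (simp add: r_def n_def power2_eq_square field_simps)
    also have "d powr \<gamma> / d = d powr (\<gamma> - 1)" using d by (simp add: powr_diff)
    also have "r / 2 * (A * (2 powr \<bar>\<gamma> - 2\<bar> * d powr (\<gamma> - 2))) = (1 / (32 * n)) * (2 powr \<bar>\<gamma> - 2\<bar> * A * (d * d powr (\<gamma> - 2)))"
      using n by (simp add: r_def)
    also have "d * d powr (\<gamma> - 2) = d powr (\<gamma> - 1)" using d powr_add[of d 1 "\<gamma> - 2"] by simp
    also have "(1 / (32 * n)) * (2 powr \<bar>\<gamma> - 2\<bar> * A * d powr (\<gamma> - 1)) \<le> 1 * (2 powr \<bar>\<gamma> - 2\<bar> * A * d powr (\<gamma> - 1))"
      using n A by (intro mult_right_mono) auto
    finally show "\<bar>Y t b w x\<bar> \<le> K * A * bdef x powr (\<gamma> - 1)"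
      unfolding Yu K_def d_def by (simp add: algebra_simps)
  qed
qed

lemma interval_abs: "\<bar>t\<bar> \<le> \<delta> \<Longrightarrow> t \<in> {-\<delta>..\<delta>}"
  unfolding atLeastAtMost_iff by linarith

lemma wbounded_dframe:
  assumes t: "\<And>i. i \<in> I \<Longrightarrow> \<bar>t i\<bar> \<le> \<delta>" and w: "\<And>i. i \<in> I \<Longrightarrow> smooth_on (ball 0 1) (w i)"
    and b: "wbounded (Suc m) \<gamma> I w"
  shows "wbounded m (\<gamma> - 1) I (\<lambda>i. Y (t i) b (w i))"
proof -
  have co: "wsmooth 0 I (\<lambda>i x. c (t i) b x \<bullet> j)" for j
    by (rule wsmooth_reindex[OF frame_coeff]) (rule interval_abs[OF t])
  have "wbounded m (0 + (\<gamma> - 1)) I (\<lambda>i x. (c (t i) b x \<bullet> j) * pd j (w i) x)" if "j \<in> Basis" for j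
    by (rule wbounded_mult[OF wsmoothD(1)[OF co] smooth_on_pd[OF w] wsmoothD(2)[OF co]])
      (use b that in \<open>auto simp: wbounded_Suc\<close>)
  then have "wbounded m (\<gamma> - 1) I (\<lambda>i x. \<Sum>j\<in>Basis. (c (t i) b x \<bullet> j) * pd j (w i) x)"
    by (intro wbounded_sum finite_Basis smooth_on_mult open_ball wsmoothD(1)[OF co] smooth_on_pd w) auto
  moreover have "Y (t i) b (w i) x = (\<Sum>j\<in>Basis. (c (t i) b x \<bullet> j) * pd j (w i) x)" if "i \<in> I" "x \<in> ball 0 1" for i x
    using dframe_expand[OF smooth_onD[OF w[OF that(1)] that(2)]] .
  ultimately show ?thesis
    using wbounded_cong[of I "\<lambda>i. Y (t i) b (w i)" "\<lambda>i x. \<Sum>j\<in>Basis. (c (t i) b x \<bullet> j) * pd j (w i) x"] by blast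
qed

lemma wsmooth_dframe:
  assumes t: "\<And>i. i \<in> I \<Longrightarrow> \<bar>t i\<bar> \<le> \<delta>" and w: "wsmooth \<gamma> I w"
  shows "wsmooth (\<gamma> - 1) I (\<lambda>i. Y (t i) b (w i))"
proof (rule wsmoothI)
  show "smooth_on (ball 0 1) (Y (t i) b (w i))" if "i \<in> I" for i
    by (rule dframe_smooth[OF abs_interval[OF t[OF that]] open_ball ball12(1) wsmoothD(1)[OF w that]])
  show "wbounded m (\<gamma> - 1) I (\<lambda>i. Y (t i) b (w i))" for m
    by (rule wbounded_dframe[OF t wsmoothD(1)[OF w] wsmoothD(2)[OF w]])
qed

text \<open>Induction on the order: after one gradient bound the frame derivatives satisfy the same
  hypotheses with the exponent lowered by one, because they commute with the operator.\<close>

lemma wbounded_interior: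
  assumes t: "\<And>i. i \<in> I \<Longrightarrow> \<bar>t i\<bar> \<le> \<delta>" and w: "\<And>i. i \<in> I \<Longrightarrow> smooth_on (ball 0 1) (w i)"
    and b: "wbounded 0 \<gamma> I w" and L: "wbounded m (\<gamma> - 2) I (\<lambda>i. L (t i) (w i))"
  shows "wbounded m \<gamma> I w"
  using w b L
proof (induction m arbitrary: \<gamma> w)
  case 0
  then show ?case by simp
next
  case (Suc m)
  have te: "\<bar>t i\<bar> < e" if "i \<in> I" for i using abs_interval[OF t[OF that]] .
  have Y0: "wbounded 0 (\<gamma> - 1) I (\<lambda>i. Y (t i) k (w i))" if k: "k \<in> Basis" for k
  proof -
    obtain C1 where C1: "C1 > 0" "\<And>i x. i \<in> I \<Longrightarrow> x \<in> ball 0 1 \<Longrightarrow> \<bar>w i x\<bar> \<le> C1 * bdef x powr \<gamma>"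
      using wbounded0E[OF Suc.prems(2)] by blast
    obtain C2 where C2: "C2 > 0" "\<And>i x. i \<in> I \<Longrightarrow> x \<in> ball 0 1 \<Longrightarrow> \<bar>L (t i) (w i) x\<bar> \<le> C2 * bdef x powr (\<gamma> - 2)"
      using wbounded0E[OF wbounded_0[OF Suc.prems(3)]] by blast
    define A where "A = max C1 C2"
    obtain K where K: "K > 0" "\<And>t w A b x. \<bar>t\<bar> < e \<Longrightarrow> smooth_on (ball 0 1) w \<Longrightarrow>
     (\<forall>x\<in>ball 0 1. \<bar>w x\<bar> \<le> A * bdef x powr \<gamma>) \<Longrightarrow> (\<forall>x\<in>ball 0 1. \<bar>L t w x\<bar> \<le> A * bdef x powr (\<gamma> - 2)) \<Longrightarrow>
     b \<in> Basis \<Longrightarrow> x \<in> ball 0 1 \<Longrightarrow> \<bar>Y t b w x\<bar> \<le> K * A * bdef x powr (\<gamma> - 1)"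
      using gradient_weighted[of \<gamma>] by blast
    have CA: "C1 * p \<le> A * p" "C2 * p \<le> A * p" if "p \<ge> 0" for p
      using that by (auto simp: A_def intro: mult_right_mono)
    have "\<bar>Y (t i) k (w i) x\<bar> \<le> K * A * bdef x powr (\<gamma> - 1)" if "i \<in> I" "x \<in> ball 0 1" for i x
    proof (rule K(2)[OF te[OF that(1)] Suc.prems(1)[OF that(1)] _ _ k that(2)])
      show "\<forall>x\<in>ball 0 1. \<bar>w i x\<bar> \<le> A * bdef x powr \<gamma>"
        using C1(2)[OF that(1)] CA(1) order_trans powr_ge_zero by meson
      show "\<forall>x\<in>ball 0 1. \<bar>L (t i) (w i) x\<bar> \<le> A * bdef x powr (\<gamma> - 2)"
        using C2(2)[OF that(1)] CA(2) order_trans powr_ge_zero by meson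
    qed
    then show ?thesis by (rule wbounded0I)
  qed
  have Ys: "smooth_on (ball 0 1) (Y (t i) k (w i))" if "i \<in> I" for i k
    by (rule dframe_smooth[OF te[OF that] open_ball ball12(1) Suc.prems(1)[OF that]])
  have Ls: "smooth_on (ball 0 1) (L (t i) (w i))" if "i \<in> I" for i
    by (rule lframe_smooth[OF te[OF that] open_ball ball12(1) Suc.prems(1)[OF that]])
  have Ym: "wbounded m (\<gamma> - 1) I (\<lambda>i. Y (t i) k (w i))" if k: "k \<in> Basis" for k
  proof (rule Suc.IH[OF Ys Y0[OF k]])
    have "wbounded m (\<gamma> - 2 - 1) I (\<lambda>i. Y (t i) k (L (t i) (w i)))"
      by (rule wbounded_dframe[OF t Ls Suc.prems(3)])
    moreover have "L (t i) (Y (t i) k (w i)) x = Y (t i) k (L (t i) (w i)) x" if "i \<in> I" "x \<in> ball 0 1" for i x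
      by (rule lframe_dframe_commute[OF te[OF that(1)] Suc.prems(1)[OF that(1)] that(2)])
    ultimately show "wbounded m (\<gamma> - 1 - 2) I (\<lambda>i. L (t i) (Y (t i) k (w i)))"
      using wbounded_cong[of I "\<lambda>i. L (t i) (Y (t i) k (w i))" "\<lambda>i. Y (t i) k (L (t i) (w i))" m "\<gamma> - 2 - 1"]
      by (simp add: algebra_simps)
  qed
  \<comment> \<open>Back from frame derivatives to coordinate derivatives; the coefficients have
    weight 0 and cost nothing.\<close>
  have "wbounded m (\<gamma> - 1) I (\<lambda>i. pd b (w i))" for b
  proof -
    have co: "wsmooth 0 I (\<lambda>i x. pd b (\<Phi> (t i)) x \<bullet> k)" for k
      by (rule wsmooth_reindex[OF grad_coeff]) (rule interval_abs[OF t])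
    have "wbounded m (0 + (\<gamma> - 1)) I (\<lambda>i x. (pd b (\<Phi> (t i)) x \<bullet> k) * Y (t i) k (w i) x)" if "k \<in> Basis" for k
      by (rule wbounded_mult[OF wsmoothD(1)[OF co] Ys wsmoothD(2)[OF co] Ym[OF that]])
    then have "wbounded m (\<gamma> - 1) I (\<lambda>i x. \<Sum>k\<in>Basis. (pd b (\<Phi> (t i)) x \<bullet> k) * Y (t i) k (w i) x)"
      by (intro wbounded_sum finite_Basis smooth_on_mult open_ball wsmoothD(1)[OF co] Ys) auto
    moreover have "pd b (w i) x = (\<Sum>k\<in>Basis. (pd b (\<Phi> (t i)) x \<bullet> k) * Y (t i) k (w i) x)" if "i \<in> I" "x \<in> ball 0 1" for i x
      by (rule pd_by_frame[OF te[OF that(1)] _ smooth_onD[OF Suc.prems(1)[OF that(1)] that(2)]]) (use that in auto)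
    ultimately show ?thesis
      using wbounded_cong[of I "\<lambda>i. pd b (w i)" "\<lambda>i x. \<Sum>k\<in>Basis. (pd b (\<Phi> (t i)) x \<bullet> k) * Y (t i) k (w i) x"] by blast
  qed
  then show ?case unfolding wbounded_Suc using Suc.prems(2) by blast
qed

text \<open>The exponents -3/2 and 1/2 differ by the order of the operator. The barrier
  \<open>bdef x powr (1/2)\<close> gives the size of the solution, and
  \<open>wbounded_interior\<close> turns it into bounds on all derivatives.\<close>

lemma wsmooth_dirichlet:
  assumes t: "\<And>i. i \<in> I \<Longrightarrow> \<bar>t i\<bar> \<le> \<delta>" and w: "\<And>i. i \<in> I \<Longrightarrow> smooth_on (ball 0 1) (w i)"
    "\<And>i. i \<in> I \<Longrightarrow> continuous_on (cball 0 1) (w i)" "\<And>i x. i \<in> I \<Longrightarrow> x \<in> sphere 0 1 \<Longrightarrow> w i x = 0"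
    and L: "wsmooth (- 3/2) I (\<lambda>i. L (t i) (w i))"
  shows "wsmooth (1/2) I w"
proof (rule wsmoothI[OF w(1)], assumption)
  fix m
  obtain C where C: "C > 0" "\<And>i x. i \<in> I \<Longrightarrow> x \<in> ball 0 1 \<Longrightarrow> \<bar>L (t i) (w i) x\<bar> \<le> C * bdef x powr (-3/2)"
    using wsmoothE[OF L] by blast
  have "\<bar>w i x\<bar> \<le> 8 * C * bdef x powr (1/2)" if "i \<in> I" "x \<in> ball 0 1" for i x
    by (rule sup_bound_half[OF abs_interval[OF t] w C(1) C(2)]) (use that in auto)
  then have w0: "wbounded 0 (1/2) I w" by (rule wbounded0I)
  show "wbounded m (1/2) I w"
    by (rule wbounded_interior[OF t w(1) w0]) (use wsmoothD(2)[OF L, of m] in simp_all)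
qed

lemma lframe_expand:
  assumes t: "\<bar>t\<bar> < e" and S: "open S" "S \<subseteq> ball 0 2" and w: "smooth_on S w" and x: "x \<in> S"
  shows "L t w x = (\<Sum>b\<in>Basis. \<Sum>l\<in>Basis. (\<Sum>j\<in>Basis. (c t b x \<bullet> l) * (c t b x \<bullet> j) * pd j (pd l w) x)
           + Y t b (\<lambda>x. c t b x \<bullet> l) x * pd l w x)"
proof -
  have "Y t b (Y t b w) x = (\<Sum>l\<in>Basis. (\<Sum>j\<in>Basis. (c t b x \<bullet> l) * (c t b x \<bullet> j) * pd j (pd l w) x)
           + Y t b (\<lambda>x. c t b x \<bullet> l) x * pd l w x)" for b
  proof -
    have dc: "(\<lambda>x. c t b x \<bullet> l) differentiable (at x)" for l
      by (rule smooth_onD[OF _ x]) (intro smooth_on_inner smooth_on_const S smooth_on_subset[OF frame_smooth_t[OF t]])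
    have dp: "pd l w differentiable (at x)" for l by (rule smooth_onD[OF smooth_on_pd[OF w] x])
    have "Y t b (Y t b w) x = Y t b (\<lambda>x. \<Sum>l\<in>Basis. (c t b x \<bullet> l) * pd l w x) x"
      by (rule dframe_cong[OF S(1) _ x]) (rule dframe_expand[OF smooth_onD[OF w]])
    also have "\<dots> = (\<Sum>l\<in>Basis. Y t b (\<lambda>x. (c t b x \<bullet> l) * pd l w x) x)"
      unfolding dframe_def by (rule pd_sum) (intro differentiable_mult dc dp)
    also have "\<dots> = (\<Sum>l\<in>Basis. (c t b x \<bullet> l) * Y t b (pd l w) x + Y t b (\<lambda>x. c t b x \<bullet> l) x * pd l w x)"
      unfolding dframe_def by (simp add: pd_mult[OF dc dp])
    also have "\<dots> = (\<Sum>l\<in>Basis. (\<Sum>j\<in>Basis. (c t b x \<bullet> l) * (c t b x \<bullet> j) * pd j (pd l w) x)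
           + Y t b (\<lambda>x. c t b x \<bullet> l) x * pd l w x)"
      by (simp add: dframe_expand[OF dp] sum_distrib_left mult.assoc)
    finally show ?thesis .
  qed
  then show ?thesis by (simp add: lframe_def)
qed

end

section \<open>Differentiation in a parameter\<close>

lemma wsmooth_pd_dir:
  assumes w: "wsmooth \<gamma> I w"
  shows "wsmooth (\<gamma> - 1) I (\<lambda>i. pd v (w i))"
proof -
  have "wsmooth (\<gamma> - 1) I (\<lambda>i x. \<Sum>b\<in>Basis. (v \<bullet> b) * pd b (w i) x)"
    by (intro wsmooth_sum finite_Basis wsmooth_cmult[of I "\<lambda>_. v \<bullet> b" "\<bar>v \<bullet> b\<bar>" for b] wsmooth_pd w) auto
  moreover have "pd v (w i) x = (\<Sum>b\<in>Basis. (v \<bullet> b) * pd b (w i) x)" if "i \<in> I" "x \<in> ball 0 1" for i x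
    using pd_expand[OF smooth_onD[OF wsmoothD(1)[OF w that(1)] that(2)], of v] by simp
  ultimately show ?thesis
    using wsmooth_cong[of I "\<lambda>i. pd v (w i)" "\<lambda>i x. \<Sum>b\<in>Basis. (v \<bullet> b) * pd b (w i) x"] by blast
qed

text \<open>A pair consists of a time and a nonzero increment.  The second difference quotient \<open>tdiff\<close> being
  bounded says that \<open>w'\<close> is the derivative of \<open>w\<close> in time, with a quadratic remainder.\<close>

definition tpairs :: "real \<Rightarrow> (real \<times> real) set" where
  "tpairs \<delta> = {p. \<bar>fst p\<bar> < \<delta> \<and> \<bar>fst p + snd p\<bar> < \<delta> \<and> snd p \<noteq> 0}"

definition tquot :: "(real \<Rightarrow> 'a \<Rightarrow> real) \<Rightarrow> real \<times> real \<Rightarrow> 'a \<Rightarrow> real" where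
  "tquot w p x = (w (fst p + snd p) x - w (fst p) x) / snd p"

definition tdiff :: "(real \<Rightarrow> 'a \<Rightarrow> real) \<Rightarrow> (real \<Rightarrow> 'a \<Rightarrow> real) \<Rightarrow> real \<times> real \<Rightarrow> 'a \<Rightarrow> real" where
  "tdiff w w' p x = (w (fst p + snd p) x - w (fst p) x - snd p * w' (fst p) x) / (snd p)\<^sup>2"

text \<open>Differentiability in time is expressed by remainders bounded over all pairs of times
  instead of by limits, so that it is itself a \<open>wsmooth\<close> statement and inherits the
  calculus of weights. All time derivatives carry the same exponent: unlike space derivatives they
  cost no power of the distance.\<close>

primrec tsmooth :: "nat \<Rightarrow> real \<Rightarrow> real \<Rightarrow> (real \<Rightarrow> 'a::euclidean_space \<Rightarrow> real) \<Rightarrow> bool" where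
  "tsmooth 0 \<delta> \<gamma> w \<longleftrightarrow> wsmooth \<gamma> {-\<delta><..<\<delta>} w"
| "tsmooth (Suc k) \<delta> \<gamma> w \<longleftrightarrow> wsmooth \<gamma> {-\<delta><..<\<delta>} w \<and>
     (\<exists>w'. tsmooth k \<delta> \<gamma> w' \<and> wsmooth \<gamma> (tpairs \<delta>) (tdiff w w'))"

declare tsmooth.simps [simp del]

lemma tpairsD: "p \<in> tpairs \<delta> \<Longrightarrow> \<bar>fst p\<bar> < \<delta>" "p \<in> tpairs \<delta> \<Longrightarrow> \<bar>fst p + snd p\<bar> < \<delta>"
  "p \<in> tpairs \<delta> \<Longrightarrow> snd p \<noteq> 0" "p \<in> tpairs \<delta> \<Longrightarrow> \<bar>snd p\<bar> \<le> 2 * \<delta>"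
  by (auto simp: tpairs_def)

lemma tsmooth_wsmooth: "tsmooth k \<delta> \<gamma> w \<Longrightarrow> wsmooth \<gamma> {-\<delta><..<\<delta>} w"
  by (cases k) (auto simp: tsmooth.simps)

lemma tsmoothI: "wsmooth \<gamma> {-\<delta><..<\<delta>} w \<Longrightarrow> tsmooth k \<delta> \<gamma> w' \<Longrightarrow> wsmooth \<gamma> (tpairs \<delta>) (tdiff w w') \<Longrightarrow> tsmooth (Suc k) \<delta> \<gamma> w"
  by (auto simp: tsmooth.simps)

lemma tsmoothE:
  assumes "tsmooth (Suc k) \<delta> \<gamma> w"
  obtains w' where "tsmooth k \<delta> \<gamma> w'" "wsmooth \<gamma> (tpairs \<delta>) (tdiff w w')"
  using assms by (auto simp: tsmooth.simps)

lemma tsmooth_SucD: "tsmooth (Suc k) \<delta> \<gamma> w \<Longrightarrow> tsmooth k \<delta> \<gamma> w"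
proof (induction k arbitrary: w)
  case 0
  then show ?case by (simp add: tsmooth.simps)
next
  case (Suc k)
  from Suc.prems obtain w' where "tsmooth (Suc k) \<delta> \<gamma> w'" "wsmooth \<gamma> (tpairs \<delta>) (tdiff w w')"
    by (rule tsmoothE)
  then show ?case using tsmoothI[OF tsmooth_wsmooth[OF Suc.prems]] Suc.IH by blast
qed

lemma wsmooth_at:
  assumes "wsmooth \<gamma> {-\<delta><..<\<delta>} w"
  shows "wsmooth \<gamma> (tpairs \<delta>) (\<lambda>p. w (fst p))" "wsmooth \<gamma> (tpairs \<delta>) (\<lambda>p. w (fst p + snd p))"
  by (rule wsmooth_reindex[OF assms]; auto simp: tpairs_def abs_less_iff)+

lemma tquot_tdiff: "snd p \<noteq> 0 \<Longrightarrow> tquot w p x = snd p * tdiff w w' p x + w' (fst p) x"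
  by (simp add: tquot_def tdiff_def field_simps power2_eq_square)

lemma wsmooth_snd: "wsmooth \<gamma> (tpairs \<delta>) w \<Longrightarrow> wsmooth \<gamma> (tpairs \<delta>) (\<lambda>p x. snd p * w p x)"
  by (rule wsmooth_cmult[OF tpairsD(4)])

lemma wsmooth_tquot:
  assumes "wsmooth \<gamma> (tpairs \<delta>) (tdiff w w')" "wsmooth \<gamma> {-\<delta><..<\<delta>} w'"
  shows "wsmooth \<gamma> (tpairs \<delta>) (tquot w)"
proof -
  have "wsmooth \<gamma> (tpairs \<delta>) (\<lambda>p x. snd p * tdiff w w' p x + w' (fst p) x)"
    by (intro wsmooth_add wsmooth_snd assms(1) wsmooth_at(1) assms(2))
  moreover have "tquot w p x = snd p * tdiff w w' p x + w' (fst p) x" if "p \<in> tpairs \<delta>" for p x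
    by (rule tquot_tdiff[OF tpairsD(3)[OF that]])
  ultimately show ?thesis
    using wsmooth_cong[of "tpairs \<delta>" "tquot w" "\<lambda>p x. snd p * tdiff w w' p x + w' (fst p) x" \<gamma>] by blast
qed

lemma tsmooth_cong:
  assumes "\<And>t x. \<bar>t\<bar> < \<delta> \<Longrightarrow> x \<in> ball 0 1 \<Longrightarrow> w t x = v t x"
  shows "tsmooth k \<delta> \<gamma> w \<longleftrightarrow> tsmooth k \<delta> \<gamma> v"
proof -
  have 1: "wsmooth \<gamma> {-\<delta><..<\<delta>} w \<longleftrightarrow> wsmooth \<gamma> {-\<delta><..<\<delta>} v"
    by (rule wsmooth_cong) (use assms in \<open>auto simp: abs_less_iff\<close>)
  have "wsmooth \<gamma> (tpairs \<delta>) (tdiff w w') \<longleftrightarrow> wsmooth \<gamma> (tpairs \<delta>) (tdiff v w')" for w'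
    by (rule wsmooth_cong) (use assms tpairsD(1,2) in \<open>auto simp: tdiff_def\<close>)
  then show ?thesis by (cases k) (auto simp: tsmooth.simps 1)
qed

lemma tsmooth_weaken: "\<gamma>' \<le> \<gamma> \<Longrightarrow> tsmooth k \<delta> \<gamma> w \<Longrightarrow> tsmooth k \<delta> \<gamma>' w"
proof (induction k arbitrary: w)
  case 0
  then show ?case using wsmooth_weaken by (auto simp: tsmooth.simps)
next
  case (Suc k)
  from Suc.prems(2) obtain w' where w': "tsmooth k \<delta> \<gamma> w'" "wsmooth \<gamma> (tpairs \<delta>) (tdiff w w')" by (elim tsmoothE)
  show ?case
    by (rule tsmoothI[OF wsmooth_weaken[OF tsmooth_wsmooth[OF Suc.prems(2)] Suc.prems(1)] Suc.IH[OF Suc.prems(1) w'(1)]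
          wsmooth_weaken[OF w'(2) Suc.prems(1)]])
qed

lemma tsmooth_add: "tsmooth k \<delta> \<gamma> w \<Longrightarrow> tsmooth k \<delta> \<gamma> v \<Longrightarrow> tsmooth k \<delta> \<gamma> (\<lambda>t x. w t x + v t x)"
proof (induction k arbitrary: w v)
  case 0
  then show ?case using wsmooth_add by (auto simp: tsmooth.simps)
next
  case (Suc k)
  from Suc.prems(1) obtain w' where w': "tsmooth k \<delta> \<gamma> w'" "wsmooth \<gamma> (tpairs \<delta>) (tdiff w w')" by (elim tsmoothE)
  from Suc.prems(2) obtain v' where v': "tsmooth k \<delta> \<gamma> v'" "wsmooth \<gamma> (tpairs \<delta>) (tdiff v v')" by (elim tsmoothE)
  have eq: "tdiff (\<lambda>t x. w t x + v t x) (\<lambda>t x. w' t x + v' t x) = (\<lambda>p x. tdiff w w' p x + tdiff v v' p x)"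
    by (auto simp: fun_eq_iff tdiff_def add_divide_distrib[symmetric] algebra_simps)
  show ?case
    by (rule tsmoothI[OF wsmooth_add[OF tsmooth_wsmooth[OF Suc.prems(1)] tsmooth_wsmooth[OF Suc.prems(2)]]
          Suc.IH[OF w'(1) v'(1)]]) (unfold eq, rule wsmooth_add[OF w'(2) v'(2)])
qed

lemma tsmooth_mult: "tsmooth k \<delta> \<gamma> w \<Longrightarrow> tsmooth k \<delta> \<gamma>' v \<Longrightarrow> tsmooth k \<delta> (\<gamma> + \<gamma>') (\<lambda>t x. w t x * v t x)"
proof (induction k arbitrary: w v)
  case 0
  then show ?case using wsmooth_mult by (auto simp: tsmooth.simps)
next
  case (Suc k)
  from Suc.prems(1) obtain w' where w': "tsmooth k \<delta> \<gamma> w'" "wsmooth \<gamma> (tpairs \<delta>) (tdiff w w')" by (elim tsmoothE)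
  from Suc.prems(2) obtain v' where v': "tsmooth k \<delta> \<gamma>' v'" "wsmooth \<gamma>' (tpairs \<delta>) (tdiff v v')" by (elim tsmoothE)
  let ?d = "\<lambda>t x. w t x * v' t x + w' t x * v t x"
  \<comment> \<open>The remainder of a product, telescoped: the remainder of \<open>v\<close> with
    \<open>w\<close> at the later time, the change of \<open>w\<close> against \<open>v'\<close>,
    and the remainder of \<open>w\<close> against \<open>v\<close> at the base time.\<close>
  let ?r = "\<lambda>p x. w (fst p + snd p) x * tdiff v v' p x + tquot w p x * v' (fst p) x + tdiff w w' p x * v (fst p) x"
  note ww = tsmooth_wsmooth[OF Suc.prems(1)] and wv = tsmooth_wsmooth[OF Suc.prems(2)]
  have eq: "tdiff (\<lambda>t x. w t x * v t x) ?d p x = ?r p x" if "p \<in> tpairs \<delta>" for p x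
    using tpairsD(3)[OF that] by (simp add: tdiff_def tquot_def field_simps power2_eq_square)
  have "wsmooth (\<gamma> + \<gamma>') (tpairs \<delta>) ?r"
    by (intro wsmooth_add wsmooth_mult wsmooth_at ww wv w'(2) v'(2) wsmooth_tquot[OF w'(2)] tsmooth_wsmooth[OF w'(1)]
        tsmooth_wsmooth[OF v'(1)])
  then have "wsmooth (\<gamma> + \<gamma>') (tpairs \<delta>) (tdiff (\<lambda>t x. w t x * v t x) ?d)"
    using wsmooth_cong[of "tpairs \<delta>" "tdiff (\<lambda>t x. w t x * v t x) ?d" ?r] eq by blast
  then show ?case
    by (rule tsmoothI[OF wsmooth_mult[OF ww wv], rotated])
      (intro tsmooth_add Suc.IH w'(1) v'(1) tsmooth_SucD[OF Suc.prems(1)] tsmooth_SucD[OF Suc.prems(2)])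
qed

lemma pd_tdiff:
  assumes "\<And>t. \<bar>t\<bar> < \<delta> \<Longrightarrow> w t differentiable (at x)" "\<And>t. \<bar>t\<bar> < \<delta> \<Longrightarrow> w' t differentiable (at x)" "p \<in> tpairs \<delta>"
  shows "pd v (tdiff w w' p) x = tdiff (\<lambda>t. pd v (w t)) (\<lambda>t. pd v (w' t)) p x"
proof -
  note d = assms(1)[OF tpairsD(1)[OF assms(3)]] assms(1)[OF tpairsD(2)[OF assms(3)]] assms(2)[OF tpairsD(1)[OF assms(3)]]
  let ?h = "snd p"
  have "((\<lambda>x. (w (fst p + ?h) x - w (fst p) x - ?h * w' (fst p) x) / ?h\<^sup>2) has_derivative
     (\<lambda>v. (pd v (w (fst p + ?h)) x - pd v (w (fst p)) x - ?h * pd v (w' (fst p)) x) / ?h\<^sup>2)) (at x)"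
    unfolding divide_inverse
    by (intro has_derivative_mult_left has_derivative_diff has_derivative_mult_right has_derivative_pd d)
  then show ?thesis unfolding tdiff_def[abs_def] by (rule pd_eq)
qed

lemma tsmooth_pd: "tsmooth k \<delta> \<gamma> w \<Longrightarrow> tsmooth k \<delta> (\<gamma> - 1) (\<lambda>t. pd v (w t))"
proof (induction k arbitrary: w)
  case 0
  then show ?case using wsmooth_pd_dir by (auto simp: tsmooth.simps)
next
  case (Suc k)
  from Suc.prems(1) obtain w' where w': "tsmooth k \<delta> \<gamma> w'" "wsmooth \<gamma> (tpairs \<delta>) (tdiff w w')" by (elim tsmoothE)
  have "tdiff (\<lambda>t. pd v (w t)) (\<lambda>t. pd v (w' t)) p x = pd v (tdiff w w' p) x" if "p \<in> tpairs \<delta>" "x \<in> ball 0 1" for p x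
    by (rule pd_tdiff[symmetric, OF _ _ that(1)])
      (use smooth_onD[OF wsmoothD(1)[OF tsmooth_wsmooth[OF Suc.prems]]] smooth_onD[OF wsmoothD(1)[OF tsmooth_wsmooth[OF w'(1)]]] that
        in \<open>auto simp: abs_less_iff\<close>)
  then have "wsmooth (\<gamma> - 1) (tpairs \<delta>) (tdiff (\<lambda>t. pd v (w t)) (\<lambda>t. pd v (w' t)))"
    using wsmooth_cong[of "tpairs \<delta>" "tdiff (\<lambda>t. pd v (w t)) (\<lambda>t. pd v (w' t))" "\<lambda>p. pd v (tdiff w w' p)"]
      wsmooth_pd_dir[OF w'(2)] by blast
  then show ?case using tsmoothI[OF wsmooth_pd_dir[OF tsmooth_wsmooth[OF Suc.prems]] Suc.IH[OF w'(1)]] by blast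
qed

lemma tsmooth_static: "wsmooth \<gamma> {-\<delta><..<\<delta>} (\<lambda>t. w) \<Longrightarrow> tsmooth k \<delta> \<gamma> (\<lambda>t. w)"
proof (induction k arbitrary: w)
  case 0
  then show ?case by (simp add: tsmooth.simps)
next
  case (Suc k)
  have "tdiff (\<lambda>t. w) (\<lambda>t x. 0) = (\<lambda>p x. 0)" by (simp add: tdiff_def fun_eq_iff)
  then show ?case using tsmoothI[OF Suc.prems(1) Suc.IH[OF wsmooth_zero]] wsmooth_zero by metis
qed

lemma tsmooth_constant: "tsmooth k \<delta> 0 (\<lambda>t x. r)"
  by (rule tsmooth_static) (rule wsmooth_constant[of _ "\<lambda>_. r" "\<bar>r\<bar>"], simp)

lemma tsmooth_cmult: "tsmooth k \<delta> \<gamma> w \<Longrightarrow> tsmooth k \<delta> \<gamma> (\<lambda>t x. r * w t x)"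
  using tsmooth_mult[OF tsmooth_constant, of k \<delta> \<gamma> w r] by simp

lemma tsmooth_diff: "tsmooth k \<delta> \<gamma> w \<Longrightarrow> tsmooth k \<delta> \<gamma> v \<Longrightarrow> tsmooth k \<delta> \<gamma> (\<lambda>t x. w t x - v t x)"
  using tsmooth_add[of k \<delta> \<gamma> w "\<lambda>t x. - 1 * v t x"] tsmooth_cmult[of k \<delta> \<gamma> v "- 1"] by simp

lemma tsmooth_sum:
  "finite A \<Longrightarrow> (\<And>a. a \<in> A \<Longrightarrow> tsmooth k \<delta> \<gamma> (w a)) \<Longrightarrow> tsmooth k \<delta> \<gamma> (\<lambda>t x. \<Sum>a\<in>A. w a t x)"
  by (induction A rule: finite_induct) (auto intro!: tsmooth_add tsmooth_static[OF wsmooth_zero])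

section \<open>Time remainders of smooth coefficients\<close>

lemma taylor_remainder_bound:
  fixes \<phi> :: "real \<Rightarrow> real"
  assumes d1: "\<And>s. s \<in> closed_segment t (t + h) \<Longrightarrow> (\<phi> has_real_derivative \<phi>' s) (at s)"
    and d2: "\<And>s. s \<in> closed_segment t (t + h) \<Longrightarrow> (\<phi>' has_real_derivative \<phi>'' s) (at s)"
    and M: "\<And>s. s \<in> closed_segment t (t + h) \<Longrightarrow> \<bar>\<phi>'' s\<bar> \<le> M"
  shows "\<bar>\<phi> (t + h) - \<phi> t - h * \<phi>' t\<bar> \<le> M * h\<^sup>2"
proof -
  let ?S = "closed_segment t (t + h)"
  have M0: "M \<ge> 0" using M[of t] by force
  have b: "\<bar>\<phi>' s - \<phi>' t\<bar> \<le> M * \<bar>h\<bar>" if s: "s \<in> ?S" for s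
  proof -
    have "norm (\<phi>' s - \<phi>' t) \<le> M * norm (s - t)"
      by (rule field_differentiable_bound[of ?S \<phi>' \<phi>''])
        (use s d2 M in \<open>auto intro: has_field_derivative_at_within\<close>)
    also have "\<dots> \<le> M * \<bar>h\<bar>"
      using s M0 by (intro mult_left_mono) (auto simp: closed_segment_eq_real_ivl split: if_splits)
    finally show ?thesis by simp
  qed
  let ?\<psi> = "\<lambda>s. \<phi> s - s * \<phi>' t"
  have d\<psi>: "(?\<psi> has_real_derivative \<phi>' s - \<phi>' t) (at s within ?S)" if "s \<in> ?S" for s
    by (rule has_field_derivative_at_within) (rule derivative_eq_intros d1[OF that] refl | simp)+
  have "norm (?\<psi> (t + h) - ?\<psi> t) \<le> (M * \<bar>h\<bar>) * norm (t + h - t)"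
    by (rule field_differentiable_bound[OF convex_closed_segment d\<psi>]) (use b in auto)
  then show ?thesis by (simp add: algebra_simps power2_eq_square)
qed

text \<open>Space derivatives commute with the formation of the time remainder, so the induction
  replaces \<open>a\<close> by one of its space derivatives. The base case is Taylor's bound with
  the second time derivative, which is bounded by compactness.\<close>

lemma wsmooth_tdiff_param:
  fixes a :: "real \<times> 'a::euclidean_space \<Rightarrow> real"
  assumes a: "smooth_on ({-e<..<e} \<times> U) a" and U: "open U" "cball 0 1 \<subseteq> U" and \<delta>: "\<delta> < e"
  shows "wsmooth 0 (tpairs \<delta>) (tdiff (\<lambda>t x. a (t, x)) (\<lambda>t x. pd (1, 0) a (t, x)))"
proof (rule wsmoothI)
  let ?I = "{-e<..<e}"
  have O: "open (?I \<times> U)" by (intro open_Times U) auto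
  have BU: "ball 0 1 \<subseteq> U" using U(2) ball_subset_cball by blast
  have sl: "smooth_on (ball 0 1) (\<lambda>x. a (t, x))" if "smooth_on (?I \<times> U) a" "\<bar>t\<bar> < \<delta>" for a :: "real \<times> 'a \<Rightarrow> real" and t
    by (rule smooth_on_subset[OF smooth_on_slice[OF that(1) _ U(1)] BU]) (use that \<delta> in auto)
  show "smooth_on (ball 0 1) (tdiff (\<lambda>t x. a (t, x)) (\<lambda>t x. pd (1, 0) a (t, x)) p)" if p: "p \<in> tpairs \<delta>" for p
    unfolding tdiff_def divide_inverse
    by (intro smooth_on_mult smooth_on_diff smooth_on_const sl a smooth_on_pd tpairsD[OF p] open_ball)
  show "wbounded m 0 (tpairs \<delta>) (tdiff (\<lambda>t x. a (t, x)) (\<lambda>t x. pd (1, 0) a (t, x)))" for m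
    using a
  proof (induction m arbitrary: a)
    have z: "wbounded 0 0 (tpairs \<delta>) (tdiff (\<lambda>t x. a (t, x)) (\<lambda>t x. pd (1, 0) a (t, x)))"
      if a: "smooth_on (?I \<times> U) a" for a :: "real \<times> 'a \<Rightarrow> real"
    proof -
      let ?a2 = "pd (1, 0) (pd (1, 0) a)"
      have "compact ({-\<delta>..\<delta>} \<times> cball (0::'a) 1)" by (intro compact_Times) auto
      moreover have "continuous_on ({-\<delta>..\<delta>} \<times> cball 0 1) ?a2"
        by (rule continuous_on_subset[OF smooth_on_continuous[OF smooth_on_pd[OF smooth_on_pd[OF a]]]]) (use \<delta> U in auto)
      ultimately have "bounded (?a2 ` ({-\<delta>..\<delta>} \<times> cball 0 1))"
        using compact_continuous_image compact_imp_bounded by blast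
      then obtain C where C: "\<And>t x. t \<in> {-\<delta>..\<delta>} \<Longrightarrow> x \<in> cball 0 1 \<Longrightarrow> \<bar>?a2 (t, x)\<bar> \<le> C"
        unfolding bounded_iff by fastforce
      have "\<bar>tdiff (\<lambda>t x. a (t, x)) (\<lambda>t x. pd (1, 0) a (t, x)) p x\<bar> \<le> C * bdef x powr 0"
        if p: "p \<in> tpairs \<delta>" and x: "x \<in> ball 0 1" for p x
      proof -
        have der: "((\<lambda>t. g (t, x)) has_real_derivative pd (1, 0) g (s, x)) (at s)"
          if g: "smooth_on (?I \<times> U) g" and s: "\<bar>s\<bar> < \<delta>" for g :: "real \<times> 'a \<Rightarrow> real" and s
        proof -
          have d: "g differentiable (at (s, x))" by (rule smooth_onD[OF g]) (use s \<delta> x BU in auto)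
          have "((\<lambda>t. (t, x)) has_derivative (\<lambda>v. (v, 0))) (at s)" by (auto intro!: derivative_eq_intros)
          from has_derivative_compose[OF this, of g] has_derivative_pd[OF d]
          have "((\<lambda>t. g (t, x)) has_derivative (\<lambda>k. pd (k, 0) g (s, x))) (at s)" by blast
          moreover have "(\<lambda>k. pd (k, 0) g (s, x)) = (*) (pd (1, 0) g (s, x))"
          proof
            fix k :: real
            have "pd (k *\<^sub>R (1, 0)) g (s, x) = k *\<^sub>R pd (1, 0) g (s, x)"
              by (rule linear.scaleR[OF pd_linear[OF d]])
            then show "pd (k, 0) g (s, x) = pd (1, 0) g (s, x) * k" by simp
          qed
          ultimately show ?thesis unfolding has_field_derivative_def by (simp only:)
        qed
        have seg: "\<bar>s\<bar> < \<delta>" if "s \<in> closed_segment (fst p) (fst p + snd p)" for s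
          using that tpairsD(1,2)[OF p] by (auto simp: closed_segment_eq_real_ivl split: if_splits)
        have C2: "\<bar>?a2 (s, x)\<bar> \<le> C" if "s \<in> closed_segment (fst p) (fst p + snd p)" for s
        proof (rule C)
          show "s \<in> {-\<delta>..\<delta>}" using seg[OF that] unfolding atLeastAtMost_iff by linarith
        qed (use x in auto)
        have "\<bar>a (fst p + snd p, x) - a (fst p, x) - snd p * pd (1, 0) a (fst p, x)\<bar> \<le> C * (snd p)\<^sup>2"
          by (rule taylor_remainder_bound[where \<phi>="\<lambda>t. a (t, x)" and \<phi>'="\<lambda>t. pd (1, 0) a (t, x)" and \<phi>''="\<lambda>t. ?a2 (t, x)"])
            (intro der a smooth_on_pd seg C2; assumption)+
        then show ?thesis
          using tpairsD(3)[OF p] bdef_norm(1)[of x] x by (simp add: tdiff_def divide_le_eq)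
      qed
      then show ?thesis by (rule wbounded0I)
    qed
    case 0
    then show ?case by (rule z)
    case (Suc m)
    have "wbounded m (0 - 1) (tpairs \<delta>) (\<lambda>p. pd b (tdiff (\<lambda>t x. a (t, x)) (\<lambda>t x. pd (1, 0) a (t, x)) p))" for b
    proof -
      let ?b = "pd (0, b) a"
      have "wbounded m 0 (tpairs \<delta>) (tdiff (\<lambda>t x. ?b (t, x)) (\<lambda>t x. pd (1, 0) ?b (t, x)))"
        by (rule Suc.IH[OF smooth_on_pd[OF Suc.prems]])
      then have "wbounded m (0 - 1) (tpairs \<delta>) (tdiff (\<lambda>t x. ?b (t, x)) (\<lambda>t x. pd (1, 0) ?b (t, x)))"
        by (rule wbounded_weaken[rotated]) simp
      moreover have "pd b (tdiff (\<lambda>t x. a (t, x)) (\<lambda>t x. pd (1, 0) a (t, x)) p) x = tdiff (\<lambda>t x. ?b (t, x)) (\<lambda>t x. pd (1, 0) ?b (t, x)) p x"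
        if p: "p \<in> tpairs \<delta>" and x: "x \<in> ball 0 1" for p x
      proof -
        have inU: "(t, x) \<in> ?I \<times> U" if "\<bar>t\<bar> < \<delta>" for t using that \<delta> x BU by auto
        have "pd b (tdiff (\<lambda>t x. a (t, x)) (\<lambda>t x. pd (1, 0) a (t, x)) p) x
          = tdiff (\<lambda>t. pd b (\<lambda>x. a (t, x))) (\<lambda>t. pd b (\<lambda>x. pd (1, 0) a (t, x))) p x"
          by (rule pd_tdiff[OF _ _ p]) (rule smooth_onD[OF sl x], use Suc.prems smooth_on_pd in auto)+
        also have "\<dots> = tdiff (\<lambda>t x. ?b (t, x)) (\<lambda>t x. pd (1, 0) ?b (t, x)) p x"
          using pd_slice(1)[OF smooth_onD[OF Suc.prems inU]] pd_slice(1)[OF smooth_onD[OF smooth_on_pd[OF Suc.prems] inU]]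
            pd_commute[OF smooth_on_Ck[OF Suc.prems] O inU] tpairsD(1,2)[OF p]
          by (simp add: tdiff_def)
        finally show ?thesis .
      qed
      ultimately show ?thesis
        using wbounded_cong[of "tpairs \<delta>" "\<lambda>p. pd b (tdiff (\<lambda>t x. a (t, x)) (\<lambda>t x. pd (1, 0) a (t, x)) p)"
            "tdiff (\<lambda>t x. ?b (t, x)) (\<lambda>t x. pd (1, 0) ?b (t, x))"] by blast
    qed
    then show ?case unfolding wbounded_Suc using z[OF Suc.prems] by blast
  qed
qed

lemma wsmooth_param_interval:
  fixes a :: "real \<times> 'a::euclidean_space \<Rightarrow> real"
  assumes a: "smooth_on ({-e<..<e} \<times> U) a" and U: "open U" "cball 0 1 \<subseteq> U" and \<delta>: "\<delta> < e"
  shows "wsmooth 0 {-\<delta><..<\<delta>} (\<lambda>t x. a (t, x))"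
  by (rule wsmooth_reindex[OF wsmooth_param[OF a open_greaterThanLessThan _ _ U, of "{-\<delta>..\<delta>}"]]) (use \<delta> in auto)

lemma tsmooth_param:
  fixes a :: "real \<times> 'a::euclidean_space \<Rightarrow> real"
  assumes a: "smooth_on ({-e<..<e} \<times> U) a" and U: "open U" "cball 0 1 \<subseteq> U" and \<delta>: "\<delta> < e"
  shows "tsmooth k \<delta> 0 (\<lambda>t x. a (t, x))"
  using a
proof (induction k arbitrary: a)
  case 0
  then show ?case using wsmooth_param_interval[OF _ U \<delta>] by (simp add: tsmooth.simps)
next
  case (Suc k)
  show ?case
    by (rule tsmoothI[OF wsmooth_param_interval[OF Suc.prems U \<delta>] Suc.IH[OF smooth_on_pd[OF Suc.prems]]
          wsmooth_tdiff_param[OF Suc.prems U \<delta>]])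
qed

section \<open>Limits of difference quotients\<close>

lemma rate_limit:
  fixes s :: "nat \<Rightarrow> real"
  assumes "\<And>n m. \<bar>s n - s m\<bar> \<le> K * (inverse (real (Suc n)) + inverse (real (Suc m)))"
  shows "convergent s" and "s \<longlonglongrightarrow> l \<Longrightarrow> \<bar>s n - l\<bar> \<le> K * inverse (real (Suc n))"
proof -
  have K: "K \<ge> 0" using assms[of 0 0] by simp
  have lim: "(\<lambda>m. K * inverse (real (Suc m))) \<longlonglongrightarrow> 0"
    using tendsto_mult_right_zero[OF LIMSEQ_inverse_real_of_nat] .
  have "Cauchy s"
  proof (rule metric_CauchyI)
    fix e :: real assume "e > 0"
    then have "\<forall>\<^sub>F m in sequentially. K * inverse (real (Suc m)) < e / 2"
      by (intro order_tendstoD(2)[OF lim]) simp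
    then obtain N where N: "\<And>m. m \<ge> N \<Longrightarrow> K * inverse (real (Suc m)) < e / 2"
      unfolding eventually_sequentially by blast
    have "dist (s m) (s n) < e" if "m \<ge> N" "n \<ge> N" for m n
      using assms[of m n] N[OF that(1)] N[OF that(2)] unfolding dist_real_def distrib_left by argo
    then show "\<exists>M. \<forall>m\<ge>M. \<forall>n\<ge>M. dist (s m) (s n) < e" by blast
  qed
  then show "convergent s" by (rule Cauchy_convergent)
  assume l: "s \<longlonglongrightarrow> l"
  have "(\<lambda>m. \<bar>s n - s m\<bar>) \<longlonglongrightarrow> \<bar>s n - l\<bar>" by (intro tendsto_intros l)
  moreover have "(\<lambda>m. K * (inverse (real (Suc n)) + inverse (real (Suc m)))) \<longlonglongrightarrow> K * (inverse (real (Suc n)) + 0)"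
    by (intro tendsto_intros LIMSEQ_inverse_real_of_nat)
  ultimately show "\<bar>s n - l\<bar> \<le> K * inverse (real (Suc n))"
    using LIMSEQ_le[of "\<lambda>m. \<bar>s n - s m\<bar>" "\<bar>s n - l\<bar>"] assms by fastforce
qed

text \<open>Convergence with a rate, so that it passes to all derivatives.\<close>

definition dconv :: "(nat \<Rightarrow> 'a::euclidean_space \<Rightarrow> real) \<Rightarrow> ('a \<Rightarrow> real) \<Rightarrow> bool" where
  "dconv q g \<longleftrightarrow> (\<forall>n. smooth_on (ball 0 1) (q n)) \<and>
    (\<exists>\<gamma>. wsmooth \<gamma> UNIV (\<lambda>p x. (q (fst p) x - q (snd p) x) /
        (inverse (real (Suc (fst p))) + inverse (real (Suc (snd p)))))) \<and>
    (\<forall>x\<in>ball 0 1. (\<lambda>n. q n x) \<longlonglongrightarrow> g x)"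

text \<open>The weighted bound covers the derivatives as well, so these are Cauchy at the same rate,
  uniformly on compact parts of the open ball. The exponent drops by one, which is why
  \<open>dconv\<close> leaves it existential.\<close>

lemma dconv_pd:
  fixes q :: "nat \<Rightarrow> 'a::euclidean_space \<Rightarrow> real"
  assumes "dconv q g"
  shows "x \<in> ball 0 1 \<Longrightarrow> g differentiable (at x)" and "dconv (\<lambda>n. pd v (q n)) (pd v g)"
proof -
  define D where "D = (\<lambda>n m. inverse (real (Suc n)) + inverse (real (Suc m)))"
  have D: "D n m > 0" for n m by (simp add: D_def add_pos_pos)
  have sm: "smooth_on (ball 0 1) (q n)" for n using assms by (simp add: dconv_def)
  note sd = smooth_onD[OF sm]
  obtain \<gamma> where \<gamma>: "wsmooth \<gamma> UNIV (\<lambda>p x. (q (fst p) x - q (snd p) x) / D (fst p) (snd p))"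
    using assms by (auto simp: dconv_def D_def)
  have lim: "\<And>x. x \<in> ball 0 1 \<Longrightarrow> (\<lambda>n. q n x) \<longlonglongrightarrow> g x" using assms by (simp add: dconv_def)
  have W: "wsmooth (\<gamma> - 1) UNIV (\<lambda>p x. (pd v (q (fst p)) x - pd v (q (snd p)) x) / D (fst p) (snd p))" for v
  proof -
    have "pd v (\<lambda>x. (q (fst p) x - q (snd p) x) / D (fst p) (snd p)) x = (pd v (q (fst p)) x - pd v (q (snd p)) x) / D (fst p) (snd p)"
      if "x \<in> ball 0 1" for p x
      unfolding divide_inverse
      by (rule pd_eq[OF has_derivative_mult_left[OF has_derivative_diff[OF has_derivative_pd has_derivative_pd]]])
        (rule sd[OF that])+
    then show ?thesis
      using wsmooth_cong[of UNIV "\<lambda>p. pd v (\<lambda>x. (q (fst p) x - q (snd p) x) / D (fst p) (snd p))"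
          "\<lambda>p x. (pd v (q (fst p)) x - pd v (q (snd p)) x) / D (fst p) (snd p)" "\<gamma> - 1"] wsmooth_pd_dir[OF \<gamma>, of v] by blast
  qed
  have "\<exists>C>0. \<forall>n m. \<forall>x\<in>ball 0 1. \<bar>pd v (q n) x - pd v (q m) x\<bar> \<le> C * bdef x powr (\<gamma> - 1) * D n m" for v
  proof -
    obtain C where C: "C > 0" "\<And>p x. p \<in> UNIV \<Longrightarrow> x \<in> ball 0 1 \<Longrightarrow> \<bar>(pd v (q (fst p)) x - pd v (q (snd p)) x) / D (fst p) (snd p)\<bar> \<le> C * bdef x powr (\<gamma> - 1)"
      by (rule wsmoothE[OF W[of v]]) blast
    have "\<bar>pd v (q n) x - pd v (q m) x\<bar> \<le> C * bdef x powr (\<gamma> - 1) * D n m" if "x \<in> ball 0 1" for n m x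
      using C(2)[OF UNIV_I that, of "(n, m)"] D[of n m] by (simp add: abs_divide divide_le_eq)
    then show ?thesis using C(1) by blast
  qed
  then obtain C where C: "\<And>v. C v > 0"
    "\<And>v n m x. x \<in> ball 0 1 \<Longrightarrow> \<bar>pd v (q n) x - pd v (q m) x\<bar> \<le> C v * bdef x powr (\<gamma> - 1) * D n m"
    by metis
  define G where "G = (\<lambda>v x. lim (\<lambda>n. pd v (q n) x))"
  have G: "(\<lambda>n. pd v (q n) x) \<longlonglongrightarrow> G v x" if x: "x \<in> ball 0 1" for v x
    using rate_limit(1)[of "\<lambda>n. pd v (q n) x", OF C(2)[OF x, unfolded D_def]] by (simp add: G_def convergent_LIMSEQ_iff)
  have Grate: "\<bar>pd v (q n) x - G v x\<bar> \<le> C v * bdef x powr (\<gamma> - 1) * inverse (real (Suc n))" if x: "x \<in> ball 0 1" for v x n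
    by (rule rate_limit(2)[OF C(2)[OF x, unfolded D_def] G[OF x]])
  have der: "(g has_derivative (\<lambda>h. \<Sum>b\<in>Basis. (h \<bullet> b) * G b x)) (at x)" if x0: "x \<in> ball 0 1" for x
  proof -
    \<comment> \<open>On a small closed ball inside the open one the weight is bounded, which turns
      the pointwise rate into a uniform limit.\<close>
    obtain \<rho> where \<rho>: "\<rho> > 0" "cball x \<rho> \<subseteq> ball 0 1" using x0 open_contains_cball open_ball by blast
    have "continuous_on (cball x \<rho>) (\<lambda>x. bdef x powr (\<gamma> - 1))"
      by (rule continuous_on_subset[OF smooth_on_continuous[OF bdef_smooth] \<rho>(2)])
    then have "bounded ((\<lambda>x. bdef x powr (\<gamma> - 1)) ` cball x \<rho>)"
      using compact_continuous_image compact_imp_bounded compact_cball by blast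
    then obtain M where M: "\<And>y. y \<in> cball x \<rho> \<Longrightarrow> bdef y powr (\<gamma> - 1) \<le> M"
      unfolding bounded_iff by (metis (no_types, lifting) image_eqI order_trans abs_ge_self real_norm_def)
    have "uniform_limit (ball x \<rho>) (\<lambda>n. pd b (q n)) (G b) sequentially" for b
    proof (rule uniform_limitI)
      fix e :: real assume e: "e > 0"
      have "(\<lambda>n. C b * M * inverse (real (Suc n))) \<longlonglongrightarrow> 0"
        using tendsto_mult_right_zero[OF LIMSEQ_inverse_real_of_nat] .
      then have "\<forall>\<^sub>F n in sequentially. C b * M * inverse (real (Suc n)) < e"
        by (rule order_tendstoD(2)[OF _ e])
      then show "\<forall>\<^sub>F n in sequentially. \<forall>y\<in>ball x \<rho>. dist (pd b (q n) y) (G b y) < e"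
      proof (rule eventually_mono, intro ballI)
        fix n y assume n: "C b * M * inverse (real (Suc n)) < e" and y: "y \<in> ball x \<rho>"
        have yB: "y \<in> ball 0 1" using y \<rho>(2) ball_subset_cball by blast
        have "\<bar>pd b (q n) y - G b y\<bar> \<le> C b * bdef y powr (\<gamma> - 1) * inverse (real (Suc n))" by (rule Grate[OF yB])
        also have "\<dots> \<le> C b * M * inverse (real (Suc n))"
          using M[of y] y C(1)[of b] by (intro mult_right_mono mult_left_mono) (auto simp: less_imp_le)
        finally show "dist (pd b (q n) y) (G b y) < e" using n by (simp add: dist_real_def)
      qed
    qed
    moreover have "y \<in> ball 0 1" if "y \<in> ball x \<rho>" for y using that \<rho>(2) ball_subset_cball by blast
    ultimately show ?thesis
      by (intro has_derivative_uniform_limit[OF open_ball convex_ball, of x \<rho> q]) (use \<rho>(1) in \<open>auto intro: sd lim\<close>)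
  qed
  show "g differentiable (at x)" if "x \<in> ball 0 1" for x using der[OF that] differentiable_def by blast
  have "(\<lambda>n. pd v (q n) x) \<longlonglongrightarrow> pd v g x" if x: "x \<in> ball 0 1" for x
  proof -
    have "(\<lambda>n. \<Sum>b\<in>Basis. (v \<bullet> b) * pd b (q n) x) \<longlonglongrightarrow> (\<Sum>b\<in>Basis. (v \<bullet> b) * G b x)"
      by (intro tendsto_intros G[OF x])
    moreover have "(\<Sum>b\<in>Basis. (v \<bullet> b) * pd b (q n) x) = pd v (q n) x" for n
      using pd_expand[OF sd[OF x], of v] by simp
    ultimately show ?thesis using pd_eq[OF der[OF x]] by simp
  qed
  then show "dconv (\<lambda>n. pd v (q n)) (pd v g)"
    unfolding dconv_def using W[of v] smooth_on_pd[OF sm] unfolding D_def by blast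
qed

lemma dconv_smooth: "dconv q g \<Longrightarrow> smooth_on (ball 0 1) g"
  by (rule smooth_on_coinduct[where P="\<lambda>g. \<exists>q. dconv q g", OF open_ball]) (use dconv_pd in blast)+

text \<open>A bound with one constant passes to pointwise limits, and by \<open>dconv_pd\<close>
  every derivative is such a limit.\<close>

lemma wbounded_limit:
  assumes "\<And>i. i \<in> I \<Longrightarrow> dconv (r i) (g i)" "wbounded m \<gamma> (I \<times> UNIV) (\<lambda>p. r (fst p) (snd p))"
  shows "wbounded m \<gamma> I g"
proof -
  have z: "wbounded 0 \<gamma> I g" if dc: "\<And>i. i \<in> I \<Longrightarrow> dconv (r i) (g i)" and wb: "wbounded 0 \<gamma> (I \<times> UNIV) (\<lambda>p. r (fst p) (snd p))" for \<gamma> r g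
  proof -
    obtain C where C: "C > 0" "\<And>p x. p \<in> I \<times> UNIV \<Longrightarrow> x \<in> ball 0 1 \<Longrightarrow> \<bar>r (fst p) (snd p) x\<bar> \<le> C * bdef x powr \<gamma>"
      using wbounded0E[OF wb] by blast
    have "\<bar>g i x\<bar> \<le> C * bdef x powr \<gamma>" if i: "i \<in> I" and x: "x \<in> ball 0 1" for i x
    proof (rule LIMSEQ_le_const2)
      show "(\<lambda>n. \<bar>r i n x\<bar>) \<longlonglongrightarrow> \<bar>g i x\<bar>"
        using dc[OF i] x by (intro tendsto_rabs) (simp add: dconv_def)
      show "\<exists>N. \<forall>n\<ge>N. \<bar>r i n x\<bar> \<le> C * bdef x powr \<gamma>" using C(2)[of "(i, _)" x] i x by auto
    qed
    then show ?thesis by (rule wbounded0I)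
  qed
  show ?thesis
    using assms
  proof (induction m arbitrary: \<gamma> r g)
    case 0
    then show ?case using z by blast
  next
  case (Suc m)
  have "wbounded m (\<gamma> - 1) I (\<lambda>i. pd b (g i))" if "b \<in> Basis" for b
    by (rule Suc.IH[of "\<lambda>i n. pd b (r i n)"]) (use dconv_pd(2) Suc.prems that in \<open>auto simp: wbounded_Suc\<close>)
  then show ?case unfolding wbounded_Suc using z[OF Suc.prems(1) wbounded_0[OF Suc.prems(2)]] by blast
  qed
qed

definition ttriples :: "real \<Rightarrow> (real \<times> real \<times> real) set" where
  "ttriples \<delta> = {z. (fst z, fst (snd z)) \<in> tpairs \<delta> \<and> (fst z, snd (snd z)) \<in> tpairs \<delta>}"

text \<open>The denominator is the sum of the sizes of the increments, not their difference:
  boundedness is a Cauchy condition with linear rate as both increments shrink.\<close>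

definition tcauchy :: "(real \<times> real \<Rightarrow> 'a \<Rightarrow> real) \<Rightarrow> real \<times> real \<times> real \<Rightarrow> 'a \<Rightarrow> real" where
  "tcauchy q z x = (q (fst z, fst (snd z)) x - q (fst z, snd (snd z)) x) / (\<bar>fst (snd z)\<bar> + \<bar>snd (snd z)\<bar>)"

text \<open>The limit at zero increment is taken along sequences \<open>r * \<epsilon> n\<close>.
  The Cauchy bound makes it independent of \<open>r\<close>, so the sequence can be adapted to the
  pair under consideration, and letting the second increment of \<open>tcauchy\<close> tend to zero
  bounds the remainder divided by the first.\<close>

lemma tquot_limit:
  fixes q :: "real \<times> real \<Rightarrow> 'a::euclidean_space \<Rightarrow> real"
  assumes sm: "\<And>p. p \<in> tpairs \<delta> \<Longrightarrow> smooth_on (ball 0 1) (q p)"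
    and W: "wsmooth \<gamma> (ttriples \<delta>) (tcauchy q)"
  shows "\<exists>w'. (\<forall>t. \<bar>t\<bar> < \<delta> \<longrightarrow> smooth_on (ball 0 1) (w' t)) \<and>
     wsmooth \<gamma> (tpairs \<delta>) (\<lambda>p x. (q p x - w' (fst p) x) / snd p)"
proof -
  define \<epsilon> where "\<epsilon> = (\<lambda>n. inverse (real (Suc n)))"
  have \<epsilon>: "0 < \<epsilon> n" "\<epsilon> n \<le> 1" for n by (auto simp: \<epsilon>_def inverse_le_1_iff)
  have \<epsilon>0: "\<epsilon> \<longlonglongrightarrow> 0" unfolding \<epsilon>_def by (rule LIMSEQ_inverse_real_of_nat)
  \<comment> \<open>Small enough to stay in the time interval, and at most the increment of the
    pair, so that \<open>\<bar>snd p\<bar> + \<sigma> p\<close> is at most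
    \<open>2 * \<bar>snd p\<bar>\<close>.\<close>
  define \<sigma> where "\<sigma> = (\<lambda>p. min \<bar>snd p\<bar> (\<delta> - \<bar>fst p\<bar>) / 2)"
  have \<sigma>: "0 < \<sigma> p" "\<sigma> p \<le> \<bar>snd p\<bar>" "\<sigma> p < \<delta> - \<bar>fst p\<bar>" if "p \<in> tpairs \<delta>" for p
    using tpairsD(1,3)[OF that] unfolding \<sigma>_def by (auto simp: min_def)
  have in1: "(t, r * \<epsilon> n) \<in> tpairs \<delta>" if r: "0 < r" "r < \<delta> - \<bar>t\<bar>" for t r n
  proof -
    have "r * \<epsilon> n \<le> r * 1" using r \<epsilon>[of n] by (intro mult_left_mono) auto
    moreover have "0 < r * \<epsilon> n" using r \<epsilon>[of n] by simp
    ultimately have "\<bar>t\<bar> < \<delta>" "\<bar>t + r * \<epsilon> n\<bar> < \<delta>" "r * \<epsilon> n \<noteq> 0" using r by linarith+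
    then show ?thesis unfolding tpairs_def by auto
  qed
  obtain C where C: "C > 0" "\<And>z x. z \<in> ttriples \<delta> \<Longrightarrow> x \<in> ball 0 1 \<Longrightarrow> \<bar>tcauchy q z x\<bar> \<le> C * bdef x powr \<gamma>"
    using wsmoothE[OF W] by blast
  have Cq: "\<bar>q (t, h) x - q (t, k) x\<bar> \<le> C * bdef x powr \<gamma> * (\<bar>h\<bar> + \<bar>k\<bar>)"
    if "(t, h) \<in> tpairs \<delta>" "(t, k) \<in> tpairs \<delta>" "x \<in> ball 0 1" for t h k x
  proof -
    have "\<bar>h\<bar> + \<bar>k\<bar> > 0" using tpairsD(3)[OF that(1)] by simp
    then show ?thesis using C(2)[of "(t, h, k)" x] that by (simp add: ttriples_def tcauchy_def abs_divide divide_le_eq)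
  qed
  have ex: "\<exists>l. \<forall>r. 0 < r \<longrightarrow> r < \<delta> - \<bar>t\<bar> \<longrightarrow> (\<lambda>n. q (t, r * \<epsilon> n) x) \<longlonglongrightarrow> l"
    if x: "x \<in> ball 0 1" for t x
  proof (cases "\<bar>t\<bar> < \<delta>")
    case True
    define r0 where "r0 = (\<delta> - \<bar>t\<bar>) / 2"
    have r0: "0 < r0" "r0 < \<delta> - \<bar>t\<bar>" using True by (auto simp: r0_def)
    let ?K = "C * bdef x powr \<gamma>"
    have "\<bar>q (t, r0 * \<epsilon> n) x - q (t, r0 * \<epsilon> m) x\<bar> \<le> ?K * r0 * (inverse (real (Suc n)) + inverse (real (Suc m)))" for n m
      using Cq[OF in1[OF r0, of n] in1[OF r0, of m] x] r0 \<epsilon>[of n] \<epsilon>[of m]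
      by (simp add: abs_mult abs_of_pos \<epsilon>_def algebra_simps)
    from rate_limit(1)[of "\<lambda>n. q (t, r0 * \<epsilon> n) x", OF this]
    obtain l where l: "(\<lambda>n. q (t, r0 * \<epsilon> n) x) \<longlonglongrightarrow> l" by (auto simp: convergent_def)
    have "(\<lambda>n. q (t, r * \<epsilon> n) x) \<longlonglongrightarrow> l" if r: "0 < r" "r < \<delta> - \<bar>t\<bar>" for r
    proof -
      have "(\<lambda>n. q (t, r * \<epsilon> n) x - q (t, r0 * \<epsilon> n) x) \<longlonglongrightarrow> 0"
      proof (rule Lim_null_comparison)
        show "\<forall>\<^sub>F n in sequentially. norm (q (t, r * \<epsilon> n) x - q (t, r0 * \<epsilon> n) x) \<le> ?K * (r + r0) * \<epsilon> n"
        proof (intro always_eventually allI)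
          fix n
          show "norm (q (t, r * \<epsilon> n) x - q (t, r0 * \<epsilon> n) x) \<le> ?K * (r + r0) * \<epsilon> n"
            using Cq[OF in1[OF r, of n] in1[OF r0, of n] x] r r0 \<epsilon>[of n]
            by (simp add: abs_mult abs_of_pos algebra_simps)
        qed
        show "(\<lambda>n. ?K * (r + r0) * \<epsilon> n) \<longlonglongrightarrow> 0" using tendsto_mult_right_zero[OF \<epsilon>0] .
      qed
      from tendsto_add[OF this l] show ?thesis by simp
    qed
    then show ?thesis by blast
  qed auto
  \<comment> \<open>Meaningful only inside the ball and for times below \<open>\<delta>\<close>. The
    condition ranges over all admissible \<open>r\<close>, so that one limit serves every pair with
    the same base time.\<close>
  define w' where "w' = (\<lambda>t x. SOME l. \<forall>r. 0 < r \<longrightarrow> r < \<delta> - \<bar>t\<bar> \<longrightarrow> (\<lambda>n. q (t, r * \<epsilon> n) x) \<longlonglongrightarrow> l)"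
  have w': "(\<lambda>n. q (t, r * \<epsilon> n) x) \<longlonglongrightarrow> w' t x" if "x \<in> ball 0 1" "0 < r" "r < \<delta> - \<bar>t\<bar>" for t x r
    using someI_ex[OF ex[OF that(1), of t]] that unfolding w'_def by blast
  let ?r = "\<lambda>p n x. (q p x - q (fst p, \<sigma> p * \<epsilon> n) x) / snd p"
  let ?g = "\<lambda>p x. (q p x - w' (fst p) x) / snd p"
  have dc: "dconv (?r p) (?g p)" if p: "p \<in> tpairs \<delta>" for p
    unfolding dconv_def
  proof (intro conjI allI exI ballI)
    note sp = in1[OF \<sigma>(1,3)[OF p]]
    show "smooth_on (ball 0 1) (?r p n)" for n
      unfolding divide_inverse
      by (intro smooth_on_mult smooth_on_diff smooth_on_const sm p sp open_ball)
    show "(\<lambda>n. ?r p n x) \<longlonglongrightarrow> ?g p x" if "x \<in> ball 0 1" for x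
      by (intro tendsto_intros w'[OF that \<sigma>(1,3)[OF p]]) (rule tpairsD(3)[OF p])
    have "wsmooth \<gamma> UNIV (\<lambda>nm x. (- \<sigma> p / snd p) * tcauchy q (fst p, \<sigma> p * \<epsilon> (fst nm), \<sigma> p * \<epsilon> (snd nm)) x)"
      by (rule wsmooth_cmult[OF _ wsmooth_reindex[OF W]]) (use sp in \<open>auto simp: ttriples_def\<close>)
    moreover have "(?r p (fst nm) x - ?r p (snd nm) x) / (inverse (real (Suc (fst nm))) + inverse (real (Suc (snd nm))))
       = (- \<sigma> p / snd p) * tcauchy q (fst p, \<sigma> p * \<epsilon> (fst nm), \<sigma> p * \<epsilon> (snd nm)) x" for nm x
    proof -
      have pos: "\<epsilon> (fst nm) + \<epsilon> (snd nm) \<noteq> 0" "snd p \<noteq> 0" "\<sigma> p \<noteq> 0" "\<sigma> p > 0"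
        using \<epsilon>(1)[of "fst nm"] \<epsilon>(1)[of "snd nm"] tpairsD(3)[OF p] \<sigma>(1)[OF p] by auto
      have a: "\<bar>\<sigma> p * \<epsilon> (fst nm)\<bar> + \<bar>\<sigma> p * \<epsilon> (snd nm)\<bar> = \<sigma> p * (\<epsilon> (fst nm) + \<epsilon> (snd nm))"
        using \<epsilon>(1)[of "fst nm"] \<epsilon>(1)[of "snd nm"] pos by (simp add: abs_mult distrib_left)
      have alg: "((P - c) / h - (P - d) / h) / E = (- s / h) * ((c - d) / (s * E))" if "h \<noteq> 0" "E \<noteq> 0" "s \<noteq> 0"
        for P c d h E s :: real
        using that by (simp add: field_simps)
      show ?thesis
        unfolding tcauchy_def fst_conv snd_conv a using alg[OF pos(2,1,3)] by (simp add: \<epsilon>_def)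
    qed
    ultimately show "wsmooth \<gamma> UNIV (\<lambda>nm x. (?r p (fst nm) x - ?r p (snd nm) x) / (inverse (real (Suc (fst nm))) + inverse (real (Suc (snd nm)))))"
      by simp
  qed
  have W2: "wsmooth \<gamma> (tpairs \<delta> \<times> UNIV) (\<lambda>pn. ?r (fst pn) (snd pn))"
  proof -
    let ?k = "\<lambda>pn. (\<bar>snd (fst pn)\<bar> + \<bar>\<sigma> (fst pn) * \<epsilon> (snd pn)\<bar>) / snd (fst pn)"
    have "wsmooth \<gamma> (tpairs \<delta> \<times> (UNIV::nat set)) (\<lambda>pn x. ?k pn * tcauchy q (fst (fst pn), snd (fst pn), \<sigma> (fst pn) * \<epsilon> (snd pn)) x)"
    proof (rule wsmooth_cmult[OF _ wsmooth_reindex[OF W]])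
      fix pn :: "(real \<times> real) \<times> nat" assume pn: "pn \<in> tpairs \<delta> \<times> UNIV"
      then have p: "fst pn \<in> tpairs \<delta>" by auto
      have "\<sigma> (fst pn) * \<epsilon> (snd pn) \<le> \<bar>snd (fst pn)\<bar> * 1"
        using \<sigma>[OF p] \<epsilon>[of "snd pn"] by (intro mult_mono) auto
      moreover have "0 \<le> \<sigma> (fst pn) * \<epsilon> (snd pn)" using \<sigma>(1)[OF p] \<epsilon>(1)[of "snd pn"] by simp
      ultimately have "\<bar>snd (fst pn)\<bar> + \<bar>\<sigma> (fst pn) * \<epsilon> (snd pn)\<bar> \<le> 2 * \<bar>snd (fst pn)\<bar>" by simp
      then show "\<bar>?k pn\<bar> \<le> 2" using tpairsD(3)[OF p] by (simp add: abs_divide divide_le_eq)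
      show "(fst (fst pn), snd (fst pn), \<sigma> (fst pn) * \<epsilon> (snd pn)) \<in> ttriples \<delta>"
        using p in1[OF \<sigma>(1,3)[OF p]] by (simp add: ttriples_def)
    qed
    moreover have "?r (fst pn) (snd pn) x = ?k pn * tcauchy q (fst (fst pn), snd (fst pn), \<sigma> (fst pn) * \<epsilon> (snd pn)) x"
      if pn: "pn \<in> tpairs \<delta> \<times> UNIV" for pn x
    proof -
      have p: "fst pn \<in> tpairs \<delta>" using pn by auto
      then have "\<bar>snd (fst pn)\<bar> + \<bar>\<sigma> (fst pn) * \<epsilon> (snd pn)\<bar> > 0" using tpairsD(3)[OF p] by simp
      then show ?thesis by (simp add: tcauchy_def)
    qed
    ultimately show ?thesis
      using wsmooth_cong[of "tpairs \<delta> \<times> (UNIV::nat set)" "\<lambda>pn. ?r (fst pn) (snd pn)"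
        "\<lambda>pn x. ?k pn * tcauchy q (fst (fst pn), snd (fst pn), \<sigma> (fst pn) * \<epsilon> (snd pn)) x" \<gamma>] by blast
  qed
  have g: "wsmooth \<gamma> (tpairs \<delta>) ?g"
    by (rule wsmoothI[OF dconv_smooth[OF dc] wbounded_limit[where r="?r", OF dc wsmoothD(2)[OF W2]]])
  \<comment> \<open>The limit is recovered from one value of \<open>q\<close> and the remainder at a
    single increment, which transfers their smoothness to it.\<close>
  have "smooth_on (ball 0 1) (w' t)" if t: "\<bar>t\<bar> < \<delta>" for t
  proof -
    define p where "p = (t, (\<delta> - \<bar>t\<bar>) / 2)"
    have p: "p \<in> tpairs \<delta>" using in1[of "(\<delta> - \<bar>t\<bar>) / 2" t 0] t unfolding p_def by (simp add: \<epsilon>_def)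
    have "smooth_on (ball 0 1) (\<lambda>x. q p x - snd p * ?g p x)"
      by (intro smooth_on_diff smooth_on_mult smooth_on_const sm p wsmoothD(1)[OF g] open_ball)
    moreover have "(\<lambda>x. q p x - snd p * ?g p x) = w' (fst p)" using tpairsD(3)[OF p] by simp
    ultimately show ?thesis by (simp add: p_def)
  qed
  then show ?thesis using g by blast
qed

text \<open>Two candidates differ by \<open>h\<close> times the difference of two bounded
  remainders, for every small \<open>h\<close>.\<close>

lemma tdiff_unique:
  assumes "wsmooth \<gamma> (tpairs \<delta>) (tdiff w w1)" "wsmooth \<gamma> (tpairs \<delta>) (tdiff w w2)" "\<bar>t\<bar> < \<delta>" "x \<in> ball 0 1"
  shows "w1 t x = w2 t x"
proof (rule ccontr)
  assume ne: "w1 t x \<noteq> w2 t x"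
  obtain C1 where C1: "C1 > 0" "\<And>p x. p \<in> tpairs \<delta> \<Longrightarrow> x \<in> ball 0 1 \<Longrightarrow> \<bar>tdiff w w1 p x\<bar> \<le> C1 * bdef x powr \<gamma>"
    using wsmoothE[OF assms(1)] by blast
  obtain C2 where C2: "C2 > 0" "\<And>p x. p \<in> tpairs \<delta> \<Longrightarrow> x \<in> ball 0 1 \<Longrightarrow> \<bar>tdiff w w2 p x\<bar> \<le> C2 * bdef x powr \<gamma>"
    using wsmoothE[OF assms(2)] by blast
  define A where "A = \<bar>w1 t x - w2 t x\<bar>"
  define K where "K = (C1 + C2) * bdef x powr \<gamma> + 1"
  have A: "A > 0" using ne by (simp add: A_def)
  have K: "K > 0" using C1(1) C2(1) by (simp add: K_def add_nonneg_pos)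
  have le: "A \<le> h * (K - 1)" if h: "0 < h" "h < \<delta> - \<bar>t\<bar>" for h
  proof -
    have p: "(t, h) \<in> tpairs \<delta>" using h by (auto simp: tpairs_def)
    have "w1 t x - w2 t x = h * (tdiff w w2 (t, h) x - tdiff w w1 (t, h) x)"
      using h by (simp add: tdiff_def field_simps power2_eq_square)
    then have "A = h * \<bar>tdiff w w2 (t, h) x - tdiff w w1 (t, h) x\<bar>" using h by (simp add: A_def abs_mult)
    also have "\<dots> \<le> h * (K - 1)"
      using C1(2)[OF p assms(4)] C2(2)[OF p assms(4)] h
      by (intro mult_left_mono) (auto simp: K_def algebra_simps)
    finally show ?thesis .
  qed
  define h where "h = min (A / K) ((\<delta> - \<bar>t\<bar>) / 2)"
  have h: "0 < h" "h < \<delta> - \<bar>t\<bar>" "h \<le> A / K"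
  proof -
    show "0 < h" "h \<le> A / K" using A K assms(3) by (auto simp: h_def)
    have "h \<le> (\<delta> - \<bar>t\<bar>) / 2" unfolding h_def by (rule min.cobounded2)
    also have "\<dots> < \<delta> - \<bar>t\<bar>" using assms(3) by simp
    finally show "h < \<delta> - \<bar>t\<bar>" .
  qed
  have "h * (K - 1) < h * K" using h by simp
  also have "\<dots> \<le> A" using h(3) K by (simp add: pos_le_divide_eq)
  finally show False using le[OF h(1,2)] by simp
qed

text \<open>A priori each order \<open>k\<close> supplies its own time derivative; uniqueness
  identifies them on the ball.\<close>

lemma tsmooth_all_deriv:
  assumes "\<And>k. tsmooth k \<delta> \<gamma> w"
  obtains w' where "\<And>k. tsmooth k \<delta> \<gamma> w'" "wsmooth \<gamma> (tpairs \<delta>) (tdiff w w')"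
proof -
  obtain w1 where w1: "wsmooth \<gamma> (tpairs \<delta>) (tdiff w w1)" using tsmoothE[OF assms[of "Suc 0"]] by blast
  have "tsmooth k \<delta> \<gamma> w1" for k
  proof -
    obtain w2 where w2: "tsmooth k \<delta> \<gamma> w2" "wsmooth \<gamma> (tpairs \<delta>) (tdiff w w2)" using tsmoothE[OF assms[of "Suc k"]] by blast
    then show ?thesis using tsmooth_cong[of \<delta> w1 w2] tdiff_unique[OF w1 w2(2)] by blast
  qed
  then show thesis using that w1 by blast
qed

section \<open>Joint smoothness in time and space\<close>

lemma has_derivative_quadratic:
  fixes R :: "'a::euclidean_space \<Rightarrow> real"
  assumes "open U" "z \<in> U" "\<And>y. y \<in> U \<Longrightarrow> \<bar>R y\<bar> \<le> C * (norm (y - z))\<^sup>2"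
  shows "(R has_derivative (\<lambda>h. 0)) (at z)"
  unfolding has_derivative_at_alt
proof (intro conjI allI impI bounded_linear_zero)
  fix e :: real assume e: "e > 0"
  obtain d where d: "d > 0" "ball z d \<subseteq> U" using assms(1,2) openE by blast
  define d' where "d' = min d (e / (\<bar>C\<bar> + 1))"
  have d': "d' > 0" using d e by (simp add: d'_def)
  have R0: "R z = 0" using assms(3)[OF assms(2)] by simp
  show "\<exists>d>0. \<forall>y. norm (y - z) < d \<longrightarrow> norm (R y - R z - 0) \<le> e * norm (y - z)"
  proof (intro exI[of _ d'] conjI d' allI impI)
    fix y assume y: "norm (y - z) < d'"
    then have "y \<in> U" using d by (auto simp: d'_def dist_norm norm_minus_commute)
    have "norm (y - z) \<le> e / (\<bar>C\<bar> + 1)" using y by (simp add: d'_def)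
    then have "(\<bar>C\<bar> + 1) * norm (y - z) \<le> e" by (simp add: pos_le_divide_eq mult.commute)
    then have le: "(\<bar>C\<bar> + 1) * norm (y - z) * norm (y - z) \<le> e * norm (y - z)" by (rule mult_right_mono) simp
    have "\<bar>R y\<bar> \<le> C * (norm (y - z))\<^sup>2" by (rule assms(3)[OF \<open>y \<in> U\<close>])
    also have "\<dots> \<le> (\<bar>C\<bar> + 1) * (norm (y - z))\<^sup>2" by (intro mult_right_mono) auto
    finally show "norm (R y - R z - 0) \<le> e * norm (y - z)" using le R0 by (simp add: power2_eq_square mult.assoc)
  qed
qed

text \<open>Functions that are smooth in time to every order with respect to some weight form a
  class closed under derivatives in all directions of time and space; a space derivative costs one
  power, so the exponent is part of the existential in the coinduction predicate.\<close>

lemma tsmooth_joint: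
  fixes w :: "real \<Rightarrow> 'a::euclidean_space \<Rightarrow> real"
  assumes "\<And>k. tsmooth k \<delta> \<gamma> w"
  shows "smooth_on ({-\<delta><..<\<delta>} \<times> ball 0 1) (\<lambda>z. w (fst z) (snd z))"
proof (rule smooth_on_coinduct[where P="\<lambda>f. \<exists>\<gamma> w. (\<forall>k. tsmooth k \<delta> \<gamma> w) \<and> f = (\<lambda>z. w (fst z) (snd z))"])
  let ?S = "{-\<delta><..<\<delta>} \<times> ball (0::'a) 1"
  show S: "open ?S" by (intro open_Times) auto
  show "\<exists>\<gamma> v. (\<forall>k. tsmooth k \<delta> \<gamma> v) \<and> (\<lambda>z. w (fst z) (snd z)) = (\<lambda>z. v (fst z) (snd z))"
    using assms by blast
  fix f :: "real \<times> 'a \<Rightarrow> real" assume "\<exists>\<gamma> w. (\<forall>k. tsmooth k \<delta> \<gamma> w) \<and> f = (\<lambda>z. w (fst z) (snd z))"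
  then obtain \<gamma> w where w: "\<And>k. tsmooth k \<delta> \<gamma> w" and f: "f = (\<lambda>z. w (fst z) (snd z))" by blast
  obtain w' where w': "\<And>k. tsmooth k \<delta> \<gamma> w'" "wsmooth \<gamma> (tpairs \<delta>) (tdiff w w')" using tsmooth_all_deriv[OF w] by blast
  have sw: "smooth_on (ball 0 1) (w t)" "smooth_on (ball 0 1) (w' t)" if "\<bar>t\<bar> < \<delta>" for t
    using wsmoothD(1)[OF tsmooth_wsmooth[OF w[of 0]]] wsmoothD(1)[OF tsmooth_wsmooth[OF w'(1)[of 0]]] that
    by (auto simp: abs_less_iff)
  have der: "(f has_derivative (\<lambda>h. fst h * w' (fst z) (snd z) + pd (snd h) (w (fst z)) (snd z))) (at z)" if z: "z \<in> ?S" for z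
  proof -
    obtain t x where tx: "z = (t, x)" by (cases z)
    have t: "\<bar>t\<bar> < \<delta>" and x: "x \<in> ball 0 1" using z tx by auto
    \<comment> \<open>The deviation from the first order expansion in time, taken at the moving
      space point. The bound on \<open>tdiff\<close> makes it quadratic in \<open>fst y - t\<close>,
      with a weight that is bounded near \<open>x\<close>.\<close>
    define R where "R = (\<lambda>y. f y - (w t (snd y) + (fst y - t) * w' t (snd y)))"
    have dw: "((\<lambda>y. w t (snd y)) has_derivative (\<lambda>h. pd (snd h) (w t) x)) (at z)"
      by (rule has_derivative_compose[OF has_derivative_snd[OF has_derivative_ident]])
        (use has_derivative_pd[OF smooth_onD[OF sw(1)[OF t] x]] tx in simp)
    have dw': "((\<lambda>y. w' t (snd y)) has_derivative (\<lambda>h. pd (snd h) (w' t) x)) (at z)"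
      by (rule has_derivative_compose[OF has_derivative_snd[OF has_derivative_ident]])
        (use has_derivative_pd[OF smooth_onD[OF sw(2)[OF t] x]] tx in simp)
    have dt: "((\<lambda>y. fst y - t) has_derivative (\<lambda>h. fst h)) (at z)" by (auto intro!: derivative_eq_intros)
    have dm: "((\<lambda>y. (fst y - t) * w' t (snd y)) has_derivative (\<lambda>h. fst h * w' t x)) (at z)"
      using has_derivative_mult[OF dt dw'] tx by simp
    obtain C where C: "C > 0" "\<And>p x. p \<in> tpairs \<delta> \<Longrightarrow> x \<in> ball 0 1 \<Longrightarrow> \<bar>tdiff w w' p x\<bar> \<le> C * bdef x powr \<gamma>"
      using wsmoothE[OF w'(2)] by blast
    have "isCont (\<lambda>x. bdef x powr \<gamma>) x"
      using smooth_on_continuous[OF bdef_smooth] x continuous_on_eq_continuous_at open_ball by blast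
    then have "((\<lambda>x. bdef x powr \<gamma>) \<longlongrightarrow> bdef x powr \<gamma>) (nhds x)"
      using tendsto_at_iff_tendsto_nhds[of "\<lambda>x. bdef x powr \<gamma>" x] unfolding isCont_def by blast
    then have "\<forall>\<^sub>F y in nhds x. bdef y powr \<gamma> < bdef x powr \<gamma> + 1"
      by (rule order_tendstoD(2)) simp
    then obtain V where V: "open V" "x \<in> V" "\<And>y. y \<in> V \<Longrightarrow> bdef y powr \<gamma> < bdef x powr \<gamma> + 1"
      unfolding eventually_nhds by blast
    let ?U = "{-\<delta><..<\<delta>} \<times> (V \<inter> ball 0 1)"
    have "(R has_derivative (\<lambda>h. 0)) (at z)"
    proof (rule has_derivative_quadratic[of ?U])
      show "open ?U" by (intro open_Times open_Int V) auto
      show "z \<in> ?U" using V t x tx by auto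
      fix y assume y: "y \<in> ?U"
      show "\<bar>R y\<bar> \<le> C * (bdef x powr \<gamma> + 1) * (norm (y - z))\<^sup>2"
      proof (cases "fst y = t")
        case True
        have "0 \<le> C * (bdef x powr \<gamma> + 1) * (norm (y - z))\<^sup>2"
          using C(1) by (intro mult_nonneg_nonneg) (auto intro: add_nonneg_nonneg)
        then show ?thesis using True by (simp add: R_def f)
      next
        case False
        let ?p = "(t, fst y - t)"
        have p: "?p \<in> tpairs \<delta>" using y t False by (auto simp: tpairs_def)
        have "R y = tdiff w w' ?p (snd y) * (fst y - t)\<^sup>2" using False by (simp add: R_def f tdiff_def)
        then have "\<bar>R y\<bar> = \<bar>tdiff w w' ?p (snd y)\<bar> * (fst y - t)\<^sup>2" by (simp add: abs_mult)
        also have "\<dots> \<le> C * (bdef x powr \<gamma> + 1) * (norm (y - z))\<^sup>2"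
        proof (rule mult_mono)
          have "\<bar>tdiff w w' ?p (snd y)\<bar> \<le> C * bdef (snd y) powr \<gamma>" using C(2)[OF p] y by auto
          also have "\<dots> \<le> C * (bdef x powr \<gamma> + 1)" using C(1) V(3)[of "snd y"] y by (intro mult_left_mono) auto
          finally show "\<bar>tdiff w w' ?p (snd y)\<bar> \<le> C * (bdef x powr \<gamma> + 1)" .
          have "\<bar>fst y - t\<bar> \<le> norm (y - z)" using norm_fst_le[of "fst (y - z)" "snd (y - z)"] tx by (metis fst_conv fst_diff prod.collapse real_norm_def)
          then show "(fst y - t)\<^sup>2 \<le> (norm (y - z))\<^sup>2" using power_mono[of "\<bar>fst y - t\<bar>" _ 2] by simp
          show "0 \<le> C * (bdef x powr \<gamma> + 1)" using C(1) by (intro mult_nonneg_nonneg) (auto intro: add_nonneg_nonneg)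
        qed simp
        finally show ?thesis .
      qed
    qed
    from has_derivative_add[OF has_derivative_add[OF dw dm] this]
    have "((\<lambda>y. w t (snd y) + (fst y - t) * w' t (snd y) + R y) has_derivative (\<lambda>h. pd (snd h) (w t) x + fst h * w' t x)) (at z)"
      by simp
    moreover have "(\<lambda>y. w t (snd y) + (fst y - t) * w' t (snd y) + R y) = f" by (simp add: R_def)
    ultimately show ?thesis using tx by (simp add: add.commute)
  qed
  show "(\<forall>z\<in>?S. f differentiable at z) \<and> (\<forall>v. \<exists>g. (\<exists>\<gamma> w. (\<forall>k. tsmooth k \<delta> \<gamma> w) \<and> g = (\<lambda>z. w (fst z) (snd z))) \<and> (\<forall>x\<in>?S. pd v f x = g x))"
  proof (intro conjI allI)
    show "\<forall>z\<in>?S. f differentiable at z" using der differentiable_def by blast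
    fix v :: "real \<times> 'a"
    let ?w = "\<lambda>t x. fst v * w' t x + pd (snd v) (w t) x"
    have "tsmooth k \<delta> (\<gamma> - 1) ?w" for k
      by (intro tsmooth_add tsmooth_cmult tsmooth_weaken[OF _ w'(1)] tsmooth_pd w) simp
    moreover have "\<forall>z\<in>?S. pd v f z = ?w (fst z) (snd z)" using pd_eq[OF der] by blast
    ultimately show "\<exists>g. (\<exists>\<gamma> w. (\<forall>k. tsmooth k \<delta> \<gamma> w) \<and> g = (\<lambda>z. w (fst z) (snd z))) \<and> (\<forall>x\<in>?S. pd v f x = g x)"
      by (intro exI[of _ "\<lambda>z. ?w (fst z) (snd z)"]) blast
  qed
qed

section \<open>The Dirichlet problem with a parameter\<close>

definition vfield :: "('a::euclidean_space \<Rightarrow> 'a \<Rightarrow> real) \<Rightarrow> ('a \<Rightarrow> real) \<Rightarrow> 'a \<Rightarrow> real" where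
  "vfield a v x = (\<Sum>j\<in>Basis. a j x * pd j v x)"

lemma wsmooth_vfield:
  assumes "\<And>j. j \<in> Basis \<Longrightarrow> wsmooth 0 I (\<lambda>i. a i j)" "wsmooth \<gamma> I v"
  shows "wsmooth (\<gamma> - 1) I (\<lambda>i. vfield (a i) (v i))"
  unfolding vfield_def by (intro wsmooth_sum finite_Basis wsmooth_mult0 wsmooth_pd assms)

lemma tsmooth_vfield:
  assumes "\<And>j. j \<in> Basis \<Longrightarrow> tsmooth k \<delta> 0 (\<lambda>t. a t j)" "tsmooth k \<delta> \<gamma> v"
  shows "tsmooth k \<delta> (\<gamma> - 1) (\<lambda>t. vfield (a t) (v t))"
proof -
  have "tsmooth k \<delta> (0 + (\<gamma> - 1)) (\<lambda>t x. \<Sum>j\<in>Basis. a t j x * pd j (v t) x)"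
    by (intro tsmooth_sum finite_Basis tsmooth_mult tsmooth_pd assms)
  then show ?thesis unfolding vfield_def by simp
qed

lemma vfield_cong:
  assumes "open S" "\<And>x. x \<in> S \<Longrightarrow> f x = g x" "x \<in> S"
  shows "vfield a f x = vfield a g x"
  unfolding vfield_def using pd_cong[OF assms] by simp

lemma vfield_add:
  "f differentiable (at x) \<Longrightarrow> g differentiable (at x) \<Longrightarrow> vfield a (\<lambda>x. f x + r * g x) x = vfield a f x + r * vfield a g x"
proof -
  assume f: "f differentiable (at x)" and g: "g differentiable (at x)"
  have "pd j (\<lambda>x. f x + r * g x) x = pd j f x + r * pd j g x" for j
    by (rule pd_eq[OF has_derivative_add[OF has_derivative_pd[OF f] has_derivative_mult_right[OF has_derivative_pd[OF g]]]])
  then show ?thesis by (simp add: vfield_def algebra_simps sum.distrib sum_distrib_left)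
qed

lemma vfield_coeff: "(\<And>j. a j x = b j x + r * d j x) \<Longrightarrow> vfield a v x = vfield b v x + r * vfield d v x"
  by (simp add: vfield_def algebra_simps sum.distrib sum_distrib_left)

lemma smooth_on_vfield:
  "open S \<Longrightarrow> (\<And>j. smooth_on S (a j)) \<Longrightarrow> smooth_on S v \<Longrightarrow> smooth_on S (vfield a v)"
  unfolding vfield_def[abs_def] by (intro smooth_on_sum smooth_on_mult smooth_on_pd finite_Basis)

lemma continuous_on_cball_vanishing:
  fixes f :: "'a::euclidean_space \<Rightarrow> real"
  assumes f: "continuous_on (ball 0 1) f" and b: "\<And>x. x \<in> ball 0 1 \<Longrightarrow> \<bar>f x\<bar> \<le> C * bdef x powr (1/2)"
    and z: "\<And>x. x \<in> sphere 0 1 \<Longrightarrow> f x = 0"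
  shows "continuous_on (cball 0 1) f"
  unfolding continuous_on_eq_continuous_within
proof
  fix x :: 'a assume x: "x \<in> cball 0 1"
  show "continuous (at x within cball 0 1) f"
  proof (cases "x \<in> ball 0 1")
    case True
    then show ?thesis using f continuous_on_eq_continuous_at open_ball continuous_at_imp_continuous_at_within by blast
  next
    case False
    then have xs: "x \<in> sphere 0 1" using x by auto
    have "((\<lambda>y. bdef y powr (1/2)) \<longlongrightarrow> bdef x powr (1/2)) (at x within cball 0 1)"
      using bdef_continuous[where 'a='a, of "1/2"] x unfolding continuous_on_def by simp
    from tendsto_mult_left[OF this, of C]
    have "((\<lambda>y. C * bdef y powr (1/2)) \<longlongrightarrow> 0) (at x within cball 0 1)"
      using bdef_sphere[OF xs] by simp
    moreover have "\<forall>\<^sub>F y in at x within cball 0 1. norm (f y) \<le> C * bdef y powr (1/2)"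
      unfolding eventually_at_filter
    proof (intro always_eventually allI impI)
      fix y :: 'a assume "y \<in> cball 0 1"
      then show "norm (f y) \<le> C * bdef y powr (1/2)"
        using b[of y] z[of y] bdef_sphere[of y] by (cases "y \<in> ball 0 1") auto
    qed
    ultimately have "(f \<longlongrightarrow> 0) (at x within cball 0 1)" by (rule Lim_null_comparison[rotated])
    then show ?thesis using z[OF xs] by (simp add: continuous_within)
  qed
qed

context domain_family
begin

definition cd :: "real^'n \<Rightarrow> real^'n \<Rightarrow> real \<Rightarrow> real^'n \<Rightarrow> real" where
  "cd b j t x = pd (1, 0) (\<lambda>z. c (fst z) b (snd z) \<bullet> j) (t, x)"

lemma coeff_smooth: "smooth_on ({-e<..<e} \<times> ball 0 2) (\<lambda>z. c (fst z) b (snd z) \<bullet> j)"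
  by (intro smooth_on_inner frame_smooth smooth_on_const open_Times open_ball open_greaterThanLessThan)

lemma tsmooth_frame: "tsmooth k \<delta> 0 (\<lambda>t x. c t b x \<bullet> j)"
  using tsmooth_param[OF coeff_smooth open_ball ball12(2) \<delta>(2)] by simp

lemma tsmooth_cd: "tsmooth k \<delta> 0 (cd b j)"
  using tsmooth_param[OF smooth_on_pd[OF coeff_smooth] open_ball ball12(2) \<delta>(2)] unfolding cd_def[abs_def] .

lemma wsmooth_tdiff_frame: "wsmooth 0 (tpairs \<delta>) (tdiff (\<lambda>t x. c t b x \<bullet> j) (cd b j))"
  using wsmooth_tdiff_param[OF coeff_smooth open_ball ball12(2) \<delta>(2)] unfolding cd_def[abs_def] by simp

lemma wsmooth_tquot_frame: "wsmooth 0 (tpairs \<delta>) (tquot (\<lambda>t x. c t b x \<bullet> j))"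
  by (rule wsmooth_tquot[OF wsmooth_tdiff_frame tsmooth_wsmooth[OF tsmooth_cd]])

abbreviation "Yd t b \<equiv> vfield (\<lambda>j. cd b j t)"
abbreviation "Yq p b \<equiv> vfield (\<lambda>j. tquot (\<lambda>t x. c t b x \<bullet> j) p)"
abbreviation "Yr p b \<equiv> vfield (\<lambda>j. tdiff (\<lambda>t x. c t b x \<bullet> j) (cd b j) p)"

text \<open>The derivative of the operator in time, its difference quotient, and the second order remainder of
  the latter.\<close>

definition Ld :: "real \<Rightarrow> (real^'n \<Rightarrow> real) \<Rightarrow> real^'n \<Rightarrow> real" where
  "Ld t v x = (\<Sum>b\<in>Basis. Yd t b (Y t b v) x + Y t b (Yd t b v) x)"

definition Lq :: "real \<times> real \<Rightarrow> (real^'n \<Rightarrow> real) \<Rightarrow> real^'n \<Rightarrow> real" where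
  "Lq p v x = (\<Sum>b\<in>Basis. Y (fst p + snd p) b (Yq p b v) x + Yq p b (Y (fst p) b v) x)"

definition Lr :: "real \<times> real \<Rightarrow> (real^'n \<Rightarrow> real) \<Rightarrow> real^'n \<Rightarrow> real" where
  "Lr p v x = (\<Sum>b\<in>Basis. Y (fst p + snd p) b (Yr p b v) x + Yr p b (Y (fst p) b v) x + Yq p b (Yd (fst p) b v) x)"

lemma small_e: "\<bar>t\<bar> < \<delta> \<Longrightarrow> \<bar>t\<bar> < e" using \<delta> by linarith

lemma Y_vfield: "v differentiable (at x) \<Longrightarrow> Y t b v x = vfield (\<lambda>j x. c t b x \<bullet> j) v x"
  unfolding vfield_def by (rule dframe_expand)

lemma Y_shift:
  assumes "p \<in> tpairs \<delta>" "v differentiable (at x)"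
  shows "Y (fst p + snd p) b v x = Y (fst p) b v x + snd p * Yq p b v x"
  unfolding Y_vfield[OF assms(2)]
  by (rule vfield_coeff) (use tpairsD(3)[OF assms(1)] in \<open>simp add: tquot_def\<close>)

lemma Yq_expand:
  assumes "p \<in> tpairs \<delta>"
  shows "Yq p b v x = Yd (fst p) b v x + snd p * Yr p b v x"
  by (rule vfield_coeff) (use tquot_tdiff[OF tpairsD(3)[OF assms]] in \<open>simp add: add.commute\<close>)

lemma Y_lin:
  "f differentiable (at x) \<Longrightarrow> g differentiable (at x) \<Longrightarrow> Y t b (\<lambda>x. f x + r * g x) x = Y t b f x + r * Y t b g x"
  unfolding dframe_def
  by (rule pd_eq[OF has_derivative_add[OF has_derivative_pd has_derivative_mult_right[OF has_derivative_pd]]])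

lemma Y_smooth: "\<bar>t\<bar> < \<delta> \<Longrightarrow> smooth_on (ball 0 1) v \<Longrightarrow> smooth_on (ball 0 1) (Y t b v)"
  by (rule dframe_smooth[OF small_e open_ball ball12(1)])

lemma Yd_smooth: "\<bar>t\<bar> < \<delta> \<Longrightarrow> smooth_on (ball 0 1) v \<Longrightarrow> smooth_on (ball 0 1) (Yd t b v)"
  by (rule smooth_on_vfield[OF open_ball wsmoothD(1)[OF tsmooth_wsmooth[OF tsmooth_cd]]]) (auto simp: abs_less_iff)

lemma Yq_smooth: "p \<in> tpairs \<delta> \<Longrightarrow> smooth_on (ball 0 1) v \<Longrightarrow> smooth_on (ball 0 1) (Yq p b v)"
  by (rule smooth_on_vfield[OF open_ball wsmoothD(1)[OF wsmooth_tquot_frame]])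

lemma Yr_smooth: "p \<in> tpairs \<delta> \<Longrightarrow> smooth_on (ball 0 1) v \<Longrightarrow> smooth_on (ball 0 1) (Yr p b v)"
  by (rule smooth_on_vfield[OF open_ball wsmoothD(1)[OF wsmooth_tdiff_frame]])

text \<open>An exact identity: the product of two shifted fields telescopes, the inner factor being
  changed under the shifted outer one and the outer factor afterwards.\<close>

lemma L_shift:
  assumes p: "p \<in> tpairs \<delta>" and v: "smooth_on (ball 0 1) v" and x: "x \<in> ball 0 1"
  shows "L (fst p + snd p) v x = L (fst p) v x + snd p * Lq p v x"
proof -
  let ?t = "fst p" and ?h = "snd p"
  have "Y (?t + ?h) b (Y (?t + ?h) b v) x = Y ?t b (Y ?t b v) x + ?h * (Y (?t + ?h) b (Yq p b v) x + Yq p b (Y ?t b v) x)" for b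
  proof -
    have "Y (?t + ?h) b (Y (?t + ?h) b v) x = Y (?t + ?h) b (\<lambda>x. Y ?t b v x + ?h * Yq p b v x) x"
      by (rule dframe_cong[OF open_ball _ x]) (rule Y_shift[OF p smooth_onD[OF v]])
    also have "\<dots> = Y (?t + ?h) b (Y ?t b v) x + ?h * Y (?t + ?h) b (Yq p b v) x"
      by (rule Y_lin; rule smooth_onD[OF _ x]) (rule Y_smooth[OF tpairsD(1)[OF p] v] Yq_smooth[OF p v])+
    also have "Y (?t + ?h) b (Y ?t b v) x = Y ?t b (Y ?t b v) x + ?h * Yq p b (Y ?t b v) x"
      by (rule Y_shift[OF p smooth_onD[OF Y_smooth[OF tpairsD(1)[OF p] v] x]])
    finally show ?thesis by (simp add: algebra_simps)
  qed
  then show ?thesis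
    unfolding lframe_def Lq_def sum_distrib_left sum.distrib[symmetric] by (intro sum.cong refl)
qed

lemma Lq_expand:
  assumes p: "p \<in> tpairs \<delta>" and v: "smooth_on (ball 0 1) v" and x: "x \<in> ball 0 1"
  shows "Lq p v x = Ld (fst p) v x + snd p * Lr p v x"
proof -
  let ?t = "fst p" and ?h = "snd p"
  note t = tpairsD(1)[OF p]
  have "Y (?t + ?h) b (Yq p b v) x + Yq p b (Y ?t b v) x = (Yd ?t b (Y ?t b v) x + Y ?t b (Yd ?t b v) x)
     + ?h * (Y (?t + ?h) b (Yr p b v) x + Yr p b (Y ?t b v) x + Yq p b (Yd ?t b v) x)" for b
  proof -
    have "Y (?t + ?h) b (Yq p b v) x = Y (?t + ?h) b (\<lambda>x. Yd ?t b v x + ?h * Yr p b v x) x"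
      by (rule dframe_cong[OF open_ball _ x]) (rule Yq_expand[OF p])
    also have "\<dots> = Y (?t + ?h) b (Yd ?t b v) x + ?h * Y (?t + ?h) b (Yr p b v) x"
      by (rule Y_lin; rule smooth_onD[OF _ x]) (rule Yd_smooth[OF t v] Yr_smooth[OF p v])+
    also have "Y (?t + ?h) b (Yd ?t b v) x = Y ?t b (Yd ?t b v) x + ?h * Yq p b (Yd ?t b v) x"
      by (rule Y_shift[OF p smooth_onD[OF Yd_smooth[OF t v] x]])
    finally show ?thesis using Yq_expand[OF p, of b "Y ?t b v" x] by (simp add: algebra_simps)
  qed
  then show ?thesis
    unfolding Ld_def Lq_def Lr_def sum_distrib_left sum.distrib[symmetric] by (intro sum.cong refl)
qed

lemma Ld_lin:
  assumes t: "\<bar>t\<bar> < \<delta>" and f: "smooth_on (ball 0 1) f" and g: "smooth_on (ball 0 1) g" and x: "x \<in> ball 0 1"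
  shows "Ld t (\<lambda>x. f x + r * g x) x = Ld t f x + r * Ld t g x"
proof -
  have 1: "Yd t b (Y t b (\<lambda>x. f x + r * g x)) x = Yd t b (Y t b f) x + r * Yd t b (Y t b g) x" for b
  proof -
    have "Yd t b (Y t b (\<lambda>x. f x + r * g x)) x = Yd t b (\<lambda>x. Y t b f x + r * Y t b g x) x"
      by (rule vfield_cong[OF open_ball _ x]) (rule Y_lin[OF smooth_onD[OF f] smooth_onD[OF g]])
    also have "\<dots> = Yd t b (Y t b f) x + r * Yd t b (Y t b g) x"
      by (rule vfield_add; rule smooth_onD[OF Y_smooth[OF t] x]; fact)
    finally show ?thesis .
  qed
  have 2: "Y t b (Yd t b (\<lambda>x. f x + r * g x)) x = Y t b (Yd t b f) x + r * Y t b (Yd t b g) x" for b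
  proof -
    have "Y t b (Yd t b (\<lambda>x. f x + r * g x)) x = Y t b (\<lambda>x. Yd t b f x + r * Yd t b g x) x"
      by (rule dframe_cong[OF open_ball _ x]) (rule vfield_add[OF smooth_onD[OF f] smooth_onD[OF g]])
    also have "\<dots> = Y t b (Yd t b f) x + r * Y t b (Yd t b g) x"
      by (rule Y_lin; rule smooth_onD[OF Yd_smooth[OF t] x]; fact)
    finally show ?thesis .
  qed
  show ?thesis unfolding Ld_def 1 2 by (simp add: sum.distrib sum_distrib_left algebra_simps)
qed

lemma tpairs_le: "p \<in> tpairs \<delta> \<Longrightarrow> \<bar>fst p\<bar> \<le> \<delta>" "p \<in> tpairs \<delta> \<Longrightarrow> \<bar>fst p + snd p\<bar> \<le> \<delta>"
  using tpairsD(1,2)[of p \<delta>] by linarith+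

lemma interval_abs_less: "\<bar>t\<bar> < \<delta> \<Longrightarrow> t \<in> {-\<delta><..<\<delta>}"
  unfolding greaterThanLessThan_iff by linarith

lemma wsmooth_Yd:
  assumes "\<And>i. i \<in> I \<Longrightarrow> \<bar>t i\<bar> < \<delta>" "wsmooth \<gamma> I v"
  shows "wsmooth (\<gamma> - 1) I (\<lambda>i. Yd (t i) b (v i))"
  by (rule wsmooth_vfield[where a="\<lambda>i j. cd b j (t i)", OF wsmooth_reindex[OF tsmooth_wsmooth[OF tsmooth_cd] interval_abs_less[OF assms(1)]] assms(2)])

lemma wsmooth_Yq: "wsmooth \<gamma> (tpairs \<delta>) v \<Longrightarrow> wsmooth (\<gamma> - 1) (tpairs \<delta>) (\<lambda>p. Yq p b (v p))"
  by (rule wsmooth_vfield[OF wsmooth_tquot_frame])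

lemma wsmooth_Yr: "wsmooth \<gamma> (tpairs \<delta>) v \<Longrightarrow> wsmooth (\<gamma> - 1) (tpairs \<delta>) (\<lambda>p. Yr p b (v p))"
  by (rule wsmooth_vfield[OF wsmooth_tdiff_frame])

lemma minus2: "\<gamma> - 1 - 1 = \<gamma> - (2::real)" by simp

lemma wsmooth_L: "(\<And>i. i \<in> I \<Longrightarrow> \<bar>t i\<bar> \<le> \<delta>) \<Longrightarrow> wsmooth \<gamma> I v \<Longrightarrow> wsmooth (\<gamma> - 2) I (\<lambda>i. L (t i) (v i))"
  unfolding lframe_def[abs_def] minus2[symmetric] by (intro wsmooth_sum finite_Basis wsmooth_dframe)

lemma wsmooth_Ld: "wsmooth \<gamma> (tpairs \<delta>) v \<Longrightarrow> wsmooth (\<gamma> - 2) (tpairs \<delta>) (\<lambda>p. Ld (fst p) (v p))"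
  unfolding Ld_def[abs_def] minus2[symmetric]
  by (intro wsmooth_sum finite_Basis wsmooth_add wsmooth_dframe wsmooth_Yd tpairs_le tpairsD)

lemma wsmooth_Lq: "wsmooth \<gamma> (tpairs \<delta>) v \<Longrightarrow> wsmooth (\<gamma> - 2) (tpairs \<delta>) (\<lambda>p. Lq p (v p))"
  unfolding Lq_def[abs_def] minus2[symmetric]
  by (intro wsmooth_sum finite_Basis wsmooth_add wsmooth_dframe wsmooth_Yq tpairs_le)

lemma wsmooth_Lr: "wsmooth \<gamma> (tpairs \<delta>) v \<Longrightarrow> wsmooth (\<gamma> - 2) (tpairs \<delta>) (\<lambda>p. Lr p (v p))"
  unfolding Lr_def[abs_def] minus2[symmetric]
  by (intro wsmooth_sum finite_Basis wsmooth_add wsmooth_dframe wsmooth_Yq wsmooth_Yr wsmooth_Yd tpairs_le tpairsD)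

lemma tsmooth_Y: "tsmooth k \<delta> \<gamma> w \<Longrightarrow> tsmooth k \<delta> (\<gamma> - 1) (\<lambda>t. Y t b (w t))"
proof -
  assume w: "tsmooth k \<delta> \<gamma> w"
  have "Y t b (w t) x = vfield (\<lambda>j x. c t b x \<bullet> j) (w t) x" if "\<bar>t\<bar> < \<delta>" "x \<in> ball 0 1" for t x
    by (rule Y_vfield[OF smooth_onD[OF wsmoothD(1)[OF tsmooth_wsmooth[OF w]] that(2)]]) (use that in \<open>auto simp: abs_less_iff\<close>)
  then show ?thesis
    using tsmooth_cong[of \<delta> "\<lambda>t. Y t b (w t)" "\<lambda>t. vfield (\<lambda>j x. c t b x \<bullet> j) (w t)" k "\<gamma> - 1"]
      tsmooth_vfield[of k \<delta> "\<lambda>t j x. c t b x \<bullet> j" \<gamma> w, OF tsmooth_frame w] by blast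
qed

lemma tsmooth_Ld: "tsmooth k \<delta> \<gamma> w \<Longrightarrow> tsmooth k \<delta> (\<gamma> - 2) (\<lambda>t. Ld t (w t))"
  unfolding Ld_def[abs_def] minus2[symmetric]
  by (intro tsmooth_sum finite_Basis tsmooth_add tsmooth_Y tsmooth_vfield tsmooth_cd)

section \<open>Solutions with zero boundary values, differentiated in time\<close>

definition dirichlet :: "(real \<Rightarrow> real^'n \<Rightarrow> real) \<Rightarrow> (real \<Rightarrow> real^'n \<Rightarrow> real) \<Rightarrow> bool" where
  "dirichlet w f \<longleftrightarrow> (\<forall>t. \<bar>t\<bar> < \<delta> \<longrightarrow> smooth_on (ball 0 1) (w t) \<and> continuous_on (cball 0 1) (w t) \<and>
     (\<forall>x\<in>sphere 0 1. w t x = 0) \<and> (\<forall>x\<in>ball 0 1. L t (w t) x = f t x))"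

lemma dirichletD:
  assumes "dirichlet w f" "\<bar>t\<bar> < \<delta>"
  shows "smooth_on (ball 0 1) (w t)" "continuous_on (cball 0 1) (w t)" "x \<in> sphere 0 1 \<Longrightarrow> w t x = 0"
    "x \<in> ball 0 1 \<Longrightarrow> L t (w t) x = f t x"
  using assms by (auto simp: dirichlet_def)

lemma dirichlet_wsmooth:
  assumes d: "dirichlet w f" and f: "wsmooth (-3/2) {-\<delta><..<\<delta>} f"
  shows "wsmooth (1/2) {-\<delta><..<\<delta>} w"
proof (rule wsmooth_dirichlet[where t="\<lambda>t. t"])
  show "wsmooth (-3/2) {-\<delta><..<\<delta>} (\<lambda>t. L t (w t))"
    using wsmooth_cong[of "{-\<delta><..<\<delta>}" "\<lambda>t. L t (w t)" f] dirichletD(4)[OF d] f by (auto simp: abs_less_iff)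
qed (use dirichletD[OF d] in \<open>auto simp: abs_less_iff\<close>)

text \<open>The quotient vanishes on the sphere and satisfies an equation with the operator frozen
  at the base time. The change of the operator, applied to the solution, moves to the right side
  with exponent 1/2 - 2 = -3/2, which is precisely the admissible one.\<close>

lemma dirichlet_tquot:
  assumes d: "dirichlet w f" and f: "wsmooth (-3/2) {-\<delta><..<\<delta>} f" "wsmooth (-3/2) (tpairs \<delta>) (tquot f)"
  shows "wsmooth (1/2) (tpairs \<delta>) (tquot w)"
    and "\<And>p. p \<in> tpairs \<delta> \<Longrightarrow> continuous_on (cball 0 1) (tquot w p)"
    and "\<And>p x. p \<in> tpairs \<delta> \<Longrightarrow> x \<in> sphere 0 1 \<Longrightarrow> tquot w p x = 0"
    and "\<And>p x. p \<in> tpairs \<delta> \<Longrightarrow> x \<in> ball 0 1 \<Longrightarrow> L (fst p) (tquot w p) x = tquot f p x - Lq p (w (fst p + snd p)) x"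
proof -
  have qe: "tquot w p = (\<lambda>x. (1 / snd p) * (w (fst p + snd p) x - w (fst p) x))" for p
    by (simp add: tquot_def fun_eq_iff)
  have sm: "smooth_on (ball 0 1) (tquot w p)" if p: "p \<in> tpairs \<delta>" for p
    unfolding qe by (intro smooth_on_cmult smooth_on_diff open_ball dirichletD(1)[OF d] tpairsD[OF p])
  show co: "continuous_on (cball 0 1) (tquot w p)" if p: "p \<in> tpairs \<delta>" for p
    unfolding qe by (intro continuous_intros dirichletD(2)[OF d] tpairsD[OF p])
  show ze: "tquot w p x = 0" if "p \<in> tpairs \<delta>" "x \<in> sphere 0 1" for p x
    unfolding qe using dirichletD(3)[OF d _ that(2)] tpairsD(1,2)[OF that(1)] by simp
  show Lqe: "L (fst p) (tquot w p) x = tquot f p x - Lq p (w (fst p + snd p)) x"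
    if p: "p \<in> tpairs \<delta>" and x: "x \<in> ball 0 1" for p x
  proof -
    note s = dirichletD(1)[OF d tpairsD(1)[OF p]] dirichletD(1)[OF d tpairsD(2)[OF p]]
    note t = small_e[OF tpairsD(1)[OF p]]
    have "L (fst p) (tquot w p) x = (1 / snd p) * (L (fst p) (w (fst p + snd p)) x - L (fst p) (w (fst p)) x)"
      unfolding qe lframe_cmult[OF t smooth_on_diff[OF open_ball s(2,1)] x] lframe_diff[OF t s(2,1) x] ..
    also have "L (fst p) (w (fst p + snd p)) x = f (fst p + snd p) x - snd p * Lq p (w (fst p + snd p)) x"
      using L_shift[OF p s(2) x] dirichletD(4)[OF d tpairsD(2)[OF p] x] by simp
    also have "L (fst p) (w (fst p)) x = f (fst p) x" by (rule dirichletD(4)[OF d tpairsD(1)[OF p] x])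
    finally show ?thesis unfolding tquot_def[of f p x] using tpairsD(3)[OF p] by (simp add: field_simps)
  qed
  show "wsmooth (1/2) (tpairs \<delta>) (tquot w)"
  proof (rule wsmooth_dirichlet[where t=fst, OF tpairs_le(1) sm co ze])
    have "wsmooth (1/2 - 2) (tpairs \<delta>) (\<lambda>p. Lq p (w (fst p + snd p)))"
      by (rule wsmooth_Lq[OF wsmooth_at(2)[OF dirichlet_wsmooth[OF d f(1)]]])
    then have "wsmooth (-3/2) (tpairs \<delta>) (\<lambda>p x. tquot f p x - Lq p (w (fst p + snd p)) x)"
      by (intro wsmooth_diff f(2)) simp
    then show "wsmooth (-3/2) (tpairs \<delta>) (\<lambda>p. L (fst p) (tquot w p))"
      using wsmooth_cong[of "tpairs \<delta>" "\<lambda>p. L (fst p) (tquot w p)" "\<lambda>p x. tquot f p x - Lq p (w (fst p + snd p)) x" "-3/2"] Lqe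
      by blast
  qed
qed

text \<open>Quotients with two increments at the same base time share the leading right side
  \<open>g\<close>. It cancels in their difference, and what remains is linear in the increments;
  \<open>wsmooth_dirichlet\<close> then gives the Cauchy bound from which \<open>tquot_limit\<close>
  produces the derivative.\<close>

lemma dirichlet_derivative:
  assumes d: "dirichlet w f" and f: "wsmooth (-3/2) {-\<delta><..<\<delta>} f" "wsmooth (-3/2) {-\<delta><..<\<delta>} f'"
      "wsmooth (-3/2) (tpairs \<delta>) (tdiff f f')"
  obtains w' where "dirichlet w' (\<lambda>t x. f' t x - Ld t (w t) x)" "wsmooth (1/2) (tpairs \<delta>) (tdiff w w')"
proof -
  let ?q = "tquot w"
  have fq: "wsmooth (-3/2) (tpairs \<delta>) (tquot f)" by (rule wsmooth_tquot[OF f(3,2)])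
  note q = dirichlet_tquot[OF d f(1) fq]
  note W = dirichlet_wsmooth[OF d f(1)]
  have sw: "smooth_on (ball 0 1) (w t)" if "\<bar>t\<bar> < \<delta>" for t by (rule dirichletD(1)[OF d that])
  have sq: "smooth_on (ball 0 1) (?q p)" if "p \<in> tpairs \<delta>" for p by (rule wsmoothD(1)[OF q(1) that])
  define g where "g = (\<lambda>t x. f' t x - Ld t (w t) x)"
  \<comment> \<open>Collects what carries a factor of the increment in the equation of the quotient;
    every term has exponent -3/2.\<close>
  define S where "S = (\<lambda>p x. tdiff f f' p x - Lr p (w (fst p + snd p)) x - Ld (fst p) (?q p) x)"
  have WS: "wsmooth (-3/2) (tpairs \<delta>) S"
  proof -
    have "wsmooth (1/2 - 2) (tpairs \<delta>) (\<lambda>p. Lr p (w (fst p + snd p)))" by (rule wsmooth_Lr[OF wsmooth_at(2)[OF W]])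
    moreover have "wsmooth (1/2 - 2) (tpairs \<delta>) (\<lambda>p. Ld (fst p) (?q p))" by (rule wsmooth_Ld[OF q(1)])
    ultimately show ?thesis unfolding S_def by (intro wsmooth_diff f(3)) simp_all
  qed
  have Lqs: "L (fst p) (?q p) x = g (fst p) x + snd p * S p x" if p: "p \<in> tpairs \<delta>" and x: "x \<in> ball 0 1" for p x
  proof -
    have "w (fst p + snd p) y = w (fst p) y + snd p * ?q p y" for y using tpairsD(3)[OF p] by (simp add: tquot_def)
    then have "Ld (fst p) (w (fst p + snd p)) x = Ld (fst p) (\<lambda>y. w (fst p) y + snd p * ?q p y) x" by presburger
    also have "\<dots> = Ld (fst p) (w (fst p)) x + snd p * Ld (fst p) (?q p) x"
      by (rule Ld_lin[OF tpairsD(1)[OF p] sw[OF tpairsD(1)[OF p]] sq[OF p] x])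
    finally have 1: "Lq p (w (fst p + snd p)) x = Ld (fst p) (w (fst p)) x + snd p * Ld (fst p) (?q p) x + snd p * Lr p (w (fst p + snd p)) x"
      using Lq_expand[OF p sw[OF tpairsD(2)[OF p]] x] by simp
    show ?thesis
      unfolding q(4)[OF p x] 1 tquot_tdiff[OF tpairsD(3)[OF p], of f x f'] S_def g_def by (simp add: algebra_simps)
  qed
  have Wc: "wsmooth (1/2) (ttriples \<delta>) (tcauchy ?q)"
  proof (rule wsmooth_dirichlet[where t=fst])
    let ?p1 = "\<lambda>z::real\<times>real\<times>real. (fst z, fst (snd z))" and ?p2 = "\<lambda>z::real\<times>real\<times>real. (fst z, snd (snd z))"
    let ?k = "\<lambda>z::real\<times>real\<times>real. \<bar>fst (snd z)\<bar> + \<bar>snd (snd z)\<bar>"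
    have zp: "?p1 z \<in> tpairs \<delta>" "?p2 z \<in> tpairs \<delta>" if "z \<in> ttriples \<delta>" for z using that by (auto simp: ttriples_def)
    have eqc: "tcauchy ?q z = (\<lambda>x. (1 / ?k z) * (?q (?p1 z) x - ?q (?p2 z) x))" for z
      by (simp add: tcauchy_def fun_eq_iff)
    show "\<bar>fst z\<bar> \<le> \<delta>" if "z \<in> ttriples \<delta>" for z using tpairs_le(1)[OF zp(1)[OF that]] by simp
    show "smooth_on (ball 0 1) (tcauchy ?q z)" if z: "z \<in> ttriples \<delta>" for z
      unfolding eqc by (intro smooth_on_cmult smooth_on_diff open_ball sq zp[OF z])
    show "continuous_on (cball 0 1) (tcauchy ?q z)" if z: "z \<in> ttriples \<delta>" for z
      unfolding eqc by (intro continuous_intros q(2) zp[OF z])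
    show "tcauchy ?q z x = 0" if "z \<in> ttriples \<delta>" "x \<in> sphere 0 1" for z x
      unfolding eqc using q(3)[OF zp(1)[OF that(1)] that(2)] q(3)[OF zp(2)[OF that(1)] that(2)] by simp
    \<comment> \<open>The increments enter only divided by the sum of their sizes, hence with
      factors of size at most 1, uniformly over all triples.\<close>
    have kb: "\<bar>fst (snd z) / ?k z\<bar> \<le> 1" "\<bar>snd (snd z) / ?k z\<bar> \<le> 1" for z :: "real \<times> real \<times> real"
      by (auto simp: abs_divide divide_le_eq_1)
    have "wsmooth (-3/2) (ttriples \<delta>) (\<lambda>z x. (fst (snd z) / ?k z) * S (?p1 z) x - (snd (snd z) / ?k z) * S (?p2 z) x)"
      by (intro wsmooth_diff wsmooth_cmult[OF kb(1)] wsmooth_cmult[OF kb(2)] wsmooth_reindex[OF WS] zp)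
    moreover have "L (fst z) (tcauchy ?q z) x = (fst (snd z) / ?k z) * S (?p1 z) x - (snd (snd z) / ?k z) * S (?p2 z) x"
      if z: "z \<in> ttriples \<delta>" and x: "x \<in> ball 0 1" for z x
    proof -
      have t: "\<bar>fst z\<bar> < e" using small_e[OF tpairsD(1)[OF zp(1)[OF z]]] by simp
      note s = sq[OF zp(1)[OF z]] sq[OF zp(2)[OF z]]
      have "L (fst z) (tcauchy ?q z) x = (1 / ?k z) * (L (fst z) (?q (?p1 z)) x - L (fst z) (?q (?p2 z)) x)"
        unfolding eqc lframe_cmult[OF t smooth_on_diff[OF open_ball s] x] lframe_diff[OF t s x] ..
      also have "L (fst z) (?q (?p1 z)) x = g (fst z) x + fst (snd z) * S (?p1 z) x" using Lqs[OF zp(1)[OF z] x] by simp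
      also have "L (fst z) (?q (?p2 z)) x = g (fst z) x + snd (snd z) * S (?p2 z) x" using Lqs[OF zp(2)[OF z] x] by simp
      finally show ?thesis by (simp add: diff_divide_distrib)
    qed
    ultimately show "wsmooth (-3/2) (ttriples \<delta>) (\<lambda>z. L (fst z) (tcauchy ?q z))"
      using wsmooth_cong[of "ttriples \<delta>" "\<lambda>z. L (fst z) (tcauchy ?q z)"
        "\<lambda>z x. (fst (snd z) / ?k z) * S (?p1 z) x - (snd (snd z) / ?k z) * S (?p2 z) x" "-3/2"] by blast
  qed
  obtain w1 where w1: "\<And>t. \<bar>t\<bar> < \<delta> \<Longrightarrow> smooth_on (ball 0 1) (w1 t)"
    and W1: "wsmooth (1/2) (tpairs \<delta>) (\<lambda>p x. (?q p x - w1 (fst p) x) / snd p)"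
    using tquot_limit[OF sq Wc] by blast
  have D1: "tdiff w w1 p x = (?q p x - w1 (fst p) x) / snd p" if "p \<in> tpairs \<delta>" for p x
    using tpairsD(3)[OF that] by (simp add: tdiff_def tquot_def field_simps power2_eq_square)
  have W1': "wsmooth (1/2) (tpairs \<delta>) (tdiff w w1)"
    using wsmooth_cong[of "tpairs \<delta>" "tdiff w w1" "\<lambda>p x. (?q p x - w1 (fst p) x) / snd p" "1/2"] D1 W1 by blast
  have half: "(t, (\<delta> - \<bar>t\<bar>) / 2) \<in> tpairs \<delta>" if "\<bar>t\<bar> < \<delta>" for t
    using that unfolding tpairs_def by (auto simp: abs_less_iff field_simps)
  have small: "(t, h) \<in> tpairs \<delta>" if "0 < h" "h < \<delta> - \<bar>t\<bar>" for t h
    using that unfolding tpairs_def by auto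
  \<comment> \<open>For each time one increment is fixed, half the distance to the nearer end of the
    interval, so that bounds over pairs yield bounds over times.\<close>
  have Ww1: "wsmooth (1/2) {-\<delta><..<\<delta>} w1"
  proof -
    let ?f = "\<lambda>t. (t, (\<delta> - \<bar>t\<bar>) / 2)"
    have "wsmooth (1/2) {-\<delta><..<\<delta>} (\<lambda>t x. ?q (?f t) x - ((\<delta> - \<bar>t\<bar>) / 2) * tdiff w w1 (?f t) x)"
      by (intro wsmooth_diff wsmooth_cmult[of _ _ "\<delta>"] wsmooth_reindex[OF q(1), of _ ?f] wsmooth_reindex[OF W1', of _ ?f] half)
        (auto simp: abs_less_iff field_simps)
    moreover have "w1 t x = ?q (?f t) x - ((\<delta> - \<bar>t\<bar>) / 2) * tdiff w w1 (?f t) x" if t: "t \<in> {-\<delta><..<\<delta>}" for t x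
    proof -
      have e: "w1 (fst p) x = ?q p x - snd p * tdiff w w1 p x" if "p \<in> tpairs \<delta>" for p
        using tpairsD(3)[OF that] by (simp add: D1[OF that])
      have "\<bar>t\<bar> < \<delta>" using t by (simp add: abs_less_iff)
      from e[OF half[OF this]] show ?thesis unfolding fst_conv snd_conv .
    qed
    ultimately show ?thesis
      using wsmooth_cong[of "{-\<delta><..<\<delta>}" w1 "\<lambda>t x. ?q (?f t) x - ((\<delta> - \<bar>t\<bar>) / 2) * tdiff w w1 (?f t) x" "1/2"] by blast
  qed
  \<comment> \<open>The defect of the limit equation equals the increment times a quantity bounded
    at \<open>x\<close>, for every small increment.\<close>
  have Lw1: "L t (w1 t) x = g t x" if t: "\<bar>t\<bar> < \<delta>" and x: "x \<in> ball 0 1" for t x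
  proof (rule ccontr)
    assume ne: "L t (w1 t) x \<noteq> g t x"
    have "wsmooth (1/2 - 2) (tpairs \<delta>) (\<lambda>p. L (fst p) (tdiff w w1 p))" by (rule wsmooth_L[OF tpairs_le(1) W1'])
    then have "wsmooth (-3/2) (tpairs \<delta>) (\<lambda>p x. S p x - L (fst p) (tdiff w w1 p) x)"
      by (intro wsmooth_diff WS) simp
    then obtain C where C: "C > 0" "\<And>p x. p \<in> tpairs \<delta> \<Longrightarrow> x \<in> ball 0 1 \<Longrightarrow> \<bar>S p x - L (fst p) (tdiff w w1 p) x\<bar> \<le> C * bdef x powr (-3/2)"
      by (rule wsmoothE) blast
    define K where "K = C * bdef x powr (-3/2)"
    have K: "K > 0" unfolding K_def using C(1) bdef_norm(1)[of x] x by simp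
    define A where "A = \<bar>L t (w1 t) x - g t x\<bar>"
    have A: "A > 0" using ne by (simp add: A_def)
    have le: "A \<le> h * K" if h: "0 < h" "h < \<delta> - \<bar>t\<bar>" for h
    proof -
      have p: "(t, h) \<in> tpairs \<delta>" by (rule small[OF h])
      have "?q (t, h) y = w1 t y + h * tdiff w w1 (t, h) y" for y using D1[OF p, of y] h by simp
      then have "L t (?q (t, h)) x = L t (\<lambda>y. w1 t y + h * tdiff w w1 (t, h) y) x" by presburger
      also have "\<dots> = L t (w1 t) x + h * L t (tdiff w w1 (t, h)) x"
        using lframe_add[OF small_e[OF t] w1[OF t] smooth_on_cmult[OF open_ball wsmoothD(1)[OF W1' p]] x]
          lframe_cmult[OF small_e[OF t] wsmoothD(1)[OF W1' p] x] by simp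
      finally have "L t (w1 t) x - g t x = h * (S (t, h) x - L t (tdiff w w1 (t, h)) x)"
        using Lqs[OF p x] by (simp add: algebra_simps)
      then have "A = h * \<bar>S (t, h) x - L t (tdiff w w1 (t, h)) x\<bar>" using h by (simp add: A_def abs_mult)
      also have "\<dots> \<le> h * K" using C(2)[OF p x] h unfolding K_def by (intro mult_left_mono) auto
      finally show ?thesis .
    qed
    define h where "h = min (A / (2 * K)) ((\<delta> - \<bar>t\<bar>) / 2)"
    have h: "0 < h" "h \<le> A / (2 * K)" using A K t by (auto simp: h_def)
    have "h \<le> (\<delta> - \<bar>t\<bar>) / 2" unfolding h_def by (rule min.cobounded2)
    also have "\<dots> < \<delta> - \<bar>t\<bar>" using t by simp
    finally have "A \<le> h * K" using le h by blast
    also have "\<dots> \<le> A / (2 * K) * K" using h K by (intro mult_right_mono) auto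
    finally show False using A K by simp
  qed
  \<comment> \<open>\<open>w1\<close> is determined only inside the ball. Continued by zero it
    becomes continuous on the closed ball, by its bound of order
    \<open>bdef x powr (1/2)\<close>.\<close>
  define w' where "w' = (\<lambda>t x. if x \<in> ball 0 1 then w1 t x else 0)"
  have ww: "w' t x = w1 t x" if "x \<in> ball 0 1" for t x using that by (simp add: w'_def)
  obtain C where "C > 0" and C: "\<And>t x. t \<in> {-\<delta><..<\<delta>} \<Longrightarrow> x \<in> ball 0 1 \<Longrightarrow> \<bar>w1 t x\<bar> \<le> C * bdef x powr (1/2)"
    by (rule wsmoothE[OF Ww1]) blast
  have "dirichlet w' g"
    unfolding dirichlet_def
  proof (intro allI impI conjI ballI)
    fix t assume t: "\<bar>t\<bar> < \<delta>"
    show s: "smooth_on (ball 0 1) (w' t)" using smooth_on_cong[OF open_ball, of 0 1 "w' t" "w1 t"] ww w1[OF t] by blast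
    show "continuous_on (cball 0 1) (w' t)"
      by (rule continuous_on_cball_vanishing[OF smooth_on_continuous[OF s], of C])
        (use C[of t] t in \<open>auto simp: w'_def abs_less_iff\<close>)
    show "w' t x = 0" if "x \<in> sphere 0 1" for x using that by (simp add: w'_def)
    show "L t (w' t) x = g t x" if "x \<in> ball 0 1" for x
      using Lw1[OF t that] lframe_cong[OF open_ball ww that] by simp
  qed
  moreover have "wsmooth (1/2) (tpairs \<delta>) (tdiff w w')"
    using wsmooth_cong[of "tpairs \<delta>" "tdiff w w'" "tdiff w w1" "1/2"] W1' ww by (simp add: tdiff_def)
  ultimately show thesis using that unfolding g_def by blast
qed

text \<open>The time derivative \<open>w'\<close> solves a problem of the same kind. By the
  induction hypothesis for \<open>w\<close> itself, the term \<open>Ld t (w t)\<close> on its right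
  side is smooth in time to the order \<open>k\<close>, again with exponent -3/2, so the induction
  hypothesis applies to \<open>w'\<close> too.\<close>

lemma tsmooth_dirichlet:
  assumes "dirichlet w f" "tsmooth k \<delta> (-3/2) f"
  shows "tsmooth k \<delta> (1/2) w"
  using assms
proof (induction k arbitrary: w f)
  case 0
  then show ?case using dirichlet_wsmooth by (simp add: tsmooth.simps)
next
  case (Suc k)
  from Suc.prems(2) obtain f' where f': "tsmooth k \<delta> (-3/2) f'" "wsmooth (-3/2) (tpairs \<delta>) (tdiff f f')" by (rule tsmoothE)
  note W = tsmooth_wsmooth[OF Suc.prems(2)]
  obtain w' where w': "dirichlet w' (\<lambda>t x. f' t x - Ld t (w t) x)" "wsmooth (1/2) (tpairs \<delta>) (tdiff w w')"
    using dirichlet_derivative[OF Suc.prems(1) W tsmooth_wsmooth[OF f'(1)] f'(2)] by blast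
  have "tsmooth k \<delta> (1/2) w" by (rule Suc.IH[OF Suc.prems(1) tsmooth_SucD[OF Suc.prems(2)]])
  from tsmooth_Ld[OF this] have "tsmooth k \<delta> (-3/2) (\<lambda>t. Ld t (w t))" by simp
  then have "tsmooth k \<delta> (1/2) w'" by (intro Suc.IH[OF w'(1)] tsmooth_diff f'(1))
  then show ?case by (rule tsmoothI[OF dirichlet_wsmooth[OF Suc.prems(1) W] _ w'(2)])
qed

end

section \<open>Regularity up to the boundary\<close>

text \<open>The Hessian bound is integrable along rays, so the gradients of the dilated functions,
  \<open>w\<close> at \<open>r n\<close> times \<open>x\<close>, converge uniformly on the closed
  ball. Differentiating the limit of the dilations treats interior and boundary points at
  once.\<close>

lemma gradient_extends:
  fixes w :: "'a::euclidean_space \<Rightarrow> real"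
  assumes co: "continuous_on (cball 0 1) w" and sm: "smooth_on (ball 0 1) w"
    and H: "\<And>b k x. b \<in> Basis \<Longrightarrow> k \<in> Basis \<Longrightarrow> x \<in> ball 0 1 \<Longrightarrow> \<bar>pd b (pd k w) x\<bar> \<le> C * bdef x powr (-1/2)"
  shows "\<exists>g. continuous_on (cball 0 1) g \<and> (\<forall>x\<in>cball 0 1. (w has_derivative (\<lambda>h. g x \<bullet> h)) (at x within cball 0 1))"
proof -
  define K where "K = 2 * (DIM('a) * \<bar>C\<bar>)"
  have K: "K \<ge> 0" by (simp add: K_def)
  have inB: "s *\<^sub>R x \<in> ball 0 1" if "0 \<le> s" "s < 1" "x \<in> cball 0 1" for s and x :: 'a
  proof -
    have "s * norm x \<le> s * 1" using that by (intro mult_left_mono) auto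
    then show ?thesis using that by simp
  qed
  have est: "\<bar>pd k w (s *\<^sub>R x) - pd k w (r *\<^sub>R x)\<bar> \<le> K * sqrt (1 - r)"
    if r: "0 \<le> r" "r < s" "s < 1" and x: "x \<in> cball 0 1" and k: "k \<in> Basis" for r s x k
  proof -
    have d: "((\<lambda>s. pd k w (s *\<^sub>R x)) has_vector_derivative pd x (pd k w) (t *\<^sub>R x)) (at t)" if t: "0 \<le> t" "t < 1" for t
    proof -
      have D: "pd k w differentiable (at (t *\<^sub>R x))" by (rule smooth_onD[OF smooth_on_pd[OF sm] inB[OF t x]])
      have "((\<lambda>s. s *\<^sub>R x) has_derivative (\<lambda>h. h *\<^sub>R x)) (at t)" by (auto intro!: derivative_eq_intros)
      from has_derivative_compose[OF this has_derivative_pd[OF D]]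
      show ?thesis unfolding has_vector_derivative_def linear.scaleR[OF pd_linear[OF D]] .
    qed
    \<comment> \<open>The comparison function is a primitive of the Hessian bound along the
      ray.\<close>
    have "norm (pd k w (s *\<^sub>R x) - pd k w (r *\<^sub>R x)) \<le> (- K * sqrt (1 - s)) - (- K * sqrt (1 - r))"
    proof (rule differentiable_bound_general[OF r(2)])
      show "continuous_on {r..s} (\<lambda>s. pd k w (s *\<^sub>R x))"
      proof (rule continuous_at_imp_continuous_on, rule ballI)
        fix t assume "t \<in> {r..s}"
        then show "isCont (\<lambda>s. pd k w (s *\<^sub>R x)) t"
          using r by (intro has_vector_derivative_continuous[OF d]) auto
      qed
      show "continuous_on {r..s} (\<lambda>s. - K * sqrt (1 - s))" by (intro continuous_intros)
      fix t assume t: "r < t" "t < s"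
      then have t': "0 \<le> t" "t < 1" using r by auto
      show "((\<lambda>s. pd k w (s *\<^sub>R x)) has_vector_derivative pd x (pd k w) (t *\<^sub>R x)) (at t)" by (rule d[OF t'])
      show "((\<lambda>s. - K * sqrt (1 - s)) has_vector_derivative (K / 2) * (1 - t) powr (-1/2)) (at t)"
        unfolding has_real_derivative_iff_has_vector_derivative[symmetric]
        by (rule derivative_eq_intros refl | use t' in \<open>simp add: powr_minus powr_half_sqrt field_simps\<close>)+
      have B: "t *\<^sub>R x \<in> ball 0 1" by (rule inB[OF t' x])
      have "t\<^sup>2 \<le> t" using t' by (simp add: power2_eq_square mult_left_le)
      moreover have "x \<bullet> x \<le> 1" using x by (simp add: dot_square_norm power_le_one)
      ultimately have "t\<^sup>2 * (x \<bullet> x) \<le> t * 1" using t' by (intro mult_mono) auto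
      \<comment> \<open>On every ray \<open>bdef\<close> is at least \<open>1 - t\<close>, so one
        scalar weight serves all \<open>x\<close> of the closed ball.\<close>
      then have le: "1 - t \<le> bdef (t *\<^sub>R x)" by (simp add: bdef_def power2_eq_square mult.assoc)
      have "\<bar>pd x (pd k w) (t *\<^sub>R x)\<bar> = \<bar>\<Sum>b\<in>Basis. (x \<bullet> b) * pd b (pd k w) (t *\<^sub>R x)\<bar>"
        by (simp only: pd_expand[OF smooth_onD[OF smooth_on_pd[OF sm] B], of x] real_scaleR_def)
      also have "\<dots> \<le> (\<Sum>b\<in>(Basis::'a set). \<bar>C\<bar> * (1 - t) powr (-1/2))"
      proof (rule sum_abs[THEN order_trans], rule sum_mono)
        fix b :: 'a assume b: "b \<in> Basis"
        have "\<bar>(x \<bullet> b) * pd b (pd k w) (t *\<^sub>R x)\<bar> \<le> 1 * (\<bar>C\<bar> * (1 - t) powr (-1/2))"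
          unfolding abs_mult
        proof (rule mult_mono)
          show "\<bar>x \<bullet> b\<bar> \<le> 1" using Basis_le_norm[OF b, of x] x by simp
          have "\<bar>pd b (pd k w) (t *\<^sub>R x)\<bar> \<le> C * bdef (t *\<^sub>R x) powr (-1/2)" by (rule H[OF b k B])
          also have "\<dots> \<le> \<bar>C\<bar> * bdef (t *\<^sub>R x) powr (-1/2)" by (intro mult_right_mono) auto
          also have "\<dots> \<le> \<bar>C\<bar> * (1 - t) powr (-1/2)" using le t' by (intro mult_left_mono powr_mono2') auto
          finally show "\<bar>pd b (pd k w) (t *\<^sub>R x)\<bar> \<le> \<bar>C\<bar> * (1 - t) powr (-1/2)" .
        qed auto
        then show "\<bar>(x \<bullet> b) * pd b (pd k w) (t *\<^sub>R x)\<bar> \<le> \<bar>C\<bar> * (1 - t) powr (-1/2)" by simp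
      qed
      finally show "norm (pd x (pd k w) (t *\<^sub>R x)) \<le> (K / 2) * (1 - t) powr (-1/2)" by (simp add: K_def)
    qed
    also have "\<dots> \<le> K * sqrt (1 - r)" using K r by simp
    finally show ?thesis by simp
  qed
  define r where "r = (\<lambda>n. 1 - inverse (real (Suc (Suc n))))"
  have r: "0 \<le> r n" "r n < 1" for n by (auto simp: r_def inverse_le_1_iff)
  have mono: "r n < r m" if "n < m" for n m using that by (simp add: r_def)
  have rlim: "r \<longlonglongrightarrow> 1"
    unfolding r_def using tendsto_diff[OF tendsto_const LIMSEQ_Suc[OF LIMSEQ_inverse_real_of_nat], of 1] by simp
  have slim: "(\<lambda>n. K * sqrt (1 - r n)) \<longlonglongrightarrow> 0"
    using tendsto_mult_left[OF tendsto_real_sqrt[OF tendsto_diff[OF tendsto_const rlim, of 1]], of K] by simp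
  have "uniformly_convergent_on (cball 0 1) (\<lambda>n x. pd k w (r n *\<^sub>R x))" if k: "k \<in> Basis" for k
  proof (rule Cauchy_uniformly_convergent, rule uniformly_Cauchy_onI')
    fix e :: real assume e: "e > 0"
    have "\<forall>\<^sub>F n in sequentially. K * sqrt (1 - r n) < e" by (rule order_tendstoD(2)[OF slim e])
    then obtain N where N: "\<And>n. n \<ge> N \<Longrightarrow> K * sqrt (1 - r n) < e" unfolding eventually_sequentially by blast
    show "\<exists>M. \<forall>x\<in>cball 0 1. \<forall>m\<ge>M. \<forall>n>m. dist (pd k w (r m *\<^sub>R x)) (pd k w (r n *\<^sub>R x)) < e"
    proof (intro exI[of _ N] ballI allI impI)
      fix x :: 'a and m n assume x: "x \<in> cball 0 1" and mn: "N \<le> m" "m < n"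
      show "dist (pd k w (r m *\<^sub>R x)) (pd k w (r n *\<^sub>R x)) < e"
        using est[OF r(1) mono[OF mn(2)] r(2) x k] N[OF mn(1)] by (simp add: dist_real_def abs_minus_commute)
    qed
  qed
  then obtain g where g: "\<And>k. k \<in> Basis \<Longrightarrow> uniform_limit (cball 0 1) (\<lambda>n x. pd k w (r n *\<^sub>R x)) (g k) sequentially"
    unfolding uniformly_convergent_on_def by metis
  have cg: "continuous_on (cball 0 1) (g k)" if k: "k \<in> Basis" for k
  proof (rule uniform_limit_theorem[OF _ g[OF k] trivial_limit_sequentially], intro always_eventually allI)
    fix n
    show "continuous_on (cball 0 1) (\<lambda>x. pd k w (r n *\<^sub>R x))"
      by (rule continuous_on_compose2[OF smooth_on_continuous[OF smooth_on_pd[OF sm]]])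
        (use inB[OF r] in \<open>auto intro!: continuous_intros\<close>)
  qed
  have bg: "\<exists>M. \<forall>x\<in>cball 0 1. \<bar>g k x\<bar> \<le> M" if k: "k \<in> Basis" for k
  proof -
    have "bounded (g k ` cball 0 1)"
      by (rule compact_imp_bounded[OF compact_continuous_image[OF cg[OF k] compact_cball]])
    then show ?thesis unfolding bounded_iff by auto
  qed
  \<comment> \<open>The chain rule for the dilation contributes a factor \<open>r n\<close>, which
    tends to 1.\<close>
  have ug: "uniform_limit (cball 0 1) (\<lambda>n x. r n * pd k w (r n *\<^sub>R x)) (g k) sequentially" if k: "k \<in> Basis" for k
  proof -
    have "uniform_limit (cball 0 1) (\<lambda>n x. r n * pd k w (r n *\<^sub>R x)) (\<lambda>x. 1 * g k x) sequentially"
    proof (rule uniform_lim_mult[OF _ g[OF k]])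
      show "uniform_limit (cball 0 1) (\<lambda>n x. r n) (\<lambda>x. 1) sequentially"
        unfolding uniform_limit_iff using tendstoD[OF rlim] by auto
      show "bounded ((\<lambda>x. 1::real) ` cball (0::'a) 1)" by (auto simp: bounded_iff)
      show "bounded (g k ` cball 0 1)" using bg[OF k] by (auto simp: bounded_iff)
    qed
    then show ?thesis by simp
  qed
  define G where "G = (\<lambda>x. \<Sum>k\<in>Basis. g k x *\<^sub>R k)"
  have Gh: "G x \<bullet> h = (\<Sum>k\<in>Basis. (h \<bullet> k) * g k x)" for x h
    unfolding G_def inner_sum_left by (intro sum.cong refl) (simp add: inner_commute)
  have der: "((\<lambda>x. w (r n *\<^sub>R x)) has_derivative (\<lambda>h. \<Sum>k\<in>Basis. (h \<bullet> k) * (r n * pd k w (r n *\<^sub>R x)))) (at x within cball 0 1)"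
    if x: "x \<in> cball 0 1" for n x
  proof -
    have D: "w differentiable (at (r n *\<^sub>R x))" by (rule smooth_onD[OF sm inB[OF r x]])
    have "((\<lambda>x. r n *\<^sub>R x) has_derivative (\<lambda>h. r n *\<^sub>R h)) (at x within cball 0 1)" by (auto intro!: derivative_eq_intros)
    from has_derivative_compose[OF this has_derivative_pd[OF D]]
    have "((\<lambda>x. w (r n *\<^sub>R x)) has_derivative (\<lambda>h. pd (r n *\<^sub>R h) w (r n *\<^sub>R x))) (at x within cball 0 1)" .
    moreover have "pd (r n *\<^sub>R h) w (r n *\<^sub>R x) = (\<Sum>k\<in>Basis. (h \<bullet> k) * (r n * pd k w (r n *\<^sub>R x)))" for h
    proof -
      have "pd (r n *\<^sub>R h) w (r n *\<^sub>R x) = r n * pd h w (r n *\<^sub>R x)" using linear.scaleR[OF pd_linear[OF D]] by simp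
      also have "pd h w (r n *\<^sub>R x) = (\<Sum>k\<in>Basis. (h \<bullet> k) * pd k w (r n *\<^sub>R x))" using pd_expand[OF D, of h] by simp
      finally show ?thesis by (simp add: sum_distrib_left mult.left_commute)
    qed
    ultimately show ?thesis by simp
  qed
  have wlim: "(\<lambda>n. w (r n *\<^sub>R x)) \<longlonglongrightarrow> w x" if x: "x \<in> cball 0 1" for x
  proof (rule continuous_on_tendsto_compose[OF co _ x])
    show "(\<lambda>n. r n *\<^sub>R x) \<longlonglongrightarrow> x" using tendsto_scaleR[OF rlim tendsto_const, of x] by simp
    show "\<forall>\<^sub>F n in sequentially. r n *\<^sub>R x \<in> cball 0 1"
      using inB[OF r x] ball_subset_cball by (intro always_eventually allI) blast
  qed
  have "\<exists>w'. \<forall>x\<in>cball 0 1. (\<lambda>n. w (r n *\<^sub>R x)) \<longlonglongrightarrow> w' x \<and> (w' has_derivative (\<lambda>h. G x \<bullet> h)) (at x within cball 0 1)"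
  proof (rule has_derivative_sequence[where f="\<lambda>n x. w (r n *\<^sub>R x)" and g'="\<lambda>x h. G x \<bullet> h"
        and f'="\<lambda>n x h. \<Sum>k\<in>Basis. (h \<bullet> k) * (r n * pd k w (r n *\<^sub>R x))" and ?x0.0=0 and l="w 0", OF convex_cball der])
    show "(0::'a) \<in> cball 0 1" by simp
    then show "(\<lambda>n. w (r n *\<^sub>R 0)) \<longlonglongrightarrow> w 0" by (rule wlim)
    fix e :: real assume e: "e > 0"
    define e' where "e' = e / DIM('a)"
    have e': "e' > 0" using e by (simp add: e'_def)
    have "\<forall>\<^sub>F n in sequentially. \<forall>k\<in>Basis. \<forall>x\<in>cball 0 1. dist (r n * pd k w (r n *\<^sub>R x)) (g k x) < e'"
      using ug e' by (auto simp: eventually_ball_finite_distrib uniform_limit_iff)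
    then show "\<forall>\<^sub>F n in sequentially. \<forall>x\<in>cball 0 1. \<forall>h. norm ((\<Sum>k\<in>Basis. (h \<bullet> k) * (r n * pd k w (r n *\<^sub>R x))) - G x \<bullet> h) \<le> e * norm h"
    proof (rule eventually_mono, intro ballI allI)
      fix n and x h :: 'a assume Hn: "\<forall>k\<in>Basis. \<forall>x\<in>cball 0 1. dist (r n * pd k w (r n *\<^sub>R x)) (g k x) < e'" and x: "x \<in> cball 0 1"
      have "norm ((\<Sum>k\<in>Basis. (h \<bullet> k) * (r n * pd k w (r n *\<^sub>R x))) - G x \<bullet> h)
        = norm (\<Sum>k\<in>Basis. (h \<bullet> k) * (r n * pd k w (r n *\<^sub>R x) - g k x))"
        unfolding Gh by (simp add: sum_subtractf right_diff_distrib)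
      also have "\<dots> \<le> (\<Sum>k\<in>(Basis::'a set). norm h * e')"
      proof (rule sum_norm_le)
        fix k :: 'a assume k: "k \<in> Basis"
        have "\<bar>r n * pd k w (r n *\<^sub>R x) - g k x\<bar> \<le> e'" using Hn k x by (auto simp: dist_real_def less_imp_le)
        then show "norm ((h \<bullet> k) * (r n * pd k w (r n *\<^sub>R x) - g k x)) \<le> norm h * e'"
          unfolding real_norm_def abs_mult by (intro mult_mono Basis_le_norm k) auto
      qed
      also have "\<dots> = e * norm h" by (simp add: e'_def)
      finally show "norm ((\<Sum>k\<in>Basis. (h \<bullet> k) * (r n * pd k w (r n *\<^sub>R x))) - G x \<bullet> h) \<le> e * norm h" .
    qed
  qed
  then obtain w' where w': "\<And>x. x \<in> cball 0 1 \<Longrightarrow> (\<lambda>n. w (r n *\<^sub>R x)) \<longlonglongrightarrow> w' x"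
    "\<And>x. x \<in> cball 0 1 \<Longrightarrow> (w' has_derivative (\<lambda>h. G x \<bullet> h)) (at x within cball 0 1)" by blast
  have "w' x = w x" if "x \<in> cball 0 1" for x using LIMSEQ_unique[OF w'(1)[OF that] wlim[OF that]] .
  then have "(w has_derivative (\<lambda>h. G x \<bullet> h)) (at x within cball 0 1)" if "x \<in> cball 0 1" for x
    using has_derivative_transform[OF that _ w'(2)[OF that], of w] by simp
  moreover have "continuous_on (cball 0 1) G" unfolding G_def by (intro continuous_intros cg)
  ultimately show ?thesis by blast
qed

section \<open>Rotations of the ball and angular derivatives\<close>

definition rot :: "'a::euclidean_space \<Rightarrow> 'a \<Rightarrow> real \<Rightarrow> 'a \<Rightarrow> 'a" where
  "rot i j \<theta> x = x + ((cos \<theta> - 1) * (x \<bullet> i) - sin \<theta> * (x \<bullet> j)) *\<^sub>R i + ((cos \<theta> - 1) * (x \<bullet> j) + sin \<theta> * (x \<bullet> i)) *\<^sub>R j"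

lemma rot_zero [simp]: "rot i j 0 x = x"
  by (simp add: rot_def)

lemma rot_diff: "rot i j \<theta> x - rot i j \<theta> y = rot i j \<theta> (x - y)"
  by (simp add: rot_def inner_diff_left algebra_simps)

lemma rot_inner:
  assumes "i \<in> Basis" "j \<in> Basis" "i \<noteq> j"
  shows "rot i j \<theta> x \<bullet> rot i j \<theta> x = x \<bullet> x"
proof -
  define c s p q where "c = cos \<theta>" and "s = sin \<theta>" and "p = x \<bullet> i" and "q = x \<bullet> j"
  have cs: "c * c + s * s = 1" unfolding c_def s_def using sin_cos_squared_add3[of \<theta>] by simp
  have ii: "i \<bullet> i = 1" "j \<bullet> j = 1" "i \<bullet> j = 0" "j \<bullet> i = 0" using assms by (auto simp: inner_Basis)
  have "rot i j \<theta> x \<bullet> rot i j \<theta> x = x \<bullet> x + 2 * ((c - 1) * p - s * q) * p + 2 * ((c - 1) * q + s * p) * q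
      + ((c - 1) * p - s * q) * ((c - 1) * p - s * q) + ((c - 1) * q + s * p) * ((c - 1) * q + s * p)"
    unfolding rot_def by (simp add: inner_add_left inner_add_right ii c_def s_def p_def q_def inner_commute[of i x] inner_commute[of j x] algebra_simps)
  also have "\<dots> = x \<bullet> x + (c * c + s * s - 1) * (p * p + q * q)" by (simp add: algebra_simps)
  finally show ?thesis by (simp add: cs)
qed

lemma rot_norm: "i \<in> Basis \<Longrightarrow> j \<in> Basis \<Longrightarrow> i \<noteq> j \<Longrightarrow> norm (rot i j \<theta> x) = norm x"
  by (simp add: norm_eq_sqrt_inner rot_inner)

lemma smooth_on_rot:
  assumes "open U" shows "smooth_on U (\<lambda>z. rot i j (fst z) (snd z))"
proof -
  have cs: "smooth_on U (\<lambda>z::real\<times>'a. cos (fst z))" "smooth_on U (\<lambda>z::real\<times>'a. sin (fst z))"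
    using smooth_on_compose[OF assms open_UNIV _ smooth_on_cos_sin smooth_on_fst[OF assms], of 1 0]
      smooth_on_compose[OF assms open_UNIV _ smooth_on_cos_sin smooth_on_fst[OF assms], of 0 1] by auto
  show ?thesis
    unfolding rot_def
    by (intro smooth_on_add smooth_on_scaleR smooth_on_diff smooth_on_mult smooth_on_inner smooth_on_const
        smooth_on_snd cs assms)
qed

lemma rot_derivative:
  "((\<lambda>\<theta>. rot i j \<theta> x) has_derivative (\<lambda>h. h *\<^sub>R ((x \<bullet> i) *\<^sub>R j - (x \<bullet> j) *\<^sub>R i))) (at 0)"
  unfolding rot_def by (auto intro!: derivative_eq_intros simp: algebra_simps)

context domain_family
begin

text \<open>Rotations are isometries that preserve the ball and the square norm, so every assumption
  on \<open>\<Phi> t\<close> is inherited with the angle in the role of time. The estimates hold for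
  all angles, and the bounds 2 and 1 are arbitrary.\<close>

lemma rotated_family:
  assumes t: "\<bar>t\<bar> < e" and ij: "i \<in> Basis" "j \<in> Basis" "i \<noteq> j"
  shows "domain_family (\<lambda>\<theta> x. \<Phi> t (rot i j \<theta> x)) 2 1"
proof -
  let ?R = "\<lambda>\<theta> x. \<Phi> t (rot i j \<theta> x)"
  note n = rot_norm[OF ij]
  interpret R: frame_family ?R 2 1
  proof
    have O: "open ({-2<..<2::real} \<times> (ball 0 2 :: (real^'n) set))" by (intro open_Times) auto
    have "smooth_on ({-2<..<2} \<times> ball 0 2) (\<lambda>z. ?R (fst z) (snd z))"
      by (rule smooth_on_compose[OF O open_ball _ smooth_t[OF t] smooth_on_rot[OF O]]) (use n in auto)
    then show "smooth_on ({-2<..<2} \<times> ball 0 2) (\<lambda>(\<theta>, x). ?R \<theta> x)" by (simp add: case_prod_beta')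
    fix \<theta> :: real and x y :: "real^'n" assume "x \<in> ball 0 2" "y \<in> ball 0 2"
    then show "norm (x - y) \<le> 2 * norm (?R \<theta> x - ?R \<theta> y)" "norm (?R \<theta> x - ?R \<theta> y) \<le> 2 * norm (x - y)"
      using low[OF t, of "rot i j \<theta> x" "rot i j \<theta> y"] up[OF t, of "rot i j \<theta> x" "rot i j \<theta> y"] n rot_diff[of i j \<theta> x y] by auto
  qed auto
  show ?thesis
  proof
    fix \<theta> :: real and x :: "real^'n" assume \<theta>: "\<bar>\<theta>\<bar> < 2" and x: "x \<in> ball 0 1"
    note S = open_ball[of "0::real^'n" 1] ball12(1)
    have sq: "smooth_on (ball 0 1) (\<lambda>x::real^'n. x \<bullet> x)" by (intro smooth_on_inner smooth_on_ident open_ball)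
    obtain u where u: "smooth_on (\<Phi> t ` ball 0 1) u" "\<And>x. x \<in> ball 0 1 \<Longrightarrow> u (\<Phi> t x) = x \<bullet> x"
      using pullback[OF t S sq] by blast
    have rx: "rot i j \<theta> y \<in> ball 0 1" if "y \<in> ball 0 1" for y using that n by simp
    have "lframe ?R \<theta> (\<lambda>x. x \<bullet> x) x = lframe ?R \<theta> (\<lambda>x. u (?R \<theta> x)) x"
      by (rule lframe_cong[OF S(1) _ x]) (simp add: u(2)[OF rx] rot_inner[OF ij])
    also have "\<dots> = laplacian u (?R \<theta> x)"
      by (rule R.lframe_compose[OF \<theta> S _ smooth_on_Ck[OF u(1)] x]) (use rx in blast)
    also have "\<dots> = L t (\<lambda>x. u (\<Phi> t x)) (rot i j \<theta> x)"
      by (rule lframe_compose[OF t S _ smooth_on_Ck[OF u(1)] rx[OF x], symmetric]) auto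
    also have "\<dots> = L t (\<lambda>x. x \<bullet> x) (rot i j \<theta> x)"
      by (rule lframe_cong[OF S(1) _ rx[OF x]]) (simp add: u(2))
    finally show "1 \<le> lframe ?R \<theta> (\<lambda>x. x \<bullet> x) x" using lframe_sq[OF t rx[OF x]] by simp
  qed
qed

text \<open>Rotating \<open>w\<close> gives a family of solutions with the angle as parameter, and
  by \<open>tsmooth_dirichlet\<close> the derivative in the angle has the same exponent 1/2 as
  \<open>w\<close>. At angle zero it is the angular derivative, which thus gains a full power over
  the general first derivative.\<close>

lemma angular_estimate:
  assumes t: "\<bar>t\<bar> < e" and w: "smooth_on (ball 0 1) w" "continuous_on (cball 0 1) w" "\<And>x. x \<in> sphere 0 1 \<Longrightarrow> w x = 0"
    and Lw: "\<And>x. x \<in> ball 0 1 \<Longrightarrow> L t w x = f x" and f: "smooth_on (ball 0 2) f"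
    and ij: "i \<in> Basis" "j \<in> Basis" "i \<noteq> j"
  shows "wsmooth (1/2) {()} (\<lambda>_ x. (x \<bullet> i) * pd j w x - (x \<bullet> j) * pd i w x)"
proof -
  let ?R = "\<lambda>\<theta> x. \<Phi> t (rot i j \<theta> x)"
  interpret R: domain_family ?R 2 1 by (rule rotated_family[OF t ij])
  note n = rot_norm[OF ij]
  note S = open_ball[of "0::real^'n" 1] ball12(1)
  define W where "W = (\<lambda>\<theta> x. w (rot i j \<theta> x))"
  have rx: "rot i j \<theta> y \<in> ball 0 1" if "y \<in> ball 0 1" for \<theta> y using that n by simp
  have sr: "smooth_on U (rot i j \<theta>)" if "open U" for U \<theta>
    using smooth_on_slice[OF smooth_on_rot[OF open_Times[OF open_UNIV that]] open_UNIV that, of \<theta> i j] by simp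
  have D: "R.dirichlet W (\<lambda>\<theta> x. f (rot i j \<theta> x))"
    unfolding R.dirichlet_def
  proof (intro allI impI conjI ballI)
    fix \<theta> :: real assume "\<bar>\<theta>\<bar> < 1"
    then have \<theta>: "\<bar>\<theta>\<bar> < 2" by simp
    show "smooth_on (ball 0 1) (W \<theta>)"
      unfolding W_def by (rule smooth_on_compose[OF open_ball open_ball rx w(1) sr[OF open_ball]])
    show "continuous_on (cball 0 1) (W \<theta>)"
      unfolding W_def
      by (rule continuous_on_compose2[OF w(2) continuous_on_subset[OF smooth_on_continuous[OF sr[OF open_UNIV]]]])
        (use n in auto)
    show "W \<theta> x = 0" if "x \<in> sphere 0 1" for x unfolding W_def using w(3) that n by simp
    obtain u where u: "smooth_on (\<Phi> t ` ball 0 1) u" "\<And>x. x \<in> ball 0 1 \<Longrightarrow> u (\<Phi> t x) = w x"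
      using pullback[OF t S w(1)] by blast
    show "lframe ?R \<theta> (W \<theta>) x = f (rot i j \<theta> x)" if x: "x \<in> ball 0 1" for x
    proof -
      have "lframe ?R \<theta> (W \<theta>) x = lframe ?R \<theta> (\<lambda>x. u (?R \<theta> x)) x"
        by (rule lframe_cong[OF S(1) _ x]) (simp add: u(2)[OF rx] W_def)
      also have "\<dots> = laplacian u (?R \<theta> x)"
        by (rule R.lframe_compose[OF \<theta> S _ smooth_on_Ck[OF u(1)] x]) (use rx in blast)
      also have "\<dots> = L t (\<lambda>x. u (\<Phi> t x)) (rot i j \<theta> x)"
        by (rule lframe_compose[OF t S _ smooth_on_Ck[OF u(1)] rx[OF x], symmetric]) auto
      also have "\<dots> = L t w (rot i j \<theta> x)"
        by (rule lframe_cong[OF S(1) _ rx[OF x]]) (simp add: u(2))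
      finally show ?thesis using Lw[OF rx[OF x]] by simp
    qed
  qed
  have O: "open ({-2<..<2::real} \<times> (ball 0 2 :: (real^'n) set))" by (intro open_Times) auto
  have "smooth_on ({-2<..<2} \<times> ball 0 2) (\<lambda>z. f (rot i j (fst z) (snd z)))"
    by (rule smooth_on_compose[OF O open_ball _ f smooth_on_rot[OF O]]) (use n in auto)
  from tsmooth_param[OF this open_ball ball12(2), of 1 "Suc 0"]
  have "tsmooth (Suc 0) 1 (-3/2) (\<lambda>\<theta> x. f (rot i j \<theta> x))" by (intro tsmooth_weaken[of "-3/2" 0]) simp_all
  from R.tsmooth_dirichlet[OF D this] have T: "tsmooth (Suc 0) 1 (1/2) W" .
  then obtain W' where W': "tsmooth 0 1 (1/2) W'" "wsmooth (1/2) (tpairs 1) (tdiff W W')" by (rule tsmoothE)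
  have W0: "W 0 = w" by (simp add: W_def)
  \<comment> \<open>The derivative supplied by \<open>tsmooth\<close> is identified by computing the
    derivative of \<open>\<lambda>\<theta>. W \<theta> x\<close> at zero in two ways, from the
    remainder bound and from the chain rule.\<close>
  have W'0: "W' 0 x = (x \<bullet> i) * pd j w x - (x \<bullet> j) * pd i w x" if x: "x \<in> ball 0 1" for x
  proof -
    obtain C where C: "C > 0" "\<And>p x. p \<in> tpairs 1 \<Longrightarrow> x \<in> ball 0 1 \<Longrightarrow> \<bar>tdiff W W' p x\<bar> \<le> C * bdef x powr (1/2)"
      by (rule wsmoothE[OF W'(2)]) blast
    define Q where "Q = (\<lambda>\<theta>. W \<theta> x - W 0 x - \<theta> * W' 0 x)"
    have "(Q has_derivative (\<lambda>h. 0)) (at 0)"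
    proof (rule has_derivative_quadratic[of "{-1<..<1}"])
      fix \<theta> :: real assume \<theta>: "\<theta> \<in> {-1<..<1}"
      show "\<bar>Q \<theta>\<bar> \<le> C * bdef x powr (1/2) * (norm (\<theta> - 0))\<^sup>2"
      proof (cases "\<theta> = 0")
        case False
        then have p: "(0, \<theta>) \<in> tpairs 1" using \<theta> by (auto simp: tpairs_def)
        have "Q \<theta> = tdiff W W' (0, \<theta>) x * \<theta>\<^sup>2" using False by (simp add: Q_def tdiff_def)
        then show ?thesis using C(2)[OF p x] by (simp add: abs_mult mult_right_mono)
      qed (simp add: Q_def)
    qed auto
    moreover have "((\<lambda>\<theta>. W 0 x + \<theta> * W' 0 x) has_derivative (\<lambda>h. h * W' 0 x)) (at 0)"
      by (auto intro!: derivative_eq_intros)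
    ultimately have "((\<lambda>\<theta>. Q \<theta> + (W 0 x + \<theta> * W' 0 x)) has_derivative (\<lambda>h. 0 + h * W' 0 x)) (at 0)"
      by (rule has_derivative_add)
    then have 1: "((\<lambda>\<theta>. W \<theta> x) has_derivative (\<lambda>h. h * W' 0 x)) (at 0)" by (simp add: Q_def)
    have dw: "w differentiable (at (rot i j 0 x))" using smooth_onD[OF w(1) x] by simp
    have 2: "((\<lambda>\<theta>. W \<theta> x) has_derivative (\<lambda>h. pd (h *\<^sub>R ((x \<bullet> i) *\<^sub>R j - (x \<bullet> j) *\<^sub>R i)) w (rot i j 0 x))) (at 0)"
      unfolding W_def by (rule has_derivative_compose[OF rot_derivative has_derivative_pd[OF dw]])
    interpret lw: linear "\<lambda>v. pd v w x" by (rule pd_linear[OF smooth_onD[OF w(1) x]])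
    have "W' 0 x = pd ((x \<bullet> i) *\<^sub>R j - (x \<bullet> j) *\<^sub>R i) w x"
      using fun_cong[OF has_derivative_unique[OF 1 2], of 1] by simp
    then show ?thesis by (simp add: lw.diff lw.scaleR)
  qed
  have "wsmooth (1/2) {()} (\<lambda>_. W' 0)" by (rule wsmooth_reindex[OF tsmooth_wsmooth[OF W'(1)]]) auto
  then show "wsmooth (1/2) {()} (\<lambda>_ x. (x \<bullet> i) * pd j w x - (x \<bullet> j) * pd i w x)"
    using wsmooth_cong[of "{()}" "\<lambda>_. W' 0" "\<lambda>_ x. (x \<bullet> i) * pd j w x - (x \<bullet> j) * pd i w x"] W'0 by simp
qed

end

section \<open>The Hessian near the sphere\<close>

lemma wsmooth_const_family:
  fixes f :: "'a::euclidean_space \<Rightarrow> real"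
  assumes f: "smooth_on U f" and U: "open U" "cball 0 1 \<subseteq> U"
  shows "wsmooth 0 I (\<lambda>_. f)"
proof -
  have "smooth_on ((UNIV::real set) \<times> U) (\<lambda>z. f (snd z))"
    by (rule smooth_on_compose[OF open_Times[OF open_UNIV U(1)] U(1) _ f smooth_on_snd[OF open_Times[OF open_UNIV U(1)]]]) auto
  from wsmooth_param[OF this open_UNIV _ _ U, of "{0}"]
  have "wsmooth 0 {0::real} (\<lambda>p. f)" by simp
  from wsmooth_reindex[OF this, of I "\<lambda>_. 0"] show ?thesis by simp
qed

lemma bounded_on_cball:
  fixes f :: "'a::euclidean_space \<Rightarrow> real"
  assumes "continuous_on U f" "cball 0 1 \<subseteq> U"
  obtains M where "M \<ge> 0" "\<And>x. x \<in> cball 0 1 \<Longrightarrow> \<bar>f x\<bar> \<le> M"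
proof -
  have "bounded (f ` cball 0 1)"
    by (rule compact_imp_bounded[OF compact_continuous_image[OF continuous_on_subset[OF assms] compact_cball]])
  then obtain M where "\<forall>y\<in>f ` cball 0 1. norm y \<le> M" unfolding bounded_iff by blast
  then have M: "\<And>x. x \<in> cball 0 1 \<Longrightarrow> \<bar>f x\<bar> \<le> M" by simp
  moreover have "M \<ge> 0" using M[of 0] by force
  ultimately show thesis using that by blast
qed

lemma weight_mono:
  fixes h p :: "'a \<Rightarrow> real"
  assumes "\<forall>x\<in>S. h x \<le> M * p x powr \<gamma>" "M \<le> M'"
  shows "\<forall>x\<in>S. h x \<le> M' * p x powr \<gamma>"
proof
  fix x assume "x \<in> S"
  then have "h x \<le> M * p x powr \<gamma>" using assms by blast
  also have "\<dots> \<le> M' * p x powr \<gamma>" using assms by (intro mult_right_mono) auto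
  finally show "h x \<le> M' * p x powr \<gamma>" .
qed

lemma finite_uniform_bound:
  fixes P :: "'i \<Rightarrow> real \<Rightarrow> bool"
  assumes "finite I" "\<And>i. i \<in> I \<Longrightarrow> \<exists>M. P i M" "\<And>i M M'. P i M \<Longrightarrow> M \<le> M' \<Longrightarrow> P i M'"
  shows "\<exists>M>0. \<forall>i\<in>I. P i M"
proof -
  from assms(2) obtain m where m: "\<And>i. i \<in> I \<Longrightarrow> P i (m i)" by metis
  define M where "M = (\<Sum>i\<in>I. \<bar>m i\<bar>) + 1"
  have "m i \<le> M" if "i \<in> I" for i
    using member_le_sum[of i I "\<lambda>i. \<bar>m i\<bar>"] assms(1) that unfolding M_def by simp
  then have "P i M" if "i \<in> I" for i using m assms(3) that by blast
  moreover have "M > 0" unfolding M_def by (simp add: add_nonneg_pos sum_nonneg)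
  ultimately show ?thesis by blast
qed

text \<open>A symmetric matrix whose rows are all almost parallel to the position vector is almost a
  multiple of the projection onto it, and the multiple is controlled by any trace of the matrix
  against a positive matrix.\<close>

lemma radial_matrix:
  fixes H :: "'a::euclidean_space \<Rightarrow> 'a \<Rightarrow> real" and x :: 'a
  assumes sym: "\<And>k l. k \<in> Basis \<Longrightarrow> l \<in> Basis \<Longrightarrow> H k l = H l k"
    and ang: "\<And>b i j. b \<in> Basis \<Longrightarrow> i \<in> Basis \<Longrightarrow> j \<in> Basis \<Longrightarrow> \<bar>(x \<bullet> i) * H b j - (x \<bullet> j) * H b i\<bar> \<le> \<kappa>"
    and x: "norm x \<le> 1"
  defines "Q \<equiv> \<Sum>l\<in>Basis. (x \<bullet> l) * (\<Sum>j\<in>Basis. (x \<bullet> j) * H l j)"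
  assumes kl: "k \<in> Basis" "l \<in> Basis"
  shows "\<bar>(x \<bullet> x)\<^sup>2 * H k l - (x \<bullet> k) * (x \<bullet> l) * Q\<bar> \<le> 2 * (real DIM('a))\<^sup>2 * \<kappa>"
proof -
  define n where "n = real DIM('a)"
  define V where "V = (\<lambda>l. \<Sum>j\<in>Basis. (x \<bullet> j) * H l j)"
  define \<rho> where "\<rho> = x \<bullet> x"
  have Vl: "V l = (\<Sum>j\<in>Basis. (x \<bullet> j) * H l j)" for l by (simp add: V_def)
  have QV: "Q = (\<Sum>j\<in>Basis. (x \<bullet> j) * V j)" by (simp add: Q_def V_def)
  have n: "n \<ge> 1" unfolding n_def by (simp add: DIM_ge_Suc0 Suc_le_eq)
  have \<kappa>: "\<kappa> \<ge> 0" using ang[OF kl(1,1,1)] by simp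
  have \<rho>: "0 \<le> \<rho>" "\<rho> \<le> 1" using x by (auto simp: \<rho>_def dot_square_norm power_le_one)
  have xj: "\<bar>x \<bullet> j\<bar> \<le> 1" if "j \<in> Basis" for j using Basis_le_norm[OF that, of x] x by simp
  have \<rho>s: "\<rho> = (\<Sum>j\<in>Basis. (x \<bullet> j) * (x \<bullet> j))" unfolding \<rho>_def by (rule euclidean_inner)
  have sb: "\<bar>\<Sum>j\<in>(Basis::'a set). (x \<bullet> j) * f j\<bar> \<le> n * B" if "\<And>j. j \<in> Basis \<Longrightarrow> \<bar>f j\<bar> \<le> B" for f B
  proof -
    have "\<bar>\<Sum>j\<in>(Basis::'a set). (x \<bullet> j) * f j\<bar> \<le> (\<Sum>j\<in>(Basis::'a set). B)"
    proof (rule order_trans[OF sum_abs], rule sum_mono)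
      fix j :: 'a assume j: "j \<in> Basis"
      have "\<bar>x \<bullet> j\<bar> * \<bar>f j\<bar> \<le> 1 * B" using xj[OF j] that[OF j] by (intro mult_mono) auto
      then show "\<bar>(x \<bullet> j) * f j\<bar> \<le> B" by (simp add: abs_mult)
    qed
    then show ?thesis by (simp add: n_def)
  qed
  \<comment> \<open>First contraction with \<open>x\<close>: every row of \<open>H\<close> is nearly
    a multiple of \<open>x\<close>.\<close>
  have e1: "\<bar>\<rho> * H l k - (x \<bullet> k) * V l\<bar> \<le> n * \<kappa>" if "k \<in> Basis" "l \<in> Basis" for k l
  proof -
    have "\<rho> * H l k - (x \<bullet> k) * V l = (\<Sum>j\<in>Basis. (x \<bullet> j) * ((x \<bullet> j) * H l k - (x \<bullet> k) * H l j))"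
      unfolding \<rho>s V_def sum_distrib_right sum_distrib_left sum_subtractf[symmetric]
      by (intro sum.cong refl) (simp add: algebra_simps)
    also have "\<bar>\<dots>\<bar> \<le> n * \<kappa>" by (rule sb) (rule ang[OF that(2) _ that(1)])
    finally show ?thesis .
  qed
  \<comment> \<open>Second contraction, in the other index; this is where the symmetry of
    \<open>H\<close> enters.\<close>
  have e2: "\<bar>\<rho> * V l - (x \<bullet> l) * Q\<bar> \<le> n * (n * \<kappa>)" if "l \<in> Basis" for l
  proof -
    have "\<rho> * V l - (x \<bullet> l) * Q = (\<Sum>j\<in>Basis. (x \<bullet> j) * (\<rho> * H j l - (x \<bullet> l) * V j))"
      unfolding QV Vl[of l] sum_distrib_left sum_subtractf[symmetric]
      by (intro sum.cong refl) (simp add: algebra_simps sym[OF that])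
    also have "\<bar>\<dots>\<bar> \<le> n * (n * \<kappa>)" by (rule sb) (rule e1[OF that])
    finally show ?thesis .
  qed
  have "\<rho>\<^sup>2 * H k l - (x \<bullet> k) * (x \<bullet> l) * Q = \<rho> * (\<rho> * H l k - (x \<bullet> k) * V l) + (x \<bullet> k) * (\<rho> * V l - (x \<bullet> l) * Q)"
    using sym[OF kl] by (simp add: algebra_simps power2_eq_square)
  also have "\<bar>\<dots>\<bar> \<le> \<bar>\<rho>\<bar> * \<bar>\<rho> * H l k - (x \<bullet> k) * V l\<bar> + \<bar>x \<bullet> k\<bar> * \<bar>\<rho> * V l - (x \<bullet> l) * Q\<bar>"
    using abs_triangle_ineq by (simp add: abs_mult[symmetric])
  also have "\<dots> \<le> 1 * (n * \<kappa>) + 1 * (n * (n * \<kappa>))"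
    using \<rho> xj[OF kl(1)] e1[OF kl] e2[OF kl(2)] by (intro add_mono mult_mono) auto
  also have "\<dots> \<le> n * (n * \<kappa>) + n * (n * \<kappa>)"
  proof -
    have "0 \<le> n * \<kappa>" using n \<kappa> by simp
    from mult_right_mono[OF n this] show ?thesis by (simp only: mult_1_left mult_1_right add_right_mono)
  qed
  finally show ?thesis unfolding \<rho>_def n_def by (simp add: power2_eq_square mult_ac)
qed

context domain_family
begin

text \<open>Differentiating an angular derivative costs one power and leaves
  \<open>bdef x powr (-1/2)\<close>, which controls the Hessian except for its radial part. That
  part is read off from the equation, whose radial coefficient is bounded below away from the
  centre. The general bound \<open>bdef x powr (-3/2)\<close> is used only near the centre.\<close>

lemma hessian_estimate:
  assumes t: "\<bar>t\<bar> \<le> \<delta>" and w: "smooth_on (ball 0 1) w" "continuous_on (cball 0 1) w" "\<And>x. x \<in> sphere 0 1 \<Longrightarrow> w x = 0"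
    and Lw: "\<And>x. x \<in> ball 0 1 \<Longrightarrow> L t w x = f x" and f: "smooth_on (ball 0 2) f"
  shows "\<exists>C. \<forall>b\<in>Basis. \<forall>k\<in>Basis. \<forall>x\<in>ball 0 1. \<bar>pd b (pd k w) x\<bar> \<le> C * bdef x powr (-1/2)"
proof -
  let ?B = "Basis :: (real^'n) set"
  note te = abs_interval[OF t]
  define n where "n = real DIM(real^'n)"
  have n: "n \<ge> 1" unfolding n_def by (simp add: DIM_ge_Suc0 Suc_le_eq)
  have "wsmooth 0 {()} (\<lambda>_. f)" by (rule wsmooth_const_family[OF f open_ball ball12(2)])
  then have "wsmooth (-3/2) {()} (\<lambda>_. f)" by (rule wsmooth_weaken) simp
  then have "wsmooth (-3/2) {()} (\<lambda>_. L t w)"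
    using wsmooth_cong[of "{()}" "\<lambda>_. L t w" "\<lambda>_. f" "-3/2"] Lw by simp
  then have W: "wsmooth (1/2) {()} (\<lambda>_. w)"
    by (intro wsmooth_dirichlet[where t="\<lambda>_. t" and w="\<lambda>_. w"]) (use t w in auto)
  have "\<exists>C1>0. \<forall>k\<in>?B. \<forall>x\<in>ball 0 1. \<bar>pd k w x\<bar> \<le> C1 * bdef x powr (-1/2)"
  proof (rule finite_uniform_bound[of ?B "\<lambda>k C. \<forall>x\<in>ball 0 1. \<bar>pd k w x\<bar> \<le> C * bdef x powr (-1/2)"])
    show "\<exists>C. \<forall>x\<in>ball 0 1. \<bar>pd k w x\<bar> \<le> C * bdef x powr (-1/2)" if k: "k \<in> ?B" for k
    proof -
      obtain C where "C > 0" and C: "\<And>i x. i \<in> {()} \<Longrightarrow> x \<in> ball 0 1 \<Longrightarrow> \<bar>pd k w x\<bar> \<le> C * bdef x powr (1/2 - 1)"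
        by (rule wsmoothE[OF wsmooth_pd[OF W k]]) blast
      have "\<forall>x\<in>ball 0 1. \<bar>pd k w x\<bar> \<le> C * bdef x powr (1/2 - 1)" using C by blast
      then show ?thesis by (intro exI[of _ C]) simp
    qed
  qed (simp, erule (1) weight_mono)
  then obtain C1 where C1: "C1 > 0" "\<And>k. k \<in> ?B \<Longrightarrow> \<forall>x\<in>ball 0 1. \<bar>pd k w x\<bar> \<le> C1 * bdef x powr (-1/2)" by blast
  have "\<exists>C2>0. \<forall>bk\<in>?B \<times> ?B. \<forall>x\<in>ball 0 1. \<bar>pd (fst bk) (pd (snd bk) w) x\<bar> \<le> C2 * bdef x powr (-3/2)"
  proof (rule finite_uniform_bound[of "?B \<times> ?B" "\<lambda>bk C. \<forall>x\<in>ball 0 1. \<bar>pd (fst bk) (pd (snd bk) w) x\<bar> \<le> C * bdef x powr (-3/2)"])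
    show "\<exists>C. \<forall>x\<in>ball 0 1. \<bar>pd (fst bk) (pd (snd bk) w) x\<bar> \<le> C * bdef x powr (-3/2)" if bk: "bk \<in> ?B \<times> ?B" for bk
    proof -
      have "fst bk \<in> ?B" "snd bk \<in> ?B" using bk by auto
      from wsmooth_pd[OF wsmooth_pd[OF W this(2)] this(1)]
      obtain C where "C > 0" and C: "\<And>i x. i \<in> {()} \<Longrightarrow> x \<in> ball 0 1 \<Longrightarrow>
          \<bar>pd (fst bk) (pd (snd bk) w) x\<bar> \<le> C * bdef x powr (1/2 - 1 - 1)"
        by (rule wsmoothE) blast
      have "\<forall>x\<in>ball 0 1. \<bar>pd (fst bk) (pd (snd bk) w) x\<bar> \<le> C * bdef x powr (1/2 - 1 - 1)" using C by blast
      then show ?thesis by (intro exI[of _ C]) simp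
    qed
  qed (simp, erule (1) weight_mono)
  then obtain C2 where C2: "C2 > 0" "\<And>bk. bk \<in> ?B \<times> ?B \<Longrightarrow> \<forall>x\<in>ball 0 1. \<bar>pd (fst bk) (pd (snd bk) w) x\<bar> \<le> C2 * bdef x powr (-3/2)" by blast
  have "\<exists>A>0. \<forall>p\<in>?B \<times> ?B \<times> ?B. \<forall>x\<in>ball 0 1.
     \<bar>(x \<bullet> fst (snd p)) * pd (fst p) (pd (snd (snd p)) w) x - (x \<bullet> snd (snd p)) * pd (fst p) (pd (fst (snd p)) w) x\<bar> \<le> A * bdef x powr (-1/2)"
  proof (rule finite_uniform_bound[of "?B \<times> ?B \<times> ?B" "\<lambda>p A. \<forall>x\<in>ball 0 1.
     \<bar>(x \<bullet> fst (snd p)) * pd (fst p) (pd (snd (snd p)) w) x - (x \<bullet> snd (snd p)) * pd (fst p) (pd (fst (snd p)) w) x\<bar> \<le> A * bdef x powr (-1/2)"])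
    fix p assume p: "p \<in> ?B \<times> ?B \<times> ?B"
    obtain b i j where bij: "p = (b, i, j)" by (cases p)
    have B: "b \<in> ?B" "i \<in> ?B" "j \<in> ?B" using p bij by auto
    have "\<exists>A. \<forall>x\<in>ball 0 1. \<bar>(x \<bullet> i) * pd b (pd j w) x - (x \<bullet> j) * pd b (pd i w) x\<bar> \<le> A * bdef x powr (-1/2)"
    proof (cases "i = j")
      case True
      then show ?thesis by (intro exI[of _ 0]) simp
    next
      case False
      define g where "g = (\<lambda>x. (x \<bullet> i) * pd j w x - (x \<bullet> j) * pd i w x)"
      have "wsmooth (1/2 - 1) {()} (\<lambda>_. pd b g)"
        using wsmooth_pd[OF angular_estimate[OF te w Lw f B(2,3) False] B(1)] unfolding g_def .
      from wsmoothE[OF this] obtain C where C: "C > 0" "\<And>x. x \<in> ball 0 1 \<Longrightarrow> \<bar>pd b g x\<bar> \<le> C * bdef x powr (1/2 - 1)"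
        by (metis singletonI)
      have "\<bar>(x \<bullet> i) * pd b (pd j w) x - (x \<bullet> j) * pd b (pd i w) x\<bar> \<le> (C + 2 * C1) * bdef x powr (-1/2)" if x: "x \<in> ball 0 1" for x
      proof -
        have d: "pd k w differentiable (at x)" for k by (rule smooth_onD[OF smooth_on_pd[OF w(1)] x])
        have "((\<lambda>x. (x \<bullet> i) * pd j w x - (x \<bullet> j) * pd i w x) has_derivative
          (\<lambda>v. ((x \<bullet> i) * pd v (pd j w) x + (v \<bullet> i) * pd j w x) - ((x \<bullet> j) * pd v (pd i w) x + (v \<bullet> j) * pd i w x))) (at x)"
          by (intro has_derivative_diff has_derivative_mult has_derivative_pd d has_derivative_inner_left has_derivative_ident)
        from pd_eq[OF this, of b]
        have eq: "(x \<bullet> i) * pd b (pd j w) x - (x \<bullet> j) * pd b (pd i w) x = pd b g x - (b \<bullet> i) * pd j w x + (b \<bullet> j) * pd i w x"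
          by (simp add: g_def)
        have ab: "\<bar>p - q + r\<bar> \<le> \<bar>p\<bar> + \<bar>q\<bar> + \<bar>r\<bar>" for p q r :: real by linarith
        have "\<bar>pd b g x\<bar> + \<bar>(b \<bullet> i) * pd j w x\<bar> + \<bar>(b \<bullet> j) * pd i w x\<bar>
            \<le> C * bdef x powr (-1/2) + C1 * bdef x powr (-1/2) + C1 * bdef x powr (-1/2)"
        proof (intro add_mono)
          have "\<bar>b \<bullet> k\<bar> \<le> 1" if "k \<in> ?B" for k using B(1) that by (simp add: inner_Basis)
          then have le: "\<bar>(b \<bullet> k) * pd k' w x\<bar> \<le> 1 * (C1 * bdef x powr (-1/2))" if "k \<in> ?B" "k' \<in> ?B" for k k'
            unfolding abs_mult using C1 that x by (intro mult_mono) auto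
          show "\<bar>(b \<bullet> i) * pd j w x\<bar> \<le> C1 * bdef x powr (-1/2)" "\<bar>(b \<bullet> j) * pd i w x\<bar> \<le> C1 * bdef x powr (-1/2)"
            using le[OF B(2,3)] le[OF B(3,2)] by auto
        qed (use C(2)[of x] x in simp)
        with ab[of "pd b g x" "(b \<bullet> i) * pd j w x" "(b \<bullet> j) * pd i w x"]
        show ?thesis unfolding eq by (simp add: distrib_right)
      qed
      then show ?thesis by blast
    qed
    then show "\<exists>A. \<forall>x\<in>ball 0 1. \<bar>(x \<bullet> fst (snd p)) * pd (fst p) (pd (snd (snd p)) w) x - (x \<bullet> snd (snd p)) * pd (fst p) (pd (fst (snd p)) w) x\<bar> \<le> A * bdef x powr (-1/2)"
      by (simp add: bij)
  qed (simp, erule (1) weight_mono)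
  then obtain A where A: "A > 0" "\<And>p. p \<in> ?B \<times> ?B \<times> ?B \<Longrightarrow> \<forall>x\<in>ball 0 1.
     \<bar>(x \<bullet> fst (snd p)) * pd (fst p) (pd (snd (snd p)) w) x - (x \<bullet> snd (snd p)) * pd (fst p) (pd (fst (snd p)) w) x\<bar> \<le> A * bdef x powr (-1/2)" by blast
  have "\<exists>Mc>0. \<forall>p\<in>?B \<times> ?B. \<forall>x\<in>cball 0 1. \<bar>c t (fst p) x \<bullet> snd p\<bar> \<le> Mc \<and> \<bar>Y t (fst p) (\<lambda>x. c t (fst p) x \<bullet> snd p) x\<bar> \<le> Mc"
  proof (rule finite_uniform_bound[of "?B \<times> ?B" "\<lambda>p M. \<forall>x\<in>cball 0 1. \<bar>c t (fst p) x \<bullet> snd p\<bar> \<le> M \<and> \<bar>Y t (fst p) (\<lambda>x. c t (fst p) x \<bullet> snd p) x\<bar> \<le> M"])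
    fix p :: "(real^'n) \<times> (real^'n)"
    have s: "smooth_on (ball 0 2) (\<lambda>x. c t (fst p) x \<bullet> snd p)"
      by (intro smooth_on_inner smooth_on_const frame_smooth_t te open_ball)
    obtain M1 where M1: "\<And>x. x \<in> cball 0 1 \<Longrightarrow> \<bar>c t (fst p) x \<bullet> snd p\<bar> \<le> M1"
      using bounded_on_cball[OF smooth_on_continuous[OF s] ball12(2)] by blast
    obtain M2 where M2: "\<And>x. x \<in> cball 0 1 \<Longrightarrow> \<bar>Y t (fst p) (\<lambda>x. c t (fst p) x \<bullet> snd p) x\<bar> \<le> M2"
      using bounded_on_cball[OF smooth_on_continuous[OF dframe_smooth[OF te open_ball order_refl s]] ball12(2)] by blast
    show "\<exists>M. \<forall>x\<in>cball 0 1. \<bar>c t (fst p) x \<bullet> snd p\<bar> \<le> M \<and> \<bar>Y t (fst p) (\<lambda>x. c t (fst p) x \<bullet> snd p) x\<bar> \<le> M"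
      using M1 M2 by (intro exI[of _ "max M1 M2"]) (auto simp: le_max_iff_disj)
  qed (simp, meson order_trans)
  then obtain Mc where Mc: "Mc > 0" "\<And>p. p \<in> ?B \<times> ?B \<Longrightarrow> \<forall>x\<in>cball 0 1. \<bar>c t (fst p) x \<bullet> snd p\<bar> \<le> Mc \<and> \<bar>Y t (fst p) (\<lambda>x. c t (fst p) x \<bullet> snd p) x\<bar> \<le> Mc" by blast
  obtain Mf where Mf: "Mf \<ge> 0" "\<And>x. x \<in> cball 0 1 \<Longrightarrow> \<bar>f x\<bar> \<le> Mf"
    using bounded_on_cball[OF smooth_on_continuous[OF f] ball12(2)] by blast
  \<comment> \<open>\<open>G\<close> bounds the second order part of the equation and
    \<open>E\<close> the error of replacing the Hessian by its radial part there. The 8 in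
    \<open>CQ\<close> is the inverse of the lower bound of \<open>S\<close>, and the 4 in
    \<open>CH\<close> that of the lower bound for the square of \<open>\<rho>\<close>.\<close>
  define G where "G = Mf + n * (n * (Mc * C1))"
  define E where "E = n * (n * (n * (Mc * Mc * (2 * n\<^sup>2 * A))))"
  define CQ where "CQ = 8 * (G + E)"
  define CH where "CH = max (2 * C2) (4 * (CQ + 2 * n\<^sup>2 * A))"
  have "\<bar>pd k (pd l w) x\<bar> \<le> CH * bdef x powr (-1/2)" if kl: "k \<in> ?B" "l \<in> ?B" and x: "x \<in> ball 0 1" for k l x
  proof -
    define d where "d = bdef x"
    define s where "s = d powr (-1/2)"
    have d: "0 < d" "d \<le> 1" using bdef_ball[OF x] by (auto simp: d_def)
    have s: "s \<ge> 1" unfolding s_def using d by (simp add: ge_one_powr_ge_zero powr_minus one_le_inverse_iff powr_le1)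
    have s0: "s \<ge> 0" using s by simp
    show ?thesis
    \<comment> \<open>Near the centre the radial direction degenerates, but there \<open>d\<close>
      is at least 1/2 and all weights are comparable.\<close>
    proof (cases "x \<bullet> x < 1/2")
      case True
      then have d2: "1 / 2 \<le> d" by (simp add: d_def bdef_def)
      have "d powr (-3/2) = (1 / d) * s" using powr_add[of d "-1" "-1/2"] d unfolding s_def by (simp add: powr_minus_divide)
      also have "\<dots> \<le> 2 * s" using d2 d s0 by (intro mult_right_mono) (auto simp: field_simps)
      finally have "C2 * d powr (-3/2) \<le> C2 * (2 * s)" using C2(1) by (intro mult_left_mono) auto
      moreover have "\<bar>pd k (pd l w) x\<bar> \<le> C2 * d powr (-3/2)" using C2(2)[of "(k, l)"] kl x by (simp add: d_def)
      moreover have "(2 * C2) * s \<le> CH * s" unfolding CH_def by (intro mult_right_mono s0) simp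
      ultimately show ?thesis unfolding d_def[symmetric] s_def[symmetric] by simp
    next
      case False
      define H where "H = (\<lambda>k l. pd k (pd l w) x)"
      define \<rho> where "\<rho> = x \<bullet> x"
      have \<rho>: "1 / 2 \<le> \<rho>" "\<rho> \<le> 1" using False d by (auto simp: \<rho>_def d_def bdef_def)
      have \<rho>2: "1 / 4 \<le> \<rho>\<^sup>2" "\<rho>\<^sup>2 \<le> 1" using power_mono[of "1/2" \<rho> 2] \<rho> by (auto simp: power2_eq_square mult_le_one)
      have nx: "norm x \<le> 1" using x by simp
      have sym: "H k l = H l k" for k l unfolding H_def by (rule pd_commute[OF smooth_on_Ck[OF w(1)] open_ball x])
      have ang: "\<bar>(x \<bullet> i) * H b j - (x \<bullet> j) * H b i\<bar> \<le> A * s" if "b \<in> ?B" "i \<in> ?B" "j \<in> ?B" for b i j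
        using A(2)[of "(b, i, j)"] that x by (simp add: H_def s_def d_def)
      define Q where "Q = (\<Sum>l\<in>?B. (x \<bullet> l) * (\<Sum>j\<in>?B. (x \<bullet> j) * H l j))"
      have rm: "\<bar>\<rho>\<^sup>2 * H k l - (x \<bullet> k) * (x \<bullet> l) * Q\<bar> \<le> 2 * n\<^sup>2 * (A * s)" if "k \<in> ?B" "l \<in> ?B" for k l
        using radial_matrix[of H x "A * s" k l, OF sym ang nx that] unfolding Q_def \<rho>_def n_def .
      define S where "S = (\<Sum>b\<in>?B. (c t b x \<bullet> x)\<^sup>2)"
      have S: "1 / 8 \<le> S" using frame_radial[OF te, of x] x \<rho> by (auto simp: S_def \<rho>_def dot_square_norm)
      define g where "g = (\<Sum>b\<in>?B. \<Sum>l\<in>?B. \<Sum>j\<in>?B. (c t b x \<bullet> l) * (c t b x \<bullet> j) * H j l)"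
      have cb: "\<bar>c t b x \<bullet> l\<bar> \<le> Mc" "\<bar>Y t b (\<lambda>x. c t b x \<bullet> l) x\<bar> \<le> Mc" if "b \<in> ?B" "l \<in> ?B" for b l
        using Mc(2)[of "(b, l)"] that x by auto
      have sumle: "\<bar>\<Sum>b\<in>?B. F b\<bar> \<le> n * B" if "\<And>b. b \<in> ?B \<Longrightarrow> \<bar>F b\<bar> \<le> B" for F B
      proof -
        have "\<bar>\<Sum>b\<in>?B. F b\<bar> \<le> (\<Sum>b\<in>?B. B)" by (rule order_trans[OF sum_abs sum_mono[OF that]])
        then show ?thesis by (simp add: n_def)
      qed
      have "g = f x - (\<Sum>b\<in>?B. \<Sum>l\<in>?B. Y t b (\<lambda>x. c t b x \<bullet> l) x * pd l w x)"
        using lframe_expand[OF te open_ball ball12(1) w(1) x] Lw[OF x] by (simp add: g_def H_def sum.distrib)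
      moreover have "\<bar>\<Sum>b\<in>?B. \<Sum>l\<in>?B. Y t b (\<lambda>x. c t b x \<bullet> l) x * pd l w x\<bar> \<le> n * (n * (Mc * (C1 * s)))"
      proof (intro sumle)
        fix b l assume "b \<in> ?B" "l \<in> ?B"
        then show "\<bar>Y t b (\<lambda>x. c t b x \<bullet> l) x * pd l w x\<bar> \<le> Mc * (C1 * s)"
          unfolding abs_mult using cb C1(2) x Mc(1) by (intro mult_mono) (auto simp: s_def d_def)
      qed
      moreover have "\<bar>f x\<bar> \<le> Mf * s" using Mf(2)[of x] x mult_left_mono[OF s Mf(1)] by simp
      ultimately have gb: "\<bar>g\<bar> \<le> G * s" unfolding G_def by (simp add: algebra_simps)
      have "\<rho>\<^sup>2 * g - Q * S = (\<Sum>b\<in>?B. \<Sum>l\<in>?B. \<Sum>j\<in>?B. (c t b x \<bullet> l) * (c t b x \<bullet> j) * (\<rho>\<^sup>2 * H j l - (x \<bullet> j) * (x \<bullet> l) * Q))"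
      proof -
        \<comment> \<open>The radial matrix contracted twice with a frame vector is a perfect
          square. These squares add up to \<open>S\<close>, so \<open>Q * S\<close> is the radial
          part of the equation.\<close>
        have "(c t b x \<bullet> x)\<^sup>2 = (\<Sum>l\<in>?B. \<Sum>j\<in>?B. (c t b x \<bullet> l) * (c t b x \<bullet> j) * ((x \<bullet> j) * (x \<bullet> l)))" for b
          unfolding power2_eq_square euclidean_inner[of "c t b x" x] sum_product
          by (intro sum.cong refl) (simp add: mult_ac)
        then show ?thesis
          unfolding g_def S_def by (simp add: sum_distrib_left sum_subtractf right_diff_distrib mult_ac)
      qed
      also have "\<bar>\<dots>\<bar> \<le> n * (n * (n * ((Mc * Mc) * (2 * n\<^sup>2 * (A * s)))))"
      proof (intro sumle)
        fix b l j assume B: "b \<in> ?B" "l \<in> ?B" "j \<in> ?B"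
        then show "\<bar>(c t b x \<bullet> l) * (c t b x \<bullet> j) * (\<rho>\<^sup>2 * H j l - (x \<bullet> j) * (x \<bullet> l) * Q)\<bar> \<le> (Mc * Mc) * (2 * n\<^sup>2 * (A * s))"
          unfolding abs_mult[of "(c t b x \<bullet> l) * (c t b x \<bullet> j)"] abs_mult[of "c t b x \<bullet> l"]
          using cb rm[OF B(3,2)] Mc(1) by (intro mult_mono) auto
      qed
      finally have "\<bar>\<rho>\<^sup>2 * g - Q * S\<bar> \<le> E * s" by (simp add: E_def mult_ac)
      moreover have "\<bar>\<rho>\<^sup>2 * g\<bar> \<le> 1 * (G * s)" unfolding abs_mult using \<rho>2 gb by (intro mult_mono) auto
      ultimately have "\<bar>Q * S\<bar> \<le> (G + E) * s" by (simp add: algebra_simps)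
      moreover have "\<bar>Q\<bar> * (1 / 8) \<le> \<bar>Q * S\<bar>" unfolding abs_mult using S by (intro mult_left_mono) auto
      ultimately have Q: "\<bar>Q\<bar> \<le> CQ * s" by (simp add: CQ_def distrib_right)
      have "\<bar>(x \<bullet> k) * (x \<bullet> l) * Q\<bar> \<le> 1 * 1 * \<bar>Q\<bar>"
        unfolding abs_mult using Basis_le_norm[OF kl(1), of x] Basis_le_norm[OF kl(2), of x] nx by (intro mult_mono) auto
      then have "\<bar>\<rho>\<^sup>2 * H k l\<bar> \<le> 2 * n\<^sup>2 * (A * s) + CQ * s" using rm[OF kl] Q by linarith
      moreover have "1 / 4 * \<bar>H k l\<bar> \<le> \<bar>\<rho>\<^sup>2 * H k l\<bar>" unfolding abs_mult using \<rho>2 by (intro mult_right_mono) auto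
      ultimately have "\<bar>H k l\<bar> \<le> 4 * (CQ + 2 * n\<^sup>2 * A) * s" by (simp add: algebra_simps)
      also have "\<dots> \<le> CH * s" unfolding CH_def by (intro mult_right_mono s0) simp
      finally show ?thesis unfolding H_def s_def d_def .
    qed
  qed
  then show ?thesis by blast
qed

lemma boundary_gradient:
  assumes "\<bar>t\<bar> \<le> \<delta>" "smooth_on (ball 0 1) w" "continuous_on (cball 0 1) w" "\<And>x. x \<in> sphere 0 1 \<Longrightarrow> w x = 0"
    "\<And>x. x \<in> ball 0 1 \<Longrightarrow> L t w x = f x" "smooth_on (ball 0 2) f"
  shows "\<exists>g. continuous_on (cball 0 1) g \<and> (\<forall>x\<in>cball 0 1. (w has_derivative (\<lambda>h. g x \<bullet> h)) (at x within cball 0 1))"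
proof -
  obtain C where "\<forall>b\<in>Basis. \<forall>k\<in>Basis. \<forall>x\<in>ball 0 1. \<bar>pd b (pd k w) x\<bar> \<le> C * bdef x powr (-1/2)"
    using hessian_estimate[OF assms] by blast
  then show ?thesis by (intro gradient_extends[OF assms(3,2), of C]) auto
qed

end

section \<open>Expansion at time zero\<close>

lemma abs_sum_Basis_le:
  fixes f :: "'a::euclidean_space \<Rightarrow> real"
  assumes "\<And>b. b \<in> Basis \<Longrightarrow> \<bar>f b\<bar> \<le> B"
  shows "\<bar>\<Sum>b\<in>Basis. f b\<bar> \<le> real DIM('a) * B"
  using sum_norm_bound[of Basis f B] assms by simp

lemma param_bounds:
  fixes a :: "real \<times> 'a::euclidean_space \<Rightarrow> real"
  assumes a: "smooth_on ({-e<..<e} \<times> U) a" and U: "open U" "cball 0 1 \<subseteq> U" and \<delta>: "0 < \<delta>" "\<delta> < e"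
  shows "\<exists>C>0. \<forall>t x. \<bar>t\<bar> < \<delta> \<longrightarrow> x \<in> ball 0 1 \<longrightarrow> \<bar>a (t, x)\<bar> \<le> C \<and> \<bar>a (t, x) - a (0, x)\<bar> \<le> C * \<bar>t\<bar>
     \<and> \<bar>a (t, x) - a (0, x) - t * pd (1, 0) a (0, x)\<bar> \<le> C * t\<^sup>2"
proof -
  have one: "1 \<le> C \<Longrightarrow> 0 < (C::real)" for C by simp
  obtain A where A: "A > 0" "\<And>t x. t \<in> {-\<delta><..<\<delta>} \<Longrightarrow> x \<in> ball 0 1 \<Longrightarrow> \<bar>a (t, x)\<bar> \<le> A * bdef x powr 0"
    by (rule wsmoothE[OF wsmooth_param_interval[OF a U \<delta>(2)]]) blast
  obtain B where B: "B > 0" "\<And>t x. t \<in> {-\<delta><..<\<delta>} \<Longrightarrow> x \<in> ball 0 1 \<Longrightarrow> \<bar>pd (1, 0) a (t, x)\<bar> \<le> B * bdef x powr 0"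
    by (rule wsmoothE[OF wsmooth_param_interval[OF smooth_on_pd[OF a] U \<delta>(2)]]) blast
  obtain D where D: "D > 0" "\<And>p x. p \<in> tpairs \<delta> \<Longrightarrow> x \<in> ball 0 1 \<Longrightarrow>
      \<bar>tdiff (\<lambda>t x. a (t, x)) (\<lambda>t x. pd (1, 0) a (t, x)) p x\<bar> \<le> D * bdef x powr 0"
    by (rule wsmoothE[OF wsmooth_tdiff_param[OF a U \<delta>(2)]]) blast
  \<comment> \<open>\<open>D * \<delta>\<close> absorbs the quadratic remainder into the linear
    estimate, where \<open>t * t\<close> is at most \<open>\<delta> * \<bar>t\<bar>\<close>.\<close>
  define C where "C = A + B + D + D * \<delta>"
  have C: "A \<le> C" "B + D * \<delta> \<le> C" "D \<le> C" "0 < C"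
    unfolding C_def using A(1) B(1) D(1) mult_pos_pos[OF D(1) \<delta>(1)] by linarith+
  have "\<bar>a (t, x)\<bar> \<le> C \<and> \<bar>a (t, x) - a (0, x)\<bar> \<le> C * \<bar>t\<bar> \<and> \<bar>a (t, x) - a (0, x) - t * pd (1, 0) a (0, x)\<bar> \<le> C * t\<^sup>2"
    if t: "\<bar>t\<bar> < \<delta>" and x: "x \<in> ball 0 1" for t x
  proof -
    have b: "bdef x \<noteq> 0" using bdef_ball[OF x] by simp
    have 1: "\<bar>a (t, x)\<bar> \<le> A" using A(2)[of t x] t x b by (simp add: abs_less_iff)
    have 2: "\<bar>t * pd (1, 0) a (0, x)\<bar> \<le> \<bar>t\<bar> * B" unfolding abs_mult using B(2)[of 0 x] \<delta>(1) x b by (intro mult_left_mono) auto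
    have 3: "\<bar>a (t, x) - a (0, x) - t * pd (1, 0) a (0, x)\<bar> \<le> D * t\<^sup>2"
    proof (cases "t = 0")
      case False
      have "(0, t) \<in> tpairs \<delta>" using t False \<delta> by (simp add: tpairs_def)
      from D(2)[OF this x] have "\<bar>a (t, x) - a (0, x) - t * pd (1, 0) a (0, x)\<bar> / t\<^sup>2 \<le> D"
        using b by (simp add: tdiff_def)
      then show ?thesis using False by (simp add: divide_le_eq)
    qed simp
    have 4: "D * t\<^sup>2 \<le> D * \<delta> * \<bar>t\<bar>"
      using mult_left_mono[of "\<bar>t\<bar>" \<delta> "D * \<bar>t\<bar>"] t D(1) by (simp add: power2_eq_square mult_ac flip: abs_mult)
    have 5: "(B + D * \<delta>) * \<bar>t\<bar> \<le> C * \<bar>t\<bar>" "D * t\<^sup>2 \<le> C * t\<^sup>2" using C by (auto intro: mult_right_mono)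
    have "\<bar>a (t, x) - a (0, x)\<bar> \<le> D * t\<^sup>2 + \<bar>t\<bar> * B" using 2 3 by linarith
    also have "\<dots> \<le> (B + D * \<delta>) * \<bar>t\<bar>" using 4 by (simp add: algebra_simps)
    finally show ?thesis using 1 C(1) 3 5 by linarith
  qed
  then show ?thesis using C(4) by blast
qed

lemma pd_pd_slice:
  fixes a :: "'p::euclidean_space \<times> 'a::euclidean_space \<Rightarrow> real"
  assumes a: "smooth_on (P \<times> U) a" and "open P" "open U" "p \<in> P" "x \<in> U"
  shows "pd b (\<lambda>x. a (p, x)) x = pd (0, b) a (p, x)" "pd d (pd b (\<lambda>x. a (p, x))) x = pd (0, d) (pd (0, b) a) (p, x)"
proof -
  have s: "pd b (\<lambda>x. f (p, x)) x = pd (0, b) f (p, x)" if "smooth_on (P \<times> U) f" "x \<in> U" for f :: "'p \<times> 'a \<Rightarrow> real" and b x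
    by (rule pd_slice(1)[OF smooth_onD[OF that(1)]]) (use assms that in auto)
  show "pd b (\<lambda>x. a (p, x)) x = pd (0, b) a (p, x)" by (rule s[OF a \<open>x \<in> U\<close>])
  have "pd d (pd b (\<lambda>x. a (p, x))) x = pd d (\<lambda>x. pd (0, b) a (p, x)) x"
    by (rule pd_cong[OF \<open>open U\<close> s[OF a] \<open>x \<in> U\<close>])
  also have "\<dots> = pd (0, d) (pd (0, b) a) (p, x)" by (rule s[OF smooth_on_pd[OF a] \<open>x \<in> U\<close>])
  finally show "pd d (pd b (\<lambda>x. a (p, x))) x = pd (0, d) (pd (0, b) a) (p, x)" .
qed

text \<open>The notion is stable under space derivatives, so the quadratic bound in time for such a
  function applies equally to its gradient and its Hessian.\<close>

definition vanishing :: "(real \<times> 'a::euclidean_space) set \<Rightarrow> (real \<times> 'a \<Rightarrow> real) \<Rightarrow> bool" where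
  "vanishing S a \<longleftrightarrow> smooth_on S a \<and> (\<forall>x. (0, x) \<in> S \<longrightarrow> a (0, x) = 0 \<and> pd (1, 0) a (0, x) = 0)"

lemma vanishing_pd:
  fixes a :: "real \<times> 'a::euclidean_space \<Rightarrow> real"
  assumes "vanishing ({-e<..<e} \<times> U) a" and U: "open U" and e: "0 < e"
  shows "vanishing ({-e<..<e} \<times> U) (pd (0, b) a)"
proof -
  let ?S = "{-e<..<e} \<times> U"
  have S: "open ?S" using U by (intro open_Times) auto
  have a: "smooth_on ?S a" and z: "\<And>x. x \<in> U \<Longrightarrow> a (0, x) = 0" "\<And>x. x \<in> U \<Longrightarrow> pd (1, 0) a (0, x) = 0"
    using assms by (auto simp: vanishing_def)
  have s: "pd (0, b) f (0, x) = 0" if f: "smooth_on ?S f" "\<And>x. x \<in> U \<Longrightarrow> f (0, x) = 0" and x: "x \<in> U" for f :: "real \<times> 'a \<Rightarrow> real" and x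
  proof -
    have "pd (0, b) f (0, x) = pd b (\<lambda>x. f (0, x)) x"
      by (rule pd_pd_slice(1)[OF f(1) _ U _ x, symmetric]) (use e in auto)
    also have "\<dots> = pd b (\<lambda>x. 0) x" by (rule pd_cong[OF U f(2) x])
    finally show ?thesis by simp
  qed
  have "pd (1, 0) (pd (0, b) a) (0, x) = 0" if x: "x \<in> U" for x
    using pd_commute[OF smooth_on_Ck[OF a] S, of "(0, x)" "(1, 0)" "(0, b)"] s[OF smooth_on_pd[OF a] z(2) x] x e by auto
  then show ?thesis unfolding vanishing_def using smooth_on_pd[OF a] s[OF a z(1)] by auto
qed

lemma vanishing_quadratic:
  fixes a :: "real \<times> 'a::euclidean_space \<Rightarrow> real"
  assumes "vanishing ({-e<..<e} \<times> U) a" and U: "open U" "cball 0 1 \<subseteq> U" and \<delta>: "0 < \<delta>" "\<delta> < e"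
  shows "\<exists>C. \<forall>t x. \<bar>t\<bar> < \<delta> \<longrightarrow> x \<in> ball 0 1 \<longrightarrow> \<bar>a (t, x)\<bar> \<le> C * t\<^sup>2"
proof -
  have a: "smooth_on ({-e<..<e} \<times> U) a" using assms by (simp add: vanishing_def)
  have z: "a (0, x) = 0 \<and> pd (1, 0) a (0, x) = 0" if "x \<in> ball 0 1" for x
  proof -
    have "x \<in> U" using that U(2) by auto
    then show ?thesis using assms(1) \<delta> unfolding vanishing_def by auto
  qed
  obtain C where "\<forall>t x. \<bar>t\<bar> < \<delta> \<longrightarrow> x \<in> ball 0 1 \<longrightarrow> \<bar>a (t, x)\<bar> \<le> C \<and> \<bar>a (t, x) - a (0, x)\<bar> \<le> C * \<bar>t\<bar>
     \<and> \<bar>a (t, x) - a (0, x) - t * pd (1, 0) a (0, x)\<bar> \<le> C * t\<^sup>2"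
    using param_bounds[OF a U \<delta>] by blast
  then show ?thesis using z by (intro exI[of _ C]) auto
qed

lemma vanishing_derivatives:
  fixes a :: "real \<times> 'a::euclidean_space \<Rightarrow> real"
  assumes a: "vanishing ({-e<..<e} \<times> U) a" and U: "open U" "cball 0 1 \<subseteq> U" and \<delta>: "0 < \<delta>" "\<delta> < e"
  shows "\<exists>C>0. \<forall>t x. \<bar>t\<bar> < \<delta> \<longrightarrow> x \<in> ball 0 1 \<longrightarrow> (\<forall>l\<in>Basis. \<bar>pd l (\<lambda>x. a (t, x)) x\<bar> \<le> C * t\<^sup>2)
    \<and> (\<forall>j\<in>Basis. \<forall>l\<in>Basis. \<bar>pd j (pd l (\<lambda>x. a (t, x))) x\<bar> \<le> C * t\<^sup>2)"
proof -
  have e: "0 < e" using \<delta> by simp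
  have sm: "smooth_on ({-e<..<e} \<times> U) a" using a by (simp add: vanishing_def)
  have "\<exists>C>0. \<forall>p\<in>Basis \<times> Basis. \<forall>t x. \<bar>t\<bar> < \<delta> \<longrightarrow> x \<in> ball 0 1 \<longrightarrow> \<bar>pd (0, snd p) a (t, x)\<bar> \<le> C * t\<^sup>2
      \<and> \<bar>pd (0, fst p) (pd (0, snd p) a) (t, x)\<bar> \<le> C * t\<^sup>2"
  proof (rule finite_uniform_bound)
    fix p :: "'a \<times> 'a"
    note v = vanishing_pd[OF a U(1) e, of "snd p"]
    obtain C1 where C1: "\<forall>t x. \<bar>t\<bar> < \<delta> \<longrightarrow> x \<in> ball 0 1 \<longrightarrow> \<bar>pd (0, snd p) a (t, x)\<bar> \<le> C1 * t\<^sup>2"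
      using vanishing_quadratic[OF v U \<delta>] by blast
    obtain C2 where C2: "\<forall>t x. \<bar>t\<bar> < \<delta> \<longrightarrow> x \<in> ball 0 1 \<longrightarrow> \<bar>pd (0, fst p) (pd (0, snd p) a) (t, x)\<bar> \<le> C2 * t\<^sup>2"
      using vanishing_quadratic[OF vanishing_pd[OF v U(1) e, of "fst p"] U \<delta>] by blast
    have "C1 * t\<^sup>2 \<le> max C1 C2 * t\<^sup>2" "C2 * t\<^sup>2 \<le> max C1 C2 * t\<^sup>2" for t :: real by (auto intro: mult_right_mono)
    then show "\<exists>C. \<forall>t x. \<bar>t\<bar> < \<delta> \<longrightarrow> x \<in> ball 0 1 \<longrightarrow> \<bar>pd (0, snd p) a (t, x)\<bar> \<le> C * t\<^sup>2
      \<and> \<bar>pd (0, fst p) (pd (0, snd p) a) (t, x)\<bar> \<le> C * t\<^sup>2"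
      using C1 C2 by (meson order_trans)
  next
    fix p :: "'a \<times> 'a" and M M' :: real
    assume M: "\<forall>t x. \<bar>t\<bar> < \<delta> \<longrightarrow> x \<in> ball 0 1 \<longrightarrow> \<bar>pd (0, snd p) a (t, x)\<bar> \<le> M * t\<^sup>2
      \<and> \<bar>pd (0, fst p) (pd (0, snd p) a) (t, x)\<bar> \<le> M * t\<^sup>2" and le: "M \<le> M'"
    have "M * t\<^sup>2 \<le> M' * t\<^sup>2" for t :: real using le by (intro mult_right_mono) auto
    then show "\<forall>t x. \<bar>t\<bar> < \<delta> \<longrightarrow> x \<in> ball 0 1 \<longrightarrow> \<bar>pd (0, snd p) a (t, x)\<bar> \<le> M' * t\<^sup>2
      \<and> \<bar>pd (0, fst p) (pd (0, snd p) a) (t, x)\<bar> \<le> M' * t\<^sup>2" using M by (meson order_trans)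
  qed simp
  then obtain C where C: "C > 0" "\<And>p t x. p \<in> Basis \<times> Basis \<Longrightarrow> \<bar>t\<bar> < \<delta> \<Longrightarrow> x \<in> ball 0 1 \<Longrightarrow> \<bar>pd (0, snd p) a (t, x)\<bar> \<le> C * t\<^sup>2
      \<and> \<bar>pd (0, fst p) (pd (0, snd p) a) (t, x)\<bar> \<le> C * t\<^sup>2" by blast
  have "\<bar>pd l (\<lambda>x. a (t, x)) x\<bar> \<le> C * t\<^sup>2 \<and> \<bar>pd j (pd l (\<lambda>x. a (t, x))) x\<bar> \<le> C * t\<^sup>2"
    if "\<bar>t\<bar> < \<delta>" "x \<in> ball 0 1" "j \<in> Basis" "l \<in> Basis" for t x j l
  proof -
    have "t \<in> {-e<..<e}" "x \<in> U" using that U(2) \<delta> by auto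
    from pd_pd_slice[OF sm _ U(1) this, of l] pd_pd_slice(2)[OF sm _ U(1) this, of j l] C(2)[of "(j, l)" t x] that
    show ?thesis by simp
  qed
  then show ?thesis using C(1) nonempty_Basis by (intro exI[of _ C]) blast
qed

context domain_family
begin

lemma lframe_coeff_smooth:
  "smooth_on ({-e<..<e} \<times> ball 0 2) (\<lambda>z. (c (fst z) b (snd z) \<bullet> l) * (c (fst z) b (snd z) \<bullet> j))"
  "smooth_on ({-e<..<e} \<times> ball 0 2) (\<lambda>z. Y (fst z) b (\<lambda>x. c (fst z) b x \<bullet> l) (snd z))"
proof -
  let ?S = "{-e<..<e} \<times> (ball 0 2 :: (real^'n) set)"
  have S: "open ?S" by (intro open_Times) auto
  show "smooth_on ?S (\<lambda>z. (c (fst z) b (snd z) \<bullet> l) * (c (fst z) b (snd z) \<bullet> j))"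
    by (intro smooth_on_mult S coeff_smooth)
  let ?a = "\<lambda>z. c (fst z) b (snd z) \<bullet> l"
  have "smooth_on ?S (\<lambda>z. \<Sum>j\<in>Basis. (c (fst z) b (snd z) \<bullet> j) * pd (0, j) ?a z)"
    by (intro smooth_on_sum smooth_on_mult S coeff_smooth smooth_on_pd) auto
  moreover have eq: "Y (fst z) b (\<lambda>x. c (fst z) b x \<bullet> l) (snd z) = (\<Sum>j\<in>Basis. (c (fst z) b (snd z) \<bullet> j) * pd (0, j) ?a z)" if z: "z \<in> ?S" for z
  proof -
    obtain t x where tx: "z = (t, x)" "t \<in> {-e<..<e}" "x \<in> ball 0 2" using z by (cases z) auto
    have "smooth_on (ball 0 2) (\<lambda>x. c t b x \<bullet> l)"
      using smooth_on_slice[OF coeff_smooth _ open_ball tx(2)] by simp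
    from dframe_expand[OF smooth_onD[OF this tx(3)]] pd_pd_slice(1)[OF coeff_smooth _ open_ball tx(2,3)] show ?thesis
      by (simp add: tx(1))
  qed
  ultimately show "smooth_on ?S (\<lambda>z. Y (fst z) b (\<lambda>x. c (fst z) b x \<bullet> l) (snd z))"
    using smooth_on_cong[OF S eq] by simp
qed

end

lemma second_order_bound:
  fixes \<alpha> :: "'a::euclidean_space \<Rightarrow> 'a \<Rightarrow> 'a \<Rightarrow> real" and \<beta> h :: "'a \<Rightarrow> 'a \<Rightarrow> real" and g :: "'a \<Rightarrow> real"
  assumes \<alpha>: "\<And>b l j. b \<in> Basis \<Longrightarrow> l \<in> Basis \<Longrightarrow> j \<in> Basis \<Longrightarrow> \<bar>\<alpha> b l j\<bar> \<le> \<kappa>"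
    and \<beta>: "\<And>b l. b \<in> Basis \<Longrightarrow> l \<in> Basis \<Longrightarrow> \<bar>\<beta> b l\<bar> \<le> \<kappa>"
    and g: "\<And>l. l \<in> Basis \<Longrightarrow> \<bar>g l\<bar> \<le> M" and h: "\<And>j l. j \<in> Basis \<Longrightarrow> l \<in> Basis \<Longrightarrow> \<bar>h j l\<bar> \<le> M"
    and \<kappa>: "0 \<le> \<kappa>"
  shows "\<bar>\<Sum>b\<in>Basis. \<Sum>l\<in>Basis. (\<Sum>j\<in>Basis. \<alpha> b l j * h j l) + \<beta> b l * g l\<bar>
    \<le> real DIM('a) * (real DIM('a) * (real DIM('a) + 1)) * (\<kappa> * M)"
proof -
  have "\<bar>\<Sum>b\<in>(Basis::'a set). \<Sum>l\<in>Basis. (\<Sum>j\<in>Basis. \<alpha> b l j * h j l) + \<beta> b l * g l\<bar>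
    \<le> real DIM('a) * (real DIM('a) * (real DIM('a) * (\<kappa> * M) + \<kappa> * M))"
  proof (intro abs_sum_Basis_le)
    fix b l :: 'a assume bl: "b \<in> Basis" "l \<in> Basis"
    have "\<bar>\<Sum>j\<in>Basis. \<alpha> b l j * h j l\<bar> \<le> real DIM('a) * (\<kappa> * M)"
      by (rule abs_sum_Basis_le) (use \<alpha> h bl \<kappa> in \<open>auto simp: abs_mult intro!: mult_mono\<close>)
    moreover have "\<bar>\<beta> b l * g l\<bar> \<le> \<kappa> * M"
      unfolding abs_mult using \<beta>[OF bl] g[OF bl(2)] \<kappa> by (intro mult_mono) auto
    ultimately show "\<bar>(\<Sum>j\<in>Basis. \<alpha> b l j * h j l) + \<beta> b l * g l\<bar> \<le> real DIM('a) * (\<kappa> * M) + \<kappa> * M" by linarith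
  qed
  then show ?thesis by (simp add: algebra_simps)
qed

lemma frame_identity:
  assumes S: "open S" "\<And>x. x \<in> S \<Longrightarrow> \<Phi> t x = x" and x: "x \<in> S"
  shows "frame \<Phi> t b x = b"
proof -
  have "pd v (\<Phi> t) x = v" for v
  proof -
    have "pd v (\<Phi> t) x = pd v (\<lambda>x. x) x" by (rule pd_cong[OF S x])
    also have "\<dots> = v" by (rule pd_eq[OF has_derivative_ident])
    finally show ?thesis .
  qed
  then show ?thesis by (simp add: frame_def inv_f_f)
qed

context domain_family
begin

lemma coeff_bounds:
  "\<exists>C>0. \<forall>t x b l j. \<bar>t\<bar> < \<delta> \<longrightarrow> x \<in> ball 0 1 \<longrightarrow> b \<in> Basis \<longrightarrow> l \<in> Basis \<longrightarrow> j \<in> Basis \<longrightarrow>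
    (\<bar>c t b x \<bullet> l\<bar> \<le> C \<and> \<bar>c t b x \<bullet> l - c 0 b x \<bullet> l\<bar> \<le> C * \<bar>t\<bar>) \<and>
    (\<bar>(c t b x \<bullet> l) * (c t b x \<bullet> j)\<bar> \<le> C \<and> \<bar>(c t b x \<bullet> l) * (c t b x \<bullet> j) - (c 0 b x \<bullet> l) * (c 0 b x \<bullet> j)\<bar> \<le> C * \<bar>t\<bar>) \<and>
    (\<bar>Y t b (\<lambda>x. c t b x \<bullet> l) x\<bar> \<le> C \<and> \<bar>Y t b (\<lambda>x. c t b x \<bullet> l) x - Y 0 b (\<lambda>x. c 0 b x \<bullet> l) x\<bar> \<le> C * \<bar>t\<bar>)"
proof -
  let ?B = "Basis :: (real^'n) set"
  define Q where "Q = (\<lambda>C (a :: real \<Rightarrow> real^'n \<Rightarrow> real). \<forall>t x. \<bar>t\<bar> < \<delta> \<longrightarrow> x \<in> ball 0 1 \<longrightarrow> \<bar>a t x\<bar> \<le> C \<and> \<bar>a t x - a 0 x\<bar> \<le> C * \<bar>t\<bar>)"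
  have Qmono: "Q C' a" if "Q C a" "C \<le> C'" for C C' a
  proof -
    have "C * \<bar>t\<bar> \<le> C' * \<bar>t\<bar>" for t :: real using that(2) by (intro mult_right_mono) auto
    then show ?thesis using that unfolding Q_def by (meson order_trans)
  qed
  have Qex: "\<exists>C. Q C (\<lambda>t x. a (t, x))" if "smooth_on ({-e<..<e} \<times> ball 0 2) a" for a :: "real \<times> (real^'n) \<Rightarrow> real"
    using param_bounds[OF that open_ball ball12(2) \<delta>] unfolding Q_def by blast
  define R where "R = (\<lambda>p C. Q C (\<lambda>t x. c t (fst p) x \<bullet> fst (snd p)) \<and>
     Q C (\<lambda>t x. (c t (fst p) x \<bullet> fst (snd p)) * (c t (fst p) x \<bullet> snd (snd p))) \<and>
     Q C (\<lambda>t x. Y t (fst p) (\<lambda>x. c t (fst p) x \<bullet> fst (snd p)) x))"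
  have "\<exists>C>0. \<forall>p\<in>?B \<times> ?B \<times> ?B. R p C"
  proof (rule finite_uniform_bound)
    fix p :: "(real^'n) \<times> (real^'n) \<times> (real^'n)"
    obtain C1 where 1: "Q C1 (\<lambda>t x. c t (fst p) x \<bullet> fst (snd p))" using Qex[OF coeff_smooth] by auto
    obtain C2 where 2: "Q C2 (\<lambda>t x. (c t (fst p) x \<bullet> fst (snd p)) * (c t (fst p) x \<bullet> snd (snd p)))"
      using Qex[OF lframe_coeff_smooth(1)[where b="fst p" and l="fst (snd p)" and j="snd (snd p)"]] by auto
    obtain C3 where 3: "Q C3 (\<lambda>t x. Y t (fst p) (\<lambda>x. c t (fst p) x \<bullet> fst (snd p)) x)"
      using Qex[OF lframe_coeff_smooth(2)] by auto
    have "R p (max C1 (max C2 C3))" unfolding R_def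
      using Qmono[OF 1] Qmono[OF 2] Qmono[OF 3] by simp
    then show "\<exists>C. R p C" by blast
  next
    fix p M M' assume "R p M" "M \<le> M'"
    then show "R p M'" unfolding R_def using Qmono by blast
  qed simp
  then obtain C where C: "C > 0" "\<And>p. p \<in> ?B \<times> ?B \<times> ?B \<Longrightarrow> R p C" by blast
  show ?thesis
  proof (intro exI[of _ C] conjI[OF C(1)] allI impI)
    fix t :: real and x b l j :: "real^'n"
    assume tx: "\<bar>t\<bar> < \<delta>" "x \<in> ball 0 1" and B: "b \<in> ?B" "l \<in> ?B" "j \<in> ?B"
    from C(2)[of "(b, l, j)"] B have R: "R (b, l, j) C" by simp
    have Q: "\<bar>a t x\<bar> \<le> C \<and> \<bar>a t x - a 0 x\<bar> \<le> C * \<bar>t\<bar>" if "Q C a" for a using that tx unfolding Q_def by blast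
    from R show "(\<bar>c t b x \<bullet> l\<bar> \<le> C \<and> \<bar>c t b x \<bullet> l - c 0 b x \<bullet> l\<bar> \<le> C * \<bar>t\<bar>) \<and>
    (\<bar>(c t b x \<bullet> l) * (c t b x \<bullet> j)\<bar> \<le> C \<and> \<bar>(c t b x \<bullet> l) * (c t b x \<bullet> j) - (c 0 b x \<bullet> l) * (c 0 b x \<bullet> j)\<bar> \<le> C * \<bar>t\<bar>) \<and>
    (\<bar>Y t b (\<lambda>x. c t b x \<bullet> l) x\<bar> \<le> C \<and> \<bar>Y t b (\<lambda>x. c t b x \<bullet> l) x - Y 0 b (\<lambda>x. c 0 b x \<bullet> l) x\<bar> \<le> C * \<bar>t\<bar>)"
      unfolding R_def fst_conv snd_conv by (intro conjI[OF Q conjI[OF Q Q]]) blast+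
  qed
qed

text \<open>\<open>M\<close> bounds the derivatives at the single point \<open>x\<close>, so it may
  be a weight that depends on \<open>x\<close> and grows towards the sphere. The comparison with the
  operator at time zero gains a factor \<open>\<bar>t\<bar>\<close>.\<close>

lemma operator_bounds:
  "\<exists>K>0. \<forall>t w M x. \<bar>t\<bar> < \<delta> \<longrightarrow> smooth_on (ball 0 1) w \<longrightarrow> x \<in> ball 0 1 \<longrightarrow>
    (\<forall>l\<in>Basis. \<bar>pd l w x\<bar> \<le> M) \<longrightarrow>
    (\<forall>b\<in>Basis. \<bar>Y t b w x\<bar> \<le> K * M \<and> \<bar>Y t b w x - Y 0 b w x\<bar> \<le> K * \<bar>t\<bar> * M) \<and>
    ((\<forall>j\<in>Basis. \<forall>l\<in>Basis. \<bar>pd j (pd l w) x\<bar> \<le> M) \<longrightarrow> \<bar>L t w x\<bar> \<le> K * M \<and> \<bar>L t w x - L 0 w x\<bar> \<le> K * \<bar>t\<bar> * M)"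
proof -
  let ?B = "Basis :: (real^'n) set"
  define n where "n = real DIM(real^'n)"
  have n: "n \<ge> 1" unfolding n_def by (simp add: DIM_ge_Suc0 Suc_le_eq)
  obtain C where C: "C > 0" and cb: "\<And>t x b l j. \<bar>t\<bar> < \<delta> \<Longrightarrow> x \<in> ball 0 1 \<Longrightarrow> b \<in> ?B \<Longrightarrow> l \<in> ?B \<Longrightarrow> j \<in> ?B \<Longrightarrow>
    (\<bar>c t b x \<bullet> l\<bar> \<le> C \<and> \<bar>c t b x \<bullet> l - c 0 b x \<bullet> l\<bar> \<le> C * \<bar>t\<bar>) \<and>
    (\<bar>(c t b x \<bullet> l) * (c t b x \<bullet> j)\<bar> \<le> C \<and> \<bar>(c t b x \<bullet> l) * (c t b x \<bullet> j) - (c 0 b x \<bullet> l) * (c 0 b x \<bullet> j)\<bar> \<le> C * \<bar>t\<bar>) \<and>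
    (\<bar>Y t b (\<lambda>x. c t b x \<bullet> l) x\<bar> \<le> C \<and> \<bar>Y t b (\<lambda>x. c t b x \<bullet> l) x - Y 0 b (\<lambda>x. c 0 b x \<bullet> l) x\<bar> \<le> C * \<bar>t\<bar>)"
    using coeff_bounds by blast
  define K where "K = n * (n * (n + 1)) * C"
  have nK: "n * C \<le> K"
  proof -
    have "1 * 1 \<le> n * (n + 1)" using n by (intro mult_mono) auto
    then have "n * 1 \<le> n * (n * (n + 1))" using n by (intro mult_left_mono) auto
    then show ?thesis unfolding K_def using C by (intro mult_right_mono) auto
  qed
  have K: "K > 0" unfolding K_def using n C by simp
  have e0: "\<bar>0\<bar> < e" using \<delta> by simp
  show ?thesis
  proof (intro exI[of _ K] conjI[OF K] allI impI)
    fix t :: real and w :: "real^'n \<Rightarrow> real" and M :: real and x :: "real^'n"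
    assume t: "\<bar>t\<bar> < \<delta>" and w: "smooth_on (ball 0 1) w" and x: "x \<in> ball 0 1" and g: "\<forall>l\<in>?B. \<bar>pd l w x\<bar> \<le> M"
    note te = small_e[OF t]
    have M: "0 \<le> M" using g nonempty_Basis by (metis abs_ge_zero all_not_in_conv order_trans)
    note wd = smooth_onD[OF w x]
    show "(\<forall>b\<in>?B. \<bar>Y t b w x\<bar> \<le> K * M \<and> \<bar>Y t b w x - Y 0 b w x\<bar> \<le> K * \<bar>t\<bar> * M) \<and>
      ((\<forall>j\<in>?B. \<forall>l\<in>?B. \<bar>pd j (pd l w) x\<bar> \<le> M) \<longrightarrow> \<bar>L t w x\<bar> \<le> K * M \<and> \<bar>L t w x - L 0 w x\<bar> \<le> K * \<bar>t\<bar> * M)"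
    proof (intro conjI ballI impI)
      fix b assume b: "b \<in> ?B"
      have "\<bar>Y t b w x\<bar> \<le> n * (C * M)"
        unfolding dframe_expand[OF wd] n_def by (rule abs_sum_Basis_le) (use cb[OF t x b] g C b in \<open>auto simp: abs_mult intro!: mult_mono\<close>)
      also have "\<dots> \<le> K * M" using mult_right_mono[OF nK M] by (simp add: mult.assoc)
      finally show "\<bar>Y t b w x\<bar> \<le> K * M" .
      have "\<bar>Y t b w x - Y 0 b w x\<bar> \<le> n * ((C * \<bar>t\<bar>) * M)"
        unfolding dframe_expand[OF wd] sum_subtractf[symmetric] left_diff_distrib[symmetric] n_def
        by (rule abs_sum_Basis_le) (use cb[OF t x b] g C b in \<open>auto simp: abs_mult intro!: mult_mono\<close>)
      also have "\<dots> \<le> K * \<bar>t\<bar> * M" using mult_right_mono[OF nK, of "\<bar>t\<bar> * M"] M by (simp add: mult_ac)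
      finally show "\<bar>Y t b w x - Y 0 b w x\<bar> \<le> K * \<bar>t\<bar> * M" .
    next
      assume h: "\<forall>j\<in>?B. \<forall>l\<in>?B. \<bar>pd j (pd l w) x\<bar> \<le> M"
      note ex = lframe_expand[OF _ open_ball ball12(1) w x]
      show "\<bar>L t w x\<bar> \<le> K * M"
      proof -
        have "\<bar>L t w x\<bar> \<le> n * (n * (n + 1)) * (C * M)"
          unfolding ex[OF te] n_def by (rule second_order_bound) (use cb[OF t x] g h C in auto)
        then show ?thesis unfolding K_def by (simp add: mult.assoc)
      qed
      have "L t w x - L 0 w x = (\<Sum>b\<in>?B. \<Sum>l\<in>?B.
          (\<Sum>j\<in>?B. ((c t b x \<bullet> l) * (c t b x \<bullet> j) - (c 0 b x \<bullet> l) * (c 0 b x \<bullet> j)) * pd j (pd l w) x)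
          + (Y t b (\<lambda>x. c t b x \<bullet> l) x - Y 0 b (\<lambda>x. c 0 b x \<bullet> l) x) * pd l w x)"
        unfolding ex[OF te] ex[OF e0] sum_subtractf[symmetric] left_diff_distrib
        by (intro sum.cong refl) (simp add: sum_subtractf algebra_simps)
      also have "\<bar>\<dots>\<bar> \<le> n * (n * (n + 1)) * ((C * \<bar>t\<bar>) * M)"
        unfolding n_def by (rule second_order_bound) (use cb[OF t x] g h C in auto)
      finally show "\<bar>L t w x - L 0 w x\<bar> \<le> K * \<bar>t\<bar> * M" unfolding K_def by (simp add: mult.assoc)
    qed
  qed
qed

end

section \<open>The velocity field, the explicit approximation and the harmonic extension\<close>

locale deformation = domain_family \<Phi> e \<delta>
  for \<Phi> :: "real \<Rightarrow> real^'n \<Rightarrow> real^'n" and e \<delta> +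
  fixes \<eta> :: "real^'n \<Rightarrow> real^'n"
  assumes at_zero: "\<And>x. x \<in> ball 0 2 \<Longrightarrow> \<Phi> 0 x = x"
    and velocity: "\<And>x. x \<in> ball 0 2 \<Longrightarrow> pd (1, 0) (\<lambda>(t, x). \<Phi> t x) (0, x) = \<eta> x"
    and \<eta>_smooth: "smooth_on (ball 0 2) \<eta>"
begin

lemma e_zero: "\<bar>0\<bar> < e" using \<delta> by simp

lemma frame_zero: "x \<in> ball 0 2 \<Longrightarrow> c 0 b x = b"
  by (rule frame_identity[where \<Phi>=\<Phi> and t=0, OF open_ball at_zero])

lemma dframe_zero: "x \<in> ball 0 2 \<Longrightarrow> Y 0 b w x = pd b w x"
  by (simp add: dframe_def frame_zero)

lemma lframe_zero: "x \<in> ball 0 2 \<Longrightarrow> L 0 w x = laplacian w x"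
  unfolding lframe_def laplacian_alt
  by (intro sum.cong refl, subst dframe_zero) (auto intro!: pd_cong[OF open_ball] dframe_zero)

end

lemma has_derivative_divide_const:
  "(f has_derivative f') F \<Longrightarrow> ((\<lambda>x. f x / (c::real)) has_derivative (\<lambda>h. f' h / c)) F"
  by (simp add: divide_inverse has_derivative_mult_left)

locale torsion_expansion = deformation \<Phi> e \<delta> \<eta>
  for \<Phi> :: "real \<Rightarrow> real^'n \<Rightarrow> real^'n" and e \<delta> \<eta> +
  fixes v :: "real \<Rightarrow> real^'n \<Rightarrow> real" and T :: "real^'n \<Rightarrow> real"
  assumes v: "dirichlet v (\<lambda>_ _. -1)"
    and T: "harmonic_extension (\<lambda>x. \<eta> x \<bullet> x) T"
begin

lemma card_ge_1: "real CARD('n) \<ge> 1" by (simp add: Suc_le_eq)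

text \<open>The torsion function of the unit ball, pulled back, and its second order Taylor remainder in time.\<close>

definition U :: "real \<Rightarrow> real^'n \<Rightarrow> real" where "U t x = (1 - \<Phi> t x \<bullet> \<Phi> t x) / (2 * real CARD('n))"

definition E :: "real \<Rightarrow> real^'n \<Rightarrow> real" where
  "E t x = U t x - bdef x / (2 * real CARD('n)) + t / real CARD('n) * (\<eta> x \<bullet> x)"

abbreviation "S \<equiv> {-e<..<e} \<times> (ball 0 2 :: (real^'n) set)"

lemma S: "open S" by (intro open_Times) auto

lemma \<Phi>_joint: "smooth_on S (\<lambda>z. \<Phi> (fst z) (snd z))"
  using smooth by (simp add: case_prod_beta')

lemma Z_smooth: "smooth_on (ball 0 2) (\<lambda>x. \<eta> x \<bullet> x)"
  by (intro smooth_on_inner \<eta>_smooth smooth_on_ident open_ball)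

lemma snd_smooth: "smooth_on (ball 0 2) f \<Longrightarrow> smooth_on S (\<lambda>z. f (snd z))"
  by (rule smooth_on_compose[OF S open_ball _ _ smooth_on_snd[OF S]]) auto

lemma U_joint: "smooth_on S (\<lambda>z. U (fst z) (snd z))"
  unfolding U_def divide_inverse
  by (intro smooth_on_mult smooth_on_diff smooth_on_const smooth_on_inner \<Phi>_joint S)

lemma E_joint: "smooth_on S (\<lambda>z. E (fst z) (snd z))"
  unfolding E_def divide_inverse bdef_def
  by (intro smooth_on_add smooth_on_diff smooth_on_mult smooth_on_const U_joint S smooth_on_inner smooth_on_fst smooth_on_snd
      snd_smooth[OF Z_smooth])

lemma velocity': "x \<in> ball 0 2 \<Longrightarrow> pd (1, 0) (\<lambda>z. \<Phi> (fst z) (snd z)) (0, x) = \<eta> x"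
  using velocity by (simp add: case_prod_beta')

text \<open>At time zero \<open>U\<close> equals \<open>bdef x\<close> over twice the dimension, and
  its time derivative is minus \<open>\<eta> x \<bullet> x\<close> over the dimension;
  \<open>E\<close> is what is left of \<open>U\<close> after these two terms.\<close>

lemma E_vanishing: "vanishing S (\<lambda>z. E (fst z) (snd z))"
proof -
  have "E 0 x = 0 \<and> pd (1, 0) (\<lambda>z. E (fst z) (snd z)) (0, x) = 0" if x: "x \<in> ball 0 2" for x
  proof
    show "E 0 x = 0" using x by (simp add: E_def U_def at_zero bdef_def)
    have z: "(0, x) \<in> S" using x \<delta> by auto
    let ?P = "\<lambda>z. \<Phi> (fst z) (snd z)"
    note P = has_derivative_pd[OF smooth_onD[OF \<Phi>_joint z]]
    note Z = has_derivative_pd[OF smooth_onD[OF snd_smooth[OF Z_smooth] z]]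
    have 1: "((\<lambda>z. (1 - ?P z \<bullet> ?P z) / (2 * real CARD('n))) has_derivative
       (\<lambda>h. (0 - (?P (0, x) \<bullet> pd h ?P (0, x) + pd h ?P (0, x) \<bullet> ?P (0, x))) / (2 * real CARD('n)))) (at (0, x))"
      by (intro has_derivative_divide_const has_derivative_diff has_derivative_const has_derivative_inner P)
    have 2: "((\<lambda>z. (1 - snd z \<bullet> snd z) / (2 * real CARD('n))) has_derivative
       (\<lambda>h. (0 - (snd (0::real, x) \<bullet> snd h + snd h \<bullet> snd (0::real, x))) / (2 * real CARD('n)))) (at ((0::real), x))"
      by (intro has_derivative_divide_const has_derivative_diff has_derivative_const has_derivative_inner has_derivative_snd has_derivative_ident)
    have 3: "((\<lambda>z. fst z / real CARD('n) * (\<eta> (snd z) \<bullet> snd z)) has_derivative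
       (\<lambda>h. fst (0, x) / real CARD('n) * pd h (\<lambda>z. \<eta> (snd z) \<bullet> snd z) (0, x) + fst h / real CARD('n) * (\<eta> (snd (0::real, x)) \<bullet> snd (0::real, x)))) (at (0, x))"
      by (intro has_derivative_mult has_derivative_divide_const has_derivative_fst has_derivative_ident Z)
    have "((\<lambda>z. E (fst z) (snd z)) has_derivative
      (\<lambda>h. (0 - (?P (0, x) \<bullet> pd h ?P (0, x) + pd h ?P (0, x) \<bullet> ?P (0, x))) / (2 * real CARD('n)) -
         (0 - (snd (0::real, x) \<bullet> snd h + snd h \<bullet> snd (0::real, x))) / (2 * real CARD('n)) +
         (fst (0, x) / real CARD('n) * pd h (\<lambda>z. \<eta> (snd z) \<bullet> snd z) (0, x) + fst h / real CARD('n) * (\<eta> (snd (0::real, x)) \<bullet> snd (0::real, x))))) (at (0, x))"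
      unfolding E_def U_def bdef_def by (intro has_derivative_add has_derivative_diff 1 2 3)
    from pd_eq[OF this, of "(1, 0)"] show "pd (1, 0) (\<lambda>z. E (fst z) (snd z)) (0, x) = 0"
      using x card_ge_1 by (simp add: velocity' at_zero inner_commute field_simps)
  qed
  then show ?thesis unfolding vanishing_def using E_joint by auto
qed

lemma E_bounds:
  "\<exists>C>0. \<forall>t x. \<bar>t\<bar> < \<delta> \<longrightarrow> x \<in> ball 0 1 \<longrightarrow> (\<forall>l\<in>Basis. \<bar>pd l (E t) x\<bar> \<le> C * t\<^sup>2)
    \<and> (\<forall>j\<in>Basis. \<forall>l\<in>Basis. \<bar>pd j (pd l (E t)) x\<bar> \<le> C * t\<^sup>2)"
  using vanishing_derivatives[OF E_vanishing open_ball ball12(2) \<delta>] by simp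

lemma slice: "\<bar>t\<bar> < e \<Longrightarrow> smooth_on S (\<lambda>z. f (fst z) (snd z)) \<Longrightarrow> smooth_on (ball 0 2) (f t)"
  using smooth_on_slice[of "{-e<..<e}" "ball 0 2" "\<lambda>z. f (fst z) (snd z)" t] by (auto simp: abs_less_iff)

definition u0 :: "real^'n \<Rightarrow> real" where "u0 y = (1 - y \<bullet> y) / (2 * real CARD('n))"

lemma pd_u0: "pd b u0 y = - (y \<bullet> b) / real CARD('n)"
proof -
  have "(u0 has_derivative (\<lambda>h. (0 - (y \<bullet> h + h \<bullet> y)) / (2 * real CARD('n)))) (at y)"
    unfolding u0_def by (intro has_derivative_divide_const has_derivative_diff has_derivative_const has_derivative_inner has_derivative_ident)
  from pd_eq[OF this, of b] show ?thesis using card_ge_1 by (simp add: inner_commute field_simps)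
qed

lemma u0_smooth: "smooth_on UNIV u0"
  unfolding u0_def divide_inverse by (intro smooth_on_mult smooth_on_diff smooth_on_const smooth_on_inner smooth_on_ident open_UNIV)

lemma laplacian_u0: "laplacian u0 y = -1"
proof -
  have "pd b (pd b u0) y = - 1 / real CARD('n)" if "b \<in> Basis" for b :: "real^'n"
  proof -
    have "((\<lambda>y. - (y \<bullet> b) / real CARD('n)) has_derivative (\<lambda>h. - (h \<bullet> b) / real CARD('n))) (at y)"
      by (intro has_derivative_divide_const has_derivative_minus has_derivative_inner_left has_derivative_ident)
    moreover have "pd b u0 = (\<lambda>y. - (y \<bullet> b) / real CARD('n))" by (rule ext) (rule pd_u0)
    ultimately show ?thesis using pd_eq[of "pd b u0" "\<lambda>h. - (h \<bullet> b) / real CARD('n)" y b] that by (simp add: inner_Basis)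
  qed
  then have "laplacian u0 y = (\<Sum>b\<in>(Basis :: (real^'n) set). - 1 / real CARD('n))" unfolding laplacian_alt by (intro sum.cong refl) auto
  then show ?thesis using card_ge_1 by simp
qed

lemma U_u0: "U t = (\<lambda>x. u0 (\<Phi> t x))" by (rule ext) (simp add: U_def u0_def)

lemma L_U: "\<bar>t\<bar> < e \<Longrightarrow> x \<in> ball 0 1 \<Longrightarrow> L t (U t) x = -1"
  unfolding U_u0 using lframe_compose[OF _ open_ball ball12(1), of t UNIV u0 x] smooth_on_Ck[OF u0_smooth] laplacian_u0 by simp

lemma Y_U: "\<bar>t\<bar> < e \<Longrightarrow> x \<in> ball 0 1 \<Longrightarrow> Y t b (U t) x = - (\<Phi> t x \<bullet> b) / real CARD('n)"
  unfolding U_u0 using dframe_compose[of t x u0 b] smooth_onD[OF u0_smooth] pd_u0 ball12(1) by auto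

lemma T_facts:
  shows "smooth_on (ball 0 1) T" "continuous_on (cball 0 1) T" "x \<in> sphere 0 1 \<Longrightarrow> T x = \<eta> x \<bullet> x"
    "x \<in> ball 0 1 \<Longrightarrow> laplacian T x = 0"
proof -
  have C: "Ck_on 2 (ball 0 1) T" and l: "\<And>x. x \<in> ball 0 1 \<Longrightarrow> laplacian T x = 0"
    using T by (auto simp: harmonic_extension_def harmonic_on_def)
  show "smooth_on (ball 0 1) T" by (rule constant_laplacian_smooth[OF open_ball C l])
  show "x \<in> ball 0 1 \<Longrightarrow> laplacian T x = 0" by (rule l)
  show "continuous_on (cball 0 1) T" "x \<in> sphere 0 1 \<Longrightarrow> T x = \<eta> x \<bullet> x"
    using T by (auto simp: harmonic_extension_def)
qed

lemma Z_smooth1: "smooth_on (ball 0 1) (\<lambda>x. \<eta> x \<bullet> x)" by (rule smooth_on_subset[OF Z_smooth ball12(1)])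

lemma Z_cont: "continuous_on (cball 0 1) (\<lambda>x. \<eta> x \<bullet> x)"
  by (rule continuous_on_subset[OF smooth_on_continuous[OF Z_smooth] ball12(2)])

text \<open>Subtracting \<open>\<eta> x \<bullet> x\<close>, which is smooth across the sphere, from
  the harmonic extension leaves a function with zero boundary values and a smooth right side. The
  boundary regularity for \<open>L 0\<close> thereby becomes available for \<open>T\<close>.\<close>

lemma defect:
  shows "smooth_on (ball 0 1) (\<lambda>x. T x - \<eta> x \<bullet> x)" "continuous_on (cball 0 1) (\<lambda>x. T x - \<eta> x \<bullet> x)"
    "x \<in> sphere 0 1 \<Longrightarrow> T x - \<eta> x \<bullet> x = 0"
    "x \<in> ball 0 1 \<Longrightarrow> L 0 (\<lambda>x. T x - \<eta> x \<bullet> x) x = - laplacian (\<lambda>x. \<eta> x \<bullet> x) x"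
    "smooth_on (ball 0 2) (\<lambda>x. - laplacian (\<lambda>x. \<eta> x \<bullet> x) x)"
proof -
  show "smooth_on (ball 0 1) (\<lambda>x. T x - \<eta> x \<bullet> x)" by (intro smooth_on_diff open_ball T_facts Z_smooth1)
  show "continuous_on (cball 0 1) (\<lambda>x. T x - \<eta> x \<bullet> x)" by (intro continuous_on_diff T_facts Z_cont)
  show "x \<in> sphere 0 1 \<Longrightarrow> T x - \<eta> x \<bullet> x = 0" using T_facts(3) by simp
  show "L 0 (\<lambda>x. T x - \<eta> x \<bullet> x) x = - laplacian (\<lambda>x. \<eta> x \<bullet> x) x" if x: "x \<in> ball 0 1"
  proof -
    have "x \<in> ball 0 2" using x ball12(1) by auto
    then show ?thesis unfolding lframe_diff[OF e_zero T_facts(1) Z_smooth1 x] using lframe_zero T_facts(4)[OF x] by simp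
  qed
  show "smooth_on (ball 0 2) (\<lambda>x. - laplacian (\<lambda>x. \<eta> x \<bullet> x) x)"
    unfolding laplacian_alt by (intro smooth_on_uminus smooth_on_sum smooth_on_pd Z_smooth open_ball) auto
qed

lemma T_gradient:
  "\<exists>g. continuous_on (cball 0 1) g \<and> (\<forall>x\<in>cball 0 1. (T has_derivative (\<lambda>h. g x \<bullet> h)) (at x within cball 0 1))"
proof -
  obtain g where g: "continuous_on (cball 0 1) g"
    "\<And>x. x \<in> cball 0 1 \<Longrightarrow> ((\<lambda>x. T x - \<eta> x \<bullet> x) has_derivative (\<lambda>h. g x \<bullet> h)) (at x within cball 0 1)"
    using boundary_gradient[OF _ defect] \<delta> by auto
  define G where "G = (\<lambda>x. \<Sum>b\<in>Basis. pd b (\<lambda>x. \<eta> x \<bullet> x) x *\<^sub>R (b :: real^'n))"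
  have "continuous_on (cball 0 1) (\<lambda>x. g x + G x)"
    unfolding G_def
    by (intro continuous_intros g(1) continuous_on_subset[OF smooth_on_continuous[OF smooth_on_pd[OF Z_smooth]] ball12(2)])
  moreover have "(T has_derivative (\<lambda>h. (g x + G x) \<bullet> h)) (at x within cball 0 1)" if x: "x \<in> cball 0 1" for x
  proof -
    have x2: "x \<in> ball 0 2" using x ball12(2) by auto
    have "pd h (\<lambda>x. \<eta> x \<bullet> x) x = G x \<bullet> h" for h
      unfolding pd_expand[OF smooth_onD[OF Z_smooth x2], of h] G_def by (simp add: inner_sum_left) (intro sum.cong refl, simp add: inner_commute mult.commute)
    with has_derivative_pd[OF smooth_onD[OF Z_smooth x2]]
    have "((\<lambda>x. \<eta> x \<bullet> x) has_derivative (\<lambda>h. G x \<bullet> h)) (at x within cball 0 1)"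
      by (simp add: has_derivative_at_withinI)
    from has_derivative_add[OF g(2)[OF x] this] show ?thesis by (simp add: inner_add_left)
  qed
  ultimately show ?thesis by blast
qed

text \<open>The gradient is bounded because it extends continuously to the sphere. The Hessian keeps
  the weight of \<open>hessian_estimate\<close>, which is just what \<open>barrier_one\<close>
  admits on a right side.\<close>

lemma T_bounds:
  "\<exists>M>0. \<forall>x\<in>ball 0 1. \<forall>l\<in>Basis. \<bar>pd l T x\<bar> \<le> M \<and> (\<forall>j\<in>Basis. \<bar>pd j (pd l T) x\<bar> \<le> M * bdef x powr (-1/2))"
proof -
  let ?Z = "\<lambda>x. \<eta> x \<bullet> x" and ?B = "Basis :: (real^'n) set"
  obtain g where g: "continuous_on (cball 0 1) g" "\<And>x. x \<in> cball 0 1 \<Longrightarrow> (T has_derivative (\<lambda>h. g x \<bullet> h)) (at x within cball 0 1)"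
    using T_gradient by blast
  have "continuous_on (cball 0 1) (\<lambda>x. norm (g x))" by (intro continuous_intros g(1))
  from bounded_on_cball[OF this order_refl] obtain M1 where M1: "M1 \<ge> 0" "\<And>x. x \<in> cball 0 1 \<Longrightarrow> norm (g x) \<le> M1" by auto
  have pT: "\<bar>pd l T x\<bar> \<le> M1" if x: "x \<in> ball 0 1" and l: "l \<in> ?B" for x l
  proof -
    have "(T has_derivative (\<lambda>h. g x \<bullet> h)) (at x within ball 0 1)"
      by (rule has_derivative_subset[OF g(2)]) (use x in auto)
    then have "(T has_derivative (\<lambda>h. g x \<bullet> h)) (at x)" using at_within_open[OF x open_ball] by simp
    then have "pd l T x = g x \<bullet> l" by (rule pd_eq)
    then show ?thesis using Basis_le_norm[OF l, of "g x"] M1(2)[of x] x by simp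
  qed
  have "\<exists>C. \<forall>b\<in>?B. \<forall>k\<in>?B. \<forall>x\<in>ball 0 1. \<bar>pd b (pd k (\<lambda>x. T x - ?Z x)) x\<bar> \<le> C * bdef x powr (-1/2)"
    by (rule hessian_estimate[OF _ defect]) (use \<delta> in auto)
  then obtain C where C: "\<And>b k x. b \<in> ?B \<Longrightarrow> k \<in> ?B \<Longrightarrow> x \<in> ball 0 1 \<Longrightarrow> \<bar>pd b (pd k (\<lambda>x. T x - ?Z x)) x\<bar> \<le> C * bdef x powr (-1/2)"
    by blast
  have "\<exists>M>0. \<forall>p\<in>?B \<times> ?B. \<forall>x\<in>cball 0 1. \<bar>pd (fst p) (pd (snd p) ?Z) x\<bar> \<le> M"
  proof (rule finite_uniform_bound)
    fix p :: "(real^'n) \<times> (real^'n)"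
    show "\<exists>M. \<forall>x\<in>cball 0 1. \<bar>pd (fst p) (pd (snd p) ?Z) x\<bar> \<le> M"
      using bounded_on_cball[OF smooth_on_continuous[OF smooth_on_pd[OF smooth_on_pd[OF Z_smooth]]] ball12(2)] by metis
  qed (simp, meson order_trans)
  then obtain M2 where M2: "M2 > 0" "\<And>p x. p \<in> ?B \<times> ?B \<Longrightarrow> x \<in> cball 0 1 \<Longrightarrow> \<bar>pd (fst p) (pd (snd p) ?Z) x\<bar> \<le> M2" by blast
  define M where "M = M1 + \<bar>C\<bar> + M2"
  have "\<bar>pd l T x\<bar> \<le> M \<and> \<bar>pd j (pd l T) x\<bar> \<le> M * bdef x powr (-1/2)" if x: "x \<in> ball 0 1" and l: "l \<in> ?B" "j \<in> ?B" for x l j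
  proof
    show "\<bar>pd l T x\<bar> \<le> M" using pT[OF x l(1)] M2(1) by (simp add: M_def)
    have d: "bdef x powr (-1/2) \<ge> 1"
      using bdef_ball[OF x] by (simp add: powr_minus one_le_inverse_iff powr_le1)
    have "pd j (pd l (\<lambda>x. T x - ?Z x + ?Z x)) x = pd j (pd l (\<lambda>x. T x - ?Z x)) x + pd j (pd l ?Z) x"
      by (rule pd_pd_add[OF open_ball smooth_on_Ck[OF defect(1)] smooth_on_Ck[OF Z_smooth1] x])
    then have "\<bar>pd j (pd l T) x\<bar> \<le> C * bdef x powr (-1/2) + M2"
      using C[OF l(2,1) x] M2(2)[of "(j, l)" x] l x by simp
    also have "\<dots> \<le> \<bar>C\<bar> * bdef x powr (-1/2) + M2 * bdef x powr (-1/2)"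
      using d M2(1) by (intro add_mono mult_right_mono) auto
    also have "\<dots> \<le> M * bdef x powr (-1/2)" unfolding M_def distrib_right using M1(1) by simp
    finally show "\<bar>pd j (pd l T) x\<bar> \<le> M * bdef x powr (-1/2)" .
  qed
  moreover have "M > 0" unfolding M_def using M1(1) M2(1) by linarith
  ultimately show ?thesis by blast
qed

end

section \<open>From the corrector to the uniform gradient expansion\<close>

lemma le_of_epsilon:
  fixes a K B :: real
  assumes "\<And>\<epsilon>. \<epsilon> > 0 \<Longrightarrow> a \<le> K * (B + \<epsilon>)" "K > 0"
  shows "a \<le> K * B"
proof (rule field_le_epsilon)
  fix \<epsilon> :: real assume "\<epsilon> > 0"
  then show "a \<le> K * B + \<epsilon>" using assms(1)[of "\<epsilon> / K"] assms(2) by (simp add: distrib_left)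
qed

text \<open>The vector \<open>n *\<^sub>R G\<close> is \<open>r - g\<close> with
  \<open>g = x + t *\<^sub>R k\<close> and an error \<open>r\<close> of second order. In the
  expanded square the cross term is of second order because \<open>r\<close> is, and the square of
  \<open>r\<close> is reduced from fourth to second order by
  \<open>\<bar>t\<bar> \<le> \<delta>\<close>.\<close>

lemma norm_square_perturbation:
  fixes G x k :: "'a::real_inner" and t \<delta> C M n :: real
  assumes n: "1 \<le> n" and r: "norm (n *\<^sub>R G + x + t *\<^sub>R k) \<le> C * t\<^sup>2"
    and k: "norm k \<le> M" and x: "norm x \<le> 1" and t: "\<bar>t\<bar> \<le> \<delta>" and C: "0 \<le> C"
  shows "\<bar>(norm G)\<^sup>2 - ((norm x)\<^sup>2 / n\<^sup>2 + 2 / n\<^sup>2 * (x \<bullet> k) * t)\<bar> \<le> (M\<^sup>2 + 2 * (1 + \<delta> * M) * C + C\<^sup>2 * \<delta>\<^sup>2) * t\<^sup>2"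
proof -
  define r where "r = n *\<^sub>R G + x + t *\<^sub>R k"
  define g where "g = x + t *\<^sub>R k"
  have nG: "n *\<^sub>R G = r - g" by (simp add: r_def g_def)
  have rr: "norm r \<le> C * t\<^sup>2" using r by (simp add: r_def)
  have M: "0 \<le> M" and \<delta>: "0 \<le> \<delta>" using k t by (auto intro: order_trans[OF norm_ge_zero] order_trans[OF abs_ge_zero])
  have g: "norm g \<le> 1 + \<delta> * M"
    unfolding g_def by (rule order_trans[OF norm_triangle_ineq], rule add_mono[OF x]) (use k t M in \<open>auto intro!: mult_mono\<close>)
  have "n\<^sup>2 * (norm G)\<^sup>2 = (r - g) \<bullet> (r - g)"
    unfolding nG[symmetric] power2_norm_eq_inner by (simp add: power2_eq_square)
  also have "\<dots> = (norm x)\<^sup>2 + 2 * (x \<bullet> k) * t + (t\<^sup>2 * (k \<bullet> k) - 2 * (g \<bullet> r) + r \<bullet> r)"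
    unfolding power2_norm_eq_inner by (simp add: g_def inner_diff_left inner_diff_right inner_add_left inner_add_right inner_commute power2_eq_square algebra_simps)
  finally have eq: "n\<^sup>2 * (norm G)\<^sup>2 - ((norm x)\<^sup>2 + 2 * (x \<bullet> k) * t) = t\<^sup>2 * (k \<bullet> k) - 2 * (g \<bullet> r) + r \<bullet> r" by simp
  have 1: "t\<^sup>2 * (k \<bullet> k) \<le> t\<^sup>2 * M\<^sup>2" using power_mono[OF k, of 2] by (intro mult_left_mono) (auto simp: power2_norm_eq_inner)
  have "\<bar>g \<bullet> r\<bar> \<le> norm g * norm r" by (rule Cauchy_Schwarz_ineq2)
  also have "\<dots> \<le> (1 + \<delta> * M) * (C * t\<^sup>2)" using g rr M \<delta> by (intro mult_mono) auto
  finally have 2: "\<bar>g \<bullet> r\<bar> \<le> (1 + \<delta> * M) * (C * t\<^sup>2)" .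
  have "r \<bullet> r \<le> (C * t\<^sup>2)\<^sup>2" using power_mono[OF rr, of 2] by (simp add: power2_norm_eq_inner)
  also have "\<dots> = C\<^sup>2 * t\<^sup>2 * t\<^sup>2" by (simp add: power2_eq_square)
  also have "\<dots> \<le> C\<^sup>2 * \<delta>\<^sup>2 * t\<^sup>2"
    using power_mono[OF t, of 2] by (intro mult_right_mono mult_left_mono) auto
  finally have 3: "r \<bullet> r \<le> C\<^sup>2 * \<delta>\<^sup>2 * t\<^sup>2" .
  have "\<bar>t\<^sup>2 * (k \<bullet> k) - 2 * (g \<bullet> r) + r \<bullet> r\<bar> \<le> t\<^sup>2 * (k \<bullet> k) + 2 * \<bar>g \<bullet> r\<bar> + r \<bullet> r"
    using mult_nonneg_nonneg[OF zero_le_power2[of t] inner_ge_zero[of k]] inner_ge_zero[of r] by linarith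
  also have "\<dots> \<le> (M\<^sup>2 + 2 * (1 + \<delta> * M) * C + C\<^sup>2 * \<delta>\<^sup>2) * t\<^sup>2" using 1 2 3 by (simp add: algebra_simps)
  finally have b: "\<bar>n\<^sup>2 * (norm G)\<^sup>2 - ((norm x)\<^sup>2 + 2 * (x \<bullet> k) * t)\<bar> \<le> (M\<^sup>2 + 2 * (1 + \<delta> * M) * C + C\<^sup>2 * \<delta>\<^sup>2) * t\<^sup>2"
    unfolding eq .
  have n2: "1 \<le> n\<^sup>2" using n by simp
  have "(norm G)\<^sup>2 - ((norm x)\<^sup>2 / n\<^sup>2 + 2 / n\<^sup>2 * (x \<bullet> k) * t) = (n\<^sup>2 * (norm G)\<^sup>2 - ((norm x)\<^sup>2 + 2 * (x \<bullet> k) * t)) / n\<^sup>2"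
    using n by (simp add: diff_divide_distrib add_divide_distrib)
  also have "\<bar>\<dots>\<bar> = \<bar>n\<^sup>2 * (norm G)\<^sup>2 - ((norm x)\<^sup>2 + 2 * (x \<bullet> k) * t)\<bar> / n\<^sup>2" by simp
  also have "\<dots> \<le> \<bar>n\<^sup>2 * (norm G)\<^sup>2 - ((norm x)\<^sup>2 + 2 * (x \<bullet> k) * t)\<bar> / 1"
    using n2 by (intro divide_left_mono) auto
  finally show ?thesis using b by simp
qed

context torsion_expansion
begin

text \<open>\<open>U t x - E t x\<close> is the affine expansion in \<open>t\<close> of the
  approximation. Writing \<open>z\<close> through \<open>U t\<close> makes the two right sides -1
  cancel, and the vanishing term \<open>L 0 T x\<close> is inserted to exhibit a difference of
  operators, which supplies the second factor of \<open>t\<close>.\<close>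

lemma corrector:
  assumes t: "\<bar>t\<bar> < \<delta>"
  defines "z \<equiv> \<lambda>x. v t x - (U t x - E t x + t / real CARD('n) * T x)"
  shows "smooth_on (ball 0 1) z" "continuous_on (cball 0 1) z" "x \<in> sphere 0 1 \<Longrightarrow> z x = 0"
    "x \<in> ball 0 1 \<Longrightarrow> L t z x = L t (E t) x - t / real CARD('n) * (L t T x - L 0 T x)"
    "x \<in> ball 0 1 \<Longrightarrow> Y t b z x = Y t b (v t) x + (\<Phi> t x \<bullet> b) / real CARD('n) + Y t b (E t) x - t / real CARD('n) * Y t b T x"
proof -
  note te = small_e[OF t]
  have U: "smooth_on (ball 0 1) (U t)" and E: "smooth_on (ball 0 1) (E t)"
    using slice[OF te U_joint] slice[OF te E_joint] smooth_on_subset ball12(1) by blast+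
  note V = dirichletD[OF v t] and T1 = T_facts(1)
  have sT: "smooth_on (ball 0 1) (\<lambda>x. t / real CARD('n) * T x)" by (intro smooth_on_cmult T1 open_ball)
  have sUE: "smooth_on (ball 0 1) (\<lambda>x. U t x - E t x)" by (intro smooth_on_diff U E open_ball)
  have sH: "smooth_on (ball 0 1) (\<lambda>x. U t x - E t x + t / real CARD('n) * T x)" by (intro smooth_on_add sUE sT open_ball)
  have z: "z = (\<lambda>x. v t x - (bdef x / (2 * real CARD('n)) + t / real CARD('n) * (T x - \<eta> x \<bullet> x)))"
    unfolding z_def E_def by (rule ext) (simp add: right_diff_distrib)
  show "smooth_on (ball 0 1) z" unfolding z_def by (intro smooth_on_diff V(1) sH open_ball)
  show "continuous_on (cball 0 1) z" unfolding z bdef_def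
    by (intro continuous_intros V(2) defect(2)) auto
  show "z x = 0" if "x \<in> sphere 0 1" using V(3)[OF that] defect(3)[OF that] bdef_sphere[OF that] unfolding z by simp
  show "L t z x = L t (E t) x - t / real CARD('n) * (L t T x - L 0 T x)" if x: "x \<in> ball 0 1"
  proof -
    have "x \<in> ball 0 2" using x ball12(1) by auto
    then have "L 0 T x = 0" using lframe_zero T_facts(4)[OF x] by simp
    then show ?thesis
      unfolding z_def lframe_diff[OF te V(1) sH x] lframe_add[OF te sUE sT x] lframe_diff[OF te U E x] lframe_cmult[OF te T1 x]
      using V(4)[OF x] L_U[OF te x] by simp
  qed
  show "Y t b z x = Y t b (v t) x + (\<Phi> t x \<bullet> b) / real CARD('n) + Y t b (E t) x - t / real CARD('n) * Y t b T x" if x: "x \<in> ball 0 1"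
  proof -
    note d = smooth_onD[OF _ x]
    show ?thesis
      unfolding z_def dframe_diff[OF d[OF V(1)] d[OF sH]] dframe_add[OF d[OF sUE] d[OF sT]] dframe_diff[OF d[OF U] d[OF E]]
        dframe_cmult[OF d[OF T1]] Y_U[OF te x] by simp
  qed
qed

text \<open>The equation of the corrector has a right side of size t^2 with the weight
  \<open>bdef x powr (-1/2)\<close>. By \<open>sup_bound_one\<close> the corrector is O(t^2) times
  \<open>bdef\<close>, and \<open>gradient_weighted\<close> with exponent 1 then bounds its gradient
  by O(t^2) without any weight.\<close>

lemma frame_gradient_expansion:
  "\<exists>C. \<forall>t x b. \<bar>t\<bar> < \<delta> \<longrightarrow> x \<in> ball 0 1 \<longrightarrow> b \<in> Basis \<longrightarrow>
    \<bar>Y t b (v t) x + (\<Phi> t x \<bullet> b) / real CARD('n) - t / real CARD('n) * pd b T x\<bar> \<le> C * t\<^sup>2"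
proof -
  let ?B = "Basis :: (real^'n) set" and ?n = "real CARD('n)"
  obtain CE where CE: "CE > 0" "\<And>t x. \<bar>t\<bar> < \<delta> \<Longrightarrow> x \<in> ball 0 1 \<Longrightarrow> (\<forall>l\<in>?B. \<bar>pd l (E t) x\<bar> \<le> CE * t\<^sup>2)
    \<and> (\<forall>j\<in>?B. \<forall>l\<in>?B. \<bar>pd j (pd l (E t)) x\<bar> \<le> CE * t\<^sup>2)" using E_bounds by blast
  obtain M where M: "M > 0" "\<And>x. x \<in> ball 0 1 \<Longrightarrow> \<forall>l\<in>?B. \<bar>pd l T x\<bar> \<le> M"
    "\<And>x. x \<in> ball 0 1 \<Longrightarrow> \<forall>j\<in>?B. \<forall>l\<in>?B. \<bar>pd j (pd l T) x\<bar> \<le> M * bdef x powr (-1/2)" using T_bounds by blast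
  obtain K where K: "K > 0" and YK: "\<And>t w D x b. \<bar>t\<bar> < \<delta> \<Longrightarrow> smooth_on (ball 0 1) w \<Longrightarrow> x \<in> ball 0 1 \<Longrightarrow>
      \<forall>l\<in>?B. \<bar>pd l w x\<bar> \<le> D \<Longrightarrow> b \<in> ?B \<Longrightarrow> \<bar>Y t b w x\<bar> \<le> K * D \<and> \<bar>Y t b w x - Y 0 b w x\<bar> \<le> K * \<bar>t\<bar> * D"
    and LK: "\<And>t w D x. \<bar>t\<bar> < \<delta> \<Longrightarrow> smooth_on (ball 0 1) w \<Longrightarrow> x \<in> ball 0 1 \<Longrightarrow>
      \<forall>l\<in>?B. \<bar>pd l w x\<bar> \<le> D \<Longrightarrow> \<forall>j\<in>?B. \<forall>l\<in>?B. \<bar>pd j (pd l w) x\<bar> \<le> D \<Longrightarrow> \<bar>L t w x\<bar> \<le> K * D \<and> \<bar>L t w x - L 0 w x\<bar> \<le> K * \<bar>t\<bar> * D"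
    using operator_bounds by blast
  obtain Kg where Kg: "Kg > 0" "\<And>t w A b x. \<bar>t\<bar> < e \<Longrightarrow> smooth_on (ball 0 1) w \<Longrightarrow>
     \<forall>x\<in>ball 0 1. \<bar>w x\<bar> \<le> A * bdef x powr 1 \<Longrightarrow> \<forall>x\<in>ball 0 1. \<bar>L t w x\<bar> \<le> A * bdef x powr (1 - 2) \<Longrightarrow>
     b \<in> ?B \<Longrightarrow> x \<in> ball 0 1 \<Longrightarrow> \<bar>Y t b w x\<bar> \<le> Kg * A * bdef x powr (1 - 1)"
    using gradient_weighted[of 1] by blast
  define K' where "K' = K * (CE + M)"
  have n1: "\<bar>t / ?n\<bar> \<le> \<bar>t\<bar>" for t :: real
    using divide_left_mono[of 1 ?n "\<bar>t\<bar>"] card_ge_1 by simp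
  have tt: "t\<^sup>2 = \<bar>t\<bar> * \<bar>t\<bar>" for t :: real by (simp add: power2_eq_square)
  have "\<bar>Y t b (v t) x + (\<Phi> t x \<bullet> b) / ?n - t / ?n * pd b T x\<bar> \<le> (Kg * 8 * K' + K * CE + K * M) * t\<^sup>2"
    if t: "\<bar>t\<bar> < \<delta>" and x: "x \<in> ball 0 1" and b: "b \<in> ?B" for t x b
  proof -
    note te = small_e[OF t]
    define z where "z = (\<lambda>x. v t x - (U t x - E t x + t / ?n * T x))"
    note z = corrector[OF t, folded z_def]
    have z0: "z y = 0" if "y \<in> sphere 0 1" for y using corrector(3)[OF t that] by (simp add: z_def)
    have E: "smooth_on (ball 0 1) (E t)" using slice[OF te E_joint] smooth_on_subset ball12(1) by blast
    have Lz: "\<bar>L t z y\<bar> \<le> (K' * t\<^sup>2) * bdef y powr (-1/2)" if y: "y \<in> ball 0 1" for y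
    proof -
      define d where "d = bdef y powr (-1/2)"
      have d: "1 \<le> d" unfolding d_def using bdef_ball[OF y] by (simp add: powr_minus one_le_inverse_iff powr_le1)
      have "\<bar>L t (E t) y\<bar> \<le> K * (CE * t\<^sup>2)" using LK[OF t E y] CE(2)[OF t y] by blast
      also have "\<dots> \<le> K * (CE * t\<^sup>2) * d" using mult_left_mono[OF d, of "K * (CE * t\<^sup>2)"] K CE(1) by simp
      finally have 1: "\<bar>L t (E t) y\<bar> \<le> K * (CE * t\<^sup>2) * d" .
      have Md: "M \<le> M * d" using mult_left_mono[OF d, of M] M(1) by simp
      have "\<forall>l\<in>?B. \<bar>pd l T y\<bar> \<le> M * d" using M(2)[OF y] Md by (meson order_trans)
      then have "\<bar>L t T y - L 0 T y\<bar> \<le> K * \<bar>t\<bar> * (M * d)" using LK[OF t T_facts(1) y] M(3)[OF y] unfolding d_def by blast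
      then have "\<bar>t / ?n * (L t T y - L 0 T y)\<bar> \<le> \<bar>t\<bar> * (K * \<bar>t\<bar> * (M * d))"
        unfolding abs_mult[of "t / ?n"] by (intro mult_mono n1) auto
      also have "\<dots> = K * (M * t\<^sup>2) * d" by (simp only: tt mult_ac)
      finally show ?thesis unfolding z(4)[OF y] K'_def d_def[symmetric] using 1 by (simp add: algebra_simps)
    qed
    \<comment> \<open>The slack keeps the constant positive even at \<open>t = 0\<close>, as
      \<open>sup_bound_one\<close> demands; \<open>le_of_epsilon\<close> removes it
      afterwards.\<close>
    have "\<bar>Y t b z x\<bar> \<le> Kg * 8 * (K' * t\<^sup>2 + \<epsilon>)" if \<epsilon>: "\<epsilon> > 0" for \<epsilon>
    proof -
      define A where "A = K' * t\<^sup>2 + \<epsilon>"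
      have K'0: "0 \<le> K' * t\<^sup>2" unfolding K'_def using K CE(1) M(1) by simp
      have A: "A > 0" "K' * t\<^sup>2 \<le> A" using K'0 \<epsilon> by (auto simp: A_def)
      have LA: "\<bar>L t z y\<bar> \<le> A * bdef y powr (-1/2)" if "y \<in> ball 0 1" for y
        using Lz[OF that] A(2) by (meson mult_right_mono order_trans powr_ge_zero)
      have zA: "\<bar>z y\<bar> \<le> 8 * A * bdef y" if "y \<in> ball 0 1" for y
        by (rule sup_bound_one[OF te z(1,2) z0 A(1) LA]) (use that in auto)
      have "\<bar>L t z y\<bar> \<le> 8 * A * bdef y powr (1 - 2)" if y: "y \<in> ball 0 1" for y
      proof -
        \<comment> \<open>The exponent is lowered to the one that \<open>gradient_weighted\<close>
          expects beside a solution of exponent 1.\<close>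
        have "bdef y powr (-1/2) \<le> bdef y powr (1 - 2)" using bdef_ball[OF y] by (intro powr_mono') auto
        then have "A * bdef y powr (-1/2) \<le> 8 * A * bdef y powr (1 - 2)" using A(1) by (intro mult_mono) auto
        then show ?thesis using LA[OF y] by linarith
      qed
      moreover have "\<bar>z y\<bar> \<le> 8 * A * bdef y powr 1" if "y \<in> ball 0 1" for y using zA[OF that] bdef_ball[OF that] by simp
      ultimately have "\<bar>Y t b z x\<bar> \<le> Kg * (8 * A) * bdef x powr (1 - 1)" using Kg(2)[OF te z(1) _ _ b x] by blast
      then show ?thesis using bdef_ball[OF x] by (simp add: A_def algebra_simps)
    qed
    from le_of_epsilon[OF this] have Yz: "\<bar>Y t b z x\<bar> \<le> Kg * 8 * (K' * t\<^sup>2)" using Kg(1) by simp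
    have YE: "\<bar>Y t b (E t) x\<bar> \<le> K * (CE * t\<^sup>2)" using YK[OF t E x _ b] CE(2)[OF t x] by blast
    have x2: "x \<in> ball 0 2" using x ball12(1) by auto
    have "\<bar>Y t b T x - pd b T x\<bar> \<le> K * \<bar>t\<bar> * M" using YK[OF t T_facts(1) x M(2)[OF x] b] dframe_zero[OF x2] by simp
    then have "\<bar>t / ?n * (Y t b T x - pd b T x)\<bar> \<le> \<bar>t\<bar> * (K * \<bar>t\<bar> * M)" unfolding abs_mult[of "t / ?n"] by (intro mult_mono n1) auto
    also have "\<dots> = K * (M * t\<^sup>2)" by (simp only: tt mult_ac)
    finally have YT: "\<bar>t / ?n * (Y t b T x - pd b T x)\<bar> \<le> K * (M * t\<^sup>2)" .
    have "Y t b (v t) x + (\<Phi> t x \<bullet> b) / ?n - t / ?n * pd b T x = Y t b z x - Y t b (E t) x + t / ?n * (Y t b T x - pd b T x)"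
      unfolding z(5)[OF x] by (simp add: right_diff_distrib)
    moreover have "\<bar>p - q + r\<bar> \<le> \<bar>p\<bar> + \<bar>q\<bar> + \<bar>r\<bar>" for p q r :: real by linarith
    ultimately have "\<bar>Y t b (v t) x + (\<Phi> t x \<bullet> b) / ?n - t / ?n * pd b T x\<bar> \<le> Kg * 8 * (K' * t\<^sup>2) + K * (CE * t\<^sup>2) + K * (M * t\<^sup>2)"
      using Yz YE YT by (smt (verit))
    then show ?thesis by (simp add: algebra_simps)
  qed
  then show ?thesis by blast
qed

lemma transport_expansion:
  "\<exists>C. \<forall>t x b. \<bar>t\<bar> < \<delta> \<longrightarrow> x \<in> ball 0 1 \<longrightarrow> b \<in> Basis \<longrightarrow> \<bar>(\<Phi> t x - x - t *\<^sub>R \<eta> x) \<bullet> b\<bar> \<le> C * t\<^sup>2"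
proof -
  let ?B = "Basis :: (real^'n) set"
  have "\<exists>C>0. \<forall>b\<in>?B. \<forall>t x. \<bar>t\<bar> < \<delta> \<longrightarrow> x \<in> ball 0 1 \<longrightarrow> \<bar>(\<Phi> t x - x - t *\<^sub>R \<eta> x) \<bullet> b\<bar> \<le> C * t\<^sup>2"
  proof (rule finite_uniform_bound)
    fix b :: "real^'n"
    let ?a = "\<lambda>z. \<Phi> (fst z) (snd z) \<bullet> b"
    have a: "smooth_on S ?a" by (intro smooth_on_inner \<Phi>_joint smooth_on_const S)
    have "pd (1, 0) ?a (0, x) = \<eta> x \<bullet> b" if x: "x \<in> ball 0 2" for x
    proof -
      have z: "(0, x) \<in> S" using x \<delta> by auto
      from pd_eq[OF has_derivative_inner_left[OF has_derivative_pd[OF smooth_onD[OF \<Phi>_joint z]]], of "(1, 0)" b] velocity'[OF x]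
      show ?thesis by simp
    qed
    then have d: "pd (1, 0) ?a (0, x) = \<eta> x \<bullet> b" "\<Phi> 0 x = x" if "x \<in> ball 0 1" for x
      using that at_zero ball12(1) by auto
    obtain C where "\<And>t x. \<bar>t\<bar> < \<delta> \<Longrightarrow> x \<in> ball 0 1 \<Longrightarrow> \<bar>?a (t, x) - ?a (0, x) - t * pd (1, 0) ?a (0, x)\<bar> \<le> C * t\<^sup>2"
      using param_bounds[OF a open_ball ball12(2) \<delta>] by blast
    then show "\<exists>C. \<forall>t x. \<bar>t\<bar> < \<delta> \<longrightarrow> x \<in> ball 0 1 \<longrightarrow> \<bar>(\<Phi> t x - x - t *\<^sub>R \<eta> x) \<bullet> b\<bar> \<le> C * t\<^sup>2"
      using d by (intro exI[of _ C]) (simp add: inner_diff_left)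
  next
    fix b :: "real^'n" and M M' :: real
    assume M: "\<forall>t x. \<bar>t\<bar> < \<delta> \<longrightarrow> x \<in> ball 0 1 \<longrightarrow> \<bar>(\<Phi> t x - x - t *\<^sub>R \<eta> x) \<bullet> b\<bar> \<le> M * t\<^sup>2" and le: "M \<le> M'"
    have "M * t\<^sup>2 \<le> M' * t\<^sup>2" for t :: real using le by (intro mult_right_mono) auto
    then show "\<forall>t x. \<bar>t\<bar> < \<delta> \<longrightarrow> x \<in> ball 0 1 \<longrightarrow> \<bar>(\<Phi> t x - x - t *\<^sub>R \<eta> x) \<bullet> b\<bar> \<le> M' * t\<^sup>2" using M by (meson order_trans)
  qed simp
  then show ?thesis by blast
qed

end

section \<open>The torsion function of a moving domain\<close>

text \<open>The difference of two derivatives vanishes along the segment from \<open>x\<close> to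
  any point of the open ball, so it is constant there; being linear, it is zero.\<close>

lemma derivative_unique_cball:
  fixes f :: "'a::euclidean_space \<Rightarrow> real"
  assumes D: "(f has_derivative D1) (at x within cball 0 1)" "(f has_derivative D2) (at x within cball 0 1)" and x: "x \<in> cball 0 1"
  shows "D1 = D2"
proof -
  define D where "D = (\<lambda>h. D1 h - D2 h)"
  have d: "((\<lambda>y. 0) has_derivative D) (at x within cball 0 1)"
    using has_derivative_diff[OF D] by (simp add: D_def)
  interpret D: bounded_linear D by (rule has_derivative_bounded_linear[OF d])
  have z: "D z = D x" if z: "z \<in> ball 0 1" for z
  proof -
    define \<gamma> where "\<gamma> = (\<lambda>s::real. x + s *\<^sub>R (z - x))"
    have seg: "\<gamma> ` {0..1} \<subseteq> cball 0 1"
    proof -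
      have "\<gamma> s = (1 - s) *\<^sub>R x + s *\<^sub>R z" for s by (simp add: \<gamma>_def algebra_simps)
      then show ?thesis using x z convexD[OF convex_cball, of x "0::'a" 1 z] by auto
    qed
    have g: "(\<gamma> has_derivative (\<lambda>h. h *\<^sub>R (z - x))) (at 0 within {0..1})"
      unfolding \<gamma>_def by (auto intro!: derivative_eq_intros)
    have "((\<lambda>y. 0) has_derivative D) (at (\<gamma> 0) within \<gamma> ` {0..1})"
      by (rule has_derivative_subset[OF _ seg]) (use d in \<open>simp add: \<gamma>_def\<close>)
    from diff_chain_within[OF g this] have "((\<lambda>s. 0) has_vector_derivative D (z - x)) (at 0 within {0..1})"
      by (simp add: has_vector_derivative_def o_def D.scaleR)
    moreover have "((\<lambda>s. 0) has_vector_derivative 0) (at (0::real) within {0..1})" by (rule has_vector_derivative_const)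
    ultimately have "D (z - x) = 0"
      by (rule vector_derivative_unique_within[rotated]) (simp add: trivial_limit_within islimpt_Icc)
    then show ?thesis by (simp add: D.diff)
  qed
  have "D h = 0" for h
  proof -
    define r where "r = inverse (norm h + 1)"
    have r: "r > 0" unfolding r_def by (simp add: add_nonneg_pos)
    have "norm (r *\<^sub>R h) < 1" unfolding r_def by (simp add: divide_simps add_nonneg_pos)
    then have "D (r *\<^sub>R h) = D 0" using z[of "r *\<^sub>R h"] z[of 0] by simp
    then show ?thesis using r by (simp add: D.scaleR D.zero)
  qed
  then show ?thesis by (auto simp: D_def)
qed

lemma gradient_within_eqI:
  assumes "(f has_derivative (\<lambda>h. g \<bullet> h)) (at x within S)"
    and "\<And>D. (f has_derivative D) (at x within S) \<Longrightarrow> D = (\<lambda>h. g \<bullet> h)"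
  shows "gradient_within S f x = g" "frechet_derivative f (at x within S) = (\<lambda>h. g \<bullet> h)"
proof -
  have "f differentiable (at x within S)" using assms(1) by (auto simp: differentiable_def)
  then show D: "frechet_derivative f (at x within S) = (\<lambda>h. g \<bullet> h)"
    using assms(2) frechet_derivative_works by blast
  show "gradient_within S f x = g" unfolding gradient_within_def D by (rule euclidean_representation)
qed

lemma gradient_eqI: "(f has_derivative (\<lambda>h. g \<bullet> h)) (at x) \<Longrightarrow> gradient f x = g"
  by (rule gradient_within_eqI(1)) (auto intro: has_derivative_unique)

lemma gradient_inner: "b \<in> Basis \<Longrightarrow> gradient f x \<bullet> b = pd b f x"
  by (simp add: gradient_within_def pd_def inner_sum_left_Basis)

locale torsion_family = deformation \<Phi> e \<delta> \<eta>
  for \<Phi> :: "real \<Rightarrow> real^'n \<Rightarrow> real^'n" and e \<delta> \<eta> +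
  fixes u :: "real \<Rightarrow> real^'n \<Rightarrow> real" and T :: "real^'n \<Rightarrow> real"
  assumes torsion: "\<And>t. \<bar>t\<bar> < \<delta> \<Longrightarrow> torsion_function (\<Phi> t ` ball 0 1) (u t)"
    and T: "harmonic_extension (\<lambda>x. \<eta> x \<bullet> x) T"
begin

lemma torsion_facts:
  assumes t: "\<bar>t\<bar> < \<delta>"
  shows "open (\<Phi> t ` ball 0 1)" "smooth_on (\<Phi> t ` ball 0 1) (u t)"
    "y \<in> \<Phi> t ` ball 0 1 \<Longrightarrow> laplacian (u t) y = -1" "continuous_on (\<Phi> t ` cball 0 1) (u t)"
    "x \<in> sphere 0 1 \<Longrightarrow> u t (\<Phi> t x) = 0" "Ck_on 2 (\<Phi> t ` ball 0 1) (u t)"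
proof -
  note te = small_e[OF t] and tf = torsion[OF t, unfolded torsion_function_def closure_image[OF small_e[OF t]] frontier_image[OF small_e[OF t]]]
  show o: "open (\<Phi> t ` ball 0 1)" by (rule inverse_facts(2)[OF te ball12(1) open_ball])
  show C: "Ck_on 2 (\<Phi> t ` ball 0 1) (u t)" using tf by blast
  have l: "laplacian (u t) y = -1" if "y \<in> \<Phi> t ` ball 0 1" for y
  proof -
    have "- laplacian (u t) y = 1" using tf that by blast
    then show ?thesis by linarith
  qed
  then show "y \<in> \<Phi> t ` ball 0 1 \<Longrightarrow> laplacian (u t) y = -1" by blast
  show "smooth_on (\<Phi> t ` ball 0 1) (u t)" by (rule constant_laplacian_smooth[OF o C l])
  show "continuous_on (\<Phi> t ` cball 0 1) (u t)" "x \<in> sphere 0 1 \<Longrightarrow> u t (\<Phi> t x) = 0" using tf by blast+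
qed

lemma dirichlet_pullback: "dirichlet (\<lambda>t x. u t (\<Phi> t x)) (\<lambda>_ _. -1)"
  unfolding dirichlet_def
proof (intro allI impI conjI ballI)
  fix t assume t: "\<bar>t\<bar> < \<delta>"
  note te = small_e[OF t] and tf = torsion_facts[OF t]
  show "smooth_on (ball 0 1) (\<lambda>x. u t (\<Phi> t x))"
    by (rule smooth_on_compose[OF open_ball tf(1) _ tf(2) smooth_on_subset[OF smooth_t[OF te] ball12(1)]]) auto
  show "continuous_on (cball 0 1) (\<lambda>x. u t (\<Phi> t x))"
    by (rule continuous_on_compose2[OF tf(4) continuous_on_subset[OF smooth_on_continuous[OF smooth_t[OF te]] ball12(2)]]) auto
  show "u t (\<Phi> t x) = 0" if "x \<in> sphere 0 1" for x by (rule tf(5)[OF that])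
  show "L t (\<lambda>x. u t (\<Phi> t x)) x = -1" if x: "x \<in> ball 0 1" for x
    using lframe_compose[OF te open_ball ball12(1) imageI tf(6) x] tf(3) x by simp
qed

sublocale torsion_expansion \<Phi> e \<delta> \<eta> "\<lambda>t x. u t (\<Phi> t x)" T
  by unfold_locales (rule dirichlet_pullback, rule T)

text \<open>The right side -1 is independent of time, hence smooth in time to every order, and the
  pulled back solution inherits this.\<close>

lemma smooth_dependence: "smooth_on ({-\<delta><..<\<delta>} \<times> ball 0 1) (\<lambda>(t, x). u t (\<Phi> t x))"
proof -
  have "tsmooth k \<delta> (1/2) (\<lambda>t x. u t (\<Phi> t x))" for k
    by (rule tsmooth_dirichlet[OF dirichlet_pullback tsmooth_weaken[OF _ tsmooth_constant]]) simp
  from tsmooth_joint[OF this] show ?thesis by (simp add: case_prod_beta')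
qed

text \<open>A frame derivative of the pulled back solution is a partial derivative of
  \<open>u t\<close> at the image point, so no change of variables is left. Multiplied by the
  dimension, the gradient is \<open>- x - t *\<^sub>R (\<eta> x - gradient T x)\<close> up to
  O(t^2), and only its square has to be expanded.\<close>

lemma interior_expansion:
  "\<exists>C. \<forall>t x. \<bar>t\<bar> < \<delta> \<longrightarrow> x \<in> ball 0 1 \<longrightarrow>
     \<bar>(norm (gradient (u t) (\<Phi> t x)))\<^sup>2 - ((norm x)\<^sup>2 / (real CARD('n))\<^sup>2
        + 2 / (real CARD('n))\<^sup>2 * (\<eta> x \<bullet> x - x \<bullet> gradient T x) * t)\<bar> \<le> C * t\<^sup>2"
proof -
  let ?B = "Basis :: (real^'n) set" and ?n = "real CARD('n)"
  obtain C1 where C1: "\<And>t x b. \<bar>t\<bar> < \<delta> \<Longrightarrow> x \<in> ball 0 1 \<Longrightarrow> b \<in> ?B \<Longrightarrow>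
    \<bar>Y t b (\<lambda>x. u t (\<Phi> t x)) x + (\<Phi> t x \<bullet> b) / ?n - t / ?n * pd b T x\<bar> \<le> C1 * t\<^sup>2"
    using frame_gradient_expansion by blast
  obtain C2 where C2: "\<And>t x b. \<bar>t\<bar> < \<delta> \<Longrightarrow> x \<in> ball 0 1 \<Longrightarrow> b \<in> ?B \<Longrightarrow> \<bar>(\<Phi> t x - x - t *\<^sub>R \<eta> x) \<bullet> b\<bar> \<le> C2 * t\<^sup>2"
    using transport_expansion by blast
  obtain M where M: "\<And>x l. x \<in> ball 0 1 \<Longrightarrow> l \<in> ?B \<Longrightarrow> \<bar>pd l T x\<bar> \<le> M" using T_bounds by blast
  have "continuous_on (ball 0 2) (\<lambda>x. norm (\<eta> x))" by (intro continuous_intros smooth_on_continuous \<eta>_smooth)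
  from bounded_on_cball[OF this ball12(2)] obtain M\<eta> where M\<eta>: "\<And>x. x \<in> cball 0 1 \<Longrightarrow> norm (\<eta> x) \<le> M\<eta>" by auto
  define C where "C = \<bar>?n * (?n * C1 + C2)\<bar>"
  define M' where "M' = M\<eta> + ?n * M"
  have "\<bar>(norm (gradient (u t) (\<Phi> t x)))\<^sup>2 - ((norm x)\<^sup>2 / ?n\<^sup>2 + 2 / ?n\<^sup>2 * (\<eta> x \<bullet> x - x \<bullet> gradient T x) * t)\<bar>
      \<le> (M'\<^sup>2 + 2 * (1 + \<delta> * M') * C + C\<^sup>2 * \<delta>\<^sup>2) * t\<^sup>2"
    if t: "\<bar>t\<bar> < \<delta>" and x: "x \<in> ball 0 1" for t x
  proof -
    have x2: "x \<in> ball 0 2" using x ball12(1) by auto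
    let ?G = "gradient (u t) (\<Phi> t x)" and ?k = "\<eta> x - gradient T x"
    have "norm (?n *\<^sub>R ?G + x + t *\<^sub>R ?k) \<le> (\<Sum>b\<in>?B. \<bar>(?n *\<^sub>R ?G + x + t *\<^sub>R ?k) \<bullet> b\<bar>)" by (rule norm_le_l1)
    also have "\<dots> \<le> (\<Sum>b\<in>?B. (?n * C1 + C2) * t\<^sup>2)"
    proof (rule sum_mono)
      fix b assume b: "b \<in> ?B"
      have "Y t b (\<lambda>x. u t (\<Phi> t x)) x = ?G \<bullet> b"
        unfolding gradient_inner[OF b]
        by (rule dframe_compose[OF small_e[OF t] x2 smooth_onD[OF torsion_facts(2)[OF t] imageI[OF x]]])
      then have e1: "\<bar>?G \<bullet> b + (\<Phi> t x \<bullet> b) / ?n - t / ?n * pd b T x\<bar> \<le> C1 * t\<^sup>2" using C1[OF t x b] by simp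
      have "(?n *\<^sub>R ?G + x + t *\<^sub>R ?k) \<bullet> b = ?n * (?G \<bullet> b + (\<Phi> t x \<bullet> b) / ?n - t / ?n * pd b T x) - (\<Phi> t x - x - t *\<^sub>R \<eta> x) \<bullet> b"
        using gradient_inner[OF b, of T x] card_ge_1
        by (simp add: inner_add_left inner_diff_left distrib_left right_diff_distrib)
      also have "\<bar>\<dots>\<bar> \<le> \<bar>?n * (?G \<bullet> b + (\<Phi> t x \<bullet> b) / ?n - t / ?n * pd b T x)\<bar> + \<bar>(\<Phi> t x - x - t *\<^sub>R \<eta> x) \<bullet> b\<bar>"
        by (rule abs_triangle_ineq4)
      also have "\<dots> \<le> ?n * (C1 * t\<^sup>2) + C2 * t\<^sup>2"
        using e1 C2[OF t x b] by (intro add_mono) (auto simp: abs_mult intro: mult_left_mono)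
      finally show "\<bar>(?n *\<^sub>R ?G + x + t *\<^sub>R ?k) \<bullet> b\<bar> \<le> (?n * C1 + C2) * t\<^sup>2" by (simp add: algebra_simps)
    qed
    also have "\<dots> = ?n * (?n * C1 + C2) * t\<^sup>2" by simp
    also have "\<dots> \<le> C * t\<^sup>2" unfolding C_def by (intro mult_right_mono abs_ge_self) simp
    finally have r: "norm (?n *\<^sub>R ?G + x + t *\<^sub>R ?k) \<le> C * t\<^sup>2" .
    have "norm (gradient T x) \<le> (\<Sum>b\<in>?B. \<bar>gradient T x \<bullet> b\<bar>)" by (rule norm_le_l1)
    also have "\<dots> \<le> (\<Sum>b\<in>?B. M)" using M[OF x] gradient_inner[of _ T x] by (intro sum_mono) simp
    finally have k: "norm ?k \<le> M'" using norm_triangle_ineq4[of "\<eta> x" "gradient T x"] M\<eta>[of x] x unfolding M'_def by simp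
    show ?thesis
      using norm_square_perturbation[OF card_ge_1 r k _ less_imp_le[OF t]] x
      by (simp add: C_def inner_diff_right inner_commute)
  qed
  then show ?thesis by blast
qed

text \<open>The pulled back solution has a continuous gradient on the closed ball. The inverse of
  \<open>\<Phi> t\<close>, taken on the ball of radius 2, is smooth across the image of the sphere,
  and the chain rule within the closed image carries the gradient over.\<close>

lemma gradient_up_to_boundary:
  assumes t: "\<bar>t\<bar> < \<delta>"
  shows "\<exists>g. continuous_on (cball 0 1) g \<and>
    (\<forall>x\<in>cball 0 1. (u t has_derivative (\<lambda>h. g x \<bullet> h)) (at (\<Phi> t x) within \<Phi> t ` cball 0 1))"
proof -
  let ?B = "Basis :: (real^'n) set"
  note te = small_e[OF t]
  define G where "G = inv_into (ball 0 2) (\<Phi> t)"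
  note inv = inverse_facts[OF te order_refl open_ball]
  have G: "G (\<Phi> t x) = x" if "x \<in> ball 0 2" for x using inv_into_f_f[OF inv(1) that] by (simp add: G_def)
  note D = dirichletD[OF dirichlet_pullback t]
  obtain g where g: "continuous_on (cball 0 1) g"
    "\<And>x. x \<in> cball 0 1 \<Longrightarrow> ((\<lambda>x. u t (\<Phi> t x)) has_derivative (\<lambda>h. g x \<bullet> h)) (at x within cball 0 1)"
    using boundary_gradient[OF less_imp_le[OF t] D(1,2) D(3) D(4) smooth_on_const] by blast
  have Gd: "G differentiable (at (\<Phi> t x))" if "x \<in> ball 0 2" for x
    unfolding G_def by (rule smooth_onD[OF inv(3) imageI[OF that]])
  define gu where "gu = (\<lambda>x. \<Sum>b\<in>?B. (g x \<bullet> pd b G (\<Phi> t x)) *\<^sub>R b)"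
  have "continuous_on (cball 0 1) gu"
    unfolding gu_def
  proof (intro continuous_intros g(1))
    fix b :: "real^'n"
    show "continuous_on (cball 0 1) (\<lambda>x. pd b G (\<Phi> t x))"
      unfolding G_def
      by (rule continuous_on_compose2[OF smooth_on_continuous[OF smooth_on_pd[OF inv(3)]]
            continuous_on_subset[OF smooth_on_continuous[OF smooth_t[OF te]] ball12(2)]]) (use ball12(2) in auto)
  qed
  moreover have "(u t has_derivative (\<lambda>h. gu x \<bullet> h)) (at (\<Phi> t x) within \<Phi> t ` cball 0 1)" if x: "x \<in> cball 0 1" for x
  proof -
    have x2: "x \<in> ball 0 2" using x ball12(2) by auto
    have im: "G ` (\<Phi> t ` cball 0 1) = cball 0 1" using G ball12(2) by (force simp: image_image)
    have "((\<lambda>x. u t (\<Phi> t x)) has_derivative (\<lambda>h. g x \<bullet> h)) (at (G (\<Phi> t x)) within G ` (\<Phi> t ` cball 0 1))"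
      unfolding im G[OF x2] by (rule g(2)[OF x])
    from diff_chain_within[OF has_derivative_at_withinI[OF has_derivative_pd[OF Gd[OF x2]]] this]
    have "((\<lambda>y. u t (\<Phi> t (G y))) has_derivative (\<lambda>h. g x \<bullet> pd h G (\<Phi> t x))) (at (\<Phi> t x) within \<Phi> t ` cball 0 1)"
      by (simp add: o_def)
    moreover have "g x \<bullet> pd h G (\<Phi> t x) = gu x \<bullet> h" for h
      unfolding gu_def pd_expand[OF Gd[OF x2], of h] by (simp add: inner_sum_left inner_sum_right) (intro sum.cong refl, simp add: inner_commute mult.commute)
    ultimately have d: "((\<lambda>y. u t (\<Phi> t (G y))) has_derivative (\<lambda>h. gu x \<bullet> h)) (at (\<Phi> t x) within \<Phi> t ` cball 0 1)" by simp
    show ?thesis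
      by (rule has_derivative_transform[OF _ _ d]) (use x G ball12(2) in auto)
  qed
  ultimately show ?thesis by blast
qed

lemma derivative_unique_image:
  assumes t: "\<bar>t\<bar> < \<delta>" and x: "x \<in> cball 0 1"
    and D: "(f has_derivative D1) (at (\<Phi> t x) within \<Phi> t ` cball 0 1)" "(f has_derivative D2) (at (\<Phi> t x) within \<Phi> t ` cball 0 1)"
  shows "D1 = (D2 :: real^'n \<Rightarrow> real)"
proof
  fix h :: "real^'n"
  note te = small_e[OF t]
  have x2: "x \<in> ball 0 2" using x ball12(2) by auto
  have "((\<lambda>x. f (\<Phi> t x)) has_derivative (\<lambda>h. D' (pd h (\<Phi> t) x))) (at x within cball 0 1)"
    if "(f has_derivative D') (at (\<Phi> t x) within \<Phi> t ` cball 0 1)" for D'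
    using diff_chain_within[OF has_derivative_at_withinI[OF has_derivative_pd[OF diff_t[OF te x2]]] that] by (simp add: o_def)
  from derivative_unique_cball[OF this[OF D(1)] this[OF D(2)] x]
  have "D1 (pd h (\<Phi> t) x) = D2 (pd h (\<Phi> t) x)" for h by (rule fun_cong)
  from this[of "c t h x"] show "D1 h = D2 h" unfolding pd_frame[OF te x2] .
qed

text \<open>The constant of the interior expansion is uniform and both sides extend continuously to
  the closed ball, so the inequality persists on the sphere. There the derivatives from inside are
  unique and hence given by the extended gradients.\<close>

lemma boundary_expansion:
  "\<exists>C. \<forall>t \<sigma>. \<bar>t\<bar> < \<delta> \<longrightarrow> \<sigma> \<in> sphere 0 1 \<longrightarrow>
     \<bar>(norm (gradient_within (\<Phi> t ` cball 0 1) (u t) (\<Phi> t \<sigma>)))\<^sup>2 - (1 / (real CARD('n))\<^sup>2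
        + 2 / (real CARD('n))\<^sup>2 * (\<eta> \<sigma> \<bullet> \<sigma> - normal_derivative T \<sigma>) * t)\<bar> \<le> C * t\<^sup>2"
proof -
  let ?n = "real CARD('n)"
  obtain C where C: "\<And>t x. \<bar>t\<bar> < \<delta> \<Longrightarrow> x \<in> ball 0 1 \<Longrightarrow>
     \<bar>(norm (gradient (u t) (\<Phi> t x)))\<^sup>2 - ((norm x)\<^sup>2 / ?n\<^sup>2 + 2 / ?n\<^sup>2 * (\<eta> x \<bullet> x - x \<bullet> gradient T x) * t)\<bar> \<le> C * t\<^sup>2"
    using interior_expansion by blast
  obtain g where g: "continuous_on (cball 0 1) g" "\<And>x. x \<in> cball 0 1 \<Longrightarrow> (T has_derivative (\<lambda>h. g x \<bullet> h)) (at x within cball 0 1)"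
    using T_gradient by blast
  have inner: "(f has_derivative D) (at y)" if "(f has_derivative D) (at y within S)" "open O'" "O' \<subseteq> S" "y \<in> O'"
    for f :: "real^'n \<Rightarrow> real" and D y S O'
    using has_derivative_subset[OF that(1,3)] at_within_open[OF that(4,2)] by simp
  have gT: "gradient T x = g x" if x: "x \<in> ball 0 1" for x
    by (rule gradient_eqI[OF inner[OF g(2) open_ball _ x]]) (use x in auto)
  have nT: "normal_derivative T x = g x \<bullet> x" if x: "x \<in> sphere 0 1" for x
  proof -
    have xc: "x \<in> cball 0 1" using x by auto
    from gradient_within_eqI(2)[OF g(2)[OF xc] derivative_unique_cball[OF _ g(2)[OF xc] xc]]
    show ?thesis by (simp add: normal_derivative_def unit_normal_def)
  qed
  have "\<bar>(norm (gradient_within (\<Phi> t ` cball 0 1) (u t) (\<Phi> t \<sigma>)))\<^sup>2 - (1 / ?n\<^sup>2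
        + 2 / ?n\<^sup>2 * (\<eta> \<sigma> \<bullet> \<sigma> - normal_derivative T \<sigma>) * t)\<bar> \<le> C * t\<^sup>2"
    if t: "\<bar>t\<bar> < \<delta>" and \<sigma>: "\<sigma> \<in> sphere 0 1" for t \<sigma>
  proof -
    obtain gu where gu: "continuous_on (cball 0 1) gu"
      "\<And>x. x \<in> cball 0 1 \<Longrightarrow> (u t has_derivative (\<lambda>h. gu x \<bullet> h)) (at (\<Phi> t x) within \<Phi> t ` cball 0 1)"
      using gradient_up_to_boundary[OF t] by blast
    have gi: "gradient (u t) (\<Phi> t x) = gu x" if x: "x \<in> ball 0 1" for x
      by (rule gradient_eqI[OF inner[OF gu(2) torsion_facts(1)[OF t] image_mono imageI[OF x]]]) (use x in auto)
    have \<sigma>c: "\<sigma> \<in> cball 0 1" using \<sigma> by auto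
    have gb: "gradient_within (\<Phi> t ` cball 0 1) (u t) (\<Phi> t \<sigma>) = gu \<sigma>"
      by (rule gradient_within_eqI(1)[OF gu(2)[OF \<sigma>c] derivative_unique_image[OF t \<sigma>c _ gu(2)[OF \<sigma>c]]])
    define f where "f = (\<lambda>x. \<bar>(norm (gu x))\<^sup>2 - ((norm x)\<^sup>2 / ?n\<^sup>2 + 2 / ?n\<^sup>2 * (\<eta> x \<bullet> x - x \<bullet> g x) * t)\<bar>)"
    have \<eta>c: "continuous_on (cball 0 1) \<eta>" by (rule continuous_on_subset[OF smooth_on_continuous[OF \<eta>_smooth] ball12(2)])
    have cl: "closure (ball 0 1) = (cball 0 1 :: (real^'n) set)" by simp
    have "f \<sigma> \<le> C * t\<^sup>2"
    proof (rule continuous_le_on_closure[of "ball 0 1" f])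
      show "continuous_on (closure (ball 0 1)) f" unfolding cl f_def divide_inverse
        by (intro continuous_intros gu(1) g(1) \<eta>c)
      show "f x \<le> C * t\<^sup>2" if "x \<in> ball 0 1" for x using C[OF t that] gT[OF that] gi[OF that] by (simp add: f_def)
    qed (use \<sigma>c cl in simp)
    then show ?thesis using \<sigma> nT[OF \<sigma>] by (simp add: f_def gb inner_commute)
  qed
  then show ?thesis by blast
qed

lemma boundary_differentiability:
  assumes t: "\<bar>t\<bar> < \<delta>" and y: "y \<in> \<Phi> t ` cball 0 1"
  shows "u t differentiable (at y within \<Phi> t ` cball 0 1)"
  using gradient_up_to_boundary[OF t] y by (auto simp: differentiable_def)

lemma extension_differentiability: "x \<in> cball 0 1 \<Longrightarrow> T differentiable (at x within cball 0 1)"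
  using T_gradient by (auto simp: differentiable_def)

end

section \<open>Deformations near the identity\<close>

lemma tube_less:
  fixes \<phi> :: "real \<times> 'a::euclidean_space \<Rightarrow> real"
  assumes S: "open S" and \<phi>: "continuous_on S \<phi>" and K: "compact K" and less: "\<And>x. x \<in> K \<Longrightarrow> (0, x) \<in> S \<and> \<phi> (0, x) < \<kappa>"
  shows "\<exists>d>0. \<forall>t x. \<bar>t\<bar> < d \<longrightarrow> x \<in> K \<longrightarrow> \<phi> (t, x) < \<kappa>"
proof -
  let ?W = "S \<inter> \<phi> -` {..<\<kappa>}"
  have "open ?W" by (rule continuous_open_preimage[OF \<phi> S open_lessThan])
  moreover have "{0} \<times> K \<subseteq> ?W" using less by auto
  ultimately obtain X where X: "0 \<in> X" "open X" "X \<times> K \<subseteq> ?W" using Elementary_Topology.tube_lemma[OF K, of ?W 0] by blast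
  then obtain d where d: "d > 0" "ball 0 d \<subseteq> X" using open_contains_ball by blast
  have "\<phi> (t, x) < \<kappa>" if "\<bar>t\<bar> < d" "x \<in> K" for t x
  proof -
    have "t \<in> X" using d(2) that(1) by (auto simp: subset_iff)
    then show ?thesis using X(3) that(2) by blast
  qed
  then show ?thesis using d(1) by blast
qed

text \<open>The Landau condition says nothing at \<open>t = 0\<close> itself, so
  \<open>F 0 x = x\<close> is obtained by continuity. After that the remainder is bounded
  quadratically on a full neighbourhood, and its derivative at zero vanishes.\<close>

lemma deformation_at_zero:
  fixes F :: "real \<Rightarrow> 'a::euclidean_space \<Rightarrow> 'a"
  assumes \<epsilon>: "\<epsilon> > 0" and F: "smooth_on ({-\<epsilon><..<\<epsilon>} \<times> UNIV) (\<lambda>(t, x). F t x)"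
    and O: "(\<lambda>t. norm (F t x - (x + t *\<^sub>R k))) \<in> O[at 0](\<lambda>t. t\<^sup>2)"
  shows "F 0 x = x" "pd (1, 0) (\<lambda>(t, x). F t x) (0, x) = k"
proof -
  define r where "r = (\<lambda>t. F t x - (x + t *\<^sub>R k))"
  obtain C where C: "C > 0" "\<forall>\<^sub>F t in at 0. norm (r t) \<le> C * t\<^sup>2"
    using landau_o.bigE[OF O] unfolding r_def by auto
  let ?f = "\<lambda>(t, x). F t x" and ?D = "pd (1, 0) (\<lambda>(t, x). F t x) (0, x)"
  have d: "?f differentiable (at (0, x))" by (rule smooth_onD[OF F]) (use \<epsilon> in auto)
  have p: "((\<lambda>t. (t, x)) has_derivative (\<lambda>h. (h, 0))) (at (0::real))"
    by (auto intro!: derivative_eq_intros)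
  have "((\<lambda>t. ?f (t, x)) has_derivative (\<lambda>h. pd (h, 0) ?f (0, x))) (at 0)"
    by (rule has_derivative_compose[OF p has_derivative_pd[OF d]])
  moreover have "(\<lambda>h. pd (h, 0) ?f (0, x)) = (\<lambda>h. h *\<^sub>R ?D)"
  proof
    fix h :: real
    show "pd (h, 0) ?f (0, x) = h *\<^sub>R ?D" using linear.scaleR[OF pd_linear[OF d], of h "(1, 0)"] by simp
  qed
  ultimately have "((\<lambda>t. F t x) has_derivative (\<lambda>h. h *\<^sub>R ?D)) (at 0)" by (simp only: prod.case)
  then have r': "(r has_derivative (\<lambda>h. h *\<^sub>R (?D - k))) (at 0)"
    unfolding r_def by (auto intro!: derivative_eq_intros simp: scaleR_diff_right)
  have "((\<lambda>t. C * t\<^sup>2) \<longlongrightarrow> C * 0\<^sup>2) (at 0)" by (intro tendsto_intros)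
  then have "(r \<longlongrightarrow> 0) (at 0)" using Lim_null_comparison[OF C(2)] by simp
  moreover have "(r \<longlongrightarrow> r 0) (at 0)" using has_derivative_continuous[OF r'] by (simp add: continuous_within)
  ultimately have r0: "r 0 = 0" using tendsto_unique[of "at (0::real)"] by (metis at_neq_bot)
  then show "F 0 x = x" by (simp add: r_def)
  obtain s where s: "s > 0" "\<And>t. t \<noteq> 0 \<Longrightarrow> \<bar>t\<bar> < s \<Longrightarrow> norm (r t) \<le> C * t\<^sup>2"
    using C(2) unfolding eventually_at by (auto simp: dist_real_def)
  have "(?D - k) \<bullet> b = 0" if b: "b \<in> Basis" for b
  proof -
    have bd: "\<bar>r t \<bullet> b\<bar> \<le> C * (norm (t - 0))\<^sup>2" if "t \<in> ball 0 s" for t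
      using s(2)[of t] that r0 Basis_le_norm[OF b, of "r t"] by (cases "t = 0") auto
    have "((\<lambda>t. r t \<bullet> b) has_derivative (\<lambda>h. 0)) (at 0)"
      by (rule has_derivative_quadratic[OF open_ball[of 0 s] _ bd]) (use s(1) in auto)
    from has_derivative_unique[OF this has_derivative_inner_left[OF r', of b]]
    have "0 = 1 *\<^sub>R (?D - k) \<bullet> b" by (rule fun_cong)
    then show ?thesis by simp
  qed
  then have "\<forall>b\<in>Basis. (?D - k) \<bullet> b = 0" by blast
  then show "?D = k" by (simp only: euclidean_all_zero_iff right_minus_eq)
qed

text \<open>The derivative of \<open>F t\<close> minus the identity is zero at time zero and stays
  below 1/2 on a compact ball for small times; the mean value inequality on the convex ball does the
  rest. The value 1/2 is what yields the Lipschitz constants 2 of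
  \<open>frame_family\<close>.\<close>

lemma near_identity:
  fixes F :: "real \<Rightarrow> 'a::euclidean_space \<Rightarrow> 'a"
  assumes \<epsilon>: "\<epsilon> > 0" and F: "smooth_on ({-\<epsilon><..<\<epsilon>} \<times> UNIV) (\<lambda>(t, x). F t x)" and F0: "\<And>x. F 0 x = x"
  shows "\<exists>d>0. d \<le> \<epsilon> \<and> (\<forall>t x y. \<bar>t\<bar> < d \<longrightarrow> x \<in> ball 0 R \<longrightarrow> y \<in> ball 0 R \<longrightarrow>
    norm ((F t x - F t y) - (x - y)) \<le> 1/2 * norm (x - y))"
proof -
  let ?S = "{-\<epsilon><..<\<epsilon>} \<times> (UNIV :: 'a set)" and ?f = "\<lambda>(t, x). F t x"
  have S: "open ?S" by (intro open_Times) auto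
  have joint: "F t differentiable (at x)" "pd v (F t) x = pd (0, v) ?f (t, x)" if "\<bar>t\<bar> < \<epsilon>" for t x v
  proof -
    have tm: "t \<in> {-\<epsilon><..<\<epsilon>}" using that by auto
    have sl: "smooth_on UNIV (F t)" using smooth_on_slice[OF F _ open_UNIV tm] by simp
    show "F t differentiable (at x)" by (rule smooth_onD[OF sl]) simp
    have "?f differentiable (at (t, x))" by (rule smooth_onD[OF F]) (use tm in auto)
    from pd_slice(1)[OF this] show "pd v (F t) x = pd (0, v) ?f (t, x)" by simp
  qed
  define N where "N = real DIM('a)"
  have N: "N \<ge> 1" unfolding N_def by (simp add: DIM_ge_Suc0 Suc_le_eq)
  \<comment> \<open>The sum over the basis is continuous in time and space and dominates the
    operator norm of the derivative of \<open>F t\<close> minus the identity.\<close>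
  define \<phi> where "\<phi> = (\<lambda>z. \<Sum>b\<in>Basis. norm (pd (0, b) ?f z - b))"
  have "continuous_on ?S \<phi>"
    unfolding \<phi>_def by (intro continuous_intros smooth_on_continuous smooth_on_pd F)
  moreover have "\<phi> (0, x) = 0" for x
  proof -
    have "F 0 = (\<lambda>x. x)" using F0 by auto
    then have "pd (0, b) ?f (0, x) = b" for b
      using joint(2)[of 0 b x] \<epsilon> pd_eq[OF has_derivative_ident, of b x] by simp
    then show ?thesis by (simp add: \<phi>_def)
  qed
  ultimately obtain d where d: "d > 0" "\<And>t x. \<bar>t\<bar> < d \<Longrightarrow> x \<in> cball 0 R \<Longrightarrow> \<phi> (t, x) < 1/2"
    using tube_less[OF S, of \<phi> "cball 0 R" "1/2"] \<epsilon> by auto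
  have "norm ((F t x - F t y) - (x - y)) \<le> 1/2 * norm (x - y)"
    if t: "\<bar>t\<bar> < min d \<epsilon>" and xy: "x \<in> ball 0 R" "y \<in> ball 0 R" for t x y
  proof -
    have t\<epsilon>: "\<bar>t\<bar> < \<epsilon>" using t by simp
    have "norm ((F t x - x) - (F t y - y)) \<le> 1/2 * norm (x - y)"
    proof (rule differentiable_bound[OF convex_ball _ _ xy])
      fix z :: 'a assume z: "z \<in> ball 0 R"
      show "((\<lambda>x. F t x - x) has_derivative (\<lambda>v. pd v (F t) z - v)) (at z within ball 0 R)"
        by (rule has_derivative_at_withinI[OF has_derivative_diff[OF has_derivative_pd[OF joint(1)[OF t\<epsilon>]] has_derivative_ident]])
      show "onorm (\<lambda>v. pd v (F t) z - v) \<le> 1/2"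
      proof (rule onorm_le)
        fix v
        have "pd v (F t) z - v = (\<Sum>b\<in>Basis. (v \<bullet> b) *\<^sub>R (pd b (F t) z - b))"
          unfolding pd_expand[OF joint(1)[OF t\<epsilon>], of v] scaleR_diff_right sum_subtractf by (simp add: euclidean_representation)
        also have "norm \<dots> \<le> (\<Sum>b\<in>Basis. norm v * norm (pd b (F t) z - b))"
          by (rule sum_norm_le) (auto intro!: mult_right_mono Basis_le_norm)
        also have "\<dots> = norm v * \<phi> (t, z)" unfolding \<phi>_def sum_distrib_left using joint(2)[OF t\<epsilon>] by simp
        also have "\<dots> \<le> norm v * (1/2)" using d(2)[of t z] t z by (intro mult_left_mono) auto
        finally show "norm (pd v (F t) z - v) \<le> 1/2 * norm v" by simp
      qed
    qed
    then show ?thesis by (simp add: algebra_simps)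
  qed
  then show ?thesis using d(1) \<epsilon> by (intro exI[of _ "min d \<epsilon>"]) auto
qed

lemma norm_near:
  fixes p q :: "'a::real_normed_vector"
  assumes "norm (p - q) \<le> 1/2 * norm q"
  shows "norm q \<le> 2 * norm p" "norm p \<le> 2 * norm q"
proof -
  have "norm q \<le> norm p + norm (p - q)" "norm p \<le> norm q + norm (p - q)"
    using norm_triangle_sub[of q p] norm_triangle_sub[of p q] by (simp_all add: norm_minus_commute)
  then show "norm q \<le> 2 * norm p" "norm p \<le> 2 * norm q" using assms norm_ge_zero[of q] by argo+
qed

context frame_family
begin

lemma lframe_sq_joint: "smooth_on ({-e<..<e} \<times> ball 0 2) (\<lambda>z. L (fst z) (\<lambda>x. x \<bullet> x) (snd z))"
proof -
  let ?S = "{-e<..<e} \<times> (ball 0 2 :: (real^'n) set)"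
  have S: "open ?S" by (intro open_Times) auto
  let ?a = "\<lambda>b z. 2 * (c (fst z) b (snd z) \<bullet> snd z)"
  have a: "smooth_on ?S (?a b)" for b
    by (intro smooth_on_mult smooth_on_const smooth_on_inner frame_smooth smooth_on_snd S)
  have "smooth_on ?S (\<lambda>z. \<Sum>b\<in>Basis. \<Sum>j\<in>Basis. (c (fst z) b (snd z) \<bullet> j) * pd (0, j) (?a b) z)"
    by (intro smooth_on_sum smooth_on_mult smooth_on_inner smooth_on_const frame_smooth smooth_on_pd a S finite_Basis)
  moreover have eq: "L (fst z) (\<lambda>x. x \<bullet> x) (snd z) = (\<Sum>b\<in>Basis. \<Sum>j\<in>Basis. (c (fst z) b (snd z) \<bullet> j) * pd (0, j) (?a b) z)"
    if z: "z \<in> ?S" for z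
  proof -
    obtain t x where tx: "z = (t, x)" "t \<in> {-e<..<e}" "x \<in> ball 0 2" using z by (cases z) auto
    have "Y t b (Y t b (\<lambda>x. x \<bullet> x)) x = (\<Sum>j\<in>Basis. (c t b x \<bullet> j) * pd (0, j) (?a b) z)" for b
    proof -
      have eq: "Y t b (\<lambda>x. x \<bullet> x) = (\<lambda>x. ?a b (t, x))" by (rule ext) (simp add: dframe_sq)
      have sm: "smooth_on (ball 0 2) (\<lambda>x. ?a b (t, x))" by (rule smooth_on_slice[OF a _ open_ball tx(2)]) simp
      show ?thesis
        unfolding eq dframe_expand[OF smooth_onD[OF sm tx(3)]]
        by (intro sum.cong refl) (use pd_pd_slice(1)[OF a _ open_ball tx(2,3)] tx(1) in simp)
    qed
    then show ?thesis by (simp add: lframe_def tx(1))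
  qed
  ultimately show ?thesis using smooth_on_cong[OF S eq] by simp
qed

lemma lframe_sq_identity:
  assumes "\<And>x. x \<in> ball 0 2 \<Longrightarrow> \<Phi> t x = x" "x \<in> ball 0 2"
  shows "L t (\<lambda>x. x \<bullet> x) x = 2 * real CARD('n)"
proof -
  have c: "c t b y = b" if "y \<in> ball 0 2" for b y
    by (rule frame_identity[where \<Phi>=\<Phi> and t=t and S="ball 0 2", OF open_ball _ that]) (rule assms(1))
  have "Y t b (Y t b (\<lambda>x. x \<bullet> x)) x = 2" if b: "b \<in> Basis" for b
  proof -
    have "Y t b (\<lambda>x. x \<bullet> x) y = 2 * (b \<bullet> y)" if "y \<in> ball 0 2" for y using c[OF that] by (simp add: dframe_sq)
    then have "Y t b (Y t b (\<lambda>x. x \<bullet> x)) x = Y t b (\<lambda>y. 2 * (b \<bullet> y)) x"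
      by (rule dframe_cong[OF open_ball _ assms(2)])
    also have "\<dots> = pd b (\<lambda>y. 2 * (b \<bullet> y)) x" by (simp add: dframe_def c[OF assms(2)])
    also have "\<dots> = 2 * (b \<bullet> b)"
      by (rule pd_eq) (auto intro!: derivative_eq_intros)
    finally show ?thesis using b by simp
  qed
  then show ?thesis by (simp add: lframe_def)
qed

end

lemma eventually_nhds_zeroI: "d > 0 \<Longrightarrow> (\<And>t. \<bar>t\<bar> < d \<Longrightarrow> P t) \<Longrightarrow> \<forall>\<^sub>F t in nhds (0::real). P t"
  unfolding eventually_nhds_metric by (auto simp: dist_real_def)

lemma diffeomorphism_eventually:
  fixes F :: "real \<Rightarrow> real^'n \<Rightarrow> real^'n"
  assumes \<epsilon>: "\<epsilon> > 0" and F: "smooth_on ({-\<epsilon><..<\<epsilon>} \<times> UNIV) (\<lambda>(t, x). F t x)" and F0: "\<And>x. F 0 x = x"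
  shows "\<forall>\<^sub>F t in nhds 0. diffeomorphism_on (ball 0 R) (F t)"
proof -
  obtain d where d: "d > 0" "d \<le> \<epsilon>" "\<And>t x y. \<bar>t\<bar> < d \<Longrightarrow> x \<in> ball 0 R \<Longrightarrow> y \<in> ball 0 R \<Longrightarrow>
    norm ((F t x - F t y) - (x - y)) \<le> 1/2 * norm (x - y)" using near_identity[OF assms] by blast
  show ?thesis
  proof (rule eventually_nhds_zeroI[OF d(1)])
    fix t assume t: "\<bar>t\<bar> < d"
    then have "t \<in> {-\<epsilon><..<\<epsilon>}" using d(2) by auto
    from smooth_on_slice[OF F _ open_UNIV this] have s: "smooth_on (ball 0 R) (F t)" by (auto intro: smooth_on_subset)
    have "1/2 * norm (x - y) \<le> norm (F t x - F t y)" if "x \<in> ball 0 R" "y \<in> ball 0 R" for x y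
      using norm_near(1)[OF d(3)[OF t that]] by simp
    from smooth_on_inverse_map[OF open_ball s _ this]
    show "diffeomorphism_on (ball 0 R) (F t)" unfolding diffeomorphism_on_def using s by simp
  qed
qed

text \<open>\<open>e\<close> is limited by the Lipschitz bounds and by the lower bound for the
  operator on the square norm, whose value at time zero exceeds 1. \<open>\<delta>\<close> is
  limited further by the times for which a torsion function is given, and by \<open>e / 2\<close> so
  that it stays strictly below \<open>e\<close>.\<close>

lemma torsion_family_exists:
  fixes F :: "real \<Rightarrow> real^'n \<Rightarrow> real^'n"
  assumes \<eta>: "smooth_on UNIV \<eta>" and \<epsilon>: "\<epsilon> > 0" and F: "smooth_on ({-\<epsilon><..<\<epsilon>} \<times> UNIV) (\<lambda>(t, x). F t x)"
    and F0: "\<And>x. F 0 x = x" and F1: "\<And>x. pd (1, 0) (\<lambda>(t, x). F t x) (0, x) = \<eta> x"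
    and torsion: "\<forall>\<^sub>F t in nhds 0. torsion_function (F t ` ball 0 1) (u t)"
    and T: "harmonic_extension (\<lambda>x. \<eta> x \<bullet> x) T"
  shows "\<exists>e \<delta>. torsion_family F e \<delta> \<eta> u T"
proof -
  obtain d where d: "d > 0" "d \<le> \<epsilon>" "\<And>t x y. \<bar>t\<bar> < d \<Longrightarrow> x \<in> ball 0 2 \<Longrightarrow> y \<in> ball 0 2 \<Longrightarrow>
    norm ((F t x - F t y) - (x - y)) \<le> 1/2 * norm (x - y)" using near_identity[OF \<epsilon> F F0] by blast
  have ff: "frame_family F e' \<delta>'" if "0 < \<delta>'" "\<delta>' < e'" "e' \<le> d" for e' \<delta>'
  proof
    show "smooth_on ({-e'<..<e'} \<times> ball 0 2) (\<lambda>(t, x). F t x)"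
      by (rule smooth_on_subset[OF F]) (use that d(2) in auto)
    show "norm (x - y) \<le> 2 * norm (F t x - F t y)" "norm (F t x - F t y) \<le> 2 * norm (x - y)"
      if "\<bar>t\<bar> < e'" "x \<in> ball 0 2" "y \<in> ball 0 2" for t x y
      using norm_near[OF d(3)[OF _ that(2,3), of t]] that(1) \<open>e' \<le> d\<close> by auto
  qed (use that in auto)
  interpret f: frame_family F d "d/2" by (rule ff) (use d(1) in auto)
  let ?S = "{-d<..<d} \<times> (ball 0 2 :: (real^'n) set)"
  have "open ?S" by (intro open_Times) auto
  \<comment> \<open>Negated, because \<open>tube_less\<close> propagates strict upper
    bounds.\<close>
  moreover have "continuous_on ?S (\<lambda>z. - lframe F (fst z) (\<lambda>x. x \<bullet> x) (snd z))"
    by (intro continuous_intros smooth_on_continuous f.lframe_sq_joint)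
  moreover have "(0, x) \<in> ?S \<and> - lframe F (fst (0, x)) (\<lambda>x. x \<bullet> x) (snd (0, x)) < - 1" if x: "x \<in> cball 0 1" for x
  proof -
    have "x \<in> ball 0 2" using x f.ball12(2) by auto
    moreover have "1 < 2 * real CARD('n)"
    proof -
      have "1 \<le> real CARD('n)" by (simp add: Suc_le_eq)
      then show ?thesis by linarith
    qed
    ultimately show ?thesis using f.lframe_sq_identity[OF F0] d(1) by simp
  qed
  ultimately obtain d' where d': "d' > 0" "\<And>t x. \<bar>t\<bar> < d' \<Longrightarrow> x \<in> cball 0 1 \<Longrightarrow> - lframe F t (\<lambda>x. x \<bullet> x) x < - 1"
    using tube_less[OF _ _ compact_cball, of ?S "\<lambda>z. - lframe F (fst z) (\<lambda>x. x \<bullet> x) (snd z)" 0 1 "-1"] by auto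
  obtain d'' where d'': "d'' > 0" "\<And>t. \<bar>t\<bar> < d'' \<Longrightarrow> torsion_function (F t ` ball 0 1) (u t)"
    using torsion unfolding eventually_nhds_metric by (auto simp: dist_real_def)
  define e where "e = min d d'"
  define \<delta> where "\<delta> = min (e / 2) d''"
  have e: "0 < e" "e \<le> d" "e \<le> d'" using d(1) d'(1) by (auto simp: e_def)
  have \<delta>: "0 < \<delta>" "\<delta> < e" "\<delta> \<le> d''" using e(1) d''(1) by (auto simp: \<delta>_def min_def)
  interpret g: frame_family F e \<delta> by (rule ff[OF \<delta>(1,2) e(2)])
  have "torsion_family F e \<delta> \<eta> u T"
  proof
    show "1 \<le> lframe F t (\<lambda>x. x \<bullet> x) x" if "\<bar>t\<bar> < e" "x \<in> ball 0 1" for t x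
      using d'(2)[of t x] that e(3) by force
    show "smooth_on (ball 0 2) \<eta>" by (rule smooth_on_subset[OF \<eta>]) simp
    show "torsion_function (F t ` ball 0 1) (u t)" if "\<bar>t\<bar> < \<delta>" for t using d''(2) that \<delta>(3) by simp
  qed (rule F0 F1 T)+
  then show ?thesis by blast
qed

theorem lemma2p1:
  fixes \<eta> :: "real ^ 'n \<Rightarrow> real ^ 'n"
    and F :: "real \<Rightarrow> real ^ 'n \<Rightarrow> real ^ 'n"
    and u :: "real \<Rightarrow> real ^ 'n \<Rightarrow> real"
    and \<Omega> :: "real \<Rightarrow> (real ^ 'n) set"
    and \<zeta> T\<zeta> :: "real ^ 'n \<Rightarrow> real"
    and \<epsilon> n :: real
  assumes n: "n = real CARD('n)"
    and \<eta>_smooth: "smooth_on UNIV \<eta>"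
    and \<eta>_support: "compact (closure {x. \<eta> x \<noteq> 0})"
    and \<epsilon>_pos: "\<epsilon> > 0"
    and F_smooth: "smooth_on ({-\<epsilon><..<\<epsilon>} \<times> UNIV) (\<lambda>(t, x). F t x)"
    and F_expansion: "\<And>x. (\<lambda>t. norm (F t x - (x + t *\<^sub>R \<eta> x))) \<in> O[at 0](\<lambda>t. t\<^sup>2)"
    and \<Omega>: "\<And>t. \<Omega> t = F t ` ball 0 1"
    and torsion: "\<forall>\<^sub>F t in nhds 0. torsion_function (\<Omega> t) (u t)"
    and \<zeta>: "\<And>\<sigma>. \<sigma> \<in> sphere 0 1 \<Longrightarrow> \<zeta> \<sigma> = \<eta> \<sigma> \<bullet> unit_normal \<sigma>"
    and T\<zeta>: "harmonic_extension \<zeta> T\<zeta>"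
  shows "(\<forall>R. \<forall>\<^sub>F t in nhds 0. diffeomorphism_on (ball 0 R) (F t)) \<and>
    (\<exists>\<delta>>0. smooth_on ({-\<delta><..<\<delta>} \<times> ball 0 1) (\<lambda>(t, x). u t (F t x))) \<and>
    (\<forall>x\<in>cball 0 1. T\<zeta> differentiable (at x within cball 0 1)) \<and>
    (\<forall>\<^sub>F t in nhds 0. \<forall>y\<in>closure (\<Omega> t). u t differentiable (at y within closure (\<Omega> t))) \<and>
    (\<exists>C. \<forall>\<^sub>F t in nhds 0. \<forall>x\<in>ball 0 1.
       \<bar>(norm (gradient (u t) (F t x)))\<^sup>2 -
         ((norm x)\<^sup>2 / n\<^sup>2 + 2 / n\<^sup>2 * (\<eta> x \<bullet> x - x \<bullet> gradient T\<zeta> x) * t)\<bar> \<le> C * t\<^sup>2) \<and>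
    (\<exists>C. \<forall>\<^sub>F t in nhds 0. \<forall>\<sigma>\<in>sphere 0 1.
       F t \<sigma> \<in> frontier (\<Omega> t) \<and>
       \<bar>(norm (gradient_within (closure (\<Omega> t)) (u t) (F t \<sigma>)))\<^sup>2 -
         (1 / n\<^sup>2 + 2 / n\<^sup>2 * (\<zeta> \<sigma> - normal_derivative T\<zeta> \<sigma>) * t)\<bar> \<le> C * t\<^sup>2)"
proof -
  note F0 = deformation_at_zero(1)[OF \<epsilon>_pos F_smooth F_expansion] and F1 = deformation_at_zero(2)[OF \<epsilon>_pos F_smooth F_expansion]
  \<comment> \<open>A harmonic extension sees its data only on the sphere, where the normal at
    \<open>x\<close> is \<open>x\<close>. The data may therefore be replaced by a function that is
    smooth on the whole space.\<close>
  have T: "harmonic_extension (\<lambda>x. \<eta> x \<bullet> x) T\<zeta>"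
    using T\<zeta> \<zeta> by (auto simp: harmonic_extension_def unit_normal_def)
  obtain e \<delta> where "torsion_family F e \<delta> \<eta> u T\<zeta>"
    using torsion_family_exists[OF \<eta>_smooth \<epsilon>_pos F_smooth F0 F1 torsion[unfolded \<Omega>] T] by blast
  then interpret torsion_family F e \<delta> \<eta> u T\<zeta> .
  note ev = eventually_nhds_zeroI[OF \<delta>(1)]
  have cl: "closure (\<Omega> t) = F t ` cball 0 1" "frontier (\<Omega> t) = F t ` sphere 0 1" if "\<bar>t\<bar> < \<delta>" for t
    unfolding \<Omega> using closure_image frontier_image small_e[OF that] by auto
  have \<zeta>': "\<zeta> \<sigma> = \<eta> \<sigma> \<bullet> \<sigma>" if "\<sigma> \<in> sphere 0 1" for \<sigma> using \<zeta>[OF that] by (simp add: unit_normal_def)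
  show ?thesis
  proof (intro conjI allI)
    show "\<forall>\<^sub>F t in nhds 0. diffeomorphism_on (ball 0 R) (F t)" for R
      by (rule diffeomorphism_eventually[OF \<epsilon>_pos F_smooth F0])
    show "\<exists>\<delta>>0. smooth_on ({-\<delta><..<\<delta>} \<times> ball 0 1) (\<lambda>(t, x). u t (F t x))" using smooth_dependence \<delta>(1) by blast
    show "\<forall>x\<in>cball 0 1. T\<zeta> differentiable (at x within cball 0 1)" using extension_differentiability by blast
    show "\<forall>\<^sub>F t in nhds 0. \<forall>y\<in>closure (\<Omega> t). u t differentiable (at y within closure (\<Omega> t))"
      by (rule ev) (use boundary_differentiability cl in auto)
    obtain C where C: "\<And>t x. \<bar>t\<bar> < \<delta> \<Longrightarrow> x \<in> ball 0 1 \<Longrightarrow> \<bar>(norm (gradient (u t) (F t x)))\<^sup>2 -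
         ((norm x)\<^sup>2 / n\<^sup>2 + 2 / n\<^sup>2 * (\<eta> x \<bullet> x - x \<bullet> gradient T\<zeta> x) * t)\<bar> \<le> C * t\<^sup>2"
      using interior_expansion unfolding n by blast
    show "\<exists>C. \<forall>\<^sub>F t in nhds 0. \<forall>x\<in>ball 0 1. \<bar>(norm (gradient (u t) (F t x)))\<^sup>2 -
         ((norm x)\<^sup>2 / n\<^sup>2 + 2 / n\<^sup>2 * (\<eta> x \<bullet> x - x \<bullet> gradient T\<zeta> x) * t)\<bar> \<le> C * t\<^sup>2"
      by (intro exI[of _ C] ev ballI C)
    obtain C' where C': "\<And>t \<sigma>. \<bar>t\<bar> < \<delta> \<Longrightarrow> \<sigma> \<in> sphere 0 1 \<Longrightarrow>
      \<bar>(norm (gradient_within (F t ` cball 0 1) (u t) (F t \<sigma>)))\<^sup>2 -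
         (1 / n\<^sup>2 + 2 / n\<^sup>2 * (\<eta> \<sigma> \<bullet> \<sigma> - normal_derivative T\<zeta> \<sigma>) * t)\<bar> \<le> C' * t\<^sup>2"
      using boundary_expansion unfolding n by blast
    show "\<exists>C. \<forall>\<^sub>F t in nhds 0. \<forall>\<sigma>\<in>sphere 0 1. F t \<sigma> \<in> frontier (\<Omega> t) \<and>
       \<bar>(norm (gradient_within (closure (\<Omega> t)) (u t) (F t \<sigma>)))\<^sup>2 -
         (1 / n\<^sup>2 + 2 / n\<^sup>2 * (\<zeta> \<sigma> - normal_derivative T\<zeta> \<sigma>) * t)\<bar> \<le> C * t\<^sup>2"
    proof (intro exI[of _ C'] ev ballI conjI)
      fix t and \<sigma> :: "real ^ 'n" assume t: "\<bar>t\<bar> < \<delta>" and \<sigma>: "\<sigma> \<in> sphere 0 1"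
      show "F t \<sigma> \<in> frontier (\<Omega> t)" unfolding cl[OF t] using \<sigma> by (rule imageI)
      show "\<bar>(norm (gradient_within (closure (\<Omega> t)) (u t) (F t \<sigma>)))\<^sup>2 -
         (1 / n\<^sup>2 + 2 / n\<^sup>2 * (\<zeta> \<sigma> - normal_derivative T\<zeta> \<sigma>) * t)\<bar> \<le> C' * t\<^sup>2"
        unfolding cl[OF t] \<zeta>'[OF \<sigma>] by (rule C'[OF t \<sigma>])
    qed
  qed
qed

end
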